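(* Let $p\geq1$, $q\ge0$ be integers and $\mathcal{B}\in M_{q,p}(\mathbb{K})$. Let $\mathbf{G}_{\mathcal{B}}=\mathbf{G}_1\times\dots\times\mathbf{G}_p\subseteq\mathbb{K}[[x_1,\dots,x_p,y_1,\dots,y_q]]^p$, with the product defined, for $F=(F_1,\dots,F_p)$ and $G=(G_1,\dots,G_p)\in\mathbf{G}_{\mathcal{B}}$, by $$F\bullet G=G\left(F_1,\dots,F_p,\ y_1\Big(\frac{F_1}{x_1}\Big)^{\mathcal{B}_{1,1}}\cdots\Big(\frac{F_p}{x_p}\Big)^{\mathcal{B}_{1,p}},\ \dots,\ y_q\Big(\frac{F_1}{x_1}\Big)^{\mathcal{B}_{q,1}}\cdots\Big(\frac{F_p}{x_p}\Big)^{\mathcal{B}_{q,p}}\right).$$ Then $\mathbf{G}_{\mathcal{B}}$ is isomorphic to the group of characters of an $\mathbb{N}^{p+q}$-graded Hopf algebra $\mathcal{H}_{\mathcal{B}}$. The graded dual of $\mathcal{H}_{\mathcal{B}}$ is the enveloping algebra of the deg1 pre-Lie algebra $\mathfrak{g}_{\mathcal{B}}$ with basis $(f_i(\alpha))_{i\in[p],\alpha\in\mathbb{N}^{p+q}\setminus\{0\}}$ and product $$f_j(\beta)*f_i(\alpha)=(A_j\cdot\alpha)\,f_i(\alpha+\beta),$$ where $A_j\in\mathbb{K}^{p+q}$ is the $j$-th column of the matrix $A=\begin{pmatrix}I_p\\\mathcal{B}\end{pmatrix}$.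
   Context: $\mathbb{K}$ is a field of characteristic zero. $\mathbb{K}[[x_1,\dots,x_p,y_1,\dots,y_q]]_+$ is the set of formal series without constant term. For $i\in[p]=\{1,\dots,p\}$, $\mathbf{G}_i=\{x_i(1+F)\mid F\in\mathbb{K}[[x_1,\dots,x_p,y_1,\dots,y_q]]_+\}$. For $F_i=x_i(1+h)\in\mathbf{G}_i$ and $c\in\mathbb{K}$, $(F_i/x_i)^c=(1+h)^c=\sum_{n\ge0}\binom{c}{n}h^n$. $\cdot$ denotes the usual inner product of $\mathbb{K}^{p+q}$. A (left) pre-Lie algebra is a vector space with a bilinear product $*$ such that $(x*y)*z-x*(y*z)=(y*x)*z-y*(x*z)$; $[x,y]=x*y-y*x$ is then a Lie bracket, and the enveloping algebra of a pre-Lie algebra is the enveloping algebra of this Lie algebra. A pre-Lie algebra is deg1 if it has a basis $(f_i(\alpha))_{i\in[M],\alpha\in\mathbb N^N\setminus\{0\}}$ with $f_j(\beta)*f_i(\alpha)=(A^{(i,j)}\cdot\alpha+b^{(i,j)})f_i(\alpha+\beta)$ for some $A^{(i,j)}\in\mathbb K^N$, $b^{(i,j)}\in\mathbb K$. The group of characters of a commutative Hopf algebra is the set of algebra morphisms to $\mathbb{K}$ with the convolution product. *)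

theory Defs
  imports
    "Jordan_Normal_Form.VS_Connect"
    "HOL-Algebra.QuotRing"
    "HOL-Library.Poly_Mapping"
begin

text \<open>
  The ground field is a type \<open>'k::field_char_0\<close>, used as a ring record through \<^const>\<open>class_ring\<close>.
  A vector space is a \<open>module\<close> record over \<^const>\<open>class_ring\<close>; its ring multiplication is not
  constrained by the module axioms, so the same record type serves for associative algebras,
  pre-Lie algebras and Lie algebras (the multiplication being then the product, the pre-Lie
  product and the bracket).

  Variables are numbered from \<open>0\<close>: in \<open>p + q\<close> variables, \<open>x\<^sub>1,\<dots>,x\<^sub>p\<close> are the variables
  \<open>0,\<dots>,p-1\<close> and \<open>y\<^sub>1,\<dots>,y\<^sub>q\<close> are \<open>p,\<dots>,p+q-1\<close>.
\<close>

section \<open>Formal power series\<close>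

text \<open>The ring of series in the countably many variables indexed by \<^typ>\<open>nat\<close>; the series in the
  first \<open>n\<close> variables form the subring \<open>mps_vars n\<close>.\<close>

typedef 'a mps = "UNIV :: ((nat \<Rightarrow>\<^sub>0 nat) \<Rightarrow> 'a) set"
  morphisms mps_coeff Mps ..

lemma mps_coeff_Mps [simp]: "mps_coeff (Mps f) = f"
  by (simp add: Mps_inverse)

lemma mps_eqI: "(\<And>\<alpha>. mps_coeff f \<alpha> = mps_coeff g \<alpha>) \<Longrightarrow> f = g"
  by (metis mps_coeff_inverse ext)

definition splits :: "(nat \<Rightarrow>\<^sub>0 nat) \<Rightarrow> ((nat \<Rightarrow>\<^sub>0 nat) \<times> (nat \<Rightarrow>\<^sub>0 nat)) set" where
  "splits \<alpha> = {(\<beta>, \<gamma>). \<beta> + \<gamma> = \<alpha>}"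

lemma finite_splits [simp]: "finite (splits \<alpha>)"
proof -
  let ?S = "{\<beta>. \<forall>i. Poly_Mapping.lookup \<beta> i \<le> Poly_Mapping.lookup \<alpha> i}"
  have "(\<lambda>\<beta>. restrict (Poly_Mapping.lookup \<beta>) (Poly_Mapping.keys \<alpha>)) ` ?S \<subseteq> (\<Pi>\<^sub>E i\<in>Poly_Mapping.keys \<alpha>. {..Poly_Mapping.lookup \<alpha> i})"
    by auto
  moreover have "finite (\<Pi>\<^sub>E i\<in>Poly_Mapping.keys \<alpha>. {..Poly_Mapping.lookup \<alpha> i})"
    by (intro finite_PiE) auto
  moreover have "inj_on (\<lambda>\<beta>. restrict (Poly_Mapping.lookup \<beta>) (Poly_Mapping.keys \<alpha>)) ?S"
  proof (rule inj_onI)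
    fix \<beta> \<gamma> assume b: "\<beta> \<in> ?S" and c: "\<gamma> \<in> ?S"
      and eq: "restrict (Poly_Mapping.lookup \<beta>) (Poly_Mapping.keys \<alpha>) = restrict (Poly_Mapping.lookup \<gamma>) (Poly_Mapping.keys \<alpha>)"
    show "\<beta> = \<gamma>"
    proof (rule poly_mapping_eqI)
      fix i
      show "Poly_Mapping.lookup \<beta> i = Poly_Mapping.lookup \<gamma> i"
      proof (cases "i \<in> Poly_Mapping.keys \<alpha>")
        case True
        then show ?thesis using fun_cong[OF eq, of i] by simp
      next
        case False
        then have "Poly_Mapping.lookup \<alpha> i = 0" by (simp add: in_keys_iff)
        moreover have "Poly_Mapping.lookup \<beta> i \<le> Poly_Mapping.lookup \<alpha> i" "Poly_Mapping.lookup \<gamma> i \<le> Poly_Mapping.lookup \<alpha> i"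
          using b c by blast+
        ultimately show ?thesis by simp
      qed
    qed
  qed
  ultimately have fin: "finite ?S"
    using finite_imageD finite_subset by blast
  have "splits \<alpha> \<subseteq> ?S \<times> ?S"
    by (auto simp: splits_def lookup_add)
  then show ?thesis
    using fin finite_subset by blast
qed

lemma splits_0 [simp]: "splits 0 = {(0, 0)}"
  by (force simp: splits_def poly_mapping_eq_iff fun_eq_iff lookup_add)

instantiation mps :: (comm_ring_1) comm_ring_1
begin

definition "0 = Mps (\<lambda>_. 0)"
definition "1 = Mps (\<lambda>\<alpha>. if \<alpha> = 0 then 1 else 0)"
definition "f + g = Mps (\<lambda>\<alpha>. mps_coeff f \<alpha> + mps_coeff g \<alpha>)"
definition "f - g = Mps (\<lambda>\<alpha>. mps_coeff f \<alpha> - mps_coeff g \<alpha>)"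
definition "- f = Mps (\<lambda>\<alpha>. - mps_coeff f \<alpha>)"
definition "f * g = Mps (\<lambda>\<alpha>. \<Sum>(\<beta>, \<gamma>)\<in>splits \<alpha>. mps_coeff f \<beta> * mps_coeff g \<gamma>)"

instance
proof
  fix a b c :: "'a mps"
  show "a + b + c = a + (b + c)" "a + b = b + a" "0 + a = a" "- a + a = 0" "a - b = a + - b"
    by (simp_all add: plus_mps_def zero_mps_def minus_mps_def uminus_mps_def algebra_simps
        mps_coeff_inverse)
  show "a * b * c = a * (b * c)"
  proof (rule mps_eqI)
    fix \<alpha>
    let ?t = "\<lambda>x y z. mps_coeff a x * mps_coeff b y * mps_coeff c z"
    let ?L = "SIGMA u:splits \<alpha>. splits (fst u)"
    let ?R = "SIGMA u:splits \<alpha>. splits (snd u)"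
    have "mps_coeff (a * b * c) \<alpha> = (\<Sum>(u, v)\<in>?L. ?t (fst v) (snd v) (snd u))"
      by (subst sum.Sigma[symmetric]) (simp_all add: times_mps_def case_prod_unfold sum_distrib_right)
    also have "\<dots> = (\<Sum>(u, v)\<in>?R. ?t (fst u) (fst v) (snd v))"
      by (rule sum.reindex_bij_witness[of _
            "\<lambda>(u, v). ((fst u + fst v, snd v), (fst u, fst v))"
            "\<lambda>(u, v). ((fst v, snd v + snd u), (snd v, snd u))"])
        (auto simp: splits_def add.assoc)
    also have "\<dots> = mps_coeff (a * (b * c)) \<alpha>"
      by (subst sum.Sigma[symmetric])
        (simp_all add: times_mps_def case_prod_unfold sum_distrib_left mult.assoc)
    finally show "mps_coeff (a * b * c) \<alpha> = mps_coeff (a * (b * c)) \<alpha>" .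
  qed
  show "a * b = b * a"
  proof (rule mps_eqI)
    fix \<alpha>
    show "mps_coeff (a * b) \<alpha> = mps_coeff (b * a) \<alpha>"
      unfolding times_mps_def mps_coeff_Mps
      by (rule sum.reindex_bij_witness[of _ "\<lambda>(u, v). (v, u)" "\<lambda>(u, v). (v, u)"])
        (auto simp: splits_def ac_simps)
  qed
  show "1 * a = a"
  proof (rule mps_eqI)
    fix \<alpha>
    have "mps_coeff (1 * a) \<alpha> = (\<Sum>u\<in>splits \<alpha>. if u = (0, \<alpha>) then mps_coeff a \<alpha> else 0)"
      unfolding times_mps_def one_mps_def mps_coeff_Mps
      by (rule sum.cong) (auto simp: splits_def split: if_splits)
    also have "\<dots> = mps_coeff a \<alpha>"
      by (simp add: sum.delta) (simp add: splits_def)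
    finally show "mps_coeff (1 * a) \<alpha> = mps_coeff a \<alpha>" .
  qed
  show "(a + b) * c = a * c + b * c"
    by (simp add: times_mps_def plus_mps_def case_prod_unfold distrib_right sum.distrib)
  show "(0 :: 'a mps) \<noteq> 1"
  proof
    assume "(0 :: 'a mps) = 1"
    then have "mps_coeff (0 :: 'a mps) 0 = mps_coeff (1 :: 'a mps) 0" by simp
    then show False by (simp add: zero_mps_def one_mps_def)
  qed
qed

end

definition multi_indices :: "nat \<Rightarrow> (nat \<Rightarrow>\<^sub>0 nat) set" where
  "multi_indices n = {\<alpha>. Poly_Mapping.keys \<alpha> \<subseteq> {..<n}}"

definition mps_vars :: "nat \<Rightarrow> 'a::zero mps set" where
  "mps_vars n = {f. \<forall>\<alpha>. mps_coeff f \<alpha> \<noteq> 0 \<longrightarrow> \<alpha> \<in> multi_indices n}"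

definition mps_vars_plus :: "nat \<Rightarrow> 'a::zero mps set" where
  "mps_vars_plus n = {f \<in> mps_vars n. mps_coeff f 0 = 0}"

definition mps_var :: "nat \<Rightarrow> 'a::{zero,one} mps" where
  "mps_var i = Mps (\<lambda>\<alpha>. if \<alpha> = Poly_Mapping.single i 1 then 1 else 0)"

text \<open>\<open>mps_div_var i f\<close> is \<open>f / x\<^sub>i\<close> for a series \<open>f\<close> divisible by the variable \<open>x\<^sub>i\<close>.\<close>

definition mps_div_var :: "nat \<Rightarrow> 'a mps \<Rightarrow> 'a mps" where
  "mps_div_var i f = Mps (\<lambda>\<alpha>. mps_coeff f (\<alpha> + Poly_Mapping.single i 1))"

text \<open>The power \<open>u\<^sup>c = (\<Sum>n. (c choose n) (u - 1)\<^sup>n)\<close> of a series \<open>u\<close> with constant term \<open>1\<close>, and the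
  substitution of series \<open>u j\<close> without constant term for the variables of a series in finitely many
  variables. In both cases every coefficient is a sum with finitely many nonzero terms.\<close>

definition mps_power :: "'a::field_char_0 mps \<Rightarrow> 'a \<Rightarrow> 'a mps" where
  "mps_power u c = Mps (\<lambda>\<alpha>. Sum_any (\<lambda>n. (c gchoose n) * mps_coeff ((u - 1) ^ n) \<alpha>))"

definition mps_subst :: "'a::comm_ring_1 mps \<Rightarrow> (nat \<Rightarrow> 'a mps) \<Rightarrow> 'a mps" where
  "mps_subst f u = Mps (\<lambda>\<gamma>. Sum_any (\<lambda>\<alpha>.
     mps_coeff f \<alpha> * mps_coeff (\<Prod>j\<in>Poly_Mapping.keys \<alpha>. u j ^ Poly_Mapping.lookup \<alpha> j) \<gamma>))"

section \<open>The group $\mathbf{G}_{\mathcal{B}}$\<close>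

definition G_factor :: "nat \<Rightarrow> nat \<Rightarrow> 'k::field_char_0 mps set" where
  "G_factor n i = {mps_var i * (1 + f) | f. f \<in> mps_vars_plus n}"

definition G_args :: "nat \<Rightarrow> 'k::field_char_0 mat \<Rightarrow> (nat \<Rightarrow> 'k mps) \<Rightarrow> nat \<Rightarrow> 'k mps" where
  "G_args p B F j = (if j < p then F j
     else mps_var j * (\<Prod>i<p. mps_power (mps_div_var i (F i)) (B $$ (j - p, i))))"

definition G_group :: "nat \<Rightarrow> nat \<Rightarrow> 'k::field_char_0 mat \<Rightarrow> (nat \<Rightarrow> 'k mps) monoid" where
  "G_group p q B = \<lparr>carrier = (\<Pi>\<^sub>E i\<in>{..<p}. G_factor (p + q) i),
     mult = (\<lambda>F G. \<lambda>i\<in>{..<p}. mps_subst (G i) (G_args p B F)),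
     one = (\<lambda>i\<in>{..<p}. mps_var i)\<rparr>"

section \<open>Free vector spaces, quotients and tensor products\<close>

definition base_algebra :: "('k::field, 'k) module" where
  "base_algebra = \<lparr>carrier = UNIV, mult = (*), one = 1, zero = 0, add = (+), smult = (*)\<rparr>"

text \<open>The space with basis \<open>S\<close>; its multiplication is a dummy.\<close>

definition free_module :: "'s set \<Rightarrow> ('k::field, 's \<Rightarrow>\<^sub>0 'k) module" where
  "free_module S = \<lparr>carrier = {P. Poly_Mapping.keys P \<subseteq> S}, mult = (\<lambda>_ _. 0), one = 0, zero = 0, add = (+),
     smult = (\<lambda>c. Poly_Mapping.map ((*) c))\<rparr>"

text \<open>\<open>quotient M N\<close> is used both for a subspace \<open>N\<close> of a vector space and for a two-sided ideal
  \<open>N\<close> of an algebra.\<close>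

definition quotient :: "('k, 'a, 'm) module_scheme \<Rightarrow> 'a set \<Rightarrow> ('k, 'a set) module" where
  "quotient M N = ring.extend (M Quot N)
     (module.fields (\<lambda>c X. \<Union>x\<in>X. N +>\<^bsub>M\<^esub> (c \<odot>\<^bsub>M\<^esub> x)))"

abbreviation lin_span :: "('k::field, 'a, 'm) module_scheme \<Rightarrow> 'a set \<Rightarrow> 'a set" where
  "lin_span V S \<equiv> LinearCombinations.module.span class_ring V S"

definition tensor_kernel ::
  "('k::field, 'a, 'm) module_scheme \<Rightarrow> ('k, 'b, 'n) module_scheme \<Rightarrow> ('a \<times> 'b \<Rightarrow>\<^sub>0 'k) set" where
  "tensor_kernel V W = lin_span (free_module (carrier V \<times> carrier W))
    ({Poly_Mapping.single (v \<oplus>\<^bsub>V\<^esub> v', w) 1 - Poly_Mapping.single (v, w) 1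
        - Poly_Mapping.single (v', w) 1 | v v' w.
        v \<in> carrier V \<and> v' \<in> carrier V \<and> w \<in> carrier W} \<union>
     {Poly_Mapping.single (v, w \<oplus>\<^bsub>W\<^esub> w') 1 - Poly_Mapping.single (v, w) 1
        - Poly_Mapping.single (v, w') 1 | v w w'.
        v \<in> carrier V \<and> w \<in> carrier W \<and> w' \<in> carrier W} \<union>
     {Poly_Mapping.single (c \<odot>\<^bsub>V\<^esub> v, w) 1 - Poly_Mapping.single (v, w) c | c v w.
        v \<in> carrier V \<and> w \<in> carrier W} \<union>
     {Poly_Mapping.single (v, c \<odot>\<^bsub>W\<^esub> w) 1 - Poly_Mapping.single (v, w) c | c v w.
        v \<in> carrier V \<and> w \<in> carrier W})"

definition pure_tensor :: "('k::field, 'a, 'm) module_scheme \<Rightarrow> ('k, 'b, 'n) module_scheme \<Rightarrow>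
    'a \<Rightarrow> 'b \<Rightarrow> ('a \<times> 'b \<Rightarrow>\<^sub>0 'k) set" where
  "pure_tensor V W v w =
     tensor_kernel V W +>\<^bsub>free_module (carrier V \<times> carrier W)\<^esub> Poly_Mapping.single (v, w) 1"

text \<open>The linear map \<open>V \<otimes> W \<rightarrow> U\<close> induced by a bilinear map \<open>\<beta> : V \<times> W \<rightarrow> U\<close>; for bilinear \<open>\<beta>\<close> the value
  does not depend on the chosen representative.\<close>

definition tensor_lift :: "('k::field, 'u, 'm) module_scheme \<Rightarrow> ('a \<Rightarrow> 'b \<Rightarrow> 'u) \<Rightarrow>
    ('a \<times> 'b \<Rightarrow>\<^sub>0 'k) set \<Rightarrow> 'u" where
  "tensor_lift U \<beta> T = (let t = SOME t. t \<in> T in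
     \<Oplus>\<^bsub>U\<^esub>vw\<in>Poly_Mapping.keys t. Poly_Mapping.lookup t vw \<odot>\<^bsub>U\<^esub> \<beta> (fst vw) (snd vw))"

definition tensor_space :: "('k::field, 'a, 'm) module_scheme \<Rightarrow> ('k, 'b, 'n) module_scheme \<Rightarrow>
    ('k, ('a \<times> 'b \<Rightarrow>\<^sub>0 'k) set) module" where
  "tensor_space V W = quotient (free_module (carrier V \<times> carrier W)) (tensor_kernel V W)"

text \<open>The tensor product of two algebras, with \<open>(a \<otimes> b)(c \<otimes> d) = ac \<otimes> bd\<close>.\<close>

definition tensor_algebra :: "('k::field, 'a, 'm) module_scheme \<Rightarrow> ('k, 'b, 'n) module_scheme \<Rightarrow>
    ('k, ('a \<times> 'b \<Rightarrow>\<^sub>0 'k) set) module" where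
  "tensor_algebra A B = (tensor_space A B)
     \<lparr>mult := (\<lambda>S T. tensor_lift (tensor_space A B)
         (\<lambda>a b. tensor_lift (tensor_space A B)
            (\<lambda>c d. pure_tensor A B (a \<otimes>\<^bsub>A\<^esub> c) (b \<otimes>\<^bsub>B\<^esub> d)) T) S),
      one := pure_tensor A B \<one>\<^bsub>A\<^esub> \<one>\<^bsub>B\<^esub>\<rparr>"

section \<open>Hopf algebras and their characters\<close>

record (overloaded) ('k::zero, 'a) hopf = "('k, 'a) module" +
  counit :: "'a \<Rightarrow> 'k"
  comult :: "'a \<Rightarrow> ('a \<times> 'a \<Rightarrow>\<^sub>0 'k) set"
  antipode :: "'a \<Rightarrow> 'a"

definition assoc_algebra :: "('k::field, 'a, 'm) module_scheme \<Rightarrow> bool" where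
  "assoc_algebra A \<longleftrightarrow> vectorspace class_ring A \<and> ring A \<and>
     (\<forall>c. \<forall>x\<in>carrier A. \<forall>y\<in>carrier A.
        (c \<odot>\<^bsub>A\<^esub> x) \<otimes>\<^bsub>A\<^esub> y = c \<odot>\<^bsub>A\<^esub> (x \<otimes>\<^bsub>A\<^esub> y) \<and> x \<otimes>\<^bsub>A\<^esub> (c \<odot>\<^bsub>A\<^esub> y) = c \<odot>\<^bsub>A\<^esub> (x \<otimes>\<^bsub>A\<^esub> y))"

definition alg_hom ::
  "('k::field, 'a, 'm) module_scheme \<Rightarrow> ('k, 'b, 'n) module_scheme \<Rightarrow> ('a \<Rightarrow> 'b) set" where
  "alg_hom A B = Ring.ring_hom A B \<inter> LinearCombinations.module_hom class_ring A B"

definition hopf_algebra :: "('k::field, 'a, 'm) hopf_scheme \<Rightarrow> bool" where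
  "hopf_algebra H \<longleftrightarrow>
     assoc_algebra H \<and>
     comult H \<in> alg_hom H (tensor_algebra H H) \<and>
     counit H \<in> alg_hom H base_algebra \<and>
     antipode H \<in> LinearCombinations.module_hom class_ring H H \<and>
     (\<forall>h\<in>carrier H.
        (let HHH = tensor_space H (tensor_space H H) in
          tensor_lift HHH (\<lambda>a b. tensor_lift HHH
              (\<lambda>a' a''. pure_tensor H (tensor_space H H) a' (pure_tensor H H a'' b)) (comult H a))
            (comult H h) =
          tensor_lift HHH (\<lambda>a b. pure_tensor H (tensor_space H H) a (comult H b)) (comult H h)) \<and>
        tensor_lift H (\<lambda>a b. counit H a \<odot>\<^bsub>H\<^esub> b) (comult H h) = h \<and>
        tensor_lift H (\<lambda>a b. counit H b \<odot>\<^bsub>H\<^esub> a) (comult H h) = h \<and>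
        tensor_lift H (\<lambda>a b. antipode H a \<otimes>\<^bsub>H\<^esub> b) (comult H h) = counit H h \<odot>\<^bsub>H\<^esub> \<one>\<^bsub>H\<^esub> \<and>
        tensor_lift H (\<lambda>a b. a \<otimes>\<^bsub>H\<^esub> antipode H b) (comult H h) = counit H h \<odot>\<^bsub>H\<^esub> \<one>\<^bsub>H\<^esub>)"

definition commutative_algebra :: "('k, 'a, 'm) module_scheme \<Rightarrow> bool" where
  "commutative_algebra A \<longleftrightarrow> (\<forall>x\<in>carrier A. \<forall>y\<in>carrier A. x \<otimes>\<^bsub>A\<^esub> y = y \<otimes>\<^bsub>A\<^esub> x)"

definition hopf_iso ::
  "('k::field, 'a, 'm) hopf_scheme \<Rightarrow> ('k, 'b, 'n) hopf_scheme \<Rightarrow> ('a \<Rightarrow> 'b) set" where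
  "hopf_iso A B = {\<phi> \<in> alg_hom A B. bij_betw \<phi> (carrier A) (carrier B) \<and>
     (\<forall>a\<in>carrier A.
        comult B (\<phi> a) =
          tensor_lift (tensor_space B B) (\<lambda>a' a''. pure_tensor B B (\<phi> a') (\<phi> a'')) (comult A a) \<and>
        counit B (\<phi> a) = counit A a \<and>
        antipode B (\<phi> a) = \<phi> (antipode A a))}"

text \<open>Characters are taken undefined outside the carrier, so that distinct elements of
  \<open>character_group H\<close> are distinct as algebra morphisms on \<open>carrier H\<close>.\<close>

definition character_group :: "('k::field, 'a, 'm) hopf_scheme \<Rightarrow> ('a \<Rightarrow> 'k) monoid" where
  "character_group H = \<lparr>carrier = alg_hom H base_algebra \<inter> extensional (carrier H),
     mult = (\<lambda>\<chi> \<psi>. \<lambda>h\<in>carrier H. tensor_lift base_algebra (\<lambda>a b. \<chi> a * \<psi> b) (comult H h)),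
     one = restrict (counit H) (carrier H)\<rparr>"

section \<open>Gradings and graded duals\<close>

definition graded_space ::
  "nat \<Rightarrow> ('k::field, 'a, 'm) module_scheme \<Rightarrow> ((nat \<Rightarrow>\<^sub>0 nat) \<Rightarrow> 'a set) \<Rightarrow> bool" where
  "graded_space n V C \<longleftrightarrow> vectorspace class_ring V \<and>
     (\<forall>\<alpha>\<in>multi_indices n. VectorSpace.subspace class_ring (C \<alpha>) V) \<and>
     (\<forall>v\<in>carrier V. \<exists>!d. d \<in> (\<Pi>\<^sub>E \<alpha>\<in>multi_indices n. C \<alpha>) \<and>
        finite {\<alpha> \<in> multi_indices n. d \<alpha> \<noteq> \<zero>\<^bsub>V\<^esub>} \<and>
        v = (\<Oplus>\<^bsub>V\<^esub>\<alpha>\<in>{\<alpha> \<in> multi_indices n. d \<alpha> \<noteq> \<zero>\<^bsub>V\<^esub>}. d \<alpha>))"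

definition graded_hopf_algebra ::
  "nat \<Rightarrow> ('k::field, 'a, 'm) hopf_scheme \<Rightarrow> ((nat \<Rightarrow>\<^sub>0 nat) \<Rightarrow> 'a set) \<Rightarrow> bool" where
  "graded_hopf_algebra n H C \<longleftrightarrow>
     hopf_algebra H \<and> graded_space n H C \<and>
     \<one>\<^bsub>H\<^esub> \<in> C 0 \<and>
     (\<forall>\<alpha>\<in>multi_indices n. \<forall>\<beta>\<in>multi_indices n. \<forall>a\<in>C \<alpha>. \<forall>b\<in>C \<beta>. a \<otimes>\<^bsub>H\<^esub> b \<in> C (\<alpha> + \<beta>)) \<and>
     (\<forall>\<alpha>\<in>multi_indices n. \<forall>a\<in>C \<alpha>.
        comult H a \<in> lin_span (tensor_space H H)
          {pure_tensor H H b c | b c \<beta> \<gamma>. \<beta> + \<gamma> = \<alpha> \<and> b \<in> C \<beta> \<and> c \<in> C \<gamma>} \<and>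
        (\<alpha> \<noteq> 0 \<longrightarrow> counit H a = 0) \<and>
        antipode H a \<in> C \<alpha>)"

text \<open>The space $\bigoplus_\alpha H_\alpha^*$ of linear forms vanishing on all but finitely many
  components, with the algebra structure dual to the coproduct of \<open>H\<close>.\<close>

definition graded_dual_algebra ::
  "nat \<Rightarrow> ('k::field, 'a, 'm) hopf_scheme \<Rightarrow> ((nat \<Rightarrow>\<^sub>0 nat) \<Rightarrow> 'a set) \<Rightarrow> ('k, 'a \<Rightarrow> 'k) module" where
  "graded_dual_algebra n H C =
     \<lparr>carrier = {f \<in> LinearCombinations.module_hom class_ring H base_algebra \<inter> extensional (carrier H).
        finite {\<alpha> \<in> multi_indices n. \<exists>h\<in>C \<alpha>. f h \<noteq> 0}},
      mult = (\<lambda>f g. \<lambda>h\<in>carrier H. tensor_lift base_algebra (\<lambda>a b. f a * g b) (comult H h)),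
      one = restrict (counit H) (carrier H),
      zero = (\<lambda>h\<in>carrier H. 0),
      add = (\<lambda>f g. \<lambda>h\<in>carrier H. f h + g h),
      smult = (\<lambda>c f. \<lambda>h\<in>carrier H. c * f h)\<rparr>"

text \<open>The coproduct of \<open>f\<close> is the tensor \<open>T\<close> of linear forms whose value on \<open>a \<otimes> b\<close> is \<open>f (a b)\<close>; it
  exists when the components of \<open>H\<close> are finite-dimensional.\<close>

definition graded_dual ::
  "nat \<Rightarrow> ('k::field, 'a, 'm) hopf_scheme \<Rightarrow> ((nat \<Rightarrow>\<^sub>0 nat) \<Rightarrow> 'a set) \<Rightarrow> ('k, 'a \<Rightarrow> 'k) hopf" where
  "graded_dual n H C = (let D = graded_dual_algebra n H C in
     module.extend D (hopf.fields
       (\<lambda>f. f \<one>\<^bsub>H\<^esub>)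
       (\<lambda>f. THE T. T \<in> carrier (tensor_space D D) \<and>
          (\<forall>a\<in>carrier H. \<forall>b\<in>carrier H.
             tensor_lift base_algebra (\<lambda>g g'. g a * g' b) T = f (a \<otimes>\<^bsub>H\<^esub> b)))
       (\<lambda>f. \<lambda>h\<in>carrier H. f (antipode H h))))"

definition graded_dual_comp ::
  "nat \<Rightarrow> ('k::field, 'a, 'm) hopf_scheme \<Rightarrow> ((nat \<Rightarrow>\<^sub>0 nat) \<Rightarrow> 'a set) \<Rightarrow>
    (nat \<Rightarrow>\<^sub>0 nat) \<Rightarrow> ('a \<Rightarrow> 'k) set" where
  "graded_dual_comp n H C \<alpha> = {f \<in> carrier (graded_dual n H C).
     \<forall>\<beta>\<in>multi_indices n. \<beta> \<noteq> \<alpha> \<longrightarrow> (\<forall>h\<in>C \<beta>. f h = 0)}"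

section \<open>Enveloping algebras\<close>

text \<open>The free associative unital algebra on the set \<open>S\<close>, with basis the words in \<open>S\<close>.\<close>

definition free_algebra :: "'s set \<Rightarrow> ('k::field, 's list \<Rightarrow>\<^sub>0 'k) module" where
  "free_algebra S = (free_module (lists S))
     \<lparr>mult := (\<lambda>P Q. \<Sum>u\<in>Poly_Mapping.keys P. \<Sum>v\<in>Poly_Mapping.keys Q.
         Poly_Mapping.single (u @ v) (Poly_Mapping.lookup P u * Poly_Mapping.lookup Q v)),
      one := Poly_Mapping.single [] 1\<rparr>"

text \<open>The enveloping algebra of a Lie algebra \<open>L\<close>, whose bracket is the multiplication of the record
  \<open>L\<close>. It is presented by one generator for each element of \<open>L\<close>; the first two families of
  relations make the map from generators to the quotient linear.\<close>

definition env_ideal :: "('k::field, 'a, 'm) module_scheme \<Rightarrow> ('a list \<Rightarrow>\<^sub>0 'k) set" where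
  "env_ideal L = Idl\<^bsub>free_algebra (carrier L)\<^esub>
    ({Poly_Mapping.single [x \<oplus>\<^bsub>L\<^esub> y] 1 - Poly_Mapping.single [x] 1 - Poly_Mapping.single [y] 1
        | x y. x \<in> carrier L \<and> y \<in> carrier L} \<union>
     {Poly_Mapping.single [c \<odot>\<^bsub>L\<^esub> x] 1 - Poly_Mapping.single [x] c | c x. x \<in> carrier L} \<union>
     {Poly_Mapping.single [x, y] 1 - Poly_Mapping.single [y, x] 1
        - Poly_Mapping.single [x \<otimes>\<^bsub>L\<^esub> y] 1 | x y. x \<in> carrier L \<and> y \<in> carrier L})"

definition env_algebra :: "('k::field, 'a, 'm) module_scheme \<Rightarrow>
    ('k, ('a list \<Rightarrow>\<^sub>0 'k) set) module" where
  "env_algebra L = quotient (free_algebra (carrier L)) (env_ideal L)"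

definition env_incl :: "('k::field, 'a, 'm) module_scheme \<Rightarrow> 'a \<Rightarrow> ('a list \<Rightarrow>\<^sub>0 'k) set" where
  "env_incl L x = env_ideal L +>\<^bsub>free_algebra (carrier L)\<^esub> Poly_Mapping.single [x] 1"

definition word_prod :: "('a, 'm) monoid_scheme \<Rightarrow> ('x \<Rightarrow> 'a) \<Rightarrow> 'x list \<Rightarrow> 'a" where
  "word_prod A f w = foldr (\<lambda>x a. f x \<otimes>\<^bsub>A\<^esub> a) w \<one>\<^bsub>A\<^esub>"

text \<open>The algebra morphism from the enveloping algebra to \<open>A\<close> induced by a linear map \<open>f : L \<rightarrow> A\<close>
  with \<open>f [x, y] = f x f y - f y f x\<close>; for such \<open>f\<close> the value does not depend on the chosen
  representative.\<close>

definition env_lift :: "('k::field, 'b, 'n) module_scheme \<Rightarrow> ('a \<Rightarrow> 'b) \<Rightarrow>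
    ('a list \<Rightarrow>\<^sub>0 'k) set \<Rightarrow> 'b" where
  "env_lift A f X = (let P = SOME P. P \<in> X in
     \<Oplus>\<^bsub>A\<^esub>w\<in>Poly_Mapping.keys P. Poly_Mapping.lookup P w \<odot>\<^bsub>A\<^esub> word_prod A f w)"

definition opposite_algebra :: "('k, 'a, 'm) module_scheme \<Rightarrow> ('k, 'a, 'm) module_scheme" where
  "opposite_algebra A = A\<lparr>mult := (\<lambda>x y. y \<otimes>\<^bsub>A\<^esub> x)\<rparr>"

text \<open>The Hopf algebra structure for which the elements of \<open>L\<close> are primitive.\<close>

definition env_hopf :: "('k::field, 'a, 'm) module_scheme \<Rightarrow>
    ('k, ('a list \<Rightarrow>\<^sub>0 'k) set) hopf" where
  "env_hopf L = (let U = env_algebra L in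
     module.extend U (hopf.fields
       (env_lift base_algebra (\<lambda>_. 0))
       (env_lift (tensor_algebra U U)
          (\<lambda>x. pure_tensor U U (env_incl L x) \<one>\<^bsub>U\<^esub>
             \<oplus>\<^bsub>tensor_algebra U U\<^esub> pure_tensor U U \<one>\<^bsub>U\<^esub> (env_incl L x)))
       (env_lift (opposite_algebra U) (\<lambda>x. \<ominus>\<^bsub>U\<^esub> env_incl L x))))"

text \<open>The grading of the enveloping algebra induced by a grading of \<open>L\<close>.\<close>

definition env_comp :: "nat \<Rightarrow> ('k::field, 'a, 'm) module_scheme \<Rightarrow>
    ((nat \<Rightarrow>\<^sub>0 nat) \<Rightarrow> 'a set) \<Rightarrow> (nat \<Rightarrow>\<^sub>0 nat) \<Rightarrow> ('a list \<Rightarrow>\<^sub>0 'k) set set" where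
  "env_comp n L C \<alpha> = lin_span (env_algebra L)
     {word_prod (env_algebra L) (env_incl L) w | w d.
        list_all2 (\<lambda>x \<beta>. \<beta> \<in> multi_indices n \<and> x \<in> C \<beta>) w d \<and> sum_list d = \<alpha>}"

section \<open>Pre-Lie algebras\<close>

definition bilinear_map :: "('k::field, 'a, 'm) module_scheme \<Rightarrow> ('k, 'b, 'n) module_scheme \<Rightarrow>
    ('k, 'c, 'o) module_scheme \<Rightarrow> ('a \<Rightarrow> 'b \<Rightarrow> 'c) \<Rightarrow> bool" where
  "bilinear_map V W U \<beta> \<longleftrightarrow>
     (\<forall>w\<in>carrier W. (\<lambda>v. \<beta> v w) \<in> LinearCombinations.module_hom class_ring V U) \<and>
     (\<forall>v\<in>carrier V. \<beta> v \<in> LinearCombinations.module_hom class_ring W U)"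

definition pre_lie_algebra :: "('k::field, 'a, 'm) module_scheme \<Rightarrow> bool" where
  "pre_lie_algebra V \<longleftrightarrow> vectorspace class_ring V \<and> bilinear_map V V V (mult V) \<and>
     (\<forall>x\<in>carrier V. \<forall>y\<in>carrier V. \<forall>z\<in>carrier V.
        (x \<otimes>\<^bsub>V\<^esub> y) \<otimes>\<^bsub>V\<^esub> z \<ominus>\<^bsub>V\<^esub> x \<otimes>\<^bsub>V\<^esub> (y \<otimes>\<^bsub>V\<^esub> z) =
        (y \<otimes>\<^bsub>V\<^esub> x) \<otimes>\<^bsub>V\<^esub> z \<ominus>\<^bsub>V\<^esub> y \<otimes>\<^bsub>V\<^esub> (x \<otimes>\<^bsub>V\<^esub> z))"

text \<open>The Lie algebra of a pre-Lie algebra, with bracket \<open>x * y - y * x\<close>.\<close>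

definition commutator_lie ::  "('k, 'a, 'm) module_scheme \<Rightarrow> ('k, 'a, 'm) module_scheme" where
  "commutator_lie V = V\<lparr>mult := (\<lambda>x y. x \<otimes>\<^bsub>V\<^esub> y \<ominus>\<^bsub>V\<^esub> y \<otimes>\<^bsub>V\<^esub> x)\<rparr>"

definition index_vec :: "nat \<Rightarrow> (nat \<Rightarrow>\<^sub>0 nat) \<Rightarrow> 'k::semiring_1 vec" where
  "index_vec n \<alpha> = vec n (\<lambda>k. of_nat (Poly_Mapping.lookup \<alpha> k))"

definition deg1_with :: "('k::field, 'a, 'm) module_scheme \<Rightarrow> nat \<Rightarrow> nat \<Rightarrow>
    (nat \<Rightarrow> (nat \<Rightarrow>\<^sub>0 nat) \<Rightarrow> 'a) \<Rightarrow> (nat \<Rightarrow> nat \<Rightarrow> 'k vec) \<Rightarrow> (nat \<Rightarrow> nat \<Rightarrow> 'k) \<Rightarrow> bool" where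
  "deg1_with V M N f A b \<longleftrightarrow>
     inj_on (\<lambda>(i, \<alpha>). f i \<alpha>) ({..<M} \<times> (multi_indices N - {0})) \<and>
     vectorspace.basis class_ring V ((\<lambda>(i, \<alpha>). f i \<alpha>) ` ({..<M} \<times> (multi_indices N - {0}))) \<and>
     (\<forall>i<M. \<forall>j<M. A i j \<in> carrier_vec N) \<and>
     (\<forall>i<M. \<forall>j<M. \<forall>\<alpha>\<in>multi_indices N - {0}. \<forall>\<beta>\<in>multi_indices N - {0}.
        f j \<beta> \<otimes>\<^bsub>V\<^esub> f i \<alpha> = (A i j \<bullet> index_vec N \<alpha> + b i j) \<odot>\<^bsub>V\<^esub> f i (\<alpha> + \<beta>))"

definition deg1_pre_lie_algebra :: "('k::field, 'a, 'm) module_scheme \<Rightarrow> bool" where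
  "deg1_pre_lie_algebra V \<longleftrightarrow> pre_lie_algebra V \<and> (\<exists>M N f A b. deg1_with V M N f A b)"

section \<open>The pre-Lie algebra $\mathfrak{g}_{\mathcal{B}}$\<close>

definition stacked_matrix :: "nat \<Rightarrow> 'k::field mat \<Rightarrow> 'k mat" where
  "stacked_matrix p B = 1\<^sub>m p @\<^sub>r B"

definition g_basis :: "nat \<Rightarrow> (nat \<Rightarrow>\<^sub>0 nat) \<Rightarrow> (nat \<times> (nat \<Rightarrow>\<^sub>0 nat)) \<Rightarrow>\<^sub>0 'k::field" where
  "g_basis i \<alpha> = Poly_Mapping.single (i, \<alpha>) 1"

definition g_algebra :: "nat \<Rightarrow> nat \<Rightarrow> 'k::field mat \<Rightarrow>
    ('k, (nat \<times> (nat \<Rightarrow>\<^sub>0 nat)) \<Rightarrow>\<^sub>0 'k) module" where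
  "g_algebra p q B = (free_module ({..<p} \<times> (multi_indices (p + q) - {0})))
     \<lparr>mult := (\<lambda>P Q. \<Sum>(j, \<beta>)\<in>Poly_Mapping.keys P. \<Sum>(i, \<alpha>)\<in>Poly_Mapping.keys Q.
        Poly_Mapping.single (i, \<alpha> + \<beta>)
          (Poly_Mapping.lookup P (j, \<beta>) * Poly_Mapping.lookup Q (i, \<alpha>) *
             (col (stacked_matrix p B) j \<bullet> index_vec (p + q) \<alpha>)))\<rparr>"

definition g_comp :: "nat \<Rightarrow> nat \<Rightarrow> 'k::field mat \<Rightarrow> (nat \<Rightarrow>\<^sub>0 nat) \<Rightarrow>
    ((nat \<times> (nat \<Rightarrow>\<^sub>0 nat)) \<Rightarrow>\<^sub>0 'k) set" where
  "g_comp p q B \<alpha> = {P \<in> carrier (g_algebra p q B). Poly_Mapping.keys P \<subseteq> {..<p} \<times> {\<alpha>}}"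

end

theory Submission
  imports Defs "HOL-Library.Product_Plus" "HOL-Library.Multiset"
begin

text \<open>
  Elements of the group are determined by their coefficients \<open>x (i, \<alpha>)\<close>, and the coefficients of a
  product are polynomials in those of the factors. Hence the polynomial algebra on the coordinates
  carries a Hopf algebra structure whose characters are the points of the group; all identities
  between its structure maps are checked at points, which separate polynomials (also in tensor powers,
  the field being infinite).

  In the graded dual, the forms reading off linear coefficients are derivations at the unit, and their
  commutators are computed on coordinates, where they reproduce the bracket of the pre-Lie algebra.
  This gives an algebra morphism from the enveloping algebra to the graded dual. Its pairing with
  monomials is triangular with nonzero diagonal (characteristic zero) on any choice of one word for
  each monomial. Such words span the enveloping algebra by reordering letters, so the morphism is
  bijective, without appeal to the Poincare-Birkhoff-Witt theorem. It respects coproducts because the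
  left-invariant operators given by derivations at the unit are derivations.
\<close>

text \<open>In the coordinate \<open>(i, \<alpha> + \<beta>)\<close> of a product,
  \<open>y (i, \<alpha>)\<close> is multiplied by a polynomial whose linear coefficient in
  \<open>x (j, \<beta>)\<close> is \<open>A j \<alpha>\<close>, the exponent of
  \<open>F_j / x_j\<close> in the substitution, plus one if \<open>i = j\<close>, because the
  leading \<open>x_i\<close> is itself replaced by \<open>F_i\<close>. So the convolution of two
  linear forms is not the pre-Lie product: it differs by this unit and by values on quadratic
  monomials. Both corrections are symmetric in the two factors and disappear in the commutator; the
  graded dual sees the Lie bracket only.

  Exponents from the field obstruct a direct treatment of the group law. The coefficients of
  \<open>u^c\<close> are polynomials in \<open>c\<close>, so the laws of powers are deduced from
  natural exponents.

  Two degrees coexist. All structure maps are homogeneous for the weight, in which the variable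
  \<open>(i, \<alpha>)\<close> counts as \<alpha>; as \<alpha> is nonzero, components are
  finite-dimensional and the recursion for the antipode ends. Triangularity of the pairing refers
  instead to the number of factors of a monomial: modulo monomials with more factors, a derivation
  at the unit acts through the coproduct as a partial derivative.\<close>

hide_const (open) Polynomial.smult

abbreviation "keys \<equiv> Poly_Mapping.keys"
abbreviation "lookup \<equiv> Poly_Mapping.lookup"
abbreviation "single \<equiv> Poly_Mapping.single"

section \<open>Linear algebra over the ground field\<close>

abbreviation lin :: "('k::field, 'a, 'm) module_scheme \<Rightarrow> ('k, 'b, 'n) module_scheme \<Rightarrow> ('a \<Rightarrow> 'b) set" where
  "lin V W \<equiv> LinearCombinations.module_hom class_ring V W"

text \<open>Every element of the type is a scalar, so the facts restated here carry no membership
  condition on scalars and use \<open>+\<close>, \<open>*\<close>, \<open>0\<close> and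
  \<open>1\<close> of the type instead of the fields of \<open>class_ring\<close>.\<close>

locale kvs =
  fixes V :: "('k::field, 'a, 'm) module_scheme" (structure)
  assumes vs: "vectorspace class_ring V"
begin

interpretation vectorspace class_ring V by (rule vs)

lemma abelian: "abelian_group V" by unfold_locales
lemma is_module: "module class_ring V" by unfold_locales
lemma ksm_closed [simp, intro]: "x \<in> carrier V \<Longrightarrow> c \<odot> x \<in> carrier V" by (rule smult_closed) auto
lemma ksm_add: "x \<in> carrier V \<Longrightarrow> y \<in> carrier V \<Longrightarrow> c \<odot> (x \<oplus> y) = c \<odot> x \<oplus> c \<odot> y"
  by (rule smult_r_distr) auto
lemma add_ksm: "x \<in> carrier V \<Longrightarrow> (a + b) \<odot> x = a \<odot> x \<oplus> b \<odot> x"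
  using smult_l_distr[of a b x] by simp
lemma ksm_ksm [simp]: "x \<in> carrier V \<Longrightarrow> a \<odot> (b \<odot> x) = (a * b) \<odot> x"
  using smult_assoc1[of a b x] by simp
lemma ksm_one [simp]: "x \<in> carrier V \<Longrightarrow> 1 \<odot> x = x"
  using smult_one[of x] by simp
lemma ksm_0 [simp]: "x \<in> carrier V \<Longrightarrow> 0 \<odot> x = \<zero>"
  using smult_l_null[of x] by simp
lemma ksm_zero [simp]: "c \<odot> \<zero> = \<zero>"
  using smult_r_null[of c] by simp
lemma ksm_m1: "x \<in> carrier V \<Longrightarrow> (-1) \<odot> x = \<ominus> x"
  using smult_minus_1[of x] by (simp add: class_ring_simps)
lemma span_sub: "S \<subseteq> carrier V \<Longrightarrow> submodule class_ring (lin_span V S) V"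
  by (rule span_is_submodule)
lemma span_min: "S \<subseteq> N \<Longrightarrow> submodule class_ring N V \<Longrightarrow> lin_span V S \<subseteq> N"
  by (rule span_is_subset)
lemma span_in: "S \<subseteq> carrier V \<Longrightarrow> x \<in> S \<Longrightarrow> x \<in> lin_span V S"
  using in_own_span by auto
lemma submodule_sp: "submodule class_ring N V \<Longrightarrow> VectorSpace.subspace class_ring N V"
  using vs by (simp add: VectorSpace.subspace_def)
lemma lin_dep_iff: "lin_dep S \<longleftrightarrow> (\<exists>A a v. finite A \<and> A \<subseteq> S \<and> (\<Oplus>v\<in>A. a v \<odot> v) = \<zero> \<and> v \<in> A \<and> a v \<noteq> 0)"
  by (simp add: lin_dep_def lincomb_def)

end

sublocale kvs \<subseteq> abelian_group V by (rule abelian)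

context kvs begin

lemma submoduleI':
  assumes "N \<subseteq> carrier V" "\<zero> \<in> N" "\<And>x y. x \<in> N \<Longrightarrow> y \<in> N \<Longrightarrow> x \<oplus> y \<in> N" "\<And>c x. x \<in> N \<Longrightarrow> c \<odot> x \<in> N"
  shows "submodule class_ring N V"
  using assms is_module by (simp add: submodule_def)

text \<open>The elements of the span that satisfy \<open>P\<close> form a subspace. Membership in
  the span is part of the set, so the cases for sums and multiples may use it.\<close>

lemma span_induct [consumes 2, case_names zero base add smult]:
  assumes x: "x \<in> lin_span V S" and S: "S \<subseteq> carrier V"
    and "P \<zero>" "\<And>s. s \<in> S \<Longrightarrow> P s"
    "\<And>x y. x \<in> carrier V \<Longrightarrow> y \<in> carrier V \<Longrightarrow> x \<in> lin_span V S \<Longrightarrow> y \<in> lin_span V S \<Longrightarrow> P x \<Longrightarrow> P y \<Longrightarrow> P (x \<oplus> y)"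
    "\<And>c x. x \<in> carrier V \<Longrightarrow> x \<in> lin_span V S \<Longrightarrow> P x \<Longrightarrow> P (c \<odot> x)"
  shows "P x"
proof -
  note sub = span_sub[OF S]
  have c: "lin_span V S \<subseteq> carrier V" using sub by (simp add: submodule_def)
  have "submodule class_ring {x \<in> lin_span V S. P x} V"
    using assms(3,5,6) sub[unfolded submodule_def] by (intro submoduleI') (auto simp: subsetD[OF c])
  moreover have "S \<subseteq> {x \<in> lin_span V S. P x}" using assms(4) span_in[OF S] by auto
  ultimately have "lin_span V S \<subseteq> {x \<in> lin_span V S. P x}" by (rule span_min[rotated])
  then show ?thesis using x by auto
qed

lemma span_carrier: "S \<subseteq> carrier V \<Longrightarrow> lin_span V S \<subseteq> carrier V"
  using span_sub by (simp add: submodule_def)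
lemma span_zero: "S \<subseteq> carrier V \<Longrightarrow> \<zero> \<in> lin_span V S"
  using span_sub by (simp add: submodule_def)
lemma span_add: "S \<subseteq> carrier V \<Longrightarrow> x \<in> lin_span V S \<Longrightarrow> y \<in> lin_span V S \<Longrightarrow> x \<oplus> y \<in> lin_span V S"
  using span_sub by (simp add: submodule_def)
lemma span_smult: "S \<subseteq> carrier V \<Longrightarrow> x \<in> lin_span V S \<Longrightarrow> c \<odot> x \<in> lin_span V S"
  using span_sub by (simp add: submodule_def)

lemma finsum_ksm:
  "finite S \<Longrightarrow> (\<And>s. s \<in> S \<Longrightarrow> f s \<in> carrier V) \<Longrightarrow> c \<odot> (\<Oplus>s\<in>S. f s) = (\<Oplus>s\<in>S. c \<odot> f s)"
proof (induction S rule: finite_induct)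
  case (insert s S)
  then have "f \<in> S \<rightarrow> carrier V" "f s \<in> carrier V" by auto
  with insert show ?case by (subst finsum_insert; simp add: finsum_insert ksm_add Pi_def)
qed simp

lemma finsum_in_sub:
  assumes N: "submodule class_ring N V" and "finite S" "\<And>s. s \<in> S \<Longrightarrow> f s \<in> N"
  shows "(\<Oplus>s\<in>S. f s) \<in> N"
  using assms(2,3)
proof (induction S rule: finite_induct)
  case empty
  then show ?case using N by (simp add: submodule_def)
next
  case (insert s S)
  have "N \<subseteq> carrier V" using N by (simp add: submodule_def)
  then have "f \<in> S \<rightarrow> carrier V" "f s \<in> carrier V" using insert by auto
  then show ?case using insert N by (simp add: finsum_insert submodule_def)
qed

end

lemma vsI:
  fixes V :: "('k::field, 'a, 'm) module_scheme" (structure)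
  assumes "\<zero> \<in> carrier V"
    "\<And>x y. x \<in> carrier V \<Longrightarrow> y \<in> carrier V \<Longrightarrow> x \<oplus> y \<in> carrier V"
    "\<And>c x. x \<in> carrier V \<Longrightarrow> c \<odot> x \<in> carrier V"
    "\<And>x y. x \<in> carrier V \<Longrightarrow> y \<in> carrier V \<Longrightarrow> x \<oplus> y = y \<oplus> x"
    "\<And>x y z. x \<in> carrier V \<Longrightarrow> y \<in> carrier V \<Longrightarrow> z \<in> carrier V \<Longrightarrow> x \<oplus> y \<oplus> z = x \<oplus> (y \<oplus> z)"
    "\<And>x. x \<in> carrier V \<Longrightarrow> x \<oplus> \<zero> = x"
    "\<And>x. x \<in> carrier V \<Longrightarrow> x \<oplus> (-1) \<odot> x = \<zero>"
    "\<And>a b x. x \<in> carrier V \<Longrightarrow> (a * b) \<odot> x = a \<odot> (b \<odot> x)"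
    "\<And>x. x \<in> carrier V \<Longrightarrow> 1 \<odot> x = x"
    "\<And>a b x. x \<in> carrier V \<Longrightarrow> (a + b) \<odot> x = a \<odot> x \<oplus> b \<odot> x"
    "\<And>c x y. x \<in> carrier V \<Longrightarrow> y \<in> carrier V \<Longrightarrow> c \<odot> (x \<oplus> y) = c \<odot> x \<oplus> c \<odot> y"
  shows "vectorspace class_ring V"
proof (rule vs_criteria)
  show "\<forall>v\<in>carrier V. \<exists>neg_v\<in>carrier V. v \<oplus> neg_v = \<zero>"
    using assms(3,7) by blast
qed (use assms in \<open>auto simp: class_field\<close>)

lemma linI:
  assumes "\<And>x. x \<in> carrier V \<Longrightarrow> f x \<in> carrier W"
    "\<And>x y. x \<in> carrier V \<Longrightarrow> y \<in> carrier V \<Longrightarrow> f (x \<oplus>\<^bsub>V\<^esub> y) = f x \<oplus>\<^bsub>W\<^esub> f y"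
    "\<And>c x. x \<in> carrier V \<Longrightarrow> f (c \<odot>\<^bsub>V\<^esub> x) = c \<odot>\<^bsub>W\<^esub> f x"
  shows "f \<in> lin V W"
  using assms by (auto simp: LinearCombinations.module_hom_def)

lemma lin_closed: "f \<in> lin V W \<Longrightarrow> x \<in> carrier V \<Longrightarrow> f x \<in> carrier W"
  and lin_add: "f \<in> lin V W \<Longrightarrow> x \<in> carrier V \<Longrightarrow> y \<in> carrier V \<Longrightarrow> f (x \<oplus>\<^bsub>V\<^esub> y) = f x \<oplus>\<^bsub>W\<^esub> f y"
  and lin_smult: "f \<in> lin V W \<Longrightarrow> x \<in> carrier V \<Longrightarrow> f (c \<odot>\<^bsub>V\<^esub> x) = c \<odot>\<^bsub>W\<^esub> f x"
  by (auto simp: LinearCombinations.module_hom_def)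

lemma lin_cong:
  "kvs V \<Longrightarrow> (\<And>x. x \<in> carrier V \<Longrightarrow> f x = g x) \<Longrightarrow> f \<in> lin V W \<longleftrightarrow> g \<in> lin V W"
  by (auto simp: LinearCombinations.module_hom_def Pi_def abelian_group.axioms
      kvs.ksm_closed abelian_monoid.a_closed[OF abelian_group.axioms(1)[OF kvs.abelian]])

lemma lin_compose: "f \<in> lin V W \<Longrightarrow> g \<in> lin W U \<Longrightarrow> (\<lambda>x. g (f x)) \<in> lin V U"
  by (auto simp: LinearCombinations.module_hom_def Pi_def)

lemma lin_zero:
  assumes "kvs V" "kvs W" "f \<in> lin V W" shows "f \<zero>\<^bsub>V\<^esub> = \<zero>\<^bsub>W\<^esub>"
proof -
  interpret V: kvs V by fact
  interpret W: kvs W by fact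
  have "f \<zero>\<^bsub>V\<^esub> = f (0 \<odot>\<^bsub>V\<^esub> \<zero>\<^bsub>V\<^esub>)" by simp
  also have "\<dots> = 0 \<odot>\<^bsub>W\<^esub> f \<zero>\<^bsub>V\<^esub>" by (rule lin_smult[OF assms(3)]) simp
  finally show ?thesis by (simp add: lin_closed[OF assms(3)])
qed

lemma lin_uminus:
  assumes "kvs V" "kvs W" "f \<in> lin V W" "x \<in> carrier V" shows "f (\<ominus>\<^bsub>V\<^esub> x) = \<ominus>\<^bsub>W\<^esub> f x"
  using assms by (simp add: kvs.ksm_m1[symmetric] lin_smult lin_closed)

lemma lin_minus:
  assumes "kvs V" "kvs W" "f \<in> lin V W" "x \<in> carrier V" "y \<in> carrier V"
  shows "f (x \<ominus>\<^bsub>V\<^esub> y) = f x \<ominus>\<^bsub>W\<^esub> f y"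
  using assms by (simp add: a_minus_def lin_add lin_uminus abelian_group.a_inv_closed[OF kvs.abelian])

lemma lin_finsum:
  assumes "kvs V" "kvs W" "f \<in> lin V W" "finite S" "\<And>s. s \<in> S \<Longrightarrow> g s \<in> carrier V"
  shows "f (\<Oplus>\<^bsub>V\<^esub>s\<in>S. g s) = (\<Oplus>\<^bsub>W\<^esub>s\<in>S. f (g s))"
  using assms(4,5)
proof (induction S rule: finite_induct)
  case empty
  interpret V: kvs V by fact
  interpret W: kvs W by fact
  show ?case by (simp add: lin_zero assms)
next
  case (insert s S)
  interpret V: kvs V by fact
  interpret W: kvs W by fact
  have c: "g \<in> S \<rightarrow> carrier V" "g s \<in> carrier V" "(\<lambda>s. f (g s)) \<in> S \<rightarrow> carrier W" "f (g s) \<in> carrier W"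
    using insert lin_closed[OF assms(3)] by auto
  then show ?case using insert by (simp add: lin_add[OF assms(3)])
qed

lemma lin_eq_on_span:
  assumes "kvs V" "kvs W" "f \<in> lin V W" "g \<in> lin V W" "S \<subseteq> carrier V" "\<And>s. s \<in> S \<Longrightarrow> f s = g s" "x \<in> lin_span V S"
  shows "f x = g x"
proof -
  interpret V: kvs V by fact
  from assms(7,5) show ?thesis
  proof (induction rule: V.span_induct)
    case zero then show ?case using assms by (simp add: lin_zero)
  qed (use assms in \<open>auto simp: lin_add lin_smult\<close>)
qed

section \<open>Vector spaces over the ground field\<close>

lemma base_simps [simp]: "carrier base_algebra = UNIV" "\<zero>\<^bsub>base_algebra\<^esub> = 0" "\<one>\<^bsub>base_algebra\<^esub> = 1"
  "x \<oplus>\<^bsub>base_algebra\<^esub> y = x + y" "x \<otimes>\<^bsub>base_algebra\<^esub> y = x * y" "x \<odot>\<^bsub>base_algebra\<^esub> y = x * y"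
  by (simp_all add: base_algebra_def)

lemma base_kvs: "kvs base_algebra"
  by (rule kvs.intro, rule vsI) (auto simp: algebra_simps)

lemma finsum_base [simp]: "finsum base_algebra f S = sum f S"
proof -
  interpret kvs base_algebra by (rule base_kvs)
  show ?thesis by (induct S rule: infinite_finite_induct) auto
qed

lemma base_alg: "assoc_algebra base_algebra"
  using base_kvs by (auto simp: assoc_algebra_def kvs_def algebra_simps
      intro!: ringI abelian_groupI monoidI exI[of _ "- x" for x])

lemma free_simps [simp]: "carrier (free_module S) = {P. keys P \<subseteq> S}"
  "\<zero>\<^bsub>free_module S\<^esub> = 0" "x \<oplus>\<^bsub>free_module S\<^esub> y = x + y"
  "c \<odot>\<^bsub>free_module S\<^esub> y = Poly_Mapping.map ((*) c) y"
  by (simp_all add: free_module_def)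

lemma lookup_scale [simp]: "lookup (Poly_Mapping.map ((*) c) P) s = c * (lookup P s :: 'k::comm_ring_1)"
  by transfer (auto simp: when_def)

lemma keys_add_sub: "keys P \<subseteq> S \<Longrightarrow> keys Q \<subseteq> S \<Longrightarrow> keys (P + Q) \<subseteq> S"
  using keys_add[of P Q] by blast

lemma keys_scale: "keys (Poly_Mapping.map ((*) (c :: 'k::comm_ring_1)) P) \<subseteq> keys P"
  by (auto simp: in_keys_iff)

lemma keys_scale_sub: "keys P \<subseteq> S \<Longrightarrow> keys (Poly_Mapping.map ((*) (c :: 'k::comm_ring_1)) P) \<subseteq> S"
  using keys_scale[of c P] by blast

lemma free_kvs: "kvs (free_module S :: ('k::field, 's \<Rightarrow>\<^sub>0 'k) module)"
  by (rule kvs.intro, rule vsI)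
    (auto simp: keys_add_sub keys_scale_sub lookup_add algebra_simps intro!: poly_mapping_eqI
      dest: subsetD[OF keys_scale] subsetD[OF keys_add])

text \<open>Universal property of the free space: prescribed images of the basis extend linearly.
  The lifts out of tensor spaces and enveloping algebras start from this map.\<close>

lemma (in kvs) lc_lin:
  assumes "\<And>s. s \<in> S \<Longrightarrow> f s \<in> carrier V"
  shows "(\<lambda>P. \<Oplus>s\<in>keys P. lookup P s \<odot> f s) \<in> lin (free_module S) V" (is "?L \<in> _")
proof -
  \<comment> \<open>The index set \<open>keys P\<close> varies with \<open>P\<close>; enlarging it
    to a common finite \<open>T\<close> adds only zero terms and lets sums be compared
    termwise.\<close>
  have ext: "?L P = (\<Oplus>s\<in>T. lookup P s \<odot> f s)"
    if "finite T" "keys P \<subseteq> T" "T \<subseteq> S" for P T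
    by (rule add.finprod_mono_neutral_cong_left)
      (use that assms in \<open>auto simp: not_in_keys_iff_lookup_eq_zero\<close>)
  show ?thesis
  proof (rule linI)
    fix P :: "'b \<Rightarrow>\<^sub>0 'k" assume P: "P \<in> carrier (free_module S)"
    show "?L P \<in> carrier V" using P assms by (intro finsum_closed) auto
    fix c
    have "?L (c \<odot>\<^bsub>free_module S\<^esub> P) = (\<Oplus>s\<in>keys P. lookup (c \<odot>\<^bsub>free_module S\<^esub> P) s \<odot> f s)"
      using P by (intro ext) (auto dest: subsetD[OF keys_scale])
    also have "\<dots> = (\<Oplus>s\<in>keys P. c \<odot> (lookup P s \<odot> f s))"
      using P assms by (intro finsum_cong') auto
    also have "\<dots> = c \<odot> ?L P" using P assms by (subst finsum_ksm) auto
    finally show "?L (c \<odot>\<^bsub>free_module S\<^esub> P) = c \<odot> ?L P" .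
  next
    fix P Q :: "'b \<Rightarrow>\<^sub>0 'k" assume PQ: "P \<in> carrier (free_module S)" "Q \<in> carrier (free_module S)"
    let ?T = "keys P \<union> keys Q"
    have "?L (P \<oplus>\<^bsub>free_module S\<^esub> Q) = (\<Oplus>s\<in>?T. lookup P s \<odot> f s \<oplus> lookup Q s \<odot> f s)"
      using PQ assms by (subst ext[of ?T]) (auto dest: subsetD[OF keys_add] simp: lookup_add intro!: finsum_cong'
        add_ksm)
    also have "\<dots> = (\<Oplus>s\<in>?T. lookup P s \<odot> f s) \<oplus> (\<Oplus>s\<in>?T. lookup Q s \<odot> f s)"
      using PQ assms by (intro finsum_addf) auto
    also have "\<dots> = ?L P \<oplus> ?L Q" using PQ by (subst (1 2) ext[of ?T]) auto
    finally show "?L (P \<oplus>\<^bsub>free_module S\<^esub> Q) = ?L P \<oplus> ?L Q" .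
  qed
qed

lemma (in kvs) lc_single: "f s \<in> carrier V \<Longrightarrow>
  (\<Oplus>t\<in>keys (single s c). lookup (single s c) t \<odot> f t) = c \<odot> f s"
  by (cases "c = 0") auto

lemma pm_sum: "(P :: _ \<Rightarrow>\<^sub>0 _::comm_monoid_add) = (\<Sum>s\<in>keys P. single s (lookup P s))"
  by (rule poly_mapping_eqI) (auto simp: lookup_sum lookup_single when_def not_in_keys_iff_lookup_eq_zero)

lemma pm_induct [consumes 1, case_names zero single add]:
  assumes "keys P \<subseteq> S" "Q 0" "\<And>s c. s \<in> S \<Longrightarrow> Q (single s c)"
    "\<And>P R. keys P \<subseteq> S \<Longrightarrow> keys R \<subseteq> S \<Longrightarrow> Q P \<Longrightarrow> Q R \<Longrightarrow> Q (P + R)"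
  shows "Q (P :: 's \<Rightarrow>\<^sub>0 'k::comm_monoid_add)"
proof -
  have "keys (sum (\<lambda>s. single s (lookup P s)) T) \<subseteq> S \<and>
     Q (sum (\<lambda>s. single s (lookup P s)) T)" if "finite T" "T \<subseteq> S" for T
    using that   proof (induction T rule: finite_induct)
    case (insert t T)
    then have "keys (single t (lookup P t)) \<subseteq> S" by auto
    with insert show ?case by (simp add: assms keys_add_sub)
  qed (simp add: assms)
  from this[of "keys P"] show ?thesis
    using assms(1) pm_sum[of P] by simp
qed

section \<open>Quotients\<close>

lemma quotient_simps:
  "carrier (quotient M N) = a_rcosets\<^bsub>M\<^esub> N" "\<zero>\<^bsub>quotient M N\<^esub> = N" "X \<oplus>\<^bsub>quotient M N\<^esub> Y = X <+>\<^bsub>M\<^esub> Y"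
  "\<one>\<^bsub>quotient M N\<^esub> = N +>\<^bsub>M\<^esub> \<one>\<^bsub>M\<^esub>" "X \<otimes>\<^bsub>quotient M N\<^esub> Y = rcoset_mult M N X Y"
  "c \<odot>\<^bsub>quotient M N\<^esub> X = (\<Union>x\<in>X. N +>\<^bsub>M\<^esub> (c \<odot>\<^bsub>M\<^esub> x))"
  by (simp_all add: quotient_def FactRing_def ring.defs module.defs)

text \<open>\<open>quotient\<close> gives both the tensor spaces and the enveloping algebras, so its
  linear structure is treated once. \<open>cls\<close> is the projection, and computations go
  through representatives.\<close>

locale kquot = kvs M for M :: "('k::field, 'a, 'm) module_scheme" (structure) +
  fixes N assumes N: "submodule class_ring N M"
begin

abbreviation cls where "cls x \<equiv> N +> x"

lemma N_carrier: "N \<subseteq> carrier M" and N_zero [simp]: "\<zero> \<in> N"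
  and N_add: "x \<in> N \<Longrightarrow> y \<in> N \<Longrightarrow> x \<oplus> y \<in> N" and N_smult: "x \<in> N \<Longrightarrow> c \<odot> x \<in> N"
  using N by (auto simp: submodule_def)

lemma N_uminus: "x \<in> N \<Longrightarrow> \<ominus> x \<in> N"
  using N_smult[of x "-1"] N_carrier by (auto simp: ksm_m1)

lemma N_minus: "x \<in> N \<Longrightarrow> y \<in> N \<Longrightarrow> x \<ominus> y \<in> N"
  by (simp add: a_minus_def N_add N_uminus)

lemma in_cls: "x \<in> carrier M \<Longrightarrow> y \<in> cls x \<longleftrightarrow> y \<in> carrier M \<and> y \<ominus> x \<in> N"
proof
  assume x: "x \<in> carrier M" and "y \<in> cls x"
  then obtain n where n: "n \<in> N" "y = n \<oplus> x" by (auto simp: a_r_coset_def')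
  then have "n \<in> carrier M" using N_carrier by auto
  with n x show "y \<in> carrier M \<and> y \<ominus> x \<in> N"
    by (simp add: a_minus_def a_assoc r_neg)
next
  assume x: "x \<in> carrier M" and y: "y \<in> carrier M \<and> y \<ominus> x \<in> N"
  then have "y = (y \<ominus> x) \<oplus> x" by (simp add: a_minus_def a_assoc l_neg)
  with y show "y \<in> cls x" by (auto simp: a_r_coset_def')
qed

lemma cls_self [simp]: "x \<in> carrier M \<Longrightarrow> x \<in> cls x"
  by (simp add: in_cls a_minus_def r_neg)

lemma cls_eqI:
  assumes "x \<in> carrier M" "y \<in> carrier M" "x \<ominus> y \<in> N" shows "cls x = cls y"
proof -
  have "z \<ominus> x \<in> N \<longleftrightarrow> z \<ominus> y \<in> N" if z: "z \<in> carrier M" for z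
  proof -
    have "(z \<ominus> x) \<oplus> (x \<ominus> y) = z \<ominus> y"
      using assms z by (metis a_minus_def a_assoc l_neg l_zero a_inv_closed a_closed minus_closed)
    moreover have "(z \<ominus> y) \<ominus> (x \<ominus> y) = z \<ominus> x"
      using assms z calculation by (metis a_minus_def a_assoc r_neg r_zero a_inv_closed a_closed minus_closed)
    ultimately show ?thesis using N_add N_minus assms by metis
  qed
  then show ?thesis using assms in_cls by blast
qed

lemma cls_eq_iff: "x \<in> carrier M \<Longrightarrow> y \<in> carrier M \<Longrightarrow> cls x = cls y \<longleftrightarrow> x \<ominus> y \<in> N"
  by (metis cls_eqI in_cls cls_self)

lemma cls_zero: "cls \<zero> = N"
  using N_carrier by (auto simp: in_cls a_minus_def)

lemma q_carrier: "carrier (quotient M N) = cls ` carrier M"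
  by (auto simp: quotient_simps A_RCOSETS_def')

lemma cls_closed [simp]: "x \<in> carrier M \<Longrightarrow> cls x \<in> carrier (quotient M N)"
  by (simp add: q_carrier)

lemma q_add: assumes x: "x \<in> carrier M" and y: "y \<in> carrier M"
  shows "cls x \<oplus>\<^bsub>quotient M N\<^esub> cls y = cls (x \<oplus> y)"
proof -
  have "z \<in> cls x <+> cls y \<longleftrightarrow> z \<in> cls (x \<oplus> y)" for z
  proof
    assume "z \<in> cls x <+> cls y"
    then obtain a b where ab: "a \<in> cls x" "b \<in> cls y" "z = a \<oplus> b" by (auto simp: set_add_def')
    then have c: "a \<in> carrier M" "b \<in> carrier M" "a \<ominus> x \<in> N" "b \<ominus> y \<in> N" using in_cls x y by auto
    have "a \<oplus> b \<ominus> (x \<oplus> y) = (a \<ominus> x) \<oplus> (b \<ominus> y)"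
      using c x y by (simp add: a_minus_def minus_add a_ac)
    with c ab x y show "z \<in> cls (x \<oplus> y)" by (simp add: in_cls N_add)
  next
    assume "z \<in> cls (x \<oplus> y)"
    then have z: "z \<in> carrier M" "z \<ominus> (x \<oplus> y) \<in> N" using in_cls x y by auto
    have "z \<ominus> (x \<oplus> y) = z \<ominus> y \<ominus> x"
      using z x y by (simp add: a_minus_def minus_add a_ac)
    moreover have "z = (z \<ominus> y) \<oplus> y"
      using z x y by (simp add: a_minus_def a_assoc l_neg)
    ultimately have "z \<ominus> y \<in> cls x" "y \<in> cls y" "z = (z \<ominus> y) \<oplus> y" using z x y by (simp_all add: in_cls[of x])
    then show "z \<in> cls x <+> cls y" unfolding set_add_def' by blast
  qed
  then show ?thesis unfolding quotient_simps by blast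
qed

lemma q_smult: assumes "x \<in> carrier M" shows "c \<odot>\<^bsub>quotient M N\<^esub> cls x = cls (c \<odot> x)"
proof -
  have "cls (c \<odot> y) = cls (c \<odot> x)" if "y \<in> cls x" for y
  proof (rule cls_eqI)
    have y: "y \<in> carrier M" "y \<ominus> x \<in> N" using that assms in_cls by auto
    have "c \<odot> y \<ominus> c \<odot> x = c \<odot> (y \<ominus> x)"
      using y assms by (simp add: a_minus_def ksm_add ksm_m1[symmetric])
    then show "c \<odot> y \<ominus> c \<odot> x \<in> N" using y N_smult by simp
  qed (use that assms in_cls in auto)
  then show ?thesis using assms cls_self unfolding quotient_simps by blast
qed

lemma q_zero: "\<zero>\<^bsub>quotient M N\<^esub> = cls \<zero>" by (simp add: quotient_simps cls_zero)

lemma q_kvs: "kvs (quotient M N)"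
proof (rule kvs.intro, rule vsI)
qed (auto simp: q_carrier q_add q_smult q_zero ksm_add add_ksm a_ac ksm_m1 r_neg)

lemma cls_lin: "cls \<in> lin M (quotient M N)"
  by (rule linI) (auto simp: q_add q_smult)

end

section \<open>Tensor products\<close>

lemma bilinearI:
  assumes "\<And>v w. v \<in> carrier V \<Longrightarrow> w \<in> carrier W \<Longrightarrow> b v w \<in> carrier U"
    "\<And>v v' w. v \<in> carrier V \<Longrightarrow> v' \<in> carrier V \<Longrightarrow> w \<in> carrier W \<Longrightarrow> b (v \<oplus>\<^bsub>V\<^esub> v') w = b v w \<oplus>\<^bsub>U\<^esub> b v' w"
    "\<And>c v w. v \<in> carrier V \<Longrightarrow> w \<in> carrier W \<Longrightarrow> b (c \<odot>\<^bsub>V\<^esub> v) w = c \<odot>\<^bsub>U\<^esub> b v w"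
    "\<And>v w w'. v \<in> carrier V \<Longrightarrow> w \<in> carrier W \<Longrightarrow> w' \<in> carrier W \<Longrightarrow> b v (w \<oplus>\<^bsub>W\<^esub> w') = b v w \<oplus>\<^bsub>U\<^esub> b v w'"
    "\<And>c v w. v \<in> carrier V \<Longrightarrow> w \<in> carrier W \<Longrightarrow> b v (c \<odot>\<^bsub>W\<^esub> w) = c \<odot>\<^bsub>U\<^esub> b v w"
  shows "bilinear_map V W U b"
  using assms unfolding bilinear_map_def by (auto intro!: linI)

lemma bil_closed: "bilinear_map V W U b \<Longrightarrow> v \<in> carrier V \<Longrightarrow> w \<in> carrier W \<Longrightarrow> b v w \<in> carrier U"
  and bil_add_l: "bilinear_map V W U b \<Longrightarrow> v \<in> carrier V \<Longrightarrow> v' \<in> carrier V \<Longrightarrow> w \<in> carrier W \<Longrightarrow>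
     b (v \<oplus>\<^bsub>V\<^esub> v') w = b v w \<oplus>\<^bsub>U\<^esub> b v' w"
  and bil_smult_l: "bilinear_map V W U b \<Longrightarrow> v \<in> carrier V \<Longrightarrow> w \<in> carrier W \<Longrightarrow> b (c \<odot>\<^bsub>V\<^esub> v) w = c \<odot>\<^bsub>U\<^esub> b v w"
  and bil_add_r: "bilinear_map V W U b \<Longrightarrow> v \<in> carrier V \<Longrightarrow> w \<in> carrier W \<Longrightarrow> w' \<in> carrier W \<Longrightarrow>
     b v (w \<oplus>\<^bsub>W\<^esub> w') = b v w \<oplus>\<^bsub>U\<^esub> b v w'"
  and bil_smult_r: "bilinear_map V W U b \<Longrightarrow> v \<in> carrier V \<Longrightarrow> w \<in> carrier W \<Longrightarrow> b v (c \<odot>\<^bsub>W\<^esub> w) = c \<odot>\<^bsub>U\<^esub> b v w"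
  and bil_lin_l: "bilinear_map V W U b \<Longrightarrow> w \<in> carrier W \<Longrightarrow> (\<lambda>v. b v w) \<in> lin V U"
  and bil_lin_r: "bilinear_map V W U b \<Longrightarrow> v \<in> carrier V \<Longrightarrow> b v \<in> lin W U"
  by (auto simp: bilinear_map_def LinearCombinations.module_hom_def)

lemma bil_compose: "bilinear_map V W U b \<Longrightarrow> f \<in> lin U X \<Longrightarrow> bilinear_map V W X (\<lambda>v w. f (b v w))"
  by (auto simp: bilinear_map_def LinearCombinations.module_hom_def Pi_def)

lemma bil_compose2: "bilinear_map V W U b \<Longrightarrow> f \<in> lin V' V \<Longrightarrow> g \<in> lin W' W \<Longrightarrow> bilinear_map V' W' U (\<lambda>v w. b (f v) (g w))"
  by (auto simp: bilinear_map_def LinearCombinations.module_hom_def Pi_def)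

lemma lin_base_bil: "f \<in> lin V base_algebra \<Longrightarrow> g \<in> lin W base_algebra \<Longrightarrow> bilinear_map V W base_algebra (\<lambda>v w. f v * g
    w)"
  by (rule bilinearI) (auto simp: lin_add lin_smult algebra_simps)

locale ktensor = V: kvs V + W: kvs W
  for V :: "('k::field, 'a, 'm) module_scheme" and W :: "('k, 'b, 'n) module_scheme"
begin

abbreviation "F \<equiv> free_module (carrier V \<times> carrier W) :: ('k, 'a \<times> 'b \<Rightarrow>\<^sub>0 'k) module"
abbreviation "VW \<equiv> tensor_space V W"
abbreviation "p \<equiv> pure_tensor V W"
abbreviation "sg v w (c :: 'k) \<equiv> single (v, w) c"

interpretation F: kvs F by (rule free_kvs)

definition "rels =
    ({sg (v \<oplus>\<^bsub>V\<^esub> v') w 1 - sg v w 1 - sg v' w 1 | v v' w. v \<in> carrier V \<and> v' \<in> carrier V \<and> w \<in> carrier W} \<union>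
     {sg v (w \<oplus>\<^bsub>W\<^esub> w') 1 - sg v w 1 - sg v w' 1 | v w w'. v \<in> carrier V \<and> w \<in> carrier W \<and> w' \<in> carrier W} \<union>
     {sg (c \<odot>\<^bsub>V\<^esub> v) w 1 - sg v w c | c v w. v \<in> carrier V \<and> w \<in> carrier W} \<union>
     {sg v (c \<odot>\<^bsub>W\<^esub> w) 1 - sg v w c | c v w. v \<in> carrier V \<and> w \<in> carrier W})"

lemma kernel: "tensor_kernel V W = lin_span F rels"
  by (simp add: tensor_kernel_def rels_def)

lemma keys_minus_sub: "keys P \<subseteq> S \<Longrightarrow> keys Q \<subseteq> S \<Longrightarrow> keys (P - Q) \<subseteq> S"
  for P Q :: "'s \<Rightarrow>\<^sub>0 'k"
  using keys_diff[of P Q] by blast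

lemma sg_F: "v \<in> carrier V \<Longrightarrow> w \<in> carrier W \<Longrightarrow> keys (sg v w c) \<subseteq> carrier V \<times> carrier W"
  by auto

lemma rels_F: "rels \<subseteq> carrier F"
proof -
  have "keys x \<subseteq> carrier V \<times> carrier W" if "x \<in> rels" for x
    using that unfolding rels_def
    by (elim UnE CollectE exE conjE; simp only:; intro keys_minus_sub sg_F; simp)
  then show ?thesis by auto
qed

sublocale Q: kquot F "tensor_kernel V W"
  rewrites "quotient F (tensor_kernel V W) = VW"
proof -
  show "kquot F (tensor_kernel V W)"
    unfolding kernel by (intro kquot.intro free_kvs kquot_axioms.intro F.span_sub rels_F)
  show "quotient F (tensor_kernel V W) = VW"
    by (simp only: tensor_space_def)
qed

lemma tensor_kvs: "kvs VW" by (rule Q.q_kvs)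

interpretation VW: kvs VW by (rule tensor_kvs)

lemma pure_def': "p v w = Q.cls (sg v w 1)" by (simp add: pure_tensor_def)

lemma pure_closed [simp]: "v \<in> carrier V \<Longrightarrow> w \<in> carrier W \<Longrightarrow> p v w \<in> carrier VW"
  unfolding pure_def' by (rule Q.cls_closed) auto

lemma minus_F: "P \<ominus>\<^bsub>F\<^esub> Q = P - Q" if "P \<in> carrier F" "Q \<in> carrier F"
proof -
  have "Poly_Mapping.map ((*) (-1)) Q = - Q" by (rule poly_mapping_eqI) simp
  then have "\<ominus>\<^bsub>F\<^esub> Q = - Q" using that F.ksm_m1[of Q] by simp
  then show ?thesis using that by (simp add: a_minus_def)
qed

lemma rel_cls: "P - Q \<in> rels \<Longrightarrow> P \<in> carrier F \<Longrightarrow> Q \<in> carrier F \<Longrightarrow> Q.cls P = Q.cls Q"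
  by (rule Q.cls_eqI) (auto simp: minus_F kernel F.span_in[OF rels_F] simp del: free_simps)

lemma pure_bil: "bilinear_map V W VW p"
proof (rule bilinearI)
  fix v v' w assume a: "v \<in> carrier V" "v' \<in> carrier V" "w \<in> carrier W"
  have "p v w \<oplus>\<^bsub>VW\<^esub> p v' w = Q.cls (sg v w 1 + sg v' w 1)"
    using a by (simp add: pure_def' Q.q_add)
  also have "\<dots> = p (v \<oplus>\<^bsub>V\<^esub> v') w" unfolding pure_def'
  proof (rule rel_cls[symmetric])
    show "sg (v \<oplus>\<^bsub>V\<^esub> v') w 1 - (sg v w 1 + sg v' w 1) \<in> rels"
      unfolding rels_def diff_diff_eq[symmetric] using a by blast
  qed (simp_all only: free_simps mem_Collect_eq keys_add_sub sg_F a V.a_closed W.a_closed)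
  finally show "p (v \<oplus>\<^bsub>V\<^esub> v') w = p v w \<oplus>\<^bsub>VW\<^esub> p v' w" by (rule sym)
next
  fix v w w' assume a: "v \<in> carrier V" "w \<in> carrier W" "w' \<in> carrier W"
  have "p v w \<oplus>\<^bsub>VW\<^esub> p v w' = Q.cls (sg v w 1 + sg v w' 1)"
    using a by (simp add: pure_def' Q.q_add)
  also have "\<dots> = p v (w \<oplus>\<^bsub>W\<^esub> w')" unfolding pure_def'
  proof (rule rel_cls[symmetric])
    show "sg v (w \<oplus>\<^bsub>W\<^esub> w') 1 - (sg v w 1 + sg v w' 1) \<in> rels"
      unfolding rels_def diff_diff_eq[symmetric] using a by blast
  qed (simp_all only: free_simps mem_Collect_eq keys_add_sub sg_F a V.a_closed W.a_closed)
  finally show "p v (w \<oplus>\<^bsub>W\<^esub> w') = p v w \<oplus>\<^bsub>VW\<^esub> p v w'" by (rule sym)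
next
  fix c v w assume a: "v \<in> carrier V" "w \<in> carrier W"
  have c: "c \<odot>\<^bsub>VW\<^esub> p v w = Q.cls (sg v w c)" using a by (simp add: pure_def' Q.q_smult)
  have "Q.cls (sg (c \<odot>\<^bsub>V\<^esub> v) w 1) = Q.cls (sg v w c)" "Q.cls (sg v (c \<odot>\<^bsub>W\<^esub> w) 1) = Q.cls (sg v w c)"
    by (rule rel_cls, unfold rels_def, use a in blast, simp_all only: free_simps mem_Collect_eq sg_F a V.ksm_closed
      W.ksm_closed)+
  with c show "p (c \<odot>\<^bsub>V\<^esub> v) w = c \<odot>\<^bsub>VW\<^esub> p v w" "p v (c \<odot>\<^bsub>W\<^esub> w) = c \<odot>\<^bsub>VW\<^esub> p v w"
    by (simp_all add: pure_def')
qed simp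

text \<open>Scalars are absorbed into the left factor of a pure tensor, and zero is the pure tensor
  of two zeros; sums are the only remaining case.\<close>

lemma tensor_induct [consumes 1, case_names pure add]:
  assumes "T \<in> carrier VW" "\<And>v w. v \<in> carrier V \<Longrightarrow> w \<in> carrier W \<Longrightarrow> P (p v w)"
    "\<And>S T. S \<in> carrier VW \<Longrightarrow> T \<in> carrier VW \<Longrightarrow> P S \<Longrightarrow> P T \<Longrightarrow> P (S \<oplus>\<^bsub>VW\<^esub> T)"
  shows "P T"
proof -
  obtain t where t: "T = Q.cls t" "keys t \<subseteq> carrier V \<times> carrier W"
    using assms(1) by (auto simp: Q.q_carrier)
  have sgl: "Q.cls (sg v w c) = p (c \<odot>\<^bsub>V\<^esub> v) w" if "v \<in> carrier V" "w \<in> carrier W" for v w c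
    unfolding pure_def' by (rule rel_cls[symmetric], unfold rels_def, use that in blast,
       simp_all only: free_simps mem_Collect_eq sg_F that V.ksm_closed)
  from t(2) have "P (Q.cls t)"
  proof (induction rule: pm_induct)
    case zero
    have "Q.cls 0 = Q.cls (sg \<zero>\<^bsub>V\<^esub> \<zero>\<^bsub>W\<^esub> 0)" by simp
    also have "\<dots> = p \<zero>\<^bsub>V\<^esub> \<zero>\<^bsub>W\<^esub>" by (subst sgl) auto
    finally show ?case by (simp add: assms)
  next
    case (single s c)
    then show ?case by (cases s) (simp add: sgl assms)
  next
    case (add S R)
    then have "Q.cls (S + R) = Q.cls S \<oplus>\<^bsub>VW\<^esub> Q.cls R" by (simp add: Q.q_add)
    with add show ?case by (simp add: assms)
  qed
  then show ?thesis using t by simp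
qed

lemma lin_eq_tensor:
  assumes "f \<in> lin VW U" "g \<in> lin VW U" "\<And>v w. v \<in> carrier V \<Longrightarrow> w \<in> carrier W \<Longrightarrow> f (p v w) = g (p v w)" "T \<in> carrier VW"
  shows "f T = g T"
  using assms(4) by (induction rule: tensor_induct) (simp_all add: assms lin_add[OF assms(1)] lin_add[OF assms(2)])

end

locale ktensor_lift = ktensor V W + U: kvs U
  for V :: "('k::field, 'a, 'm) module_scheme" and W :: "('k, 'b, 'n) module_scheme" and U :: "('k, 'c, 'o)
    module_scheme" +
  fixes b assumes bil: "bilinear_map V W U b"
begin

definition "L t = (\<Oplus>\<^bsub>U\<^esub>vw\<in>keys t. lookup t vw \<odot>\<^bsub>U\<^esub> b (fst vw) (snd vw))"

lemma L_lin: "L \<in> lin F U"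
  unfolding L_def by (rule U.lc_lin) (auto intro: bil_closed[OF bil])

lemma L_single: "v \<in> carrier V \<Longrightarrow> w \<in> carrier W \<Longrightarrow> L (sg v w c) = c \<odot>\<^bsub>U\<^esub> b v w"
  unfolding L_def using U.lc_single[of "\<lambda>vw. b (fst vw) (snd vw)" "(v, w)" c] by (simp add: bil_closed[OF bil])

lemma L_minus: "P \<in> carrier F \<Longrightarrow> Q \<in> carrier F \<Longrightarrow> L (P - Q) = L P \<ominus>\<^bsub>U\<^esub> L Q"
  using lin_minus[OF free_kvs U.kvs_axioms L_lin] by (simp add: minus_F)

lemma L_sg_minus: "v \<in> carrier V \<Longrightarrow> w \<in> carrier W \<Longrightarrow> P \<in> carrier F \<Longrightarrow> L (P - sg v w c) = L P \<ominus>\<^bsub>U\<^esub> c \<odot>\<^bsub>U\<^esub> b v w"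
  by (subst L_minus) (simp_all add: L_single)

lemma U_cancel: "x \<in> carrier U \<Longrightarrow> y \<in> carrier U \<Longrightarrow> (x \<oplus>\<^bsub>U\<^esub> y) \<ominus>\<^bsub>U\<^esub> x \<ominus>\<^bsub>U\<^esub> y = \<zero>\<^bsub>U\<^esub>"
  using U.r_neg[of "x \<oplus>\<^bsub>U\<^esub> y"] by (simp add: a_minus_def U.minus_add U.a_assoc)

lemma L_rels: "t \<in> rels \<Longrightarrow> L t = \<zero>\<^bsub>U\<^esub>"
proof -
  note bl = bil_closed[OF bil] bil_add_l[OF bil] bil_add_r[OF bil] bil_smult_l[OF bil] bil_smult_r[OF bil]
  have m: "P - sg v w c \<in> carrier F" if "P \<in> carrier F" "v \<in> carrier V" "w \<in> carrier W" for P v w c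
    using that keys_minus_sub[OF _ sg_F] by simp
  have g: "sg v w c \<in> carrier F" if "v \<in> carrier V" "w \<in> carrier W" for v w c
    using that by simp
  assume "t \<in> rels"
  then show ?thesis unfolding rels_def
    by (elim UnE CollectE exE conjE; simp only: L_sg_minus m g V.a_closed W.a_closed V.ksm_closed W.ksm_closed
      U.a_closed
        L_single bl U.ksm_one U_cancel U.r_neg a_minus_def[of U "_ \<odot>\<^bsub>U\<^esub> _" "_ \<odot>\<^bsub>U\<^esub> _"] U.ksm_closed)
qed

lemma L_kernel: "t \<in> tensor_kernel V W \<Longrightarrow> L t = \<zero>\<^bsub>U\<^esub>"
  unfolding kernel
proof (rule lin_eq_on_span[OF free_kvs U.kvs_axioms L_lin, of "\<lambda>_. \<zero>\<^bsub>U\<^esub>"])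
qed (auto simp: L_rels rels_F simp del: free_simps intro!: linI)

text \<open>\<open>tensor_lift\<close> evaluates at a representative picked by choice. Two
  representatives differ by an element of the kernel, which \<open>L\<close> kills, so the value is
  that of the explicit linear map \<open>L\<close>.\<close>

lemma lift_cls: assumes t: "t \<in> carrier F" shows "tensor_lift U b (Q.cls t) = L t"
proof -
  define s where "s = (SOME s. s \<in> Q.cls t)"
  have "s \<in> Q.cls t" unfolding s_def by (rule someI, rule Q.cls_self[OF t])
  then have s: "s \<in> carrier F" "s - t \<in> tensor_kernel V W" using Q.in_cls t minus_F by auto
  have "L s \<ominus>\<^bsub>U\<^esub> L t = \<zero>\<^bsub>U\<^esub>" using L_kernel[OF s(2)] L_minus[OF s(1) t] by argo
  moreover have "L s = (L s \<ominus>\<^bsub>U\<^esub> L t) \<oplus>\<^bsub>U\<^esub> L t"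
    using lin_closed[OF L_lin s(1)] lin_closed[OF L_lin t] by (simp only: a_minus_def U.a_assoc U.l_neg U.r_zero
      U.a_inv_closed)
  ultimately have "L s = L t" using lin_closed[OF L_lin t] by (simp only: U.l_zero)
  then show ?thesis by (simp add: tensor_lift_def L_def s_def Let_def)
qed

lemma lift_lin: "tensor_lift U b \<in> lin VW U"
proof (rule linI)
  show "tensor_lift U b x \<in> carrier U" if "x \<in> carrier VW" for x
    using that lin_closed[OF L_lin] lift_cls unfolding Q.q_carrier by (auto simp del: free_simps)
  show "tensor_lift U b (x \<oplus>\<^bsub>VW\<^esub> y) = tensor_lift U b x \<oplus>\<^bsub>U\<^esub> tensor_lift U b y"
    if xy: "x \<in> carrier VW" "y \<in> carrier VW" for x y
  proof -
    obtain s t where s: "s \<in> carrier F" and t: "t \<in> carrier F" and x: "x = Q.cls s" and y: "y = Q.cls t"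
      using xy[unfolded Q.q_carrier] by (elim imageE)
    show ?thesis unfolding x y Q.q_add[OF s t] lift_cls[OF Q.a_closed[OF s t]] lift_cls[OF s] lift_cls[OF t]
      by (rule lin_add[OF L_lin s t])
  qed
  show "tensor_lift U b (c \<odot>\<^bsub>VW\<^esub> x) = c \<odot>\<^bsub>U\<^esub> tensor_lift U b x" if xc: "x \<in> carrier VW" for c x
  proof -
    obtain s where s: "s \<in> carrier F" and x: "x = Q.cls s"
      using xc[unfolded Q.q_carrier] by (elim imageE)
    show ?thesis unfolding x Q.q_smult[OF s] lift_cls[OF Q.ksm_closed[OF s]] lift_cls[OF s]
      by (rule lin_smult[OF L_lin s])
  qed
qed

lemma lift_pure: "v \<in> carrier V \<Longrightarrow> w \<in> carrier W \<Longrightarrow> tensor_lift U b (p v w) = b v w"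
  unfolding pure_def' by (subst lift_cls) (simp_all add: L_single bil_closed[OF bil])

end

lemma tl_lin: "kvs V \<Longrightarrow> kvs W \<Longrightarrow> kvs U \<Longrightarrow> bilinear_map V W U b \<Longrightarrow> tensor_lift U b \<in> lin (tensor_space V W) U"
  by (intro ktensor_lift.lift_lin ktensor_lift.intro ktensor.intro ktensor_lift_axioms.intro)

lemma tl_pure: "kvs V \<Longrightarrow> kvs W \<Longrightarrow> kvs U \<Longrightarrow> bilinear_map V W U b \<Longrightarrow> v \<in> carrier V \<Longrightarrow> w \<in> carrier W \<Longrightarrow>
   tensor_lift U b (pure_tensor V W v w) = b v w"
  by (intro ktensor_lift.lift_pure ktensor_lift.intro ktensor.intro ktensor_lift_axioms.intro)

lemma tl_closed: "kvs V \<Longrightarrow> kvs W \<Longrightarrow> kvs U \<Longrightarrow> bilinear_map V W U b \<Longrightarrow> T \<in> carrier (tensor_space V W) \<Longrightarrow>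
   tensor_lift U b T \<in> carrier U"
  using tl_lin by (rule lin_closed)

text \<open>A lift depends on the bilinear map only through its values on the carriers: agreement
  there makes \<open>c\<close> bilinear too, and linear maps that agree on pure tensors are
  equal.\<close>

lemma tl_cong:
  assumes "kvs V" "kvs W" "kvs U" "bilinear_map V W U b" "T \<in> carrier (tensor_space V W)"
    "\<And>v w. v \<in> carrier V \<Longrightarrow> w \<in> carrier W \<Longrightarrow> b v w = c v w"
  shows "tensor_lift U b T = tensor_lift U c T"
proof -
  interpret ktensor V W using assms by (intro ktensor.intro)
  have c: "bilinear_map V W U c"
    by (rule bilinearI) (simp_all add: assms(6)[symmetric] bil_closed[OF assms(4)] bil_add_l[OF assms(4)] bil_add_r[OF
      assms(4)]
      bil_smult_l[OF assms(4)] bil_smult_r[OF assms(4)])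
  show ?thesis using assms(5)
    by (rule lin_eq_tensor[OF tl_lin[OF assms(1-4)] tl_lin[OF assms(1-3) c], rotated]) (simp add: tl_pure assms c)
qed

lemma lin_tl:
  assumes "kvs V" "kvs W" "kvs U" "kvs X" "bilinear_map V W U b" "f \<in> lin U X" "T \<in> carrier (tensor_space V W)"
  shows "f (tensor_lift U b T) = tensor_lift X (\<lambda>v w. f (b v w)) T"
proof -
  interpret ktensor V W using assms by (intro ktensor.intro)
  note c = bil_compose[OF assms(5,6)]
  show ?thesis using assms(7)
    by (rule lin_eq_tensor[OF lin_compose[OF tl_lin[OF assms(1-3,5)] assms(6)] tl_lin[OF assms(1,2,4) c], rotated])
      (simp add: tl_pure assms c)
qed

lemma lin_add_fun: "kvs U \<Longrightarrow> f \<in> lin V U \<Longrightarrow> g \<in> lin V U \<Longrightarrow> (\<lambda>x. f x \<oplus>\<^bsub>U\<^esub> g x) \<in> lin V U"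
proof -
  assume a: "kvs U" "f \<in> lin V U" "g \<in> lin V U"
  interpret kvs U by fact
  show ?thesis
    by (rule linI) (simp_all add: lin_closed[OF a(2)] lin_closed[OF a(3)] lin_add[OF a(2)] lin_add[OF a(3)]
      lin_smult[OF a(2)] lin_smult[OF a(3)] a_ac ksm_add)
qed

lemma lin_smult_fun: "kvs U \<Longrightarrow> f \<in> lin V U \<Longrightarrow> (\<lambda>x. c \<odot>\<^bsub>U\<^esub> f x) \<in> lin V U"
proof -
  assume a: "kvs U" "f \<in> lin V U"
  interpret kvs U by fact
  show ?thesis
    by (rule linI) (simp_all add: lin_closed[OF a(2)] lin_add[OF a(2)] lin_smult[OF a(2)] ksm_add mult.commute)
qed

context ktensor begin

interpretation VW: kvs VW by (rule tensor_kvs)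

lemma pure_simps:
  "v \<in> carrier V \<Longrightarrow> v' \<in> carrier V \<Longrightarrow> w \<in> carrier W \<Longrightarrow> p (v \<oplus>\<^bsub>V\<^esub> v') w = p v w \<oplus>\<^bsub>VW\<^esub> p v' w"
  "v \<in> carrier V \<Longrightarrow> w \<in> carrier W \<Longrightarrow> w' \<in> carrier W \<Longrightarrow> p v (w \<oplus>\<^bsub>W\<^esub> w') = p v w \<oplus>\<^bsub>VW\<^esub> p v w'"
  "v \<in> carrier V \<Longrightarrow> w \<in> carrier W \<Longrightarrow> p (c \<odot>\<^bsub>V\<^esub> v) w = c \<odot>\<^bsub>VW\<^esub> p v w"
  "v \<in> carrier V \<Longrightarrow> w \<in> carrier W \<Longrightarrow> p v (c \<odot>\<^bsub>W\<^esub> w) = c \<odot>\<^bsub>VW\<^esub> p v w"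
  by (simp_all add: bil_add_l[OF pure_bil] bil_add_r[OF pure_bil] bil_smult_l[OF pure_bil] bil_smult_r[OF pure_bil])

lemma pure_zero_l: "w \<in> carrier W \<Longrightarrow> p \<zero>\<^bsub>V\<^esub> w = \<zero>\<^bsub>VW\<^esub>"
  using lin_zero[OF V.kvs_axioms VW.kvs_axioms bil_lin_l[OF pure_bil]] .

lemma pure_finsum_r: "v \<in> carrier V \<Longrightarrow> finite S \<Longrightarrow> (\<And>s. s \<in> S \<Longrightarrow> f s \<in> carrier W) \<Longrightarrow>
   p v (\<Oplus>\<^bsub>W\<^esub>s\<in>S. f s) = (\<Oplus>\<^bsub>VW\<^esub>s\<in>S. p v (f s))"
  by (rule lin_finsum[OF W.kvs_axioms VW.kvs_axioms bil_lin_r[OF pure_bil]])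

lemma tensor_sum_form:
  assumes "T \<in> carrier VW"
  shows "\<exists>(n::nat) v w. (\<forall>s<n. v s \<in> carrier V \<and> w s \<in> carrier W) \<and> T = (\<Oplus>\<^bsub>VW\<^esub>s\<in>{..<n}. p (v s) (w s))"
  using assms
  proof (induction rule: tensor_induct)
    case (pure v w)
    then show ?case
      by (intro exI[of _ 1] exI[of _ "\<lambda>_. v"] exI[of _ "\<lambda>_. w"]) (simp add: lessThan_Suc)
  next
    case (add S T)
    from add(3) obtain n v w where S: "\<forall>s<(n::nat). v s \<in> carrier V \<and> w s \<in> carrier W"
      "S = (\<Oplus>\<^bsub>VW\<^esub>s\<in>{..<n}. p (v s) (w s))" by (elim exE conjE)
    from add(4) obtain m v' w' where T: "\<forall>s<(m::nat). v' s \<in> carrier V \<and> w' s \<in> carrier W"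
      "T = (\<Oplus>\<^bsub>VW\<^esub>s\<in>{..<m}. p (v' s) (w' s))" by (elim exE conjE)
    note S(1)[rule_format, simp] T(1)[rule_format, simp]
    let ?v = "\<lambda>s. if s < n then v s else v' (s - n)" and ?w = "\<lambda>s. if s < n then w s else w' (s - n)"
    have *: "k \<le> m \<Longrightarrow> (\<Oplus>\<^bsub>VW\<^esub>s\<in>{..<n+k}. p (?v s) (?w s)) = (\<Oplus>\<^bsub>VW\<^esub>s\<in>{..<n}. p (v s) (w s)) \<oplus>\<^bsub>VW\<^esub> (\<Oplus>\<^bsub>VW\<^esub>s\<in>{..<k}. p (v'
      s) (w' s))" for k
    proof (induction k)
      case 0
      have "(\<Oplus>\<^bsub>VW\<^esub>s\<in>{..<n}. p (?v s) (?w s)) = (\<Oplus>\<^bsub>VW\<^esub>s\<in>{..<n}. p (v s) (w s))"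
        by (rule VW.finsum_cong') (use S in auto)
      moreover have "(\<Oplus>\<^bsub>VW\<^esub>s\<in>{..<n}. p (v s) (w s)) \<in> carrier VW"
        by (rule VW.finsum_closed) (use S in auto)
      ultimately show ?case by simp
    next
      case (Suc k)
      have c: "(\<Oplus>\<^bsub>VW\<^esub>s\<in>{..<n}. p (v s) (w s)) \<in> carrier VW" "(\<Oplus>\<^bsub>VW\<^esub>s\<in>{..<k}. p (v' s) (w' s)) \<in> carrier VW"
        "p (v' k) (w' k) \<in> carrier VW"
        using S T Suc by (auto intro!: VW.finsum_closed)
      have "(\<Oplus>\<^bsub>VW\<^esub>s\<in>{..<n+Suc k}. p (?v s) (?w s)) = p (v' k) (w' k) \<oplus>\<^bsub>VW\<^esub> (\<Oplus>\<^bsub>VW\<^esub>s\<in>{..<n+k}. p (?v s) (?w s))"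
        using S T Suc by (simp only: add_Suc_right lessThan_Suc) (subst VW.finsum_insert, auto)
      also have "\<dots> = (\<Oplus>\<^bsub>VW\<^esub>s\<in>{..<n}. p (v s) (w s)) \<oplus>\<^bsub>VW\<^esub> (p (v' k) (w' k) \<oplus>\<^bsub>VW\<^esub> (\<Oplus>\<^bsub>VW\<^esub>s\<in>{..<k}. p (v' s) (w' s)))"
        using Suc c by (simp add: VW.a_lcomm)
      also have "(p (v' k) (w' k) \<oplus>\<^bsub>VW\<^esub> (\<Oplus>\<^bsub>VW\<^esub>s\<in>{..<k}. p (v' s) (w' s))) = (\<Oplus>\<^bsub>VW\<^esub>s\<in>{..<Suc k}. p (v' s) (w' s))"
        using T Suc unfolding lessThan_Suc by (subst VW.finsum_insert) auto
      finally show ?case .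
    qed
    show ?case
      using S T *[of m] by (intro exI[of _ "n+m"] exI[of _ ?v] exI[of _ ?w]) auto
  qed

text \<open>Induction on the number of pure tensors. If \<open>l\<close> does not vanish at
  \<open>v i\<close>, contraction with \<open>l\<close> yields a combination of the
  \<open>w s\<close> killed by all of \<open>M\<close>, hence zero. It expresses \<open>w i\<close>
  through the others, and the \<open>i\<close>-th term is absorbed into the rest.\<close>

lemma tensor_separate:
  assumes T: "T \<in> carrier VW"
    and \<Lambda>: "\<Lambda> \<subseteq> lin V base_algebra" "\<And>v. v \<in> carrier V \<Longrightarrow> (\<And>l. l \<in> \<Lambda> \<Longrightarrow> l v = 0) \<Longrightarrow> v = \<zero>\<^bsub>V\<^esub>"
    and M: "M \<subseteq> lin W base_algebra" "\<And>w. w \<in> carrier W \<Longrightarrow> (\<And>l. l \<in> M \<Longrightarrow> l w = 0) \<Longrightarrow> w = \<zero>\<^bsub>W\<^esub>"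
    and zero: "\<And>l m. l \<in> \<Lambda> \<Longrightarrow> m \<in> M \<Longrightarrow> tensor_lift base_algebra (\<lambda>v w. l v * m w) T = 0"
  shows "T = \<zero>\<^bsub>VW\<^esub>"
proof -
  have val: "tensor_lift base_algebra (\<lambda>v w. l v * m w) (\<Oplus>\<^bsub>VW\<^esub>s\<in>S. p (v s) (w s)) = (\<Sum>s\<in>S. l (v s) * m (w s))"
    if "l \<in> \<Lambda>" "m \<in> M" "finite S" "\<And>s. s \<in> S \<Longrightarrow> v s \<in> carrier V" "\<And>s. s \<in> S \<Longrightarrow> w s \<in> carrier W"
      for l m and S :: "nat set" and v w
  proof -
    have b: "bilinear_map V W base_algebra (\<lambda>v w. l v * m w)" using that \<Lambda> M by (intro lin_base_bil) auto
    show ?thesis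
      using that by (subst lin_finsum[OF VW.kvs_axioms base_kvs tl_lin[OF V.kvs_axioms W.kvs_axioms base_kvs b]])
        (simp_all add: tl_pure[OF V.kvs_axioms W.kvs_axioms base_kvs b])
  qed
  have main: "(\<Oplus>\<^bsub>VW\<^esub>s\<in>S. p (v s) (w s)) = \<zero>\<^bsub>VW\<^esub>"
    if "card S = n" "finite S" "\<And>s. s \<in> S \<Longrightarrow> v s \<in> carrier V" "\<And>s. s \<in> S \<Longrightarrow> w s \<in> carrier W"
      "\<And>l m. l \<in> \<Lambda> \<Longrightarrow> m \<in> M \<Longrightarrow> (\<Sum>s\<in>S. l (v s) * m (w s)) = 0" for n and S :: "nat set" and v w
    using that
  proof (induction n arbitrary: S v w)
    case 0 then show ?case by simp
  next
    case (Suc n)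
    note S = Suc.prems
    show ?case
    proof (cases "\<forall>s\<in>S. v s = \<zero>\<^bsub>V\<^esub>")
      case True
      then show ?thesis using S by (subst VW.finsum_cong'[of S S "\<lambda>_. \<zero>\<^bsub>VW\<^esub>"]) (auto simp: pure_zero_l)
    next
      case False
      then obtain i l where i: "i \<in> S" and l: "l \<in> \<Lambda>" "l (v i) \<noteq> 0" using \<Lambda>(2) S(3) by blast
      define c where "c j = l (v j) / l (v i)" for j
      define R where "R = S - {i}"
      have R: "finite R" "i \<notin> R" "S = insert i R" "card R = n" using S i by (auto simp: R_def)
      have ll: "l \<in> lin V base_algebra" using l \<Lambda> by auto
      \<comment> \<open>Contracting the tensor with \<open>l\<close> on the left gives
        \<open>l (v i)\<close> times this vector, which is why every form in \<open>M\<close>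
        vanishes on it.\<close>
      define z where "z = w i \<oplus>\<^bsub>W\<^esub> (\<Oplus>\<^bsub>W\<^esub>j\<in>R. c j \<odot>\<^bsub>W\<^esub> w j)"
      have sc: "(\<Oplus>\<^bsub>W\<^esub>j\<in>R. c j \<odot>\<^bsub>W\<^esub> w j) \<in> carrier W" using S(4) R by (intro W.finsum_closed) auto
      have zc: "z \<in> carrier W" unfolding z_def using S(4) i sc by simp
      have "z = \<zero>\<^bsub>W\<^esub>"
      proof (rule M(2)[OF zc])
        fix m assume m: "m \<in> M"
        then have ml: "m \<in> lin W base_algebra" using M by auto
        have "m z = m (w i) + (\<Sum>j\<in>R. c j * m (w j))"
          unfolding z_def using S(4) i sc R by (simp add: lin_add[OF ml] lin_finsum[OF W.kvs_axioms base_kvs ml]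
            lin_smult[OF ml])
        also have "\<dots> = (\<Sum>s\<in>S. l (v s) * m (w s)) / l (v i)"
          using R l by (simp add: c_def add_divide_distrib sum_divide_distrib)
        finally show "m z = 0" using S(5)[OF l(1) m] by simp
      qed
      then have wi: "w i = \<ominus>\<^bsub>W\<^esub> (\<Oplus>\<^bsub>W\<^esub>j\<in>R. c j \<odot>\<^bsub>W\<^esub> w j)"
        using W.minus_equality[of "w i" "(\<Oplus>\<^bsub>W\<^esub>j\<in>R. c j \<odot>\<^bsub>W\<^esub> w j)"] S(4) i sc by (simp add: z_def)
      also have "\<dots> = (\<Oplus>\<^bsub>W\<^esub>j\<in>R. (- c j) \<odot>\<^bsub>W\<^esub> w j)"
        unfolding W.ksm_m1[OF sc, symmetric] using S(4) R by (subst W.finsum_ksm) (auto intro!: W.finsum_cong')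
      finally have wi: "w i = (\<Oplus>\<^bsub>W\<^esub>j\<in>R. (- c j) \<odot>\<^bsub>W\<^esub> w j)" .
      \<comment> \<open>Substituting for \<open>w i\<close> moves the coefficient
        \<open>- c j\<close> across the tensor sign: the shorter sum over \<open>R\<close>
        represents the same tensor once \<open>v j\<close> is corrected by a multiple of
        \<open>v i\<close>.\<close>
      define v' where "v' j = v j \<oplus>\<^bsub>V\<^esub> (- c j) \<odot>\<^bsub>V\<^esub> v i" for j
      have vi: "v i \<in> carrier V" using S(3) i by auto
      have "p (v i) (w i) = (\<Oplus>\<^bsub>VW\<^esub>j\<in>R. p (v i) ((- c j) \<odot>\<^bsub>W\<^esub> w j))"
        unfolding wi using S(4) R vi by (intro pure_finsum_r) auto
      also have "\<dots> = (\<Oplus>\<^bsub>VW\<^esub>j\<in>R. p ((- c j) \<odot>\<^bsub>V\<^esub> v i) (w j))"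
        by (rule VW.finsum_cong') (use S(4) R vi in \<open>auto simp: pure_simps\<close>)
      finally have "(\<Oplus>\<^bsub>VW\<^esub>s\<in>S. p (v s) (w s)) = (\<Oplus>\<^bsub>VW\<^esub>j\<in>R. p ((- c j) \<odot>\<^bsub>V\<^esub> v i) (w j)) \<oplus>\<^bsub>VW\<^esub> (\<Oplus>\<^bsub>VW\<^esub>j\<in>R. p (v j) (w
        j))"
        using S R unfolding R(3) by (subst VW.finsum_insert) auto
      also have "\<dots> = (\<Oplus>\<^bsub>VW\<^esub>j\<in>R. p ((- c j) \<odot>\<^bsub>V\<^esub> v i) (w j) \<oplus>\<^bsub>VW\<^esub> p (v j) (w j))"
        using S R vi by (subst VW.finsum_addf) auto
      also have "\<dots> = (\<Oplus>\<^bsub>VW\<^esub>j\<in>R. p (v' j) (w j))"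
        unfolding v'_def using S R vi by (intro VW.finsum_cong') (auto simp: pure_simps VW.a_comm)
      also have "\<dots> = \<zero>\<^bsub>VW\<^esub>"
      proof (rule Suc.IH[OF R(4,1)])
        show "v' s \<in> carrier V" "w s \<in> carrier W" if "s \<in> R" for s using that S R vi by (auto simp: v'_def)
        fix l' m assume lm: "l' \<in> \<Lambda>" "m \<in> M"
        then have ll': "l' \<in> lin V base_algebra" and ml: "m \<in> lin W base_algebra" using \<Lambda> M by auto
        have "m (w i) = (\<Sum>j\<in>R. - c j * m (w j))"
          unfolding wi using S(4) R by (simp add: lin_finsum[OF W.kvs_axioms base_kvs ml] lin_smult[OF ml])
        then have "(\<Sum>s\<in>R. l' (v' s) * m (w s)) = (\<Sum>s\<in>R. l' (v s) * m (w s)) + l' (v i) * m (w i)"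
          using S(3) R vi by (simp add: v'_def lin_add[OF ll'] lin_smult[OF ll'] sum_distrib_left sum_negf[symmetric]
            sum.distrib[symmetric] algebra_simps)
        also have "\<dots> = (\<Sum>s\<in>S. l' (v s) * m (w s))" using R by simp
        finally show "(\<Sum>s\<in>R. l' (v' s) * m (w s)) = 0" using S(5)[OF lm] by simp
      qed
      finally show ?thesis .
    qed
  qed
  obtain n :: nat and v w where S: "\<forall>s<n. v s \<in> carrier V \<and> w s \<in> carrier W"
    and TS: "T = (\<Oplus>\<^bsub>VW\<^esub>s\<in>{..<n}. p (v s) (w s))" using tensor_sum_form[OF T] by (elim exE conjE)
  show ?thesis unfolding TS
    by (rule main[OF refl]) (use S zero val[of _ _ "{..<n}" v w] in \<open>simp_all add: TS\<close>)
qed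

lemma tensor_separate_eq:
  assumes ST: "S \<in> carrier VW" "T \<in> carrier VW"
    and \<Lambda>: "\<Lambda> \<subseteq> lin V base_algebra" "\<And>v. v \<in> carrier V \<Longrightarrow> (\<And>l. l \<in> \<Lambda> \<Longrightarrow> l v = 0) \<Longrightarrow> v = \<zero>\<^bsub>V\<^esub>"
    and M: "M \<subseteq> lin W base_algebra" "\<And>w. w \<in> carrier W \<Longrightarrow> (\<And>l. l \<in> M \<Longrightarrow> l w = 0) \<Longrightarrow> w = \<zero>\<^bsub>W\<^esub>"
    and eq: "\<And>l m. l \<in> \<Lambda> \<Longrightarrow> m \<in> M \<Longrightarrow> tensor_lift base_algebra (\<lambda>v w. l v * m w) S = tensor_lift base_algebra (\<lambda>v w. l v
      * m w) T"
  shows "S = T"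
proof -
  have "S \<ominus>\<^bsub>VW\<^esub> T = \<zero>\<^bsub>VW\<^esub>"
  proof (rule tensor_separate[OF _ \<Lambda> M])
    show "S \<ominus>\<^bsub>VW\<^esub> T \<in> carrier VW" using ST by simp
    fix l m assume lm: "l \<in> \<Lambda>" "m \<in> M"
    have b: "bilinear_map V W base_algebra (\<lambda>v w. l v * m w)" using lm \<Lambda> M by (intro lin_base_bil) auto
    interpret B: kvs base_algebra by (rule base_kvs)
    show "tensor_lift base_algebra (\<lambda>v w. l v * m w) (S \<ominus>\<^bsub>VW\<^esub> T) = 0"
      using B.r_neg[of "tensor_lift base_algebra (\<lambda>v w. l v * m w) T"] eq[OF lm] lin_minus[OF VW.kvs_axioms base_kvs
        tl_lin[OF V.kvs_axioms W.kvs_axioms base_kvs b] ST]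
      by (simp add: a_minus_def)
  qed auto
  moreover have "S = (S \<ominus>\<^bsub>VW\<^esub> T) \<oplus>\<^bsub>VW\<^esub> T" using ST by (simp add: a_minus_def VW.a_assoc VW.l_neg)
  ultimately show ?thesis using ST by simp
qed

end

section \<open>Algebras and their tensor products\<close>

lemma kvs_transfer:
  assumes "kvs V" "carrier W = carrier V" "add W = add V" "zero W = zero V" "smult W = smult V"
  shows "kvs W"
proof -
  interpret kvs V by fact
  show ?thesis
    by (rule kvs.intro, rule vsI) (simp_all add: assms ksm_add add_ksm a_ac ksm_m1 r_neg)
qed

locale kalg = fixes A :: "('k::field, 'a, 'm) module_scheme" (structure)
  assumes alg: "assoc_algebra A"

sublocale kalg \<subseteq> kvs A using alg by (simp add: assoc_algebra_def kvs_def)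
sublocale kalg \<subseteq> ring A using alg by (simp add: assoc_algebra_def)

lemma (in kalg) mult_bil: "bilinear_map A A A (mult A)"
  using alg by (intro bilinearI) (auto simp: l_distr r_distr assoc_algebra_def)

lemma (in kalg) smult_mult [simp]: "x \<in> carrier A \<Longrightarrow> y \<in> carrier A \<Longrightarrow> (c \<odot> x) \<otimes> y = c \<odot> (x \<otimes> y)"
  and mult_smult [simp]: "x \<in> carrier A \<Longrightarrow> y \<in> carrier A \<Longrightarrow> x \<otimes> (c \<odot> y) = c \<odot> (x \<otimes> y)"
  using alg by (auto simp: assoc_algebra_def)

lemma kalgI:
  fixes A :: "('k::field, 'a, 'm) module_scheme" (structure)
  assumes "kvs A" and b: "bilinear_map A A A (mult A)" and "\<one> \<in> carrier A"
    "\<And>x y z. x \<in> carrier A \<Longrightarrow> y \<in> carrier A \<Longrightarrow> z \<in> carrier A \<Longrightarrow> x \<otimes> y \<otimes> z = x \<otimes> (y \<otimes> z)"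
    "\<And>x. x \<in> carrier A \<Longrightarrow> \<one> \<otimes> x = x" "\<And>x. x \<in> carrier A \<Longrightarrow> x \<otimes> \<one> = x"
  shows "kalg A"
proof -
  interpret kvs A by fact
  have "ring A"
    by (intro ringI monoidI abelian) (simp_all add: assms bil_closed[OF b] bil_add_l[OF b] bil_add_r[OF b])
  then show ?thesis
    by (simp add: kalg_def assoc_algebra_def vs bil_smult_l[OF b] bil_smult_r[OF b])
qed

lemma tensor_algebra_simps [simp]:
  "carrier (tensor_algebra A B) = carrier (tensor_space A B)"
  "add (tensor_algebra A B) = add (tensor_space A B)"
  "zero (tensor_algebra A B) = zero (tensor_space A B)"
  "smult (tensor_algebra A B) = smult (tensor_space A B)"
  "\<one>\<^bsub>tensor_algebra A B\<^esub> = pure_tensor A B \<one>\<^bsub>A\<^esub> \<one>\<^bsub>B\<^esub>"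
  by (simp_all add: tensor_algebra_def)

locale ktalg = A: kalg A + B: kalg B for A :: "('k::field, 'a, 'm) module_scheme" and B :: "('k, 'b, 'n)
    module_scheme"

sublocale ktalg \<subseteq> ktensor A B by unfold_locales

context ktalg begin

abbreviation "AB \<equiv> tensor_algebra A B"

interpretation VW: kvs VW by (rule tensor_kvs)

lemma AB_kvs: "kvs AB" by (rule kvs_transfer[OF tensor_kvs]) simp_all

lemma inner_bil: "a \<in> carrier A \<Longrightarrow> b \<in> carrier B \<Longrightarrow> bilinear_map A B VW (\<lambda>c d. p (a \<otimes>\<^bsub>A\<^esub> c) (b \<otimes>\<^bsub>B\<^esub> d))"
  by (rule bil_compose2[OF pure_bil]) (rule bil_lin_r[OF A.mult_bil] bil_lin_r[OF B.mult_bil]; assumption)+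

lemmas tl0 = tl_lin[OF A.kvs_axioms B.kvs_axioms tensor_kvs] tl_pure[OF A.kvs_axioms B.kvs_axioms tensor_kvs]

lemma inner_lin: "a \<in> carrier A \<Longrightarrow> b \<in> carrier B \<Longrightarrow> tensor_lift VW (\<lambda>c d. p (a \<otimes>\<^bsub>A\<^esub> c) (b \<otimes>\<^bsub>B\<^esub> d)) \<in> lin VW VW"
  by (rule tl0 inner_bil)+

text \<open>The product of two tensors is a lift inside a lift. The outer one is well behaved only
  if the inner one is bilinear in \<open>(a, b)\<close>, which is verified on pure tensors
  \<open>T\<close>.\<close>

lemma outer_bil:
  assumes T: "T \<in> carrier VW"
  shows "bilinear_map A B VW (\<lambda>a b. tensor_lift VW (\<lambda>c d. p (a \<otimes>\<^bsub>A\<^esub> c) (b \<otimes>\<^bsub>B\<^esub> d)) T)" (is "bilinear_map A B VW ?f")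
proof (rule bilinearI)
  show "?f a b \<in> carrier VW" if "a \<in> carrier A" "b \<in> carrier B" for a b
    by (rule lin_closed[OF inner_lin]) (use that T in auto)
next
  fix a a' b assume "a \<in> carrier A" "a' \<in> carrier A" "b \<in> carrier B"
  then show "?f (a \<oplus>\<^bsub>A\<^esub> a') b = ?f a b \<oplus>\<^bsub>VW\<^esub> ?f a' b"
    by (intro lin_eq_tensor[OF inner_lin lin_add_fun[OF tensor_kvs inner_lin inner_lin] _ T])
      (simp_all add: tl0(2) inner_bil A.l_distr pure_simps)
next
  fix a b b' assume "a \<in> carrier A" "b \<in> carrier B" "b' \<in> carrier B"
  then show "?f a (b \<oplus>\<^bsub>B\<^esub> b') = ?f a b \<oplus>\<^bsub>VW\<^esub> ?f a b'"
    by (intro lin_eq_tensor[OF inner_lin lin_add_fun[OF tensor_kvs inner_lin inner_lin] _ T])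
      (simp_all add: tl0(2) inner_bil B.l_distr pure_simps)
next
  fix a b c assume "a \<in> carrier A" "b \<in> carrier B"
  then show "?f (c \<odot>\<^bsub>A\<^esub> a) b = c \<odot>\<^bsub>VW\<^esub> ?f a b" "?f a (c \<odot>\<^bsub>B\<^esub> b) = c \<odot>\<^bsub>VW\<^esub> ?f a b"
    by (intro lin_eq_tensor[OF inner_lin lin_smult_fun[OF tensor_kvs inner_lin] _ T];
      simp add: tl0(2) inner_bil pure_simps)+
qed

lemma AB_mult: "S \<otimes>\<^bsub>AB\<^esub> T = tensor_lift VW (\<lambda>a b. tensor_lift VW (\<lambda>c d. p (a \<otimes>\<^bsub>A\<^esub> c) (b \<otimes>\<^bsub>B\<^esub> d)) T) S"
  by (simp add: tensor_algebra_def)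

lemma AB_pure: "a \<in> carrier A \<Longrightarrow> b \<in> carrier B \<Longrightarrow> c \<in> carrier A \<Longrightarrow> d \<in> carrier B \<Longrightarrow>
  p a b \<otimes>\<^bsub>AB\<^esub> p c d = p (a \<otimes>\<^bsub>A\<^esub> c) (b \<otimes>\<^bsub>B\<^esub> d)"
  by (simp add: AB_mult tl0(2) outer_bil inner_bil)

lemma AB_lin_l: "T \<in> carrier VW \<Longrightarrow> (\<lambda>S. S \<otimes>\<^bsub>AB\<^esub> T) \<in> lin VW VW"
  unfolding AB_mult by (intro tl0 outer_bil)

lemma AB_mult_bil: "bilinear_map VW VW VW (mult AB)"
proof -
  have add: "S \<otimes>\<^bsub>AB\<^esub> (T \<oplus>\<^bsub>VW\<^esub> T') = S \<otimes>\<^bsub>AB\<^esub> T \<oplus>\<^bsub>VW\<^esub> S \<otimes>\<^bsub>AB\<^esub> T'"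
    if "S \<in> carrier VW" "T \<in> carrier VW" "T' \<in> carrier VW" for S T T'
    by (rule lin_eq_tensor[OF AB_lin_l lin_add_fun[OF tensor_kvs AB_lin_l AB_lin_l] _ that(1)])
      (use that in \<open>simp_all add: AB_mult tl0(2) outer_bil lin_add[OF inner_lin]\<close>)
  have smult: "S \<otimes>\<^bsub>AB\<^esub> (c \<odot>\<^bsub>VW\<^esub> T) = c \<odot>\<^bsub>VW\<^esub> (S \<otimes>\<^bsub>AB\<^esub> T)"
    if "S \<in> carrier VW" "T \<in> carrier VW" for S T c
    by (rule lin_eq_tensor[OF AB_lin_l lin_smult_fun[OF tensor_kvs AB_lin_l] _ that(1)])
      (use that in \<open>simp_all add: AB_mult tl0(2) outer_bil lin_smult[OF inner_lin]\<close>)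
  show ?thesis
    by (rule bilinearI) (simp_all add: lin_closed[OF AB_lin_l] lin_add[OF AB_lin_l] lin_smult[OF AB_lin_l] add smult)
qed

text \<open>Both sides of each law are additive in every argument, so pure tensors suffice, where
  the laws hold factor by factor.\<close>

lemma AB_alg: "kalg AB"
proof (rule kalgI[OF AB_kvs])
  note b = AB_mult_bil
  show "bilinear_map AB AB AB (mult AB)"
    using b by (simp add: bilinear_map_def LinearCombinations.module_hom_def)
  show "\<one>\<^bsub>AB\<^esub> \<in> carrier AB" by simp
  fix x y z assume xyz: "x \<in> carrier AB" "y \<in> carrier AB" "z \<in> carrier AB"
  note s = bil_add_l[OF b] bil_add_r[OF b] bil_closed[OF b]
  from xyz(1)[simplified] show "x \<otimes>\<^bsub>AB\<^esub> y \<otimes>\<^bsub>AB\<^esub> z = x \<otimes>\<^bsub>AB\<^esub> (y \<otimes>\<^bsub>AB\<^esub> z)"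
  proof (induction rule: tensor_induct)
    case (pure v w)
    note v = pure
    from xyz(2)[simplified] show ?case
    proof (induction rule: tensor_induct)
      case (pure v' w')
      note v' = pure
      from xyz(3)[simplified] show ?case
      proof (induction rule: tensor_induct)
        case (pure v'' w'')
        with v v' show ?case by (simp add: AB_pure A.m_assoc B.m_assoc)
      qed (use v v' in \<open>simp add: s\<close>)
    qed (use v xyz in \<open>simp add: s\<close>)
  qed (use xyz in \<open>simp add: s\<close>)
next
  note b = AB_mult_bil
  note s = bil_add_l[OF b] bil_add_r[OF b] bil_closed[OF b]
  fix x assume "x \<in> carrier AB"
  then have x: "x \<in> carrier VW" by simp
  from x show "\<one>\<^bsub>AB\<^esub> \<otimes>\<^bsub>AB\<^esub> x = x" by (induction rule: tensor_induct) (simp_all add: AB_pure s)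
  from x show "x \<otimes>\<^bsub>AB\<^esub> \<one>\<^bsub>AB\<^esub> = x" by (induction rule: tensor_induct) (simp_all add: AB_pure s)
qed

end

lemma (in kvs) diff_eqI: "x \<ominus> y = \<zero> \<Longrightarrow> x \<in> carrier V \<Longrightarrow> y \<in> carrier V \<Longrightarrow> x = y"
proof -
  assume a: "x \<ominus> y = \<zero>" "x \<in> carrier V" "y \<in> carrier V"
  have "x = (x \<ominus> y) \<oplus> y" using a(2,3) by (simp add: a_minus_def a_assoc l_neg)
  then show ?thesis using a by simp
qed

lemma pm_induct0 [case_names zero single add]:
  assumes "Q 0" "\<And>s c. Q (single s c)" "\<And>P R. Q P \<Longrightarrow> Q R \<Longrightarrow> Q (P + R)"
  shows "Q (P :: 's \<Rightarrow>\<^sub>0 'k::comm_monoid_add)"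
  using subset_UNIV by (induction P rule: pm_induct) (use assms in auto)

text \<open>Bilinear extension of a product in which two basis elements multiply to a multiple of a
  single basis element. Concatenation of words and the pre-Lie product are both of this
  kind.\<close>

definition bil_ext :: "('s \<Rightarrow> 't \<Rightarrow> 'k) \<Rightarrow> ('s \<Rightarrow> 't \<Rightarrow> 'w) \<Rightarrow> ('s \<Rightarrow>\<^sub>0 'k) \<Rightarrow> ('t \<Rightarrow>\<^sub>0 'k) \<Rightarrow> ('w \<Rightarrow>\<^sub>0 'k::comm_ring_1)" where
  "bil_ext c f P Q = (\<Sum>u\<in>keys P. \<Sum>v\<in>keys Q.
     single (f u v) (lookup P u * lookup Q v * c u v))"

lemma bil_ext_add_l: "bil_ext c f (P + P') Q = bil_ext c f P Q + bil_ext c f P' Q"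
  unfolding bil_ext_def
  by (rule setsum_keys_plus_distrib[of "\<lambda>u a. \<Sum>v\<in>keys Q. single (f u v) (a * lookup Q v * c u v)"])
    (simp_all add: sum.distrib[symmetric] algebra_simps single_add)

lemma bil_ext_add_r: "bil_ext c f P (Q + Q') = bil_ext c f P Q + bil_ext c f P Q'"
  unfolding bil_ext_def sum.distrib[symmetric]
  by (intro sum.cong refl setsum_keys_plus_distrib[of "\<lambda>v a. single (f u v) (lookup P u * a * c u v)" for u])
    (simp_all add: algebra_simps single_add)

lemma bil_ext_single: "bil_ext c f (single u a) (single v b) = single (f u v) (a * b * c u v)"
  by (auto simp: bil_ext_def)

lemma bil_ext_0 [simp]: "bil_ext c f 0 Q = 0" "bil_ext c f P 0 = 0"
  by (simp_all add: bil_ext_def)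

lemma map_scale_add [simp]: "Poly_Mapping.map ((*) (c::'k::comm_ring_1)) (P + Q) = Poly_Mapping.map ((*) c) P +
    Poly_Mapping.map ((*) c) Q"
  by (rule poly_mapping_eqI) (simp add: lookup_add algebra_simps)

lemma map_scale_0 [simp]: "Poly_Mapping.map ((*) (c::'k::comm_ring_1)) 0 = 0"
  by (rule poly_mapping_eqI) simp

lemma map_scale_single [simp]: "Poly_Mapping.map ((*) (c::'k::comm_ring_1)) (single s a) = single s (c * a)"
  by (rule poly_mapping_eqI) (simp add: lookup_single when_def)

lemma bil_ext_scale_l: "bil_ext c f (Poly_Mapping.map ((*) a) P) Q = Poly_Mapping.map ((*) a) (bil_ext c f P Q)"
proof (induction P rule: pm_induct0)
  case (single s b)
  show ?case by (induction Q rule: pm_induct0) (simp_all add: bil_ext_single bil_ext_add_r mult.assoc)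
qed (simp_all add: bil_ext_add_l)

lemma bil_ext_scale_r: "bil_ext c f P (Poly_Mapping.map ((*) a) Q) = Poly_Mapping.map ((*) a) (bil_ext c f P Q)"
proof (induction P rule: pm_induct0)
  case (single s b)
  show ?case
  proof (induction Q rule: pm_induct0)
    case (single t d) show ?case by (simp add: bil_ext_single mult_ac)
  qed (simp_all add: bil_ext_add_r)
qed (simp_all add: bil_ext_add_l)

lemma bil_ext_keys: "keys P \<subseteq> S \<Longrightarrow> keys Q \<subseteq> T \<Longrightarrow> (\<And>u v. u \<in> S \<Longrightarrow> v \<in> T \<Longrightarrow> f u v \<in> R) \<Longrightarrow>
  keys (bil_ext c f P Q) \<subseteq> R"
  unfolding bil_ext_def by (rule order.trans[OF keys_sum], rule UN_least, rule order.trans[OF keys_sum]) auto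

lemma fa_simps [simp]:
  "carrier (free_algebra S) = carrier (free_module (lists S))" "add (free_algebra S) = (+)" "zero (free_algebra S) =
    0"
  "\<one>\<^bsub>free_algebra S\<^esub> = single [] 1" "smult (free_algebra S) = (\<lambda>c. Poly_Mapping.map ((*) c))"
  "mult (free_algebra S) = bil_ext (\<lambda>_ _. 1) (@)"
  by (simp_all add: free_algebra_def free_module_def bil_ext_def fun_eq_iff)

lemma fa_kalg: "kalg (free_algebra S :: ('k::field, 's list \<Rightarrow>\<^sub>0 'k) module)"
proof (rule kalgI)
  let ?m = "bil_ext (\<lambda>_ _. 1) (@) :: ('s list \<Rightarrow>\<^sub>0 'k) \<Rightarrow> _"
  show "kvs (free_algebra S :: ('k, 's list \<Rightarrow>\<^sub>0 'k) module)"
    by (rule kvs_transfer[OF free_kvs[of "lists S"]]) (simp_all add: free_module_def)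
  show "bilinear_map (free_algebra S) (free_algebra S) (free_algebra S :: ('k, 's list \<Rightarrow>\<^sub>0 'k) module) (mult
    (free_algebra S))"
    by (rule bilinearI) (simp_all add: bil_ext_add_l bil_ext_add_r bil_ext_scale_l bil_ext_scale_r bil_ext_keys[where
      S="lists S" and T="lists S"])
  have a: "?m (?m x y) z = ?m x (?m y z)" for x y z :: "'s list \<Rightarrow>\<^sub>0 'k"
  proof (induction x rule: pm_induct0)
    case (single s a)
    show ?case
    proof (induction y rule: pm_induct0)
      case (single t b)
      show ?case by (induction z rule: pm_induct0) (simp_all add: bil_ext_single bil_ext_add_r mult.assoc)
    qed (simp_all add: bil_ext_add_l bil_ext_add_r)
  qed (simp_all add: bil_ext_add_l)
  have "?m (single [] 1) x = x" "?m x (single [] 1) = x" for x :: "'s list \<Rightarrow>\<^sub>0 'k"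
    by (induction x rule: pm_induct0; simp add: bil_ext_single bil_ext_add_r bil_ext_add_l)+
  with a show "x \<in> carrier (free_algebra S) \<Longrightarrow> y \<in> carrier (free_algebra S) \<Longrightarrow> z \<in> carrier (free_algebra S) \<Longrightarrow>
     x \<otimes>\<^bsub>free_algebra S\<^esub> y \<otimes>\<^bsub>free_algebra S\<^esub> z = x \<otimes>\<^bsub>free_algebra S\<^esub> (y \<otimes>\<^bsub>free_algebra S\<^esub> z)"
    "\<one>\<^bsub>free_algebra S\<^esub> \<otimes>\<^bsub>free_algebra S\<^esub> x = x" "x \<otimes>\<^bsub>free_algebra S\<^esub> \<one>\<^bsub>free_algebra S\<^esub> = x"
      for x y z :: "'s list \<Rightarrow>\<^sub>0 'k"
    by simp_all
qed simp

lemma alg_homI: "f \<in> lin A B \<Longrightarrow> (\<And>x y. x \<in> carrier A \<Longrightarrow> y \<in> carrier A \<Longrightarrow> f (x \<otimes>\<^bsub>A\<^esub> y) = f x \<otimes>\<^bsub>B\<^esub> f y) \<Longrightarrow> f \<one>\<^bsub>A\<^esub> = \<one>\<^bsub>B\<^esub> \<Longrightarrow>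
    f \<in> alg_hom A B"
  by (auto simp: alg_hom_def Ring.ring_hom_def LinearCombinations.module_hom_def)

lemma alg_hom_lin: "f \<in> alg_hom A B \<Longrightarrow> f \<in> lin A B"
  and alg_hom_mult: "f \<in> alg_hom A B \<Longrightarrow> x \<in> carrier A \<Longrightarrow> y \<in> carrier A \<Longrightarrow> f (x \<otimes>\<^bsub>A\<^esub> y) = f x \<otimes>\<^bsub>B\<^esub> f y"
  and alg_hom_one: "f \<in> alg_hom A B \<Longrightarrow> f \<one>\<^bsub>A\<^esub> = \<one>\<^bsub>B\<^esub>"
  by (auto simp: alg_hom_def Ring.ring_hom_def)

lemma (in kalg) word_prod_closed: "(\<And>x. x \<in> set w \<Longrightarrow> f x \<in> carrier A) \<Longrightarrow> word_prod A f w \<in> carrier A"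
  by (induction w) (auto simp: word_prod_def)

lemma word_prod_simps [simp]: "word_prod A f [] = \<one>\<^bsub>A\<^esub>" "word_prod A f (x # w) = f x \<otimes>\<^bsub>A\<^esub> word_prod A f w"
  by (simp_all add: word_prod_def)

lemma (in kalg) word_prod_append: "(\<And>x. x \<in> set v \<union> set w \<Longrightarrow> f x \<in> carrier A) \<Longrightarrow>
   word_prod A f (v @ w) = word_prod A f v \<otimes> word_prod A f w"
  by (induction v) (auto simp: word_prod_closed m_assoc)

lemma op_simps [simp]:
  "carrier (opposite_algebra A) = carrier A" "add (opposite_algebra A) = add A" "zero (opposite_algebra A) = zero A"
  "one (opposite_algebra A) = one A" "smult (opposite_algebra A) = smult A" "x \<otimes>\<^bsub>opposite_algebra A\<^esub> y = y \<otimes>\<^bsub>A\<^esub> x"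
  by (simp_all add: opposite_algebra_def)

lemma (in kalg) op_kalg: "kalg (opposite_algebra A)"
  by (rule kalgI, rule kvs_transfer[OF kvs_axioms])
    (auto intro!: bilinearI simp: l_distr r_distr m_assoc)

section \<open>Enveloping algebras\<close>

locale kenv = L: kvs L for L :: "('k::field, 'a, 'm) module_scheme" +
  assumes bracket_closed [simp]: "x \<in> carrier L \<Longrightarrow> y \<in> carrier L \<Longrightarrow> x \<otimes>\<^bsub>L\<^esub> y \<in> carrier L"
begin

abbreviation "FA \<equiv> free_algebra (carrier L) :: ('k, 'a list \<Rightarrow>\<^sub>0 'k) module"
abbreviation "UL \<equiv> env_algebra L"
abbreviation "sw w (c::'k) \<equiv> single w c"

sublocale FA: kalg FA by (rule fa_kalg)

definition "erels = ({sw [x \<oplus>\<^bsub>L\<^esub> y] 1 - sw [x] 1 - sw [y] 1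
        | x y. x \<in> carrier L \<and> y \<in> carrier L} \<union>
     {sw [c \<odot>\<^bsub>L\<^esub> x] 1 - sw [x] c | c x. x \<in> carrier L} \<union>
     {sw [x, y] 1 - sw [y, x] 1 - sw [x \<otimes>\<^bsub>L\<^esub> y] 1 | x y. x \<in> carrier L \<and> y \<in> carrier L})"

lemma fa_minus_keys: "P \<in> carrier FA \<Longrightarrow> Q \<in> carrier FA \<Longrightarrow> P - Q \<in> carrier FA"
  using keys_diff[of P Q] by auto

lemma sw_FA: "set w \<subseteq> carrier L \<Longrightarrow> sw w c \<in> carrier FA"
  by auto

lemma erels_FA: "erels \<subseteq> carrier FA"
proof
  fix x assume "x \<in> erels"
  then show "x \<in> carrier FA" unfolding erels_def
    by (elim UnE CollectE exE conjE; simp only:; intro fa_minus_keys sw_FA; simp)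
qed

lemma env_ideal: "env_ideal L = Idl\<^bsub>FA\<^esub> erels"
  by (simp add: env_ideal_def erels_def)

sublocale I: ideal "env_ideal L" FA
  unfolding env_ideal using erels_FA by (rule FA.genideal_ideal)

lemma rel_in: "r \<in> erels \<Longrightarrow> r \<in> env_ideal L"
  unfolding env_ideal using FA.genideal_self[OF erels_FA] by auto

text \<open>In a unital algebra \<open>c x = (c 1) x\<close>, so a ring ideal is a subspace. The
  quotient can thus be used both as a quotient ring and as a quotient space.\<close>

lemma ideal_sub: "submodule class_ring (env_ideal L) FA"
proof (rule FA.submoduleI')
  fix c x assume x: "x \<in> env_ideal L"
  then have xc: "x \<in> carrier FA" using I.a_subset by auto
  have "c \<odot>\<^bsub>FA\<^esub> x = (c \<odot>\<^bsub>FA\<^esub> \<one>\<^bsub>FA\<^esub>) \<otimes>\<^bsub>FA\<^esub> x"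
    using FA.smult_mult[OF FA.one_closed xc] FA.l_one[OF xc] by metis
  also have "\<dots> \<in> env_ideal L"
    by (rule I.I_l_closed[OF x]) (rule FA.ksm_closed[OF FA.one_closed])
  finally show "c \<odot>\<^bsub>FA\<^esub> x \<in> env_ideal L" .
qed (use I.a_subset I.zero_closed I.a_closed in auto)

sublocale Q: kquot FA "env_ideal L"
  rewrites "quotient FA (env_ideal L) = UL"
proof -
  show "kquot FA (env_ideal L)"
    by (intro kquot.intro FA.kvs_axioms kquot_axioms.intro ideal_sub)
  show "quotient FA (env_ideal L) = UL" by (simp add: env_algebra_def)
qed

lemma UL_mult: "x \<in> carrier FA \<Longrightarrow> y \<in> carrier FA \<Longrightarrow> Q.cls x \<otimes>\<^bsub>UL\<^esub> Q.cls y = Q.cls (x \<otimes>\<^bsub>FA\<^esub> y)"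
  unfolding env_algebra_def quotient_simps by (rule I.rcoset_mult_add)

lemma UL_one: "\<one>\<^bsub>UL\<^esub> = Q.cls \<one>\<^bsub>FA\<^esub>"
  unfolding env_algebra_def quotient_simps ..

lemma UL_kalg: "kalg UL"
proof (rule kalgI[OF Q.q_kvs])
  show "bilinear_map UL UL UL (mult UL)"
  proof (rule bilinearI)
  qed (auto simp only: Q.q_carrier UL_mult Q.q_add Q.q_smult FA.r_distr FA.l_distr FA.m_closed FA.a_closed
      FA.smult_mult FA.mult_smult FA.ksm_closed intro!: imageI)
qed (auto simp only: Q.q_carrier UL_mult UL_one FA.m_closed FA.m_assoc FA.one_closed FA.l_one FA.r_one intro!: imageI)

sublocale UL: kalg UL by (rule UL_kalg)

abbreviation "inc \<equiv> env_incl L"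

lemma inc_def': "inc x = Q.cls (sw [x] 1)" by (simp add: env_incl_def)

lemma inc_closed [simp]: "x \<in> carrier L \<Longrightarrow> inc x \<in> carrier UL"
  unfolding inc_def' by (rule Q.cls_closed) auto

lemma cls_minus: "P \<in> carrier FA \<Longrightarrow> Q \<in> carrier FA \<Longrightarrow> Q.cls (P - Q) = Q.cls P \<ominus>\<^bsub>UL\<^esub> Q.cls Q"
proof -
  assume PQ: "P \<in> carrier FA" "Q \<in> carrier FA"
  have "Poly_Mapping.map ((*) (-1)) Q = - Q" by (rule poly_mapping_eqI) simp
  then have "P \<ominus>\<^bsub>FA\<^esub> Q = P - Q" using PQ FA.ksm_m1[of Q] by (simp add: a_minus_def)
  then show ?thesis using lin_minus[OF FA.kvs_axioms UL.kvs_axioms Q.cls_lin PQ] by simp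
qed

lemma cls_rel: "r \<in> erels \<Longrightarrow> Q.cls r = \<zero>\<^bsub>UL\<^esub>"
  using Q.cls_eq_iff[of r "\<zero>\<^bsub>FA\<^esub>"] rel_in erels_FA FA.zero_closed unfolding Q.q_zero
  by (auto simp: a_minus_def simp del: fa_simps)

lemma UL_eqI: "x \<ominus>\<^bsub>UL\<^esub> y = \<zero>\<^bsub>UL\<^esub> \<Longrightarrow> x \<in> carrier UL \<Longrightarrow> y \<in> carrier UL \<Longrightarrow> x = y"
  by (rule UL.diff_eqI)

lemma UL_diff2: "x \<ominus>\<^bsub>UL\<^esub> y \<ominus>\<^bsub>UL\<^esub> z = \<zero>\<^bsub>UL\<^esub> \<Longrightarrow> x \<in> carrier UL \<Longrightarrow> y \<in> carrier UL \<Longrightarrow> z \<in> carrier UL \<Longrightarrow> x = y \<oplus>\<^bsub>UL\<^esub> z"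
  by (rule UL_eqI) (simp_all add: a_minus_def UL.a_assoc UL.minus_add)

lemma inc_add: "x \<in> carrier L \<Longrightarrow> y \<in> carrier L \<Longrightarrow> inc (x \<oplus>\<^bsub>L\<^esub> y) = inc x \<oplus>\<^bsub>UL\<^esub> inc y"
proof (rule UL_diff2)
  assume xy: "x \<in> carrier L" "y \<in> carrier L"
  have "sw [x \<oplus>\<^bsub>L\<^esub> y] 1 - sw [x] 1 - sw [y] 1 \<in> erels" unfolding erels_def using xy by blast
  from cls_rel[OF this] show "inc (x \<oplus>\<^bsub>L\<^esub> y) \<ominus>\<^bsub>UL\<^esub> inc x \<ominus>\<^bsub>UL\<^esub> inc y = \<zero>\<^bsub>UL\<^esub>"
    unfolding inc_def' using xy by (simp only: cls_minus fa_minus_keys sw_FA list.set subset_insertI empty_subsetI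
      insert_subset L.a_closed)
qed auto

lemma cls_sw1: "x \<in> carrier L \<Longrightarrow> Q.cls (sw [x] c) = c \<odot>\<^bsub>UL\<^esub> inc x"
  unfolding inc_def' by (subst Q.q_smult) auto

lemma inc_smult: "x \<in> carrier L \<Longrightarrow> inc (c \<odot>\<^bsub>L\<^esub> x) = c \<odot>\<^bsub>UL\<^esub> inc x"
proof (rule UL_eqI)
  assume x: "x \<in> carrier L"
  have "sw [c \<odot>\<^bsub>L\<^esub> x] 1 - sw [x] c \<in> erels" unfolding erels_def using x by blast
  from cls_rel[OF this] show "inc (c \<odot>\<^bsub>L\<^esub> x) \<ominus>\<^bsub>UL\<^esub> c \<odot>\<^bsub>UL\<^esub> inc x = \<zero>\<^bsub>UL\<^esub>"
    unfolding inc_def'[of "c \<odot>\<^bsub>L\<^esub> x"] cls_sw1[OF x, symmetric] using x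
      by (simp only: cls_minus fa_minus_keys sw_FA list.set empty_subsetI insert_subset L.ksm_closed)
qed auto

lemma inc_lin: "inc \<in> lin L UL" by (rule linI) (simp_all add: inc_add inc_smult)

lemma inc_mult: "x \<in> carrier L \<Longrightarrow> y \<in> carrier L \<Longrightarrow> inc x \<otimes>\<^bsub>UL\<^esub> inc y = Q.cls (sw [x, y] 1)"
  unfolding inc_def' by (subst UL_mult) (auto simp: bil_ext_single)

lemma inc_bracket: "x \<in> carrier L \<Longrightarrow> y \<in> carrier L \<Longrightarrow> inc x \<otimes>\<^bsub>UL\<^esub> inc y = inc y \<otimes>\<^bsub>UL\<^esub> inc x \<oplus>\<^bsub>UL\<^esub> inc (x \<otimes>\<^bsub>L\<^esub> y)"
proof (rule UL_diff2)
  assume xy: "x \<in> carrier L" "y \<in> carrier L"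
  have "sw [x, y] 1 - sw [y, x] 1 - sw [x \<otimes>\<^bsub>L\<^esub> y] 1 \<in> erels" unfolding erels_def using xy by blast
  from cls_rel[OF this] show "inc x \<otimes>\<^bsub>UL\<^esub> inc y \<ominus>\<^bsub>UL\<^esub> inc y \<otimes>\<^bsub>UL\<^esub> inc x \<ominus>\<^bsub>UL\<^esub> inc (x \<otimes>\<^bsub>L\<^esub> y) = \<zero>\<^bsub>UL\<^esub>"
    unfolding inc_mult[OF xy] inc_mult[OF xy(2,1)] unfolding inc_def' using xy
      by (simp only: cls_minus fa_minus_keys sw_FA list.set empty_subsetI insert_subset bracket_closed)
qed auto

lemma cls_word: "set w \<subseteq> carrier L \<Longrightarrow> Q.cls (sw w c) = c \<odot>\<^bsub>UL\<^esub> word_prod UL inc w"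
proof -
  have "set w \<subseteq> carrier L \<Longrightarrow> Q.cls (sw w 1) = word_prod UL inc w"
  proof (induction w)
    case Nil show ?case by (simp add: UL_one)
  next
    case (Cons x w)
    have "Q.cls (sw (x # w) 1) = Q.cls (sw [x] 1) \<otimes>\<^bsub>UL\<^esub> Q.cls (sw w 1)"
      using Cons.prems by (subst UL_mult) (auto simp: bil_ext_single)
    then show ?case using Cons by (simp add: inc_def')
  qed
  moreover assume "set w \<subseteq> carrier L"
  ultimately show ?thesis using Q.q_smult[of "sw w 1" c] by auto
qed

lemma UL_induct [consumes 1, case_names word add]:
  assumes "X \<in> carrier UL" "\<And>w c. set w \<subseteq> carrier L \<Longrightarrow> P (c \<odot>\<^bsub>UL\<^esub> word_prod UL inc w)"
    "\<And>X Y. X \<in> carrier UL \<Longrightarrow> Y \<in> carrier UL \<Longrightarrow> P X \<Longrightarrow> P Y \<Longrightarrow> P (X \<oplus>\<^bsub>UL\<^esub> Y)"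
  shows "P X"
proof -
  obtain t where X: "X = Q.cls t" and t: "keys t \<subseteq> lists (carrier L)"
    using assms(1) unfolding Q.q_carrier by auto
  from t have "P (Q.cls t)"
  proof (induction rule: pm_induct)
    case zero
    show ?case using assms(2)[of "[]" 0] cls_word[of "[]" 0] by simp
  next
    case (single s c)
    then have "set s \<subseteq> carrier L" by auto
    then show ?case using assms(2) cls_word[of s c] by simp
  next
    case (add S R)
    then have "Q.cls (S + R) = Q.cls S \<oplus>\<^bsub>UL\<^esub> Q.cls R" by (simp add: Q.q_add)
    with add show ?case by (simp add: assms)
  qed
  then show ?thesis by (simp add: X)
qed

lemma UL_word_closed [simp]: "set w \<subseteq> carrier L \<Longrightarrow> word_prod UL inc w \<in> carrier UL"
  by (rule UL.word_prod_closed) auto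

text \<open>The enveloping algebra is generated by the image of \<open>L\<close>. Counits and
  antipodes are compared in this way.\<close>

lemma UL_hom_eq:
  assumes "kalg A" "f \<in> alg_hom UL A" "g \<in> alg_hom UL A" "\<And>x. x \<in> carrier L \<Longrightarrow> f (inc x) = g (inc x)" "X \<in> carrier UL"
  shows "f X = g X"
proof -
  note linform = alg_hom_lin[OF assms(2)] and gl = alg_hom_lin[OF assms(3)]
  have w: "set w \<subseteq> carrier L \<Longrightarrow> f (word_prod UL inc w) = g (word_prod UL inc w)" for w
    by (induction w) (simp_all add: alg_hom_mult[OF assms(2)] alg_hom_mult[OF assms(3)] alg_hom_one[OF assms(2)]
      alg_hom_one[OF assms(3)] assms)
  from assms(5) show ?thesis
    by (induction rule: UL_induct) (simp_all add: lin_add[OF linform] lin_add[OF gl] lin_smult[OF linform]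
      lin_smult[OF gl] w)
qed

end

text \<open>Universal property of the enveloping algebra, used with four targets: the graded dual,
  and the ground field, the opposite algebra and the tensor square for the counit, the antipode and
  the coproduct.\<close>

locale kenv_lift = kenv L + A: kalg A for L :: "('k::field, 'a, 'm) module_scheme" and A :: "('k, 'b, 'n)
    module_scheme" +
  fixes f assumes f_lin: "f \<in> lin L A"
    and f_br: "\<And>x y. x \<in> carrier L \<Longrightarrow> y \<in> carrier L \<Longrightarrow> f (x \<otimes>\<^bsub>L\<^esub> y) = f x \<otimes>\<^bsub>A\<^esub> f y \<ominus>\<^bsub>A\<^esub> f y \<otimes>\<^bsub>A\<^esub> f x"
begin

definition "E t = (\<Oplus>\<^bsub>A\<^esub>w\<in>keys t. lookup t w \<odot>\<^bsub>A\<^esub> word_prod A f w)"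

lemma f_closed [simp]: "x \<in> carrier L \<Longrightarrow> f x \<in> carrier A" by (rule lin_closed[OF f_lin])

lemma wp_closed [simp]: "set w \<subseteq> carrier L \<Longrightarrow> word_prod A f w \<in> carrier A"
  by (rule A.word_prod_closed) auto

lemma E_lin: "E \<in> lin FA A"
proof -
  have "E \<in> lin (free_module (lists (carrier L))) A"
    unfolding E_def by (rule A.lc_lin, rule wp_closed) auto
  then show ?thesis by (simp add: LinearCombinations.module_hom_def)
qed

lemma E_single: "set w \<subseteq> carrier L \<Longrightarrow> E (sw w c) = c \<odot>\<^bsub>A\<^esub> word_prod A f w"
  unfolding E_def by (rule A.lc_single) simp

lemma E_mult: "P \<in> carrier FA \<Longrightarrow> Q \<in> carrier FA \<Longrightarrow> E (P \<otimes>\<^bsub>FA\<^esub> Q) = E P \<otimes>\<^bsub>A\<^esub> E Q"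
proof -
  have E0: "E 0 = \<zero>\<^bsub>A\<^esub>" using lin_zero[OF FA.kvs_axioms A.kvs_axioms E_lin] by simp
  have Ea: "keys P \<subseteq> lists (carrier L) \<Longrightarrow> keys Q \<subseteq> lists (carrier L) \<Longrightarrow> E (P + Q) = E P \<oplus>\<^bsub>A\<^esub> E Q" for P Q
    using lin_add[OF E_lin, of P Q] by simp
  have Ec: "keys P \<subseteq> lists (carrier L) \<Longrightarrow> E P \<in> carrier A" for P
    using lin_closed[OF E_lin, of P] by simp
  note k = bil_ext_keys[where S="lists (carrier L)" and T="lists (carrier L)" and R="lists (carrier L)" and f="(@)"]
  assume "P \<in> carrier FA" and "Q \<in> carrier FA"
  then have P: "keys P \<subseteq> lists (carrier L)" and Q: "keys Q \<subseteq> lists (carrier L)" by auto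
  from P have "E (bil_ext (\<lambda>_ _. 1) (@) P Q) = E P \<otimes>\<^bsub>A\<^esub> E Q"
  proof (induction rule: pm_induct)
    case zero then show ?case using Q by (simp add: E0 Ec)
  next
    case (single u a)
    then have u: "set u \<subseteq> carrier L" "keys (sw u a) \<subseteq> lists (carrier L)" by auto
    from Q show ?case
    proof (induction rule: pm_induct)
      case (single v b)
      then have v: "set v \<subseteq> carrier L" by auto
      have "word_prod A f (u @ v) = word_prod A f u \<otimes>\<^bsub>A\<^esub> word_prod A f v"
        by (rule A.word_prod_append) (use u v in auto)
      then show ?case using u v by (simp add: bil_ext_single E_single mult.commute)
    qed (use u in \<open>simp_all add: E0 Ec bil_ext_add_r Ea k A.r_distr\<close>)
  qed (use Q in \<open>simp_all add: bil_ext_add_l Ea Ec k A.l_distr\<close>)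
  then show ?thesis by simp
qed

lemma E_minus: "P \<in> carrier FA \<Longrightarrow> Q \<in> carrier FA \<Longrightarrow> E (P - Q) = E P \<ominus>\<^bsub>A\<^esub> E Q"
proof -
  assume PQ: "P \<in> carrier FA" "Q \<in> carrier FA"
  have "Poly_Mapping.map ((*) (-1)) Q = - Q" by (rule poly_mapping_eqI) simp
  then have "P \<ominus>\<^bsub>FA\<^esub> Q = P - Q" using PQ FA.ksm_m1[of Q] by (simp add: a_minus_def)
  then show ?thesis using lin_minus[OF FA.kvs_axioms A.kvs_axioms E_lin PQ] by simp
qed

lemma E_sw_minus: "set w \<subseteq> carrier L \<Longrightarrow> P \<in> carrier FA \<Longrightarrow> E (P - sw w c) = E P \<ominus>\<^bsub>A\<^esub> c \<odot>\<^bsub>A\<^esub> word_prod A f w"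
  by (subst E_minus) (auto simp: E_single)

lemma A_cancel: "x \<in> carrier A \<Longrightarrow> y \<in> carrier A \<Longrightarrow> (x \<oplus>\<^bsub>A\<^esub> y) \<ominus>\<^bsub>A\<^esub> x \<ominus>\<^bsub>A\<^esub> y = \<zero>\<^bsub>A\<^esub>"
  using A.r_neg[of "x \<oplus>\<^bsub>A\<^esub> y"] by (simp add: a_minus_def A.minus_add A.a_assoc)

lemma A_self: "x \<in> carrier A \<Longrightarrow> x \<ominus>\<^bsub>A\<^esub> x = \<zero>\<^bsub>A\<^esub>"
  by (simp add: a_minus_def A.r_neg)

lemma E_rels: "t \<in> erels \<Longrightarrow> E t = \<zero>\<^bsub>A\<^esub>"
proof -
  assume "t \<in> erels"
  then show ?thesis unfolding erels_def
    by (elim UnE CollectE exE conjE; simp only: E_sw_minus fa_minus_keys sw_FA E_single list.set empty_subsetI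
      insert_subset
        L.a_closed L.ksm_closed bracket_closed word_prod_simps lin_add[OF f_lin] lin_smult[OF f_lin] f_br f_closed
        A.r_one A.ksm_one A.a_closed A.ksm_closed A.m_closed A.minus_closed A_cancel A_self simp_thms)
qed

text \<open>The kernel of a ring homomorphism is a two-sided ideal; containing the relations, it
  contains the ideal generated by them.\<close>

lemma E_ideal: "t \<in> env_ideal L \<Longrightarrow> E t = \<zero>\<^bsub>A\<^esub>"
proof -
  have "ring_hom_ring FA A E"
    by (rule ring_hom_ringI2[OF FA.ring_axioms A.ring_axioms])
      (use lin_closed[OF E_lin] lin_add[OF E_lin] E_mult E_single[of "[]" 1] in \<open>auto simp: Ring.ring_hom_def simp
        del: fa_simps(1,2,3,5,6)\<close>)
  from ring_hom_ring.kernel_is_ideal[OF this] have i: "ideal (a_kernel FA A E) FA" .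
  have "erels \<subseteq> a_kernel FA A E" using E_rels erels_FA unfolding a_kernel_def' by blast
  from FA.genideal_minimal[OF i this] have "env_ideal L \<subseteq> a_kernel FA A E" unfolding env_ideal .
  moreover assume "t \<in> env_ideal L"
  ultimately show ?thesis unfolding a_kernel_def' by auto
qed

lemma env_lift_cls: assumes t: "t \<in> carrier FA" shows "env_lift A f (Q.cls t) = E t"
proof -
  define s where "s = (SOME s. s \<in> Q.cls t)"
  have "s \<in> Q.cls t" unfolding s_def by (rule someI, rule Q.cls_self[OF t])
  then have s: "s \<in> carrier FA" "s \<ominus>\<^bsub>FA\<^esub> t \<in> env_ideal L" using Q.in_cls t by auto
  have "E s \<ominus>\<^bsub>A\<^esub> E t = \<zero>\<^bsub>A\<^esub>" using E_ideal[OF s(2)] lin_minus[OF FA.kvs_axioms A.kvs_axioms E_lin s(1) t] by argo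
  then have "E s = E t" by (rule A.diff_eqI[OF _ lin_closed[OF E_lin s(1)] lin_closed[OF E_lin t]])
  then show ?thesis by (simp add: env_lift_def E_def s_def Let_def)
qed

lemma env_lift_hom: "env_lift A f \<in> alg_hom UL A"
proof (rule alg_homI)
  show "env_lift A f \<in> lin UL A"
    by (rule linI) (auto simp only: Q.q_carrier env_lift_cls Q.q_add Q.q_smult FA.a_closed FA.ksm_closed
        lin_closed[OF E_lin] lin_add[OF E_lin] lin_smult[OF E_lin])
  show "env_lift A f (x \<otimes>\<^bsub>UL\<^esub> y) = env_lift A f x \<otimes>\<^bsub>A\<^esub> env_lift A f y" if "x \<in> carrier UL" "y \<in> carrier UL" for x y
    using that by (auto simp only: Q.q_carrier env_lift_cls UL_mult FA.m_closed E_mult)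
  show "env_lift A f \<one>\<^bsub>UL\<^esub> = \<one>\<^bsub>A\<^esub>"
    unfolding UL_one env_lift_cls[OF FA.one_closed] using E_single[of "[]" 1] by simp
qed

lemma env_lift_inc: "x \<in> carrier L \<Longrightarrow> env_lift A f (inc x) = f x"
  unfolding inc_def' by (subst env_lift_cls) (auto simp: E_single)

end

text \<open>In the coassociativity law an inner lift depends on a factor of the outer tensor; this
  provides linearity in that factor.\<close>

lemma tl_param_lin:
  assumes k: "kvs V" "kvs V'" "kvs U" and b: "\<And>w. w \<in> carrier W \<Longrightarrow> bilinear_map V V' U (\<beta> w)"
    and l: "\<And>a a'. a \<in> carrier V \<Longrightarrow> a' \<in> carrier V' \<Longrightarrow> (\<lambda>w. \<beta> w a a') \<in> lin W U"
    and W: "kvs W" and T: "T \<in> carrier (tensor_space V V')"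
  shows "(\<lambda>w. tensor_lift U (\<beta> w) T) \<in> lin W U"
proof -
  interpret ktensor V V' using k by (intro ktensor.intro)
  interpret WW: kvs W by fact
  note tl = tl_lin[OF k b] and tp = tl_pure[OF k b]
  show ?thesis
  proof (rule linI)
    show "tensor_lift U (\<beta> w) T \<in> carrier U" if "w \<in> carrier W" for w by (rule lin_closed[OF tl[OF that] T])
    fix w w' assume w: "w \<in> carrier W" "w' \<in> carrier W"
    then show "tensor_lift U (\<beta> (w \<oplus>\<^bsub>W\<^esub> w')) T = tensor_lift U (\<beta> w) T \<oplus>\<^bsub>U\<^esub> tensor_lift U (\<beta> w') T"
      by (intro lin_eq_tensor[OF tl lin_add_fun[OF k(3) tl tl] _ T]) (simp_all add: tp lin_add[OF l])
  next
    fix c w assume w: "w \<in> carrier W"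
    then show "tensor_lift U (\<beta> (c \<odot>\<^bsub>W\<^esub> w)) T = c \<odot>\<^bsub>U\<^esub> tensor_lift U (\<beta> w) T"
      by (intro lin_eq_tensor[OF tl lin_smult_fun[OF k(3) tl] _ T]) (simp_all add: tp lin_smult[OF l])
  qed
qed

lemma bil_from_lin: "(\<And>w. w \<in> carrier W \<Longrightarrow> (\<lambda>v. b v w) \<in> lin V U) \<Longrightarrow> (\<And>v. v \<in> carrier V \<Longrightarrow> b v \<in> lin W U) \<Longrightarrow>
    bilinear_map V W U b"
  by (simp add: bilinear_map_def)

text \<open>Both sides of multiplicativity are linear in \<open>S\<close> and in \<open>T\<close>,
  so pure tensors suffice. Pairs of points thereby become characters of the tensor square.\<close>

lemma (in ktalg) base_tensor_hom:
  assumes f: "f \<in> alg_hom A base_algebra" and g: "g \<in> alg_hom B base_algebra"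
  shows "tensor_lift base_algebra (\<lambda>a b. f a * g b) \<in> alg_hom AB base_algebra" (is "?F \<in> _")
proof (rule alg_homI)
  have b: "bilinear_map A B base_algebra (\<lambda>a b. f a * g b)" by (intro lin_base_bil alg_hom_lin[OF f] alg_hom_lin[OF
    g])
  have tl: "?F \<in> lin VW base_algebra" by (rule tl_lin[OF A.kvs_axioms B.kvs_axioms base_kvs b])
  note tp = tl_pure[OF A.kvs_axioms B.kvs_axioms base_kvs b]
  show "?F \<in> lin AB base_algebra" using tl by (simp add: LinearCombinations.module_hom_def)
  show "?F \<one>\<^bsub>AB\<^esub> = \<one>\<^bsub>base_algebra\<^esub>" using alg_hom_one[OF f] alg_hom_one[OF g] by (simp add: tp)
  fix S T assume "S \<in> carrier AB" and "T \<in> carrier AB"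
  then have S: "S \<in> carrier VW" and T: "T \<in> carrier VW" by simp_all
  note bm = AB_mult_bil
  have l1: "(\<lambda>S. ?F (S \<otimes>\<^bsub>AB\<^esub> T)) \<in> lin VW base_algebra" if "T \<in> carrier VW" for T
    by (rule lin_compose[OF bil_lin_l[OF bm that] tl])
  have l2: "(\<lambda>T. ?F (S \<otimes>\<^bsub>AB\<^esub> T)) \<in> lin VW base_algebra" if "S \<in> carrier VW" for S
    by (rule lin_compose[OF bil_lin_r[OF bm that] tl])
  have l3: "(\<lambda>S. ?F S * c) \<in> lin VW base_algebra" for c
    by (rule linI) (simp_all add: lin_add[OF tl] lin_smult[OF tl] algebra_simps)
  have l4: "(\<lambda>S. c * ?F S) \<in> lin VW base_algebra" for c
    by (rule linI) (simp_all add: lin_add[OF tl] lin_smult[OF tl] algebra_simps)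
  have "?F (p a b \<otimes>\<^bsub>AB\<^esub> T) = ?F (p a b) * ?F T" if ab: "a \<in> carrier A" "b \<in> carrier B" for a b
    by (rule lin_eq_tensor[OF l2 l4 _ T])
      (use ab in \<open>simp_all add: AB_pure tp alg_hom_mult[OF f] alg_hom_mult[OF g]\<close>)
  then have "?F (S \<otimes>\<^bsub>AB\<^esub> T) = ?F S * ?F T"
    by (intro lin_eq_tensor[OF l1[OF T] l3 _ S]) simp
  then show "?F (S \<otimes>\<^bsub>AB\<^esub> T) = ?F S \<otimes>\<^bsub>base_algebra\<^esub> ?F T" by simp
qed

text \<open>A tensor space reads only carriers, additions and scalar multiplications. Records that
  differ in their other fields share it, such as an algebra and the Hopf algebra built upon
  it.\<close>

lemma tensor_kernel_cong:
  assumes "carrier V' = carrier V" "add V' = add V" "smult V' = smult V" "carrier W' = carrier W" "add W' =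
    add W" "smult W' = smult W"
  shows "tensor_kernel V' W' = tensor_kernel V W"
  by (simp add: tensor_kernel_def assms)

lemma tensor_space_cong:
  assumes "carrier V' = carrier V" "add V' = add V" "smult V' = smult V" "carrier W' = carrier W" "add W' =
    add W" "smult W' = smult W"
  shows "tensor_space V' W' = tensor_space V W"
  by (simp add: tensor_space_def tensor_kernel_cong[OF assms] assms)

lemma pure_tensor_cong:
  assumes "carrier V' = carrier V" "add V' = add V" "smult V' = smult V" "carrier W' = carrier W" "add W' =
    add W" "smult W' = smult W"
  shows "pure_tensor V' W' = pure_tensor V W"
  by (intro ext) (simp add: pure_tensor_def tensor_kernel_cong[OF assms] assms)

section \<open>The pre-Lie algebra of the matrix\<close>

locale gB =
  fixes p q :: nat and B :: "'k::field_char_0 mat"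
  assumes p1: "1 \<le> p" and Bc: "B \<in> carrier_mat q p"
begin

abbreviation "n \<equiv> p + q"
abbreviation "mi \<equiv> multi_indices (p + q)"
definition "I = {..<p} \<times> (mi - {0})"
abbreviation "g \<equiv> g_algebra p q B"
text \<open>Additivity of this form in \<alpha> is the source both of the pre-Lie identity and of
  the multiplicativity of the substitutions in the group law.\<close>

definition A :: "nat \<Rightarrow> (nat \<Rightarrow>\<^sub>0 nat) \<Rightarrow> 'k" where "A j \<alpha> = col (stacked_matrix p B) j \<bullet> index_vec (p + q) \<alpha>"

lemma stacked_carrier: "stacked_matrix p B \<in> carrier_mat (p + q) p"
  unfolding stacked_matrix_def using Bc by (intro carrier_append_rows) auto

lemma col_carrier: "col (stacked_matrix p B) j \<in> carrier_vec (p + q)"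
  by (rule carrier_vecI) (use stacked_carrier in simp)

lemma index_carrier [simp]: "index_vec m \<alpha> \<in> carrier_vec m" by (simp add: index_vec_def)

lemma index_add: "index_vec m (\<alpha> + \<beta>) = index_vec m \<alpha> + (index_vec m \<beta> :: 'k vec)"
  by (rule eq_vecI) (simp_all add: index_vec_def lookup_add)

lemma A_add: "A j (\<alpha> + \<beta>) = A j \<alpha> + A j \<beta>"
  unfolding A_def index_add by (rule scalar_prod_add_distrib) (rule col_carrier, simp_all)

lemma A_0 [simp]: "A j 0 = 0" using A_add[of j 0 0] by simp

text \<open>The identity block records that \<open>x_i\<close> is multiplied by
  \<open>F_i / x_i\<close> in the group law; the block \<open>B\<close> holds the exponents of the
  factors multiplying the variables \<open>y\<close>.\<close>

lemma A_x: "j < p \<Longrightarrow> i < p \<Longrightarrow> A j (single i 1) = (if i = j then 1 else 0)"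
  and A_y: "j < p \<Longrightarrow> i < q \<Longrightarrow> A j (single (p + i) 1) = B $$ (i, j)"
proof -
  have *: "A j (single k 1) = stacked_matrix p B $$ (k, j)" if "k < p + q" "j < p" for k j
  proof -
    have "A j (single k 1) = (\<Sum>l<p+q. stacked_matrix p B $$ (l, j) * (if l = k then 1 else 0))"
      unfolding A_def scalar_prod_def using that stacked_carrier
      by (auto simp: index_vec_def lookup_single when_def lessThan_atLeast0 intro!: sum.cong)
    also have "\<dots> = stacked_matrix p B $$ (k, j)" using that by (simp add: if_distrib[of "\<lambda>z. _ * z"] cong: if_cong)
    finally show ?thesis .
  qed
  show "j < p \<Longrightarrow> i < p \<Longrightarrow> A j (single i 1) = (if i = j then 1 else 0)"
    using Bc by (subst *) (auto simp: stacked_matrix_def append_rows_def)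
  show "j < p \<Longrightarrow> i < q \<Longrightarrow> A j (single (p + i) 1) = B $$ (i, j)"
    using Bc by (subst *) (auto simp: stacked_matrix_def append_rows_def)
qed

lemma mi_0 [simp]: "0 \<in> mi" by (simp add: multi_indices_def)

lemma mi_add: "\<alpha> \<in> mi \<Longrightarrow> \<beta> \<in> mi \<Longrightarrow> \<alpha> + \<beta> \<in> mi"
  using keys_add_sub[of \<alpha> "{..<n}" \<beta>] by (simp add: multi_indices_def)

lemma mi_add_iff: "\<alpha> + \<beta> \<in> mi \<longleftrightarrow> \<alpha> \<in> mi \<and> \<beta> \<in> mi"
proof -
  have "keys (\<alpha> + \<beta>) = keys \<alpha> \<union> keys \<beta>"
    by (auto simp: in_keys_iff lookup_add)
  then show ?thesis by (auto simp: multi_indices_def)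
qed

lemma mi_add_0: "\<alpha> + \<beta> = 0 \<longleftrightarrow> \<alpha> = 0 \<and> \<beta> = (0 :: nat \<Rightarrow>\<^sub>0 nat)"
  by (auto simp: poly_mapping_eq_iff fun_eq_iff lookup_add)

lemma I_add: "(i, \<alpha>) \<in> I \<Longrightarrow> (j, \<beta>) \<in> I \<Longrightarrow> (i, \<alpha> + \<beta>) \<in> I"
  by (auto simp: I_def mi_add mi_add_0)

definition gm where "gm = bil_ext (\<lambda>(j, \<beta>) (i, \<alpha>). A j \<alpha>) (\<lambda>(j, \<beta> :: nat \<Rightarrow>\<^sub>0 nat) (i :: nat, \<alpha>). (i, \<alpha> + \<beta>))"

lemma g_simps [simp]: "carrier g = carrier (free_module I)" "add g = (+)" "zero g = 0" "smult g =
    (\<lambda>c. Poly_Mapping.map ((*) c))"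
  "mult g = gm"
  by (simp_all add: g_algebra_def free_module_def I_def gm_def bil_ext_def A_def fun_eq_iff case_prod_unfold)

lemma g_kvs: "kvs g" by (rule kvs_transfer[OF free_kvs[of I]]) (simp_all add: free_module_def)

sublocale g: kvs g by (rule g_kvs)

lemma gm_keys: "keys P \<subseteq> I \<Longrightarrow> keys Q \<subseteq> I \<Longrightarrow> keys (gm P Q) \<subseteq> I"
  unfolding gm_def by (rule bil_ext_keys[where S = I and T = I]) (auto intro: I_add)

lemma g_minus: "P \<in> carrier g \<Longrightarrow> Q \<in> carrier g \<Longrightarrow> P \<ominus>\<^bsub>g\<^esub> Q = P - Q"
proof -
  assume PQ: "P \<in> carrier g" "Q \<in> carrier g"
  have "Poly_Mapping.map ((*) (-1)) Q = - Q" by (rule poly_mapping_eqI) simp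
  then show ?thesis using PQ g.ksm_m1[of Q] by (simp add: a_minus_def)
qed

lemma gm_single: "gm (single (j, \<beta>) a) (single (i, \<alpha>) b) = single (i, \<alpha> + \<beta>) (a * b * A j \<alpha>)"
  by (simp add: gm_def bil_ext_single)

lemma gm_add: "gm (P + P') Q = gm P Q + gm P' Q" "gm P (Q + Q') = gm P Q + gm P Q'"
  by (simp_all add: gm_def bil_ext_add_l bil_ext_add_r)

lemma gm_0 [simp]: "gm 0 Q = 0" "gm P 0 = 0" by (simp_all add: gm_def)

lemma gm_scale: "gm (Poly_Mapping.map ((*) c) P) Q = Poly_Mapping.map ((*) c) (gm P Q)"
  "gm P (Poly_Mapping.map ((*) c) Q) = Poly_Mapping.map ((*) c) (gm P Q)"
  by (simp_all add: gm_def bil_ext_scale_l bil_ext_scale_r)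

lemma g_finsum: "finite S \<Longrightarrow> (\<And>s. s \<in> S \<Longrightarrow> keys (f s) \<subseteq> I) \<Longrightarrow> finsum g f S = sum f S"
proof (induction S rule: finite_induct)
  case empty show ?case using g.finsum_empty by simp
next
  case (insert s S)
  have "finsum g f (insert s S) = f s \<oplus>\<^bsub>g\<^esub> finsum g f S"
    by (rule g.finsum_insert) (use insert in auto)
  then show ?case using insert by simp
qed

text \<open>For \<open>f_j(\<beta>)\<close>, \<open>f_i(\<alpha>)\<close>,
  \<open>f_k(\<delta>)\<close> the associator is \<open>- (A i \<delta>) (A j \<delta>) f_k(\<alpha>
  + \<beta> + \<delta>)\<close>, symmetric in the two left arguments. The identity is rearranged
  into sums, so that in the induction the step for \<open>+\<close> adds two instances.\<close>

lemma gm_pre_lie: "gm (gm x y) z + gm y (gm x z) = gm (gm y x) z + gm x (gm y z)"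
proof (induction x rule: pm_induct0)
  case (single s a)
  show ?case
  proof (induction y rule: pm_induct0)
    case (single t b)
    show ?case
    proof (induction z rule: pm_induct0)
      case (single u c)
      obtain j \<beta> i \<alpha> k \<delta> where "s = (j, \<beta>)" "t = (i, \<alpha>)" "u = (k, \<delta>)" by (cases s, cases t, cases u) auto
      then show ?case by (simp add: gm_single A_add single_add[symmetric] ac_simps algebra_simps)
    next
      case (add P R)
      from arg_cong2[OF add, of "(+)"] show ?case by (simp add: gm_add ac_simps)
    qed simp
  next
    case (add P R)
    from arg_cong2[OF add, of "(+)"] show ?case by (simp add: gm_add ac_simps)
  qed simp
next
  case (add P R)
  from arg_cong2[OF add, of "(+)"] show ?case by (simp add: gm_add ac_simps)
qed simp

lemma g_pre_lie: "pre_lie_algebra g"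
proof -
  have "bilinear_map g g g (mult g)"
    by (rule bilinearI) (simp_all add: gm_keys gm_add gm_scale)
  moreover have "(x \<otimes>\<^bsub>g\<^esub> y) \<otimes>\<^bsub>g\<^esub> z \<ominus>\<^bsub>g\<^esub> x \<otimes>\<^bsub>g\<^esub> (y \<otimes>\<^bsub>g\<^esub> z) = (y \<otimes>\<^bsub>g\<^esub> x) \<otimes>\<^bsub>g\<^esub> z \<ominus>\<^bsub>g\<^esub> y \<otimes>\<^bsub>g\<^esub> (x \<otimes>\<^bsub>g\<^esub> z)"
    if "x \<in> carrier g" "y \<in> carrier g" "z \<in> carrier g" for x y z
    using that gm_pre_lie[of x y z] by (simp add: g_minus gm_keys algebra_simps)
  ultimately show ?thesis using g.vs by (simp add: pre_lie_algebra_def)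
qed

lemma g_deg1: "deg1_with g p n g_basis (\<lambda>i j. col (stacked_matrix p B) j) (\<lambda>i j. 0)"
proof -
  let ?f = "\<lambda>(i, \<alpha>). g_basis i \<alpha> :: (nat \<times> (nat \<Rightarrow>\<^sub>0 nat)) \<Rightarrow>\<^sub>0 'k"
  have f: "?f s = single s 1" for s by (cases s) (simp add: g_basis_def)
  have inj: "inj_on ?f I" by (rule inj_onI) (metis f lookup_single_eq lookup_single_not_eq zero_neq_one)
  have sub: "?f ` I \<subseteq> carrier g" by (auto simp: f)
  interpret vectorspace class_ring g by (rule g.vs)
  have "basis (?f ` I)"
    unfolding basis_def
  proof (intro conjI sub)
    show "\<not> lin_dep (?f ` I)"
    proof
      assume "lin_dep (?f ` I)"
      then obtain S a v where S: "finite S" "S \<subseteq> ?f ` I" "(\<Oplus>\<^bsub>g\<^esub>v\<in>S. a v \<odot>\<^bsub>g\<^esub> v) = \<zero>\<^bsub>g\<^esub>" "v \<in> S" "a v \<noteq> 0"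
        unfolding g.lin_dep_iff by blast
      have "keys u \<subseteq> I" if "u \<in> S" for u using S(2) sub that by auto
      then have "finsum g (\<lambda>v. a v \<odot>\<^bsub>g\<^esub> v) S = (\<Sum>v\<in>S. a v \<odot>\<^bsub>g\<^esub> v)"
        by (intro g_finsum[OF S(1)]) (simp add: keys_scale_sub)
      then have sum0: "(\<Sum>v\<in>S. a v \<odot>\<^bsub>g\<^esub> v) = 0" using S(3) by simp
      obtain s where s: "v = single s 1" "s \<in> I" using S(2,4) f by auto
      have "lookup u s = (if u = v then 1 else 0)" if "u \<in> S" for u
        using that S(2) s f by (auto simp: lookup_single when_def)
      then have "lookup (\<Sum>v\<in>S. a v \<odot>\<^bsub>g\<^esub> v) s = (\<Sum>u\<in>S. if u = v then a u else 0)"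
        unfolding lookup_sum by (intro sum.cong) auto
      with sum0 S show False by simp
    qed
    have "x \<in> lin_span g (?f ` I)" if "keys x \<subseteq> I" for x
      using that
    proof (induction rule: pm_induct)
      case zero show ?case using g.span_zero[OF sub] by simp
    next
      case (single s c)
      have "c \<odot>\<^bsub>g\<^esub> ?f s \<in> lin_span g (?f ` I)" using single by (intro g.span_smult[OF sub] g.span_in[OF sub]) auto
      then show ?case by (simp add: f)
    next
      case (add P R) then show ?case using g.span_add[OF sub] by simp
    qed
    then show "lin_span g (?f ` I) = carrier g" using g.span_carrier[OF sub] by auto
  qed
  with inj show ?thesis
    unfolding deg1_with_def I_def[symmetric]
    by (intro conjI ballI allI impI col_carrier) (assumption | simp add: g_basis_def gm_single A_def)+
qed

lemma g_deg1_pre_lie: "deg1_pre_lie_algebra g"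
  using g_pre_lie g_deg1 unfolding deg1_pre_lie_algebra_def by blast

abbreviation "gL \<equiv> commutator_lie g"

lemma gL_simps [simp]: "carrier gL = carrier (free_module I)" "add gL = (+)" "zero gL = 0" "smult gL =
    (\<lambda>c. Poly_Mapping.map ((*) c))"
  by (simp_all add: commutator_lie_def)

lemma gL_mult: "x \<in> carrier g \<Longrightarrow> y \<in> carrier g \<Longrightarrow> x \<otimes>\<^bsub>gL\<^esub> y = gm x y - gm y x"
  by (simp add: commutator_lie_def g_minus gm_keys)

lemma gL_kvs: "kvs gL" by (rule kvs_transfer[OF g_kvs]) (simp_all add: commutator_lie_def)

lemma gL_env: "kenv gL"
proof (rule kenv.intro[OF gL_kvs], unfold_locales)
  fix x y assume "x \<in> carrier gL" "y \<in> carrier gL"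
  then show "x \<otimes>\<^bsub>gL\<^esub> y \<in> carrier gL" using gL_mult[of x y] keys_diff[of "gm x y" "gm y x"] gm_keys[of x y] gm_keys[of
    y x] by auto
qed

end

section \<open>Coefficients and total degree of power series\<close>

lemma mps_coeff_0 [simp]: "mps_coeff 0 \<alpha> = 0"
  and mps_coeff_1: "mps_coeff 1 \<alpha> = (if \<alpha> = 0 then 1 else 0)"
  and mps_coeff_add [simp]: "mps_coeff (f + g) \<alpha> = mps_coeff f \<alpha> + mps_coeff g \<alpha>"
  and mps_coeff_diff [simp]: "mps_coeff (f - g) \<alpha> = mps_coeff f \<alpha> - mps_coeff g \<alpha>"
  and mps_coeff_uminus [simp]: "mps_coeff (- f) \<alpha> = - mps_coeff f \<alpha>"
  and mps_coeff_mult: "mps_coeff (f * g) \<alpha> = (\<Sum>(\<beta>, \<gamma>)\<in>splits \<alpha>. mps_coeff f \<beta> * mps_coeff g \<gamma>)"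
  by (simp_all add: zero_mps_def one_mps_def plus_mps_def minus_mps_def uminus_mps_def times_mps_def)

lemma mps_coeff_1_0 [simp]: "mps_coeff 1 0 = 1" by (simp add: mps_coeff_1)

lemma mps_coeff_mult_0 [simp]: "mps_coeff (f * g) 0 = mps_coeff f 0 * mps_coeff g 0"
  by (simp add: mps_coeff_mult)

lemma mps_coeff_power_0 [simp]: "mps_coeff (f ^ n) 0 = mps_coeff f 0 ^ n"
  by (induction n) auto

lemma mps_coeff_sum: "mps_coeff (sum f S) \<alpha> = (\<Sum>s\<in>S. mps_coeff (f s) \<alpha>)"
  by (induction S rule: infinite_finite_induct) auto

lemma mps_coeff_prod_0: "mps_coeff (prod f S) 0 = (\<Prod>s\<in>S. mps_coeff (f s) 0)"
  by (induction S rule: infinite_finite_induct) auto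

definition mdeg :: "(nat \<Rightarrow>\<^sub>0 nat) \<Rightarrow> nat" where "mdeg \<alpha> = sum (lookup \<alpha>) (keys \<alpha>)"

lemma mdeg_add [simp]: "mdeg (\<alpha> + \<beta>) = mdeg \<alpha> + mdeg \<beta>"
  unfolding mdeg_def by (rule setsum_keys_plus_distrib) auto

lemma mdeg_0 [simp]: "mdeg 0 = 0" by (simp add: mdeg_def)

lemma mdeg_0_iff [simp]: "mdeg \<alpha> = 0 \<longleftrightarrow> \<alpha> = 0"
  by (auto simp: mdeg_def in_keys_iff intro!: poly_mapping_eqI)

lemma splits_mdeg: "(\<beta>, \<gamma>) \<in> splits \<alpha> \<Longrightarrow> mdeg \<beta> + mdeg \<gamma> = mdeg \<alpha>"
  by (auto simp: splits_def)

lemma splits_iff: "(\<beta>, \<gamma>) \<in> splits \<alpha> \<longleftrightarrow> \<beta> + \<gamma> = \<alpha>" by (simp add: splits_def)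

text \<open>Each factor without constant term raises the total degree by at least one. This
  truncates series in powers of \<open>u - 1\<close> at \<open>mdeg \<alpha>\<close>.\<close>

lemma mps_coeff_power_high: "mps_coeff f 0 = 0 \<Longrightarrow> mdeg \<alpha> < n \<Longrightarrow> mps_coeff (f ^ n) \<alpha> = 0"
proof (induction n arbitrary: \<alpha>)
  case (Suc n)
  have "mps_coeff f \<beta> * mps_coeff (f ^ n) \<gamma> = 0" if "(\<beta>, \<gamma>) \<in> splits \<alpha>" for \<beta> \<gamma>
  proof (cases "\<beta> = 0")
    case False
    then have "mdeg \<beta> > 0" using mdeg_0_iff[of \<beta>] by linarith
    then have "mdeg \<gamma> < n" using splits_mdeg[OF that] Suc.prems by linarith
    then show ?thesis using Suc by simp
  qed (use Suc in simp)
  then show ?case unfolding power_Suc mps_coeff_mult by (intro sum.neutral) auto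
qed simp

section \<open>Powers with exponents in the ground field\<close>

text \<open>The power \<^const>\<open>mps_power\<close> for coefficients in a \<open>'k\<close>-algebra with structure map \<open>\<iota>\<close>; truncating the sum at
  \<open>mdeg \<alpha>\<close> loses nothing when the constant term of \<open>u\<close> is \<open>1\<close>.\<close>

definition gpow :: "('k::field_char_0 \<Rightarrow> 'r::comm_ring_1) \<Rightarrow> 'r mps \<Rightarrow> 'k \<Rightarrow> 'r mps" where
  "gpow \<iota> u c = Mps (\<lambda>\<alpha>. \<Sum>n\<le>mdeg \<alpha>. \<iota> (c gchoose n) * mps_coeff ((u - 1) ^ n) \<alpha>)"

lemma mps_power_coeff:
  assumes "mps_coeff u 0 = 1"
  shows "mps_coeff (mps_power u c) \<alpha> = (\<Sum>n\<le>mdeg \<alpha>. (c gchoose n) * mps_coeff ((u - 1) ^ n) \<alpha>)"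
  unfolding mps_power_def mps_coeff_Mps
proof (rule Sum_any.expand_superset)
  show "{n. (c gchoose n) * mps_coeff ((u - 1) ^ n) \<alpha> \<noteq> 0} \<subseteq> {..mdeg \<alpha>}"
    using mps_coeff_power_high[of "u - 1" \<alpha>] assms by (force simp: not_le[symmetric])
qed simp

text \<open>Each coefficient of \<open>mps_power u c\<close> is of this kind in \<open>c\<close>.
  Polynomial functions that agree at all natural numbers are equal in characteristic zero, so laws
  of powers reduce to natural exponents.\<close>

definition polyfun :: "('k::field_char_0 \<Rightarrow> 'k) \<Rightarrow> bool" where "polyfun f \<longleftrightarrow> (\<exists>P. \<forall>c. f c = poly P c)"

lemma polyfun_const [intro]: "polyfun (\<lambda>_. a)" unfolding polyfun_def by (rule exI[of _ "[:a:]"]) simp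
lemma polyfun_id [intro]: "polyfun (\<lambda>c. c)" unfolding polyfun_def by (rule exI[of _ "[:0, 1:]"]) simp
lemma polyfun_add: "polyfun f \<Longrightarrow> polyfun g \<Longrightarrow> polyfun (\<lambda>c. f c + g c)"
  unfolding polyfun_def by (metis poly_add)
lemma polyfun_diff: "polyfun f \<Longrightarrow> polyfun g \<Longrightarrow> polyfun (\<lambda>c. f c - g c)"
  unfolding polyfun_def by (metis poly_diff)
lemma polyfun_mult: "polyfun f \<Longrightarrow> polyfun g \<Longrightarrow> polyfun (\<lambda>c. f c * g c)"
  unfolding polyfun_def by (metis poly_mult)
lemma polyfun_sum: "(\<And>s. s \<in> S \<Longrightarrow> polyfun (f s)) \<Longrightarrow> polyfun (\<lambda>c. \<Sum>s\<in>S. f s c)"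
  by (induction S rule: infinite_finite_induct) (auto intro: polyfun_add)
lemma polyfun_prod: "(\<And>s. s \<in> S \<Longrightarrow> polyfun (f s)) \<Longrightarrow> polyfun (\<lambda>c. \<Prod>s\<in>S. f s c)"
  by (induction S rule: infinite_finite_induct) (auto intro: polyfun_mult)
lemma polyfun_gchoose: "polyfun (\<lambda>c. c gchoose n)"
proof -
  have "polyfun (\<lambda>c. (\<Prod>i = 0..<n. c - of_nat i) * (1 / fact n))"
    by (intro polyfun_mult polyfun_prod polyfun_diff) auto
  then show ?thesis by (simp add: gbinomial_prod_rev)
qed

lemma polyfun_eq:
  fixes f :: "'k::field_char_0 \<Rightarrow> 'k"
  assumes "polyfun f" "polyfun g" "\<And>m::nat. f (of_nat m) = g (of_nat m)"
  shows "f c = g c"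
proof -
  obtain P Q where P: "\<And>c. f c = poly P c" and Q: "\<And>c. g c = poly Q c" using assms unfolding polyfun_def by blast
  have "P - Q = 0"
  proof (rule ccontr)
    assume "P - Q \<noteq> 0"
    then have "finite {x. poly (P - Q) x = 0}" by (rule poly_roots_finite)
    moreover have "range of_nat \<subseteq> {x. poly (P - Q) x = 0}" using assms(3) P Q by auto
    ultimately have "finite (range (of_nat :: nat \<Rightarrow> 'k))" by (rule finite_subset[rotated])
    then show False using range_inj_infinite[of "of_nat :: nat \<Rightarrow> 'k"] by (auto simp: inj_on_def)
  qed
  then show ?thesis using P Q by simp
qed

lemma polyfun_mps_power: "mps_coeff u 0 = 1 \<Longrightarrow> polyfun (\<lambda>c. mps_coeff (mps_power u c) \<alpha>)"
  unfolding mps_power_coeff by (intro polyfun_sum polyfun_mult polyfun_gchoose polyfun_const)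

lemma polyfun_coeff_mult: "(\<And>\<alpha>. polyfun (\<lambda>c. mps_coeff (f c) \<alpha>)) \<Longrightarrow> (\<And>\<alpha>. polyfun (\<lambda>c. mps_coeff (g c) \<alpha>)) \<Longrightarrow>
   polyfun (\<lambda>c. mps_coeff (f c * g c) \<alpha>)"
  unfolding mps_coeff_mult case_prod_unfold by (intro polyfun_sum polyfun_mult)

text \<open>Binomial theorem. The sums up to \<open>m\<close> and up to \<open>mdeg \<alpha>\<close>
  agree because the binomial coefficients vanish beyond \<open>m\<close> and the coefficients of
  powers of \<open>u - 1\<close> beyond \<open>mdeg \<alpha>\<close>.\<close>

lemma mps_power_of_nat:
  assumes u: "mps_coeff u 0 = 1"
  shows "mps_power u (of_nat m) = u ^ m"
proof (rule mps_eqI)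
  fix \<alpha>
  let ?h = "\<lambda>n. of_nat (m choose n) * mps_coeff ((u - 1) ^ n) \<alpha>"
  have oc: "mps_coeff (of_nat k * f) \<alpha> = of_nat k * mps_coeff f \<alpha>" for k and f :: "'a mps"
    by (induction k) (auto simp: algebra_simps)
  have "u ^ m = (\<Sum>n\<le>m. of_nat (m choose n) * (u - 1) ^ n)"
    using binomial_ring[of "u - 1" 1 m] by simp
  then have "mps_coeff (u ^ m) \<alpha> = sum ?h {..m}" by (simp add: mps_coeff_sum oc)
  also have "\<dots> = sum ?h {..m + mdeg \<alpha>}" by (rule sum.mono_neutral_left) auto
  also have "\<dots> = sum ?h {..mdeg \<alpha>}"
    using mps_coeff_power_high[of "u - 1" \<alpha>] u by (intro sum.mono_neutral_right) auto
  also have "\<dots> = mps_coeff (mps_power u (of_nat m)) \<alpha>"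
    by (simp add: mps_power_coeff[OF u] binomial_gbinomial)
  finally show "mps_coeff (mps_power u (of_nat m)) \<alpha> = mps_coeff (u ^ m) \<alpha>" by simp
qed

lemma mps_power_0 [simp]: "mps_coeff u 0 = 1 \<Longrightarrow> mps_power u 0 = 1"
  using mps_power_of_nat[of u 0] by simp
lemma mps_power_1 [simp]: "mps_coeff u 0 = 1 \<Longrightarrow> mps_power u 1 = u"
  using mps_power_of_nat[of u 1] by simp

lemma mps_power_mult:
  assumes u: "mps_coeff u 0 = 1" and v: "mps_coeff v 0 = 1"
  shows "mps_power (u * v) c = mps_power u c * mps_power v c"
proof (rule mps_eqI)
  fix \<alpha>
  show "mps_coeff (mps_power (u * v) c) \<alpha> = mps_coeff (mps_power u c * mps_power v c) \<alpha>"
    by (rule polyfun_eq[where f = "\<lambda>c. mps_coeff (mps_power (u * v) c) \<alpha>"])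
      (use u v in \<open>auto intro!: polyfun_mps_power polyfun_coeff_mult simp: mps_power_of_nat power_mult_distrib\<close>)
qed

text \<open>The polynomial argument is applied twice: in \<open>c\<close> for natural
  \<open>d\<close>, then in \<open>d\<close> for arbitrary \<open>c\<close>.\<close>

lemma mps_power_add:
  assumes u: "mps_coeff u 0 = 1"
  shows "mps_power u (c + d) = mps_power u c * mps_power u d"
proof (rule mps_eqI)
  fix \<alpha>
  have pa: "polyfun (\<lambda>c. mps_coeff (mps_power u (c + d)) \<alpha>)" for d
  proof -
    obtain P where "\<And>c. mps_coeff (mps_power u c) \<alpha> = poly P c" using polyfun_mps_power[OF u] unfolding polyfun_def
      by blast
    then have "mps_coeff (mps_power u (c + d)) \<alpha> = poly (P \<circ>\<^sub>p [:d, 1:]) c" for c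
      by (simp add: poly_pcompose add.commute)
    then show ?thesis unfolding polyfun_def by blast
  qed
  have n: "mps_coeff (mps_power u (c + of_nat m)) \<alpha> = mps_coeff (mps_power u c * mps_power u (of_nat m)) \<alpha>" for c m
    by (rule polyfun_eq[where f = "\<lambda>c. mps_coeff (mps_power u (c + of_nat m)) \<alpha>", OF pa])
     (use u in \<open>auto intro!: polyfun_mps_power polyfun_coeff_mult polyfun_const simp: mps_power_of_nat power_add
       of_nat_add[symmetric] simp del: of_nat_add\<close>)
  have "polyfun (\<lambda>d. mps_coeff (mps_power u (c + d)) \<alpha>)" using pa[of c] by (simp add: add.commute)
  then show "mps_coeff (mps_power u (c + d)) \<alpha> = mps_coeff (mps_power u c * mps_power u d) \<alpha>"
    by (rule polyfun_eq) (use u n in \<open>auto intro!: polyfun_mps_power polyfun_coeff_mult polyfun_const\<close>)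
qed

section \<open>Substitution\<close>

text \<open>For \<open>E \<alpha> = (\<Prod>j. e\<^sub>j ^ \<alpha> j)\<close> this is the substitution of \<open>x\<^sub>j e\<^sub>j\<close> for the variables \<open>x\<^sub>j\<close>.\<close>

definition sub :: "((nat \<Rightarrow>\<^sub>0 nat) \<Rightarrow> 'r::comm_ring_1 mps) \<Rightarrow> 'r mps \<Rightarrow> 'r mps" where
  "sub E f = Mps (\<lambda>\<gamma>. \<Sum>(\<alpha>, \<delta>)\<in>splits \<gamma>. mps_coeff f \<alpha> * mps_coeff (E \<alpha>) \<delta>)"

lemma mps_coeff_sub: "mps_coeff (sub E f) \<gamma> = (\<Sum>(\<alpha>, \<delta>)\<in>splits \<gamma>. mps_coeff f \<alpha> * mps_coeff (E \<alpha>) \<delta>)"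
  by (simp add: sub_def)

definition mps_mono :: "(nat \<Rightarrow>\<^sub>0 nat) \<Rightarrow> 'r::comm_ring_1 mps" where "mps_mono \<alpha> = Mps (\<lambda>\<beta>. if \<beta> = \<alpha> then 1 else 0)"

lemma mps_coeff_mono: "mps_coeff (mps_mono \<alpha>) \<beta> = (if \<beta> = \<alpha> then 1 else 0)" by (simp add: mps_mono_def)

lemma mps_mono_0 [simp]: "mps_mono 0 = 1" by (rule mps_eqI) (simp add: mps_coeff_mono mps_coeff_1)

lemma mps_coeff_mono_mult: "mps_coeff (mps_mono \<alpha> * f) (\<alpha> + \<delta>) = mps_coeff f \<delta>"
  and mps_coeff_mono_mult_0: "(\<And>\<delta>. \<gamma> \<noteq> \<alpha> + \<delta>) \<Longrightarrow> mps_coeff (mps_mono \<alpha> * f) \<gamma> = 0"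
proof -
  have "mps_coeff (mps_mono \<alpha> * f) (\<alpha> + \<delta>) = (\<Sum>u\<in>splits (\<alpha> + \<delta>). if u = (\<alpha>, \<delta>) then mps_coeff f \<delta> else 0)"
    unfolding mps_coeff_mult by (rule sum.cong) (auto simp: mps_coeff_mono splits_iff split: if_splits)
  also have "\<dots> = mps_coeff f \<delta>" by (simp add: sum.delta splits_iff)
  finally show "mps_coeff (mps_mono \<alpha> * f) (\<alpha> + \<delta>) = mps_coeff f \<delta>" .
  show "(\<And>\<delta>. \<gamma> \<noteq> \<alpha> + \<delta>) \<Longrightarrow> mps_coeff (mps_mono \<alpha> * f) \<gamma> = 0"
    unfolding mps_coeff_mult by (intro sum.neutral ballI) (metis (mono_tags, lifting) case_prodE mps_coeff_mono
      mult_zero_left splits_iff case_prod_conv surj_pair)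
qed

lemma mps_mono_add: "mps_mono (\<alpha> + \<beta>) = mps_mono \<alpha> * mps_mono \<beta>"
proof (rule mps_eqI)
  fix \<gamma>
  show "mps_coeff (mps_mono (\<alpha> + \<beta>)) \<gamma> = mps_coeff (mps_mono \<alpha> * mps_mono \<beta>) \<gamma>"
  proof (cases "\<exists>\<delta>. \<gamma> = \<alpha> + \<delta>")
    case True
    then show ?thesis by (auto simp: mps_coeff_mono_mult) (simp add: mps_coeff_mono)
  next
    case False
    then have "\<gamma> \<noteq> \<alpha> + \<beta>" by blast
    then show ?thesis using False by (simp add: mps_coeff_mono_mult_0) (simp add: mps_coeff_mono)
  qed
qed

lemma mps_mono_cancel: "mps_mono \<alpha> * f = mps_mono \<alpha> * g \<Longrightarrow> f = g"
  by (rule mps_eqI) (metis mps_coeff_mono_mult)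

lemma sub_mono: "sub E (mps_mono \<alpha>) = mps_mono \<alpha> * E \<alpha>"
  by (rule mps_eqI) (auto simp: mps_coeff_sub mps_coeff_mult mps_coeff_mono intro!: sum.cong)

lemma var_mono: "mps_var i = mps_mono (single i 1)"
  by (simp add: mps_var_def mps_mono_def)

text \<open>\<open>sub\<close> is linear in the family \<open>E\<close>, whatever its dependence on
  \<alpha>. This turns a product into a single substitution, in \<open>sub_mult\<close> and in
  \<open>mul_coord\<close>.\<close>

lemma mult_sub: "h * sub E f = sub (\<lambda>\<alpha>. h * E \<alpha>) f"
proof (rule mps_eqI)
  fix \<gamma>
  let ?t = "\<lambda>x y z. mps_coeff h x * mps_coeff f y * mps_coeff (E y) z"
  have "mps_coeff (h * sub E f) \<gamma> = (\<Sum>(u, v)\<in>(SIGMA u:splits \<gamma>. splits (snd u)). ?t (fst u) (fst v) (snd v))"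
    by (subst sum.Sigma[symmetric])
        (simp_all add: mps_coeff_mult mps_coeff_sub case_prod_unfold sum_distrib_left mult.assoc)
  also have "\<dots> = (\<Sum>(u, v)\<in>(SIGMA u:splits \<gamma>. splits (snd u)). ?t (fst v) (fst u) (snd v))"
    by (rule sum.reindex_bij_witness[of _ "\<lambda>(u, v). ((fst v, fst u + snd v), (fst u, snd v))" "\<lambda>(u, v). ((fst v, fst u
      + snd v), (fst u, snd v))"])
      (auto simp: splits_def ac_simps)
  also have "\<dots> = mps_coeff (sub (\<lambda>\<alpha>. h * E \<alpha>) f) \<gamma>"
    by (subst sum.Sigma[symmetric])
        (simp_all add: mps_coeff_mult mps_coeff_sub case_prod_unfold sum_distrib_left mult_ac)
  finally show "mps_coeff (h * sub E f) \<gamma> = mps_coeff (sub (\<lambda>\<alpha>. h * E \<alpha>) f) \<gamma>" .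
qed

text \<open>Multiplicativity is axiomatised because the families of interest are products of powers
  with field exponents linear in \<alpha>, not literally products of ordinary powers.\<close>

locale mchar = fixes E :: "(nat \<Rightarrow>\<^sub>0 nat) \<Rightarrow> 'r::comm_ring_1 mps"
  assumes E_0: "E 0 = 1" and E_add: "E (\<alpha> + \<beta>) = E \<alpha> * E \<beta>"
begin

lemma sub_coeff_0: "mps_coeff (sub E f) 0 = mps_coeff f 0"
  by (simp add: mps_coeff_sub E_0)

lemma sub_1: "sub E 1 = 1" using sub_mono[of E 0] by (simp add: E_0)

text \<open>A monomial with exponent \<alpha> is multiplied by \<open>E' \<alpha>\<close> and the
  result is transformed by \<open>E\<close>, which gives the factor
  \<open>E \<alpha> * sub E (E' \<alpha>)\<close>. The coefficient sums are matched by reassociating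
  triple splittings.\<close>

lemma sub_sub: "sub E (sub E' f) = sub (\<lambda>\<alpha>. E \<alpha> * sub E (E' \<alpha>)) f"
proof (rule mps_eqI)
  fix \<gamma>
  have 1: "mps_coeff (sub E (sub E' f)) \<gamma> = (\<Sum>(u, v)\<in>(SIGMA u:splits \<gamma>. splits (fst u)).
     mps_coeff f (fst v) * mps_coeff (E' (fst v)) (snd v) * mps_coeff (E (fst v + snd v)) (snd u))"
    unfolding mps_coeff_sub
    by (subst sum.Sigma[symmetric]) (auto simp: mps_coeff_sub case_prod_unfold sum_distrib_right splits_iff intro!:
      sum.cong)
  have 2: "\<dots> = (\<Sum>(u, v)\<in>(SIGMA u:splits \<gamma>. splits (snd u)).
     mps_coeff f (fst u) * mps_coeff (E' (fst u)) (fst v) * mps_coeff (E (fst u + fst v)) (snd v))"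
    by (rule sum.reindex_bij_witness[of _
            "\<lambda>(u, v). ((fst u + fst v, snd v), (fst u, fst v))"
            "\<lambda>(u, v). ((fst v, snd v + snd u), (snd v, snd u))"])
        (auto simp: splits_def add.assoc)
  have 3: "\<dots> = mps_coeff (sub (\<lambda>\<alpha>. E \<alpha> * sub E (E' \<alpha>)) f) \<gamma>"
    unfolding mult_sub mps_coeff_sub E_add[symmetric]
    by (subst sum.Sigma[symmetric]) (simp_all add: case_prod_unfold sum_distrib_left mult.assoc)
  from 1 2 3 show "mps_coeff (sub E (sub E' f)) \<gamma> = mps_coeff (sub (\<lambda>\<alpha>. E \<alpha> * sub E (E' \<alpha>)) f) \<gamma>" by simp
qed

lemma sub_mult: "sub E (f * g) = sub E f * sub E g"
proof -
  \<comment> \<open>Multiplication by \<open>g\<close> is itself of the form \<open>sub\<close>,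
    with a constant family, so multiplicativity becomes an instance of
    \<open>sub_sub\<close>.\<close>
  have "f * g = sub (\<lambda>_. g) f" by (rule mps_eqI) (simp add: mps_coeff_sub mps_coeff_mult)
  then have "sub E (f * g) = sub (\<lambda>\<alpha>. sub E g * E \<alpha>) f" by (simp only: sub_sub mult.commute)
  then show ?thesis using mult_sub[of "sub E g" E f] by (simp add: mult.commute)
qed

lemma sub_power: "sub E (f ^ m) = sub E f ^ m"
  by (induction m) (simp_all add: sub_1 sub_mult)

lemma sub_prod: "sub E (prod f S) = (\<Prod>s\<in>S. sub E (f s))"
  by (induction S rule: infinite_finite_induct) (simp_all add: sub_1 sub_mult)

end

text \<open>Coefficients on both sides are polynomial in \<open>c\<close>, and for natural
  \<open>c\<close> the claim is multiplicativity.\<close>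

lemma sub_mps_power:
  assumes u: "mps_coeff u 0 = 1" and E: "mchar E"
  shows "sub E (mps_power u c) = mps_power (sub E u) c"
proof (rule mps_eqI)
  interpret mchar E by fact
  fix \<alpha>
  have "polyfun (\<lambda>c. mps_coeff (sub E (mps_power u c)) \<alpha>)"
    unfolding mps_coeff_sub case_prod_unfold by (intro polyfun_sum polyfun_mult polyfun_mps_power[OF u] polyfun_const)
  moreover have s: "mps_coeff (sub E u) 0 = 1" using u by (simp add: sub_coeff_0)
  ultimately show "mps_coeff (sub E (mps_power u c)) \<alpha> = mps_coeff (mps_power (sub E u) c) \<alpha>"
    by (rule polyfun_eq[OF _ polyfun_mps_power]) (simp add: mps_power_of_nat[OF u] mps_power_of_nat[OF s] sub_power)
qed

lemma mi_split: "(\<beta>, \<gamma>) \<in> splits \<alpha> \<Longrightarrow> \<alpha> \<in> multi_indices n \<longleftrightarrow> \<beta> \<in> multi_indices n \<and> \<gamma> \<in> multi_indices n"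
proof -
  assume "(\<beta>, \<gamma>) \<in> splits \<alpha>"
  then have "keys \<alpha> = keys \<beta> \<union> keys \<gamma>"
    by (auto simp: in_keys_iff lookup_add splits_def)
  then show ?thesis by (auto simp: multi_indices_def)
qed

lemma vars_coeff: "f \<in> mps_vars n \<Longrightarrow> \<alpha> \<notin> multi_indices n \<Longrightarrow> mps_coeff f \<alpha> = 0"
  by (auto simp: mps_vars_def)

lemma vars_memb: "f \<in> mps_vars n \<Longrightarrow> mps_coeff f \<alpha> \<noteq> 0 \<Longrightarrow> \<alpha> \<in> multi_indices n"
  by (auto simp: mps_vars_def)

lemma varsI: "(\<And>\<alpha>. \<alpha> \<notin> multi_indices n \<Longrightarrow> mps_coeff f \<alpha> = 0) \<Longrightarrow> f \<in> mps_vars n"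
  by (auto simp: mps_vars_def)

lemma vars_1 [intro]: "1 \<in> mps_vars n" by (rule varsI) (auto simp: mps_coeff_1 multi_indices_def)
lemma vars_mult [intro]:
  assumes "f \<in> mps_vars n" "g \<in> mps_vars n" shows "f * g \<in> mps_vars n"
proof (rule varsI)
  fix \<alpha> assume "\<alpha> \<notin> multi_indices n"
  then show "mps_coeff (f * g) \<alpha> = 0"
    unfolding mps_coeff_mult by (intro sum.neutral) (auto dest!: mi_split[of _ _ _ n] intro: vars_memb[OF assms(1)]
      vars_memb[OF assms(2)])
qed
lemma vars_diff [intro]: "f \<in> mps_vars n \<Longrightarrow> g \<in> mps_vars n \<Longrightarrow> f - g \<in> mps_vars n"
  by (rule varsI) (simp add: vars_coeff)
lemma vars_power [intro]: "f \<in> mps_vars n \<Longrightarrow> f ^ m \<in> mps_vars n"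
  by (induction m) auto
lemma vars_prod: "(\<And>s. s \<in> S \<Longrightarrow> f s \<in> mps_vars n) \<Longrightarrow> prod f S \<in> mps_vars n"
  by (induction S rule: infinite_finite_induct) auto
lemma vars_mps_power [intro]: "mps_coeff f 0 = 1 \<Longrightarrow> f \<in> mps_vars n \<Longrightarrow> mps_power f c \<in> mps_vars n"
proof (rule varsI)
  fix \<alpha> assume f: "mps_coeff f 0 = 1" "f \<in> mps_vars n" "\<alpha> \<notin> multi_indices n"
  then have "mps_coeff ((f - 1) ^ m) \<alpha> = 0" for m by (intro vars_coeff[of _ n]) auto
  with f show "mps_coeff (mps_power f c) \<alpha> = 0" by (simp add: mps_power_coeff)
qed
lemma vars_sub [intro]:
  assumes "f \<in> mps_vars n" "\<And>\<alpha>. E \<alpha> \<in> mps_vars n" shows "sub E f \<in> mps_vars n"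
proof (rule varsI)
  fix \<alpha> assume "\<alpha> \<notin> multi_indices n"
  then show "mps_coeff (sub E f) \<alpha> = 0"
    unfolding mps_coeff_sub by (intro sum.neutral) (auto dest!: mi_split[of _ _ _ n] mult_not_zero intro: vars_memb[OF
      assms(1)] dest: vars_memb[OF assms(2)])
qed

text \<open>Change of coefficients. Applied to the evaluation at a point, it specialises the
  universal series to the series of that point.\<close>

definition mmap :: "('a \<Rightarrow> 'b) \<Rightarrow> 'a mps \<Rightarrow> 'b mps" where "mmap \<rho> f = Mps (\<lambda>\<alpha>. \<rho> (mps_coeff f \<alpha>))"

lemma mps_coeff_mmap [simp]: "mps_coeff (mmap \<rho> f) \<alpha> = \<rho> (mps_coeff f \<alpha>)" by (simp add: mmap_def)

locale rhom = fixes \<rho> :: "'a::comm_ring_1 \<Rightarrow> 'b::comm_ring_1"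
  assumes rho_add: "\<rho> (x + y) = \<rho> x + \<rho> y" and rho_mult: "\<rho> (x * y) = \<rho> x * \<rho> y" and rho_1: "\<rho> 1 = 1"
begin
lemma rho_0: "\<rho> 0 = 0" using rho_add[of 0 0] by simp
lemma rho_uminus: "\<rho> (- x) = - \<rho> x" using rho_add[of "-x" x] by (simp add: rho_0 eq_neg_iff_add_eq_0)
lemma rho_diff: "\<rho> (x - y) = \<rho> x - \<rho> y" using rho_add[of x "-y"] by (simp add: rho_uminus)
lemma rho_sum: "\<rho> (sum f S) = (\<Sum>s\<in>S. \<rho> (f s))" by (induction S rule: infinite_finite_induct) (auto simp: rho_0
    rho_add)
lemma rho_prod: "\<rho> (prod f S) = (\<Prod>s\<in>S. \<rho> (f s))" by (induction S rule: infinite_finite_induct) (auto simp: rho_1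
    rho_mult)
lemma rho_power: "\<rho> (x ^ m) = \<rho> x ^ m" by (induction m) (auto simp: rho_1 rho_mult)
lemma mmap_1: "mmap \<rho> 1 = 1" by (rule mps_eqI) (simp add: mps_coeff_1 rho_0 rho_1)
lemma mmap_mult: "mmap \<rho> (f * g) = mmap \<rho> f * mmap \<rho> g"
  by (rule mps_eqI) (simp add: mps_coeff_mult rho_sum rho_mult case_prod_unfold)
lemma mmap_diff: "mmap \<rho> (f - g) = mmap \<rho> f - mmap \<rho> g" by (rule mps_eqI) (simp add: rho_diff)
lemma mmap_power: "mmap \<rho> (f ^ m) = mmap \<rho> f ^ m" by (induction m) (auto simp: mmap_1 mmap_mult)
lemma mmap_prod: "mmap \<rho> (prod f S) = (\<Prod>s\<in>S. mmap \<rho> (f s))" by (induction S rule: infinite_finite_induct) (auto simp: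
    mmap_1 mmap_mult)
lemma mmap_gpow: "mmap \<rho> (gpow \<iota> u c) = gpow (\<lambda>c. \<rho> (\<iota> c)) (mmap \<rho> u) c"
proof (rule mps_eqI)
  fix \<alpha>
  have "\<rho> (mps_coeff ((u - 1) ^ n) \<alpha>) = mps_coeff ((mmap \<rho> u - 1) ^ n) \<alpha>" for n
    by (simp only: mps_coeff_mmap[symmetric, of \<rho>] mmap_power mmap_diff mmap_1)
  then show "mps_coeff (mmap \<rho> (gpow \<iota> u c)) \<alpha> = mps_coeff (gpow (\<lambda>c. \<rho> (\<iota> c)) (mmap \<rho> u) c) \<alpha>"
    by (simp add: gpow_def rho_sum rho_mult)
qed
end

lemma gpow_id: "mps_coeff u 0 = 1 \<Longrightarrow> gpow (\<lambda>c. c) u c = mps_power u c"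
  by (rule mps_eqI) (simp add: gpow_def mps_power_coeff)

section \<open>Polynomial algebras\<close>

text \<open>For multiplicative \<open>\<mu>\<close> and a ring homomorphism \<open>\<iota>\<close>,
  this is the induced homomorphism on polynomials. Evaluations at points and at pairs of points,
  substitutions and the embeddings into the tensor square all have this form.\<close>

definition aev :: "('k::comm_ring_1 \<Rightarrow> 'r::comm_ring_1) \<Rightarrow> ('m \<Rightarrow> 'r) \<Rightarrow> ('m \<Rightarrow>\<^sub>0 'k) \<Rightarrow> 'r" where
  "aev \<iota> \<mu> h = (\<Sum>m\<in>keys h. \<iota> (lookup h m) * \<mu> m)"

locale maev = rhom \<iota> for \<iota> :: "'k::comm_ring_1 \<Rightarrow> 'r::comm_ring_1" +
  fixes \<mu> :: "'m::comm_monoid_add \<Rightarrow> 'r"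
  assumes mu_0: "\<mu> 0 = 1" and mu_add: "\<mu> (a + b) = \<mu> a * \<mu> b"
begin

lemma aev_add: "aev \<iota> \<mu> (f + g) = aev \<iota> \<mu> f + aev \<iota> \<mu> g"
  unfolding aev_def by (rule setsum_keys_plus_distrib) (auto simp: rho_0 rho_add algebra_simps)

lemma aev_single: "aev \<iota> \<mu> (single m c) = \<iota> c * \<mu> m"
  by (auto simp: aev_def rho_0)

lemma aev_0: "aev \<iota> \<mu> 0 = 0" by (simp add: aev_def)

lemma aev_mult: "aev \<iota> \<mu> (f * g) = aev \<iota> \<mu> f * aev \<iota> \<mu> g"
proof (induction f rule: pm_induct0)
  case (single m c)
  show ?case
  proof (induction g rule: pm_induct0)
    case (single m' c')
    show ?case by (simp add: mult_single aev_single mu_add rho_mult mult_ac)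
  qed (simp_all add: aev_0 aev_add algebra_simps)
qed (simp_all add: aev_0 aev_add algebra_simps)

lemma aev_1: "aev \<iota> \<mu> 1 = 1"
  using aev_single[of 0 1] by (simp add: mu_0 rho_1)

sublocale ev: rhom "aev \<iota> \<mu>"
  by unfold_locales (simp_all add: aev_add aev_mult aev_1)

end

type_synonym var = "nat \<times> (nat \<Rightarrow>\<^sub>0 nat)"
type_synonym mon = "var \<Rightarrow>\<^sub>0 nat"

definition mev :: "('v \<Rightarrow> 'r::comm_ring_1) \<Rightarrow> ('v \<Rightarrow>\<^sub>0 nat) \<Rightarrow> 'r" where
  "mev x m = (\<Prod>t\<in>keys m. x t ^ lookup m t)"

lemma mev_superset: "finite T \<Longrightarrow> keys m \<subseteq> T \<Longrightarrow> mev x m = (\<Prod>t\<in>T. x t ^ lookup m t)"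
  unfolding mev_def by (rule prod.mono_neutral_left) (auto simp: in_keys_iff)

lemma mev_0 [simp]: "mev x 0 = 1" by (simp add: mev_def)

lemma mev_add: "mev x (m + m') = mev x m * mev x m'"
proof -
  let ?T = "keys m \<union> keys m'"
  have "mev x (m + m') = (\<Prod>t\<in>?T. x t ^ lookup (m + m') t)"
    using keys_add[of m m'] by (intro mev_superset) auto
  also have "\<dots> = mev x m * mev x m'"
    by (simp add: mev_superset[of ?T] lookup_add power_add prod.distrib)
  finally show ?thesis .
qed

lemma mev_single [simp]: "mev x (single t c) = x t ^ c"
  by (auto simp: mev_def)

definition Cst :: "'k::comm_ring_1 \<Rightarrow> ('m::comm_monoid_add \<Rightarrow>\<^sub>0 'k)" where "Cst c = single 0 c"
definition Xv :: "'v \<Rightarrow> (('v \<Rightarrow>\<^sub>0 nat) \<Rightarrow>\<^sub>0 'k::comm_ring_1)" where "Xv t = single (single t 1) 1"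

lemma C_rhom: "rhom Cst"
  by unfold_locales (simp_all add: Cst_def single_add mult_single)

lemma C_mult: "Cst c * h = Poly_Mapping.map ((*) c) h"
  by (simp add: Cst_def mult_map_scale_conv_mult)

lemma lookup_C_mult [simp]: "lookup (Cst c * h) m = c * lookup h m"
  by (simp add: C_mult)

abbreviation "pev \<iota> x \<equiv> aev \<iota> (mev x)"

lemma pev_maev: "rhom \<iota> \<Longrightarrow> maev \<iota> (mev x)"
  by (intro maev.intro maev_axioms.intro) (simp_all add: mev_add)

lemma rhom_id: "rhom (\<lambda>c. c)" by unfold_locales auto

lemma rhom_compose: "rhom f \<Longrightarrow> rhom g \<Longrightarrow> rhom (\<lambda>x. g (f x))"
  by (simp add: rhom_def)

lemma pev_C: "rhom \<iota> \<Longrightarrow> pev \<iota> x (Cst c) = \<iota> c"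
  using maev.aev_single[OF pev_maev, of \<iota> x 0 c] by (simp add: Cst_def)

lemma pev_V: "rhom \<iota> \<Longrightarrow> pev \<iota> x (Xv t) = x t"
  using maev.aev_single[OF pev_maev, of \<iota> x "single t 1" 1] by (simp add: Xv_def rhom.rho_1)

lemma pev_rhom: "rhom \<iota> \<Longrightarrow> rhom (pev \<iota> x)"
proof -
  assume "rhom \<iota>"
  then interpret maev \<iota> "mev x" by (rule pev_maev)
  show ?thesis by (rule ev.rhom_axioms)
qed

lemma V_mev: "(mev Xv m :: ('v \<Rightarrow>\<^sub>0 nat) \<Rightarrow>\<^sub>0 'k::comm_ring_1) = single m 1"
proof -
  have s: "Xv t ^ k = single (single t k) (1::'k)" for t :: 'v and k
    by (induction k) (simp_all add: Xv_def mult_single single_add[symmetric])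
  have "finite T \<Longrightarrow> (\<Prod>t\<in>T. Xv t ^ lookup m t) = single (\<Sum>t\<in>T. single t (lookup m t)) (1 :: 'k)" for T
    by (induction T rule: finite_induct) (simp_all add: s mult_single)
  then show ?thesis unfolding mev_def by (simp add: pm_sum[of m, symmetric])
qed

lemma rhom_ext:
  assumes "rhom \<rho>" "rhom \<sigma>" "\<And>c. \<rho> (Cst c) = \<sigma> (Cst c)" "\<And>t. t \<in> I \<Longrightarrow> \<rho> (Xv t) = \<sigma> (Xv t)"
    "keys h \<subseteq> {m. keys m \<subseteq> I}"
  shows "\<rho> h = \<sigma> h"
  using assms(5)
proof (induction rule: pm_induct)
  case zero show ?case using assms by (simp add: rhom.rho_0)
next
  case (single m c)
  have "single m c = Cst c * mev Xv m" by (simp add: V_mev Cst_def mult_single)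
  moreover have "\<rho> (mev Xv m) = \<sigma> (mev Xv m)"
    using assms single by (auto simp: mev_def rhom.rho_prod rhom.rho_power intro!: prod.cong)
  ultimately show ?case using assms by (simp add: rhom.rho_mult)
qed (use assms in \<open>simp add: rhom.rho_add\<close>)

lemma rhom_pev: "rhom \<rho> \<Longrightarrow> rhom \<iota> \<Longrightarrow> \<rho> (pev \<iota> x h) = pev (\<lambda>c. \<rho> (\<iota> c)) (\<lambda>t. \<rho> (x t)) h"
proof -
  assume r: "rhom \<rho>" "rhom \<iota>"
  have "(\<lambda>h. \<rho> (pev \<iota> x h)) h = pev (\<lambda>c. \<rho> (\<iota> c)) (\<lambda>t. \<rho> (x t)) h"
    by (rule rhom_ext[where I = UNIV], rule rhom_compose[OF pev_rhom])
      (use r in \<open>simp_all add: pev_rhom rhom_compose pev_C pev_V\<close>)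
  then show ?thesis .
qed

lemma pev_cong: "(\<And>m t. m \<in> keys h \<Longrightarrow> t \<in> keys m \<Longrightarrow> x t = y t) \<Longrightarrow> pev \<iota> x h = pev \<iota> y h"
  unfolding aev_def mev_def by (intro sum.cong refl arg_cong2[where f = "(*)"] prod.cong) auto

text \<open>Induction on the number of variables. Expand \<open>h\<close> in powers of one variable
  \<open>t\<close>; each assignment of the others gives a one-variable polynomial with all values
  zero. The field being infinite, its coefficients vanish, so each \<open>cut k\<close> vanishes at
  all points.\<close>

lemma poly_separate:
  fixes h :: "('v \<Rightarrow>\<^sub>0 nat) \<Rightarrow>\<^sub>0 'k::field_char_0"
  assumes "\<And>x. pev (\<lambda>c. c) x h = 0" shows "h = 0"
proof -
  have "\<And>h :: ('v \<Rightarrow>\<^sub>0 nat) \<Rightarrow>\<^sub>0 'k. (\<And>m. m \<in> keys h \<Longrightarrow> keys m \<subseteq> S) \<Longrightarrow> (\<And>x. pev (\<lambda>c. c) x h = 0) \<Longrightarrow> h = 0"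
    if "finite S" for S
    using that
  proof (induction S rule: finite_induct)
    case empty
    have "keys h \<subseteq> {0}" using empty(1) by auto
    then have "pev (\<lambda>c. c) (\<lambda>_. 0) h = lookup h 0"
      unfolding aev_def by (subst sum.mono_neutral_left[of "{0}"]) (auto simp: in_keys_iff)
    then have "lookup h 0 = 0" using empty(2) by simp
    then show ?case using \<open>keys h \<subseteq> {0}\<close> by (metis empty_iff in_keys_iff poly_mapping_eqI lookup_zero singletonD
      subsetD)
  next
    case (insert t S)
    \<comment> \<open>The coefficient of the \<open>k\<close>-th power of \<open>t\<close> as a
      polynomial in the remaining variables; the case distinction discards exponents in which
      \<open>t\<close> still occurs.\<close>
    define cut where "cut k = Poly_Mapping.Abs_poly_mapping (\<lambda>m. if t \<in> keys m then 0 else lookup h (m + single t k))"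
      for k
    have fin: "finite {m. (if t \<in> keys m then 0 else lookup h (m + single t k)) \<noteq> 0}" for k
    proof (rule finite_subset)
      show "{m. (if t \<in> keys m then 0 else lookup h (m + single t k)) \<noteq> 0} \<subseteq> (\<lambda>m. m - single t k) ` keys h"
      proof
        fix m assume "m \<in> {m. (if t \<in> keys m then 0 else lookup h (m + single t k)) \<noteq> 0}"
        then have "m + single t k \<in> keys h" by (auto simp: in_keys_iff split: if_splits)
        then have "(m + single t k) - single t k \<in> (\<lambda>m. m - single t k) ` keys h" by (rule imageI)
        then show "m \<in> (\<lambda>m. m - single t k) ` keys h" by simp
      qed
    qed simp
    have lc: "lookup (cut k) m = (if t \<in> keys m then 0 else lookup h (m + single t k))" for k m
      unfolding cut_def by (rule lookup_Abs_poly_mapping[THEN fun_cong, OF fin])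
    define N where "N = Max (insert 0 ((\<lambda>m. lookup m t) ` keys h))"
    have N: "lookup m t \<le> N" if "m \<in> keys h" for m
      unfolding N_def using that by (intro Max_ge) auto
    have dec: "h = (\<Sum>k\<le>N. cut k * Xv t ^ k)"
    proof (rule poly_mapping_eqI)
      fix m
      have Vk: "Xv t ^ k = single (single t k) (1::'k)" for k
        by (induction k) (simp_all add: Xv_def mult_single single_add[symmetric])
      have lm: "lookup (cut k * Xv t ^ k) m = (if lookup m t = k then lookup h m else 0)" for k
      proof -
        have *: "lookup (P * single e (1::'k)) (m' + e) = lookup P m'" for P and e m' :: "'v \<Rightarrow>\<^sub>0 nat"
          by (induction P rule: pm_induct0) (simp_all add: distrib_right lookup_add mult_single lookup_single
            when_def)
        have **: "lookup (P * single e (1::'k)) m' = 0" if "\<And>m''. m' \<noteq> m'' + e" for P and e m' :: "'v \<Rightarrow>\<^sub>0 nat"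
          using that by (induction P rule: pm_induct0) (auto simp: distrib_right lookup_add mult_single lookup_single
            when_def)
        show ?thesis
        proof (cases "k \<le> lookup m t")
          case True
          define m' where "m' = m - single t k"
          have m': "m = m' + single t k"
            by (rule poly_mapping_eqI) (use True in \<open>auto simp: m'_def lookup_add lookup_minus lookup_single
              when_def\<close>)
          have "t \<in> keys m' \<longleftrightarrow> lookup m t \<noteq> k"
            by (simp add: m' in_keys_iff lookup_add)
          moreover have "lookup (cut k * single (single t k) (1::'k)) m = lookup (cut k) m'"
            by (subst m') (rule *)
          moreover have "lookup (cut k) m' = (if t \<in> keys m' then 0 else lookup h m)"
            unfolding m' by (rule lc)
          ultimately show ?thesis unfolding Vk by simp
        next
          case False
          then have "m \<noteq> m'' + single t k" for m'' by (auto simp: lookup_add)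
          then show ?thesis using False unfolding Vk by (simp add: **)
        qed
      qed
      show "lookup h m = lookup (\<Sum>k\<le>N. cut k * Xv t ^ k) m"
        using N[of m] by (cases "m \<in> keys h") (simp_all add: lookup_sum lm in_keys_iff)
    qed
    have ck: "t \<notin> keys m \<and> keys m \<subseteq> S" if "m \<in> keys (cut k)" for m k
    proof -
      have m: "t \<notin> keys m" "m + single t k \<in> keys h"
        using that unfolding in_keys_iff[of _ "cut k"] lc by (auto simp: in_keys_iff[of _ h] split: if_splits)
      have "keys m \<subseteq> keys (m + single t k)" by (auto simp: in_keys_iff lookup_add)
      then show ?thesis using insert.prems(1)[OF m(2)] m(1) by auto
    qed
    have pv: "pev (\<lambda>c. c) x (cut k) = 0" if "k \<le> N" for x k
    proof -
      \<comment> \<open>With the other variables fixed by \<open>x\<close>, this is \<open>h\<close>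
        as a polynomial in the value of \<open>t\<close>, on which the \<open>cut k\<close> do not
        depend.\<close>
      define Q where "Q = (\<Sum>k\<le>N. monom (pev (\<lambda>c. c) x (cut k)) k)"
      have "poly Q c = 0" for c
      proof -
        interpret R: rhom "pev (\<lambda>c. c) (x(t := c))" by (rule pev_rhom[OF rhom_id])
        have "pev (\<lambda>c. c) (x(t := c)) (cut k) = pev (\<lambda>c. c) x (cut k)" for k
          by (rule pev_cong) (use ck in auto)
        then have "pev (\<lambda>c. c) (x(t := c)) h = poly Q c"
          by (subst dec) (simp add: R.rho_sum R.rho_mult R.rho_power pev_V[OF rhom_id] Q_def poly_sum poly_monom)
        then show ?thesis using insert.prems(2) by simp
      qed
      then have "Q = 0" using poly_all_0_iff_0 by blast
      then have "coeff Q k = 0" by simp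
      then show ?thesis using that by (simp add: Q_def coeff_sum)
    qed
    have "cut k = 0" if "k \<le> N" for k
      by (rule insert.IH) (use ck pv[OF that] in blast)+
    then show ?case using dec by simp
  qed
  from this[of "\<Union>m\<in>keys h. keys m" h] show ?thesis using assms by auto
qed

text \<open>The pair \<open>(0, \<gamma>)\<close> is left out because the constant terms of the series below are \<open>1\<close> and not variables.\<close>

definition nsplits :: "(nat \<Rightarrow>\<^sub>0 nat) \<Rightarrow> ((nat \<Rightarrow>\<^sub>0 nat) \<times> (nat \<Rightarrow>\<^sub>0 nat)) set" where
  "nsplits \<gamma> = splits \<gamma> - {(0, \<gamma>)}"

lemma finite_nsplits [simp]: "finite (nsplits \<gamma>)" by (simp add: nsplits_def)

lemma nsplits_iff: "(\<alpha>, \<delta>) \<in> nsplits \<gamma> \<longleftrightarrow> \<alpha> + \<delta> = \<gamma> \<and> \<alpha> \<noteq> 0"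
  by (auto simp: nsplits_def splits_def)

text \<open>The variable \<open>(i, \<alpha>)\<close> has weight \<alpha>, the exponent of the
  coefficient it stands for. The product \<open>of_nat k * \<beta>\<close> multiplies all entries of
  \<beta> by \<open>k\<close>, because \<open>of_nat k\<close> is a multiple of the unit for
  convolution.\<close>

definition weight :: "mon \<Rightarrow> (nat \<Rightarrow>\<^sub>0 nat)" where
  "weight m = (\<Sum>t\<in>keys m. of_nat (lookup m t) * snd t)"

lemma weight_add: "weight (m + m') = weight m + weight m'"
  unfolding weight_def by (rule setsum_keys_plus_distrib) (auto simp: algebra_simps)

lemma weight_0 [simp]: "weight 0 = 0" by (simp add: weight_def)

lemma weight_single [simp]: "weight (single t (Suc 0)) = snd t" by (simp add: weight_def)

lemma weight_remove: "t \<in> keys m \<Longrightarrow> \<exists>\<beta>. weight m = snd t + \<beta>"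
proof -
  assume "t \<in> keys m"
  then have "m = single t 1 + (m - single t 1)"
    by (intro poly_mapping_eqI) (auto simp: lookup_add lookup_minus lookup_single when_def in_keys_iff)
  then have "weight m = snd t + weight (m - single t 1)" by (metis weight_add weight_single One_nat_def)
  then show ?thesis by blast
qed

text \<open>The partial derivative in \<open>t\<close> at the origin, which is the unit of the
  group: a tangent vector there.\<close>

definition lin_coeff :: "'v \<Rightarrow> (('v \<Rightarrow>\<^sub>0 nat) \<Rightarrow>\<^sub>0 'k::comm_ring_1) \<Rightarrow> 'k" where
  "lin_coeff t h = lookup h (single t 1)"

definition const_coeff :: "('m::zero \<Rightarrow>\<^sub>0 'k::comm_ring_1) \<Rightarrow> 'k" where
  "const_coeff h = lookup h 0"

lemma single_neq_0 [simp]: "single t (Suc 0) \<noteq> 0"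
  by (metis lookup_single_eq lookup_zero nat.distinct(1))

lemma lin_coeff_add [simp]: "lin_coeff t (f + h) = lin_coeff t f + lin_coeff t h"
    by (simp add: lin_coeff_def lookup_add)
lemma const_coeff_add [simp]: "const_coeff (f + h) = const_coeff f + const_coeff h"
    by (simp add: const_coeff_def lookup_add)
lemma lin_coeff_0 [simp]: "lin_coeff t 0 = 0" and const_coeff_0 [simp]: "const_coeff 0 = 0"
    by (simp_all add: lin_coeff_def const_coeff_def)
lemma lin_coeff_1 [simp]: "lin_coeff t 1 = 0" and const_coeff_1 [simp]: "const_coeff 1 = 1"
  by (simp_all add: lin_coeff_def const_coeff_def lookup_one)
lemma lin_coeff_diff [simp]: "lin_coeff t (f - h) = lin_coeff t f - lin_coeff t h"
    by (simp add: lin_coeff_def lookup_minus)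
lemma lin_coeff_C_mult [simp]: "lin_coeff t (Cst c * f) = c * lin_coeff t f" by (simp add: lin_coeff_def)
lemma lin_coeff_sum: "lin_coeff t (sum f S) = (\<Sum>s\<in>S. lin_coeff t (f s))" by (simp add: lin_coeff_def lookup_sum)
lemma mon_add_0: "a + b = 0 \<longleftrightarrow> a = 0 \<and> b = (0 :: 'v \<Rightarrow>\<^sub>0 nat)"
  by (auto simp: poly_mapping_eq_iff fun_eq_iff lookup_add)

lemma mon_add_single: "a + b = single t 1 \<longleftrightarrow> (a = single t 1 \<and> b = 0) \<or> (a = 0 \<and> b = (single t (1::nat)))"
proof
  assume e: "a + b = single t 1"
  then have l: "lookup a s + lookup b s = (if s = t then 1 else 0)" for s
    by (metis lookup_add lookup_single_eq lookup_single_not_eq)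
  then have o: "s \<noteq> t \<Longrightarrow> lookup a s = 0 \<and> lookup b s = 0" for s
    by (metis add_is_0)
  show "(a = single t 1 \<and> b = 0) \<or> (a = 0 \<and> b = single t 1)"
  proof (cases "lookup a t = 0")
    case True
    then have "a = 0" by (intro poly_mapping_eqI) (metis o lookup_zero)
    then show ?thesis using e by simp
  next
    case False
    then have "lookup b t = 0" using l[of t] by simp
    then have "b = 0" by (intro poly_mapping_eqI) (metis o lookup_zero)
    then show ?thesis using e by simp
  qed
qed auto

lemma const_coeff_mult [simp]: "const_coeff (f * h) = const_coeff f * const_coeff (h :: ('v \<Rightarrow>\<^sub>0 nat) \<Rightarrow>\<^sub>0
    'k::comm_ring_1)"
proof (induction f rule: pm_induct0)
  case (single m c)
  show ?case
    by (induction h rule: pm_induct0) (auto simp: mult_single const_coeff_def lookup_single when_def mon_add_0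
      distrib_left lookup_add)
qed (simp_all add: distrib_right)

lemma lin_coeff_mult: "lin_coeff t (f * h) = lin_coeff t f * const_coeff h + const_coeff f * lin_coeff t (h :: ('v \<Rightarrow>\<^sub>0
    nat) \<Rightarrow>\<^sub>0 'k::comm_ring_1)"
proof (induction f rule: pm_induct0)
  case (single m c)
  show ?case
  proof (induction h rule: pm_induct0)
    case (single m' c')
    have "single t (Suc 0) \<noteq> 0" by (metis lookup_single_eq lookup_zero nat.distinct(1))
    then show ?case
      using mon_add_single[of m m' t] by (auto simp: mult_single const_coeff_def lin_coeff_def lookup_single when_def)
  qed (simp_all add: distrib_left distrib_right)
qed (simp_all add: distrib_right algebra_simps)

lemma lin_coeff_V: "lin_coeff t (Xv s) = (if s = t then 1 else 0)"
proof -
  have "single s (Suc 0) = single t (Suc 0) \<longleftrightarrow> s = t"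
    by (metis lookup_single_eq lookup_single_not_eq nat.distinct(1))
  then show ?thesis by (simp add: lin_coeff_def Xv_def lookup_single when_def)
qed

section \<open>Homogeneous polynomials in the coordinates\<close>

context gB begin

text \<open>The type has variables for all pairs of a number and an exponent; only those in
  \<open>I\<close> are coordinates of the group.\<close>

definition HI :: "(mon \<Rightarrow>\<^sub>0 'k) set" where "HI = {h. keys h \<subseteq> {m. keys m \<subseteq> I}}"

definition HC :: "(nat \<Rightarrow>\<^sub>0 nat) \<Rightarrow> (mon \<Rightarrow>\<^sub>0 'k) set" where "HC \<gamma> = {h. keys h \<subseteq> {m. keys m \<subseteq> I \<and> weight m = \<gamma>}}"

lemma HC_HI: "h \<in> HC \<gamma> \<Longrightarrow> h \<in> HI" by (auto simp: HC_def HI_def)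

lemma HC_0 [intro]: "0 \<in> HC \<gamma>" by (simp add: HC_def)
lemma HC_add [intro]: "f \<in> HC \<gamma> \<Longrightarrow> h \<in> HC \<gamma> \<Longrightarrow> f + h \<in> HC \<gamma>" by (simp add: HC_def keys_add_sub)
lemma HC_uminus [intro]: "f \<in> HC \<gamma> \<Longrightarrow> - f \<in> HC \<gamma>" by (auto simp: HC_def)
lemma HC_diff [intro]: "f \<in> HC \<gamma> \<Longrightarrow> h \<in> HC \<gamma> \<Longrightarrow> f - h \<in> HC \<gamma>" using HC_add[of f \<gamma> "- h"] by auto
lemma HC_sum: "(\<And>s. s \<in> S \<Longrightarrow> f s \<in> HC \<gamma>) \<Longrightarrow> sum f S \<in> HC \<gamma>"
  by (induction S rule: infinite_finite_induct) auto
lemma HC_mult: "f \<in> HC \<gamma> \<Longrightarrow> h \<in> HC \<delta> \<Longrightarrow> f * h \<in> HC (\<gamma> + \<delta>)"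
proof -
  assume f: "f \<in> HC \<gamma>" "h \<in> HC \<delta>"
  show ?thesis unfolding HC_def
  proof (rule CollectI, rule subsetI)
    fix m assume "m \<in> keys (f * h)"
    then obtain a b where ab: "a \<in> keys f" "b \<in> keys h" "m = a + b" using keys_mult[of f h] by blast
    then have "keys a \<subseteq> I" "keys b \<subseteq> I" "weight a = \<gamma>" "weight b = \<delta>" using f by (auto simp: HC_def)
    with ab show "m \<in> {m. keys m \<subseteq> I \<and> weight m = \<gamma> + \<delta>}" by (simp add: keys_add_sub weight_add)
  qed
qed
lemma HC_1: "1 \<in> HC 0" by (simp add: HC_def)
lemma HC_C: "Cst c \<in> HC 0" by (auto simp: HC_def Cst_def)
lemma HC_V: "t \<in> I \<Longrightarrow> Xv t \<in> HC (snd t)" by (auto simp: HC_def Xv_def)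
lemma HC_C_mult: "h \<in> HC \<gamma> \<Longrightarrow> Cst c * h \<in> HC \<gamma>" using HC_mult[OF HC_C, of h \<gamma> c] by simp
lemma HC_power: "h \<in> HC \<gamma> \<Longrightarrow> h ^ k \<in> HC (of_nat k * \<gamma>)"
  by (induction k) (auto simp: HC_1 algebra_simps dest: HC_mult)

lemma HI_0 [simp]: "0 \<in> HI" by (simp add: HI_def)
lemma HI_add [simp]: "f \<in> HI \<Longrightarrow> h \<in> HI \<Longrightarrow> f + h \<in> HI" by (simp add: HI_def keys_add_sub)
lemma HI_mult [simp]: "f \<in> HI \<Longrightarrow> h \<in> HI \<Longrightarrow> f * h \<in> HI"
proof -
  assume f: "f \<in> HI" "h \<in> HI"
  show ?thesis unfolding HI_def
  proof (rule CollectI, rule subsetI)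
    fix m assume "m \<in> keys (f * h)"
    then obtain a b where ab: "a \<in> keys f" "b \<in> keys h" "m = a + b" using keys_mult[of f h] by blast
    then have "keys a \<subseteq> I" "keys b \<subseteq> I" using f by (auto simp: HI_def)
    with ab show "m \<in> {m. keys m \<subseteq> I}" by (simp add: keys_add_sub)
  qed
qed
lemma HI_1 [simp]: "1 \<in> HI" using HC_HI[OF HC_1] .
lemma HI_C [simp]: "Cst c \<in> HI" using HC_HI[OF HC_C] .
lemma HI_V [simp]: "t \<in> I \<Longrightarrow> Xv t \<in> HI" using HC_HI[OF HC_V] .
lemma HI_uminus [simp]: "f \<in> HI \<Longrightarrow> - f \<in> HI" by (simp add: HI_def)
lemma HI_diff [simp]: "f \<in> HI \<Longrightarrow> h \<in> HI \<Longrightarrow> f - h \<in> HI" using HI_add[of f "- h"] by simp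

lemma HC_const_coeff: "h \<in> HC \<gamma> \<Longrightarrow> \<gamma> \<noteq> 0 \<Longrightarrow> const_coeff h = 0"
  by (auto simp: HC_def const_coeff_def in_keys_iff)

section \<open>The universal series\<close>

text \<open>This match between exponents and weights is preserved by products and powers, and is
  what makes the coproduct and the antipode graded.\<close>

definition homog :: "(mon \<Rightarrow>\<^sub>0 'k) mps \<Rightarrow> bool" where "homog f \<longleftrightarrow> (\<forall>\<gamma>. mps_coeff f \<gamma> \<in> HC \<gamma>)"

lemma homogD: "homog f \<Longrightarrow> mps_coeff f \<gamma> \<in> HC \<gamma>" by (simp add: homog_def)
lemma homog_1: "homog 1" by (auto simp: homog_def mps_coeff_1 HC_1)
lemma homog_diff: "homog f \<Longrightarrow> homog h \<Longrightarrow> homog (f - h)" by (auto simp: homog_def)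
lemma homog_mult: "homog f \<Longrightarrow> homog h \<Longrightarrow> homog (f * h)"
  unfolding homog_def mps_coeff_mult by (auto intro!: HC_sum simp: splits_def dest: HC_mult)
lemma homog_power: "homog f \<Longrightarrow> homog (f ^ k)" by (induction k) (auto simp: homog_1 homog_mult)
lemma homog_prod: "(\<And>s. s \<in> S \<Longrightarrow> homog (f s)) \<Longrightarrow> homog (prod f S)"
  by (induction S rule: infinite_finite_induct) (auto simp: homog_1 homog_mult)
lemma homog_gpow: "homog f \<Longrightarrow> homog (gpow Cst f c)"
proof (subst homog_def, rule allI)
  fix \<gamma> assume "homog f"
  then show "mps_coeff (gpow Cst f c) \<gamma> \<in> HC \<gamma>"
    unfolding gpow_def mps_coeff_Mps by (intro HC_sum HC_C_mult homogD homog_power homog_diff homog_1)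
qed

definition LP :: "var \<Rightarrow> (mon \<Rightarrow>\<^sub>0 'k) mps \<Rightarrow> (nat \<Rightarrow>\<^sub>0 nat) \<Rightarrow> 'k" where "LP t f \<delta> = lin_coeff t (mps_coeff f \<delta>)"

lemma homog_const_coeff: "homog f \<Longrightarrow> \<delta> \<noteq> 0 \<Longrightarrow> const_coeff (mps_coeff f \<delta>) = 0" using HC_const_coeff homogD by blast

text \<open>By homogeneity a coefficient with nonzero exponent has no constant term, so only the two
  extreme splittings survive in the Leibniz sum.\<close>

lemma LP_mult_gen: "homog f \<Longrightarrow> homog h \<Longrightarrow> LP t (f * h) \<delta> = LP t f \<delta> * const_coeff (mps_coeff h 0) +
    const_coeff (mps_coeff f 0) * LP t h \<delta>"
proof -
  assume f: "homog f" "homog h"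
  have "LP t (f * h) \<delta> = (\<Sum>u\<in>splits \<delta>. lin_coeff t (mps_coeff f (fst u)) * const_coeff (mps_coeff h (snd u)) +
    const_coeff (mps_coeff f (fst u)) * lin_coeff t (mps_coeff h (snd u)))"
    by (simp add: LP_def mps_coeff_mult lin_coeff_sum lin_coeff_mult case_prod_unfold)
  also have "\<dots> = (\<Sum>u\<in>splits \<delta>. (if u = (\<delta>, 0) then LP t f \<delta> * const_coeff (mps_coeff h 0) else 0)) + (\<Sum>u\<in>splits \<delta>.
    if u = (0, \<delta>) then const_coeff (mps_coeff f 0) * LP t h \<delta> else 0)"
  proof -
    have 1: "lin_coeff t (mps_coeff f (fst u)) * const_coeff (mps_coeff h (snd u)) = (if u = (\<delta>, 0) then LP t f \<delta> *
      const_coeff (mps_coeff h 0) else 0)"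
      if "u \<in> splits \<delta>" for u
      using that homog_const_coeff[OF f(2), of "snd u"] by (cases "snd u = 0") (auto simp: splits_def LP_def)
    have 2: "const_coeff (mps_coeff f (fst u)) * lin_coeff t (mps_coeff h (snd u)) = (if u = (0, \<delta>) then const_coeff
      (mps_coeff f 0) * LP t h \<delta> else 0)"
      if "u \<in> splits \<delta>" for u
      using that homog_const_coeff[OF f(1), of "fst u"] by (cases "fst u = 0") (auto simp: splits_def LP_def)
    show ?thesis unfolding sum.distrib[symmetric] by (intro sum.cong refl arg_cong2[where f = "(+)"] 1 2)
  qed
  also have "\<dots> = LP t f \<delta> * const_coeff (mps_coeff h 0) + const_coeff (mps_coeff f 0) * LP t h \<delta>"
    by (simp add: sum.delta splits_iff)
  finally show ?thesis .
qed

lemma LP_mult: "homog f \<Longrightarrow> homog h \<Longrightarrow> mps_coeff f 0 = 1 \<Longrightarrow> mps_coeff h 0 = 1 \<Longrightarrow> LP t (f * h) \<delta> = LP t f \<delta> + LP t h \<delta>"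
  by (simp add: LP_mult_gen)

lemma LP_prod: "finite S \<Longrightarrow> (\<And>s. s \<in> S \<Longrightarrow> homog (f s)) \<Longrightarrow> (\<And>s. s \<in> S \<Longrightarrow> mps_coeff (f s) 0 = 1) \<Longrightarrow>
    LP t (prod f S) \<delta> = (\<Sum>s\<in>S. LP t (f s) \<delta>)"
  by (induction S rule: finite_induct) (simp_all add: LP_mult homog_prod mps_coeff_prod_0, simp add: LP_def
    mps_coeff_1)

lemma gpow_coeff_0: "mps_coeff f 0 = 1 \<Longrightarrow> mps_coeff (gpow Cst f c) 0 = 1"
  by (simp add: gpow_def Cst_def)

text \<open>To first order \<open>(1 + h)^c\<close> is \<open>1 + c h\<close>: in higher powers of
  \<open>h\<close> every linear coefficient would need a factor with a constant term.\<close>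

lemma LP_gpow: "homog f \<Longrightarrow> mps_coeff f 0 = 1 \<Longrightarrow> LP t (gpow Cst f c) \<delta> = c * LP t f \<delta>"
proof -
  assume f: "homog f" "mps_coeff f 0 = 1"
  have h: "homog (f - 1)" using f by (simp add: homog_diff homog_1)
  have hi: "LP t ((f - 1) ^ n) \<delta> = (if n = 1 then LP t f \<delta> else 0)" for n
  proof -
    consider "n = 0" | "n = 1" | k where "n = Suc (Suc k)" by (metis One_nat_def not0_implies_Suc)
    then show ?thesis
    proof cases
      case 3
      then show ?thesis using f h by (simp add: LP_mult_gen homog_mult homog_power)
    qed (auto simp: LP_def mps_coeff_1)
  qed
  have "LP t (gpow Cst f c) \<delta> = (\<Sum>n\<le>mdeg \<delta>. (c gchoose n) * LP t ((f - 1) ^ n) \<delta>)"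
    by (simp add: LP_def gpow_def lin_coeff_sum)
  also have "\<dots> = (\<Sum>n\<le>mdeg \<delta>. if n = 1 then c * LP t f \<delta> else 0)" by (intro sum.cong) (auto simp: hi)
  also have "\<dots> = (if mdeg \<delta> \<ge> 1 then c * LP t f \<delta> else 0)" by (simp add: sum.delta)
  \<comment> \<open>For \<open>\<delta> = 0\<close> the truncation removes the term
    \<open>n = 1\<close>, but then the coefficient of \<open>f\<close> is \<open>1\<close> and has
    no linear part.\<close>
  also have "\<dots> = c * LP t f \<delta>"
    using f mdeg_0_iff[of \<delta>] by (auto simp: LP_def not_le)
  finally show ?thesis .
qed

text \<open>The variables \<open>Xv (i, \<alpha>)\<close> are the coefficients of a generic element \<open>(x\<^sub>i U i)\<^sub>i\<close> of the group, and
  \<open>EU \<alpha>\<close> is the factor that the monomial with exponent \<open>\<alpha>\<close> acquires under the substitution of the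
  group law. Hence the \<open>(i, \<gamma>)\<close>-coefficient of a product \<open>F \<bullet> G\<close> is the sum of
  \<open>PP i \<alpha> \<delta>\<close> at \<open>F\<close> times the \<open>(i, \<alpha>)\<close>-coefficient of \<open>G\<close>, over \<open>\<alpha> + \<delta> = \<gamma>\<close>.\<close>

definition U :: "nat \<Rightarrow> (mon \<Rightarrow>\<^sub>0 'k) mps" where
  "U i = Mps (\<lambda>\<alpha>. if \<alpha> = 0 then 1 else if (i, \<alpha>) \<in> I then Xv (i, \<alpha>) else 0)"

lemma homog_U: "homog (U i)" using HC_V by (fastforce simp: homog_def U_def HC_1)
lemma U_0: "mps_coeff (U i) 0 = 1" by (simp add: U_def)
lemma LP_U: "LP (j, \<beta>) (U i) \<delta> = (if (j, \<beta>) \<in> I \<and> i = j \<and> \<delta> = \<beta> then 1 else 0)"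
  by (auto simp: LP_def U_def lin_coeff_V I_def)

definition EU :: "(nat \<Rightarrow>\<^sub>0 nat) \<Rightarrow> (mon \<Rightarrow>\<^sub>0 'k) mps" where "EU \<alpha> = (\<Prod>k<p. gpow Cst (U k) (A k \<alpha>))"
definition PP :: "nat \<Rightarrow> (nat \<Rightarrow>\<^sub>0 nat) \<Rightarrow> (nat \<Rightarrow>\<^sub>0 nat) \<Rightarrow> (mon \<Rightarrow>\<^sub>0 'k)" where "PP i \<alpha> \<delta> = mps_coeff (U i * EU \<alpha>) \<delta>"

lemma homog_EU: "homog (EU \<alpha>)" unfolding EU_def by (intro homog_prod homog_gpow homog_U)
lemma EU_0: "mps_coeff (EU \<alpha>) 0 = 1" by (simp add: EU_def mps_coeff_prod_0 gpow_coeff_0 U_0)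

lemma PP_HC: "PP i \<alpha> \<delta> \<in> HC \<delta>" unfolding PP_def by (intro homogD homog_mult homog_U homog_EU)
text \<open>First-order expansion of \<open>U i\<close> times the powers of the \<open>U k\<close>
  with exponents \<open>A k \<alpha>\<close>. The unit for \<open>i = j\<close> comes from the
  leading factor \<open>U i\<close>; the rest, the structure constant of the pre-Lie algebra, comes
  from the exponent of \<open>U j\<close>.\<close>

lemma lin_coeff_PP: "(j, \<beta>) \<in> I \<Longrightarrow> lin_coeff (j, \<beta>) (PP i \<alpha> \<delta>) = (if \<delta> = \<beta> then (if i = j then 1 else 0) +
    A j \<alpha> else 0)"
proof -
  assume t: "(j, \<beta>) \<in> I"
  have "lin_coeff (j, \<beta>) (PP i \<alpha> \<delta>) = LP (j, \<beta>) (U i) \<delta> + (\<Sum>k<p. A k \<alpha> * LP (j, \<beta>) (U k) \<delta>)"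
    using LP_mult[OF homog_U homog_EU U_0 EU_0, of "(j, \<beta>)" i \<alpha> \<delta>]
    unfolding PP_def LP_def[symmetric] EU_def
    by (simp add: LP_prod homog_gpow homog_U gpow_coeff_0 U_0 LP_gpow)
  also have "(\<Sum>k<p. A k \<alpha> * LP (j, \<beta>) (U k) \<delta>) = (\<Sum>k<p. if k = j then (if \<delta> = \<beta> then A j \<alpha> else 0) else 0)"
    using t by (intro sum.cong) (auto simp: LP_U)
  also have "\<dots> = (if \<delta> = \<beta> then A j \<alpha> else 0)" using t by (simp add: I_def)
  finally show ?thesis using t by (simp add: LP_U)
qed

lemma pev_HC: "h \<in> HC \<gamma> \<Longrightarrow> (\<And>t. t \<in> I \<Longrightarrow> s t \<in> HC (snd t)) \<Longrightarrow> pev Cst s h \<in> HC \<gamma>"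
proof -
  assume h: "h \<in> HC \<gamma>" and s: "\<And>t. t \<in> I \<Longrightarrow> s t \<in> HC (snd t)"
  have m: "mev s m \<in> HC (weight m)" if "keys m \<subseteq> I" for m
  proof -
    have "finite T \<Longrightarrow> T \<subseteq> I \<Longrightarrow> (\<Prod>t\<in>T. s t ^ lookup m t) \<in> HC (\<Sum>t\<in>T. of_nat (lookup m t) * snd t)" for T
      by (induction T rule: finite_induct) (auto simp: HC_1 intro!: HC_mult HC_power s)
    then show ?thesis using that by (simp add: mev_def weight_def)
  qed
  show ?thesis unfolding aev_def
  proof (rule HC_sum, rule HC_C_mult)
    fix k assume "k \<in> keys h"
    then have "keys k \<subseteq> I" "weight k = \<gamma>" using h by (auto simp: HC_def)
    then show "mev s k \<in> HC \<gamma>" using m by metis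
  qed
qed

text \<open>A variable of a monomial contributes its own exponent to the weight. This bounds the
  coordinates on which \<open>PP i \<alpha> \<delta>\<close> depends and makes the recursion for the
  antipode well founded.\<close>

lemma HC_keys_mdeg: "h \<in> HC \<gamma> \<Longrightarrow> m \<in> keys h \<Longrightarrow> t \<in> keys m \<Longrightarrow> t \<in> I \<and> mdeg (snd t) \<le> mdeg \<gamma>"
proof -
  assume h: "h \<in> HC \<gamma>" "m \<in> keys h" "t \<in> keys m"
  then obtain \<beta> where "\<gamma> = snd t + \<beta>" using weight_remove[of t m] by (auto simp: HC_def)
  with h show ?thesis by (auto simp: HC_def)
qed

text \<open>Solves \<open>inverse(x) \<bullet> x = 1\<close> for the coordinates of the inverse, recursively in the degree; the first
  argument is only a bound on the recursion depth.\<close>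

fun sN :: "nat \<Rightarrow> var \<Rightarrow> (mon \<Rightarrow>\<^sub>0 'k)" where
  "sN 0 t = 0"
| "sN (Suc N) t = (if t \<in> I then - (\<Sum>(\<alpha>, \<delta>)\<in>nsplits (snd t). Xv (fst t, \<alpha>) * pev Cst (sN N) (PP (fst t) \<alpha> \<delta>)) else 0)"

definition anti :: "var \<Rightarrow> (mon \<Rightarrow>\<^sub>0 'k)" where "anti t = sN (mdeg (snd t)) t"

lemma split_I: "(i, \<gamma>) \<in> I \<Longrightarrow> (\<alpha>, \<delta>) \<in> nsplits \<gamma> \<Longrightarrow> (i, \<alpha>) \<in> I \<and> mdeg \<delta> < mdeg \<gamma>"
proof -
  assume a: "(i, \<gamma>) \<in> I" "(\<alpha>, \<delta>) \<in> nsplits \<gamma>"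
  then have "\<alpha> \<noteq> 0" by (auto simp: nsplits_iff)
  then have "mdeg \<alpha> > 0" using mdeg_0_iff[of \<alpha>] by linarith
  then show ?thesis using a \<open>\<alpha> \<noteq> 0\<close> by (auto simp: I_def mi_add_iff nsplits_iff)
qed

lemma sN_HC: "t \<in> I \<Longrightarrow> sN N t \<in> HC (snd t)"
proof (induction N arbitrary: t)
  case (Suc N)
  have "Xv (fst t, \<alpha>) * pev Cst (sN N) (PP (fst t) \<alpha> \<delta>) \<in> HC (snd t)" if "(\<alpha>, \<delta>) \<in> nsplits (snd t)" for \<alpha> \<delta>
  proof -
    have "(fst t, \<alpha>) \<in> I" using split_I[of "fst t" "snd t"] that Suc.prems by simp
    then have "Xv (fst t, \<alpha>) * pev Cst (sN N) (PP (fst t) \<alpha> \<delta>) \<in> HC (\<alpha> + \<delta>)"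
      using HC_V[of "(fst t, \<alpha>)"] by (intro HC_mult pev_HC PP_HC Suc.IH) simp_all
    then show ?thesis using that by (simp add: nsplits_iff)
  qed
  then show ?case using Suc.prems by (auto intro!: HC_sum)
qed auto

text \<open>As \<alpha> is nonzero in every splitting used, the recursion only meets coordinates of
  degree at most \<open>mdeg \<delta>\<close>, below the degree of \<open>t\<close>; any depth from
  that degree on gives the same value. Depth \<open>0\<close> is harmless because no coordinate in
  \<open>I\<close> has degree zero.\<close>

lemma sN_stable: "t \<in> I \<Longrightarrow> mdeg (snd t) \<le> N \<Longrightarrow> N \<le> N' \<Longrightarrow> sN N' t = sN N t"
proof (induction N arbitrary: N' t)
  case 0
  then show ?case by (auto simp: I_def)
next
  case (Suc N)
  then obtain M where M: "N' = Suc M" "N \<le> M" by (cases N') auto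
  have "pev Cst (sN M) (PP (fst t) \<alpha> \<delta>) = pev Cst (sN N) (PP (fst t) \<alpha> \<delta>)" if "(\<alpha>, \<delta>) \<in> nsplits (snd t)" for \<alpha> \<delta>
  proof (rule pev_cong)
    fix m s assume "m \<in> keys (PP (fst t) \<alpha> \<delta>)" "s \<in> keys m"
    then have "s \<in> I" "mdeg (snd s) \<le> mdeg \<delta>" using HC_keys_mdeg[OF PP_HC] by blast+
    moreover have "mdeg \<delta> < mdeg (snd t)" using split_I[of "fst t" "snd t"] that Suc.prems by simp
    ultimately show "sN M s = sN N s" using Suc.prems M by (intro Suc.IH) auto
  qed
  then show ?case using M by (auto intro!: sum.cong)
qed

lemma anti_HC: "t \<in> I \<Longrightarrow> anti t \<in> HC (snd t)" by (simp add: anti_def sN_HC)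

lemma anti_rec: "(i, \<gamma>) \<in> I \<Longrightarrow> anti (i, \<gamma>) = - (\<Sum>(\<alpha>, \<delta>)\<in>nsplits \<gamma>. Xv (i, \<alpha>) * pev Cst anti (PP i \<alpha> \<delta>))"
proof -
  assume t: "(i, \<gamma>) \<in> I"
  then obtain N where N: "mdeg \<gamma> = Suc N" by (cases "mdeg \<gamma>") (auto simp: I_def)
  have "pev Cst (sN N) (PP i \<alpha> \<delta>) = pev Cst anti (PP i \<alpha> \<delta>)" if "(\<alpha>, \<delta>) \<in> nsplits \<gamma>" for \<alpha> \<delta>
  proof (rule pev_cong)
    fix m s assume "m \<in> keys (PP i \<alpha> \<delta>)" "s \<in> keys m"
    then have "s \<in> I" "mdeg (snd s) \<le> mdeg \<delta>" using HC_keys_mdeg[OF PP_HC] by blast+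
    moreover have "mdeg \<delta> < mdeg \<gamma>" using split_I that t by simp
    ultimately show "sN N s = anti s" unfolding anti_def using N by (intro sN_stable) auto
  qed
  then show ?thesis using t N by (auto simp: anti_def intro!: sum.cong)
qed

end

lemma mps_power_one: "mps_power 1 c = (1 :: 'k::field_char_0 mps)"
proof (rule mps_eqI)
  fix \<alpha>
  have "mps_coeff (mps_power 1 c) \<alpha> = (mps_coeff 1 \<alpha> :: 'k)"
    by (rule polyfun_eq[where f = "\<lambda>c. mps_coeff (mps_power 1 c) \<alpha>" and g = "\<lambda>c. mps_coeff 1 \<alpha>"])
      (auto intro!: polyfun_mps_power simp: mps_power_of_nat)
  then show "mps_coeff (mps_power 1 c) \<alpha> = (mps_coeff 1 \<alpha> :: 'k)" .
qed

lemma sub_one: "sub (\<lambda>_. 1) f = f"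
proof -
  have "sub (\<lambda>_. 1) f = f * 1" by (rule mps_eqI) (simp only: mps_coeff_sub mps_coeff_mult)
  then show ?thesis by simp
qed

lemma mps_div_var_mult: "mps_div_var i (mps_var i * f) = f"
  by (rule mps_eqI) (simp only: mps_div_var_def var_mono mps_coeff_Mps add.commute[of _ "single i 1"]
    mps_coeff_mono_mult)

section \<open>The group law on points\<close>

context gB begin

abbreviation ev :: "(var \<Rightarrow> 'k) \<Rightarrow> (mon \<Rightarrow>\<^sub>0 'k) \<Rightarrow> 'k" where "ev x \<equiv> pev (\<lambda>c. c) x"

lemma ev_rhom: "rhom (ev x)" by (rule pev_rhom[OF rhom_id])

lemmas ev_simps = rhom.rho_add[OF ev_rhom] rhom.rho_mult[OF ev_rhom] rhom.rho_1[OF ev_rhom] rhom.rho_0[OF ev_rhom]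
  rhom.rho_uminus[OF ev_rhom] rhom.rho_sum[OF ev_rhom] pev_C[OF rhom_id] pev_V[OF rhom_id]

lemma ev_pev: "ev x (pev Cst s h) = ev (\<lambda>t. ev x (s t)) h"
  using rhom_pev[OF ev_rhom C_rhom] by (simp add: pev_C[OF rhom_id])

lemma ev_cong: "h \<in> HI \<Longrightarrow> (\<And>t. t \<in> I \<Longrightarrow> x t = y t) \<Longrightarrow> ev x h = ev y h"
  by (rule pev_cong) (auto simp: HI_def)

definition ser :: "(var \<Rightarrow> 'k) \<Rightarrow> nat \<Rightarrow> 'k mps" where
  "ser x i = Mps (\<lambda>\<alpha>. if \<alpha> = 0 then 1 else if (i, \<alpha>) \<in> I then x (i, \<alpha>) else 0)"

definition Ek :: "(var \<Rightarrow> 'k) \<Rightarrow> (nat \<Rightarrow>\<^sub>0 nat) \<Rightarrow> 'k mps" where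
  "Ek x \<alpha> = (\<Prod>k<p. mps_power (ser x k) (A k \<alpha>))"

lemma ser_0 [simp]: "mps_coeff (ser x i) 0 = 1" by (simp add: ser_def)

lemma ser_vars: "ser x i \<in> mps_vars n" by (rule varsI) (auto simp: ser_def I_def)

lemma Ek_vars: "Ek x \<alpha> \<in> mps_vars n" unfolding Ek_def by (intro vars_prod vars_mps_power ser_0 ser_vars)

text \<open>Combines additivity of \<open>A k\<close> in \<alpha> with additivity of powers in the
  exponent.\<close>

lemma Ek_mchar: "mchar (Ek x)"
  by unfold_locales (simp_all add: Ek_def A_add mps_power_add prod.distrib)

lemma ser_U: "mmap (ev x) (U i) = ser x i"
  by (rule mps_eqI) (simp add: U_def ser_def ev_simps)

lemma Ek_EU: "mmap (ev x) (EU \<alpha>) = Ek x \<alpha>"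
  unfolding EU_def Ek_def rhom.mmap_prod[OF ev_rhom] rhom.mmap_gpow[OF ev_rhom] ser_U
  by (simp add: gpow_id pev_C[OF rhom_id])

lemma ev_PP: "ev x (PP i \<alpha> \<delta>) = mps_coeff (ser x i * Ek x \<alpha>) \<delta>"
  unfolding PP_def mps_coeff_mmap[symmetric, of "ev x"] rhom.mmap_mult[OF ev_rhom] ser_U Ek_EU ..

text \<open>The group in coordinates: \<open>x (i, \<alpha>)\<close> is the coefficient of \<open>x\<^sub>i\<close> times the monomial with exponent
  \<open>\<alpha>\<close> in the \<open>i\<close>-th component.\<close>

definition mul :: "(var \<Rightarrow> 'k) \<Rightarrow> (var \<Rightarrow> 'k) \<Rightarrow> (var \<Rightarrow> 'k)" where
  "mul x y t = (if t \<in> I then mps_coeff (ser x (fst t) * sub (Ek x) (ser y (fst t))) (snd t) else 0)"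

text \<open>Coordinates off \<open>I\<close> are set to zero, so that a point is determined by its
  series.\<close>

definition pts :: "(var \<Rightarrow> 'k) set" where "pts = {x. \<forall>t. t \<notin> I \<longrightarrow> x t = 0}"

lemma mul_pts: "mul x y \<in> pts" by (simp add: pts_def mul_def)

text \<open>\<open>mul\<close> records only the coefficients indexed by \<open>I\<close>. The others
  agree because the right side is a series in the first \<open>n\<close> variables with constant
  term \<open>1\<close>.\<close>

lemma ser_mul: "i < p \<Longrightarrow> ser (mul x y) i = ser x i * sub (Ek x) (ser y i)"
proof (rule mps_eqI)
  fix \<alpha> assume i: "i < p"
  have v: "ser x i * sub (Ek x) (ser y i) \<in> mps_vars n" by (intro vars_mult vars_sub ser_vars Ek_vars)
  show "mps_coeff (ser (mul x y) i) \<alpha> = mps_coeff (ser x i * sub (Ek x) (ser y i)) \<alpha>"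
    using i vars_coeff[OF v, of \<alpha>] mchar.sub_coeff_0[OF Ek_mchar]
    by (auto simp: ser_def[of "mul x y"] mul_def I_def)
qed

lemma ser_eqI: "x \<in> pts \<Longrightarrow> y \<in> pts \<Longrightarrow> (\<And>i. i < p \<Longrightarrow> ser x i = ser y i) \<Longrightarrow> x = y"
proof
  fix t assume a: "x \<in> pts" "y \<in> pts" "\<And>i. i < p \<Longrightarrow> ser x i = ser y i"
  show "x t = y t"
  proof (cases "t \<in> I")
    case True
    then have "mps_coeff (ser x (fst t)) (snd t) = mps_coeff (ser y (fst t)) (snd t)" using a(3)[of "fst t"]
      by (auto simp: I_def)
    then show ?thesis using True by (auto simp: ser_def I_def split: if_splits)
  qed (use a in \<open>cases t, simp add: pts_def\<close>)
qed

text \<open>The coordinates of a product as polynomials in those of the factors; the coproduct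
  \<open>Del\<close> is read off from this formula.\<close>

lemma mul_coord: "(i, \<gamma>) \<in> I \<Longrightarrow> mul x y (i, \<gamma>) = x (i, \<gamma>) + (\<Sum>(\<alpha>, \<delta>)\<in>nsplits \<gamma>. y (i, \<alpha>) * ev x (PP i \<alpha> \<delta>))"
proof -
  assume t: "(i, \<gamma>) \<in> I"
  have "mul x y (i, \<gamma>) = (\<Sum>(\<alpha>, \<delta>)\<in>splits \<gamma>. mps_coeff (ser y i) \<alpha> * ev x (PP i \<alpha> \<delta>))"
    using t by (simp add: mul_def mult_sub mps_coeff_sub ev_PP)
  \<comment> \<open>The splitting \<open>(0, \<gamma>)\<close> meets the constant term
    \<open>1\<close> of the second factor and reproduces the coordinate of \<open>x\<close>.\<close>
  also have "\<dots> = mps_coeff (ser y i) 0 * ev x (PP i 0 \<gamma>) + (\<Sum>(\<alpha>, \<delta>)\<in>nsplits \<gamma>. mps_coeff (ser y i) \<alpha> * ev x (PP i \<alpha>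
    \<delta>))"
    unfolding nsplits_def by (subst sum.remove[of _ "(0, \<gamma>)"]) (simp_all add: splits_iff)
  also have "mps_coeff (ser y i) 0 * ev x (PP i 0 \<gamma>) = x (i, \<gamma>)"
    using t mchar.E_0[OF Ek_mchar] by (simp add: ev_PP) (auto simp: ser_def I_def)
  also have "(\<Sum>(\<alpha>, \<delta>)\<in>nsplits \<gamma>. mps_coeff (ser y i) \<alpha> * ev x (PP i \<alpha> \<delta>)) = (\<Sum>(\<alpha>, \<delta>)\<in>nsplits \<gamma>. y (i, \<alpha>) * ev x (PP i
    \<alpha> \<delta>))"
    using split_I[OF t] by (intro sum.cong) (auto simp: ser_def nsplits_iff)
  finally show ?thesis .
qed

text \<open>A cocycle rule: the factor of a product is the factor of the first element times the
  transformed factor of the second. With it, associativity becomes the composition law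
  \<open>sub_sub\<close>.\<close>

lemma Ek_mul: "Ek (mul x y) \<alpha> = Ek x \<alpha> * sub (Ek x) (Ek y \<alpha>)"
proof -
  have "Ek (mul x y) \<alpha> = (\<Prod>k<p. mps_power (ser x k) (A k \<alpha>) * sub (Ek x) (mps_power (ser y k) (A k \<alpha>)))"
    unfolding Ek_def[of "mul x y"]
    by (intro prod.cong refl) (simp add: ser_mul mps_power_mult mchar.sub_coeff_0[OF Ek_mchar] sub_mps_power[OF _
      Ek_mchar])
  also have "\<dots> = Ek x \<alpha> * sub (Ek x) (Ek y \<alpha>)"
    unfolding prod.distrib Ek_def[of y] mchar.sub_prod[OF Ek_mchar] by (simp only: Ek_def[of x \<alpha>])
  finally show ?thesis .
qed

lemma mul_assoc: "mul (mul x y) z = mul x (mul y z)"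
proof (rule ser_eqI[OF mul_pts mul_pts])
  fix i assume i: "i < p"
  have "ser (mul (mul x y) z) i = ser x i * (sub (Ek x) (ser y i) * sub (\<lambda>\<alpha>. Ek x \<alpha> * sub (Ek x) (Ek y \<alpha>)) (ser z i))"
    using i by (simp add: ser_mul Ek_mul[abs_def] mult.assoc)
  also have "\<dots> = ser (mul x (mul y z)) i"
    using i by (simp add: ser_mul mchar.sub_mult[OF Ek_mchar] mchar.sub_sub[OF Ek_mchar])
  finally show "ser (mul (mul x y) z) i = ser (mul x (mul y z)) i" .
qed

definition unit :: "var \<Rightarrow> 'k" where "unit = (\<lambda>_. 0)"

lemma unit_pts: "unit \<in> pts" by (simp add: unit_def pts_def)

lemma ser_unit: "ser unit i = 1" by (rule mps_eqI) (simp add: ser_def unit_def mps_coeff_1)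

lemma Ek_unit: "Ek unit = (\<lambda>_. 1)" by (simp add: Ek_def fun_eq_iff ser_unit mps_power_one)

lemma mul_unit_l: "x \<in> pts \<Longrightarrow> mul unit x = x"
  by (rule ser_eqI[OF mul_pts]) (simp_all add: ser_mul ser_unit Ek_unit sub_one)

lemma mul_unit_r: "x \<in> pts \<Longrightarrow> mul x unit = x"
  by (rule ser_eqI[OF mul_pts]) (simp_all add: ser_mul ser_unit mchar.sub_1[OF Ek_mchar])

definition inver :: "(var \<Rightarrow> 'k) \<Rightarrow> (var \<Rightarrow> 'k)" where "inver x t = (if t \<in> I then ev x (anti t) else 0)"

lemma inver_pts: "inver x \<in> pts" by (simp add: inver_def pts_def)

lemma ev_inver: "h \<in> HI \<Longrightarrow> ev (inver x) h = ev x (pev Cst anti h)"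
  unfolding ev_pev by (rule ev_cong) (simp_all add: inver_def)

lemma mul_inver_l: "mul (inver x) x = unit"
proof
  fix t :: var
  obtain i \<gamma> where t: "t = (i, \<gamma>)" by (cases t)
  show "mul (inver x) x t = unit t"
  proof (cases "t \<in> I")
    case True
    then have "inver x (i, \<gamma>) = - (\<Sum>(\<alpha>, \<delta>)\<in>nsplits \<gamma>. x (i, \<alpha>) * ev x (pev Cst anti (PP i \<alpha> \<delta>)))"
      by (simp add: t inver_def anti_rec ev_simps case_prod_unfold)
    then show ?thesis using True ev_inver[OF HC_HI[OF PP_HC]] by (simp add: t mul_coord unit_def case_prod_unfold)
  qed (simp add: mul_def unit_def)
qed

definition point_group :: "(var \<Rightarrow> 'k) monoid" where "point_group = \<lparr>carrier = pts, mult = mul, one = unit\<rparr>"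

lemma point_group_group: "group point_group"
proof (rule groupI)
  show "\<exists>y\<in>carrier point_group. y \<otimes>\<^bsub>point_group\<^esub> x = \<one>\<^bsub>point_group\<^esub>" for x
    by (rule bexI[of _ "inver x"]) (simp_all add: point_group_def mul_inver_l inver_pts)
qed (simp_all add: point_group_def mul_pts unit_pts mul_assoc mul_unit_l)

section \<open>Points as tuples of series\<close>

definition group_of_point :: "(var \<Rightarrow> 'k) \<Rightarrow> nat \<Rightarrow> 'k mps" where "group_of_point x = (\<lambda>i\<in>{..<p}. mps_var i * ser x i)"

lemma Ek_x: "j < p \<Longrightarrow> Ek x (single j 1) = ser x j"
proof -
  assume j: "j < p"
  have "Ek x (single j 1) = (\<Prod>k<p. if k = j then ser x k else 1)"
    unfolding Ek_def using j by (intro prod.cong) (auto simp: A_x simp del: One_nat_def)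
  then show ?thesis using j by simp
qed

text \<open>By the two blocks of the stacked matrix, both cases of \<open>G_args\<close> are the
  variable times the value of \<open>Ek x\<close> at its unit vector. The group law thus becomes the
  uniform substitution \<open>sub (Ek x)\<close>.\<close>

lemma args: "j < n \<Longrightarrow> G_args p B (group_of_point x) j = mps_var j * Ek x (single j 1)"
proof (cases "j < p")
  case True then show ?thesis by (simp add: G_args_def group_of_point_def Ek_x[simplified])
next
  case False
  assume "j < n"
  then have "A k (single j 1) = B $$ (j - p, k)" if "k < p" for k
    using A_y[of k "j - p"] False that by simp
  then show ?thesis using False
    by (simp add: G_args_def group_of_point_def Ek_def mps_div_var_mult)
qed

lemma mev_args: "\<alpha> \<in> mi \<Longrightarrow> mev (G_args p B (group_of_point x)) \<alpha> = mps_mono \<alpha> * Ek x \<alpha>"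
proof -
  interpret mchar "Ek x" by (rule Ek_mchar)
  have *: "mev (G_args p B (group_of_point x)) (single j c) = mps_mono (single j c) * Ek x (single j c)" if "j < n"
    for j c
  proof (induction c)
    case (Suc c)
    have s: "single j (Suc c) = single j 1 + single j c" by (simp add: single_add[symmetric])
    show ?case unfolding s mev_add Suc mps_mono_add E_add using args[OF that] by (simp add: var_mono mult_ac)
  qed (simp add: E_0)
  assume "\<alpha> \<in> mi"
  then have "keys \<alpha> \<subseteq> {..<n}" by (simp add: multi_indices_def)
  then show ?thesis
    by (induction rule: pm_induct) (simp_all add: * E_0 mev_add mps_mono_add E_add mult_ac del: mev_single)
qed

lemma subst_sub: "f \<in> mps_vars n \<Longrightarrow> mps_subst f (G_args p B (group_of_point x)) = sub (Ek x) f"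
proof (rule mps_eqI)
  fix \<gamma> assume f: "f \<in> mps_vars n"
  let ?h = "\<lambda>\<alpha>. mps_coeff f \<alpha> * mps_coeff (mps_mono \<alpha> * Ek x \<alpha>) \<gamma>"
  have "mps_coeff f \<alpha> * mps_coeff (mev (G_args p B (group_of_point x)) \<alpha>) \<gamma> = ?h \<alpha>" for \<alpha>
    using mev_args[of \<alpha> x] vars_coeff[OF f, of \<alpha>] by (cases "\<alpha> \<in> mi") auto
  then have "mps_coeff (mps_subst f (G_args p B (group_of_point x))) \<gamma> = Sum_any ?h"
    unfolding mps_subst_def mps_coeff_Mps mev_def[symmetric] by (simp only:)
  \<comment> \<open>The formal sum runs over all exponents; a term reaches the coefficient at
    \<open>\<gamma>\<close> only if its monomial divides that of \<open>\<gamma>\<close>.\<close>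
  also have "\<dots> = sum ?h (fst ` splits \<gamma>)"
  proof (rule Sum_any.expand_superset)
    show "{\<alpha>. ?h \<alpha> \<noteq> 0} \<subseteq> fst ` splits \<gamma>"
    proof
      fix \<alpha> assume "\<alpha> \<in> {\<alpha>. ?h \<alpha> \<noteq> 0}"
      then have "mps_coeff (mps_mono \<alpha> * Ek x \<alpha>) \<gamma> \<noteq> 0" by auto
      then obtain \<delta> where "\<gamma> = \<alpha> + \<delta>" using mps_coeff_mono_mult_0 by blast
      then show "\<alpha> \<in> fst ` splits \<gamma>" by (auto simp: splits_def image_iff)
    qed
  qed simp
  also have "\<dots> = (\<Sum>u\<in>splits \<gamma>. ?h (fst u))" by (rule sum.reindex_cong[of fst]) (auto simp: inj_on_def splits_def)
  also have "\<dots> = mps_coeff (sub (Ek x) f) \<gamma>"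
    unfolding mps_coeff_sub by (intro sum.cong) (auto simp: splits_def mps_coeff_mono_mult)
  finally show "mps_coeff (mps_subst f (G_args p B (group_of_point x))) \<gamma> = mps_coeff (sub (Ek x) f) \<gamma>" .
qed

abbreviation "G \<equiv> G_group p q B"

lemma group_of_point_carrier: "group_of_point x \<in> carrier G"
proof -
  have "ser x i - 1 \<in> mps_vars_plus n" for i using ser_vars[of x i] by (auto simp: mps_vars_plus_def)
  then have "mps_var i * ser x i \<in> G_factor n i" for i
    unfolding G_factor_def by (intro CollectI exI[of _ "ser x i - 1"]) auto
  then show ?thesis by (simp add: G_group_def group_of_point_def)
qed

lemma group_of_point_inj: "inj_on group_of_point pts"
proof (rule inj_onI)
  fix x y assume xy: "x \<in> pts" "y \<in> pts" "group_of_point x = group_of_point y"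
  show "x = y"
  proof (rule ser_eqI[OF xy(1,2)])
    fix i assume "i < p"
    then have "mps_var i * ser x i = mps_var i * ser y i" using fun_cong[OF xy(3), of i]
      by (simp add: group_of_point_def)
    then show "ser x i = ser y i" unfolding var_mono by (rule mps_mono_cancel)
  qed
qed

lemma group_of_point_surj: "F \<in> carrier G \<Longrightarrow> \<exists>x\<in>pts. group_of_point x = F"
proof -
  assume F: "F \<in> carrier G"
  then have "\<forall>i\<in>{..<p}. \<exists>f. f \<in> mps_vars_plus n \<and> F i = mps_var i * (1 + f)" by (auto simp: G_group_def G_factor_def)
  then obtain f where f: "\<And>i. i < p \<Longrightarrow> f i \<in> mps_vars_plus n \<and> F i = mps_var i * (1 + f i)" by (metis lessThan_iff)
  define x where "x t = (if t \<in> I then mps_coeff (f (fst t)) (snd t) else 0)" for t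
  have "ser x i = 1 + f i" if "i < p" for i
    using f[OF that] that by (intro mps_eqI) (auto simp: ser_def x_def mps_coeff_1 I_def mps_vars_plus_def vars_coeff)
  then have "group_of_point x i = F i" for i using f F by (cases "i < p") (auto simp: group_of_point_def G_group_def
    PiE_def extensional_def)
  then show ?thesis by (intro bexI[of _ x]) (auto simp: x_def pts_def)
qed

lemma group_of_point_mult: "group_of_point x \<otimes>\<^bsub>G\<^esub> group_of_point y = group_of_point (mul x y)"
proof
  fix i
  show "(group_of_point x \<otimes>\<^bsub>G\<^esub> group_of_point y) i = group_of_point (mul x y) i"
  proof (cases "i < p")
    case True
    have "mps_var i \<in> mps_vars n" using True by (intro varsI) (auto simp: mps_var_def multi_indices_def)
    then have "mps_var i * ser y i \<in> mps_vars n" using ser_vars by (rule vars_mult)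
    then have "(group_of_point x \<otimes>\<^bsub>G\<^esub> group_of_point y) i = sub (Ek x) (mps_var i * ser y i)"
      using True by (simp add: G_group_def group_of_point_def subst_sub[unfolded group_of_point_def])
    also have "\<dots> = mps_var i * ser x i * sub (Ek x) (ser y i)"
      using Ek_x[OF True] by (simp add: mchar.sub_mult[OF Ek_mchar] var_mono sub_mono)
    finally show ?thesis using True by (simp add: group_of_point_def ser_mul mult.assoc)
  qed (simp add: G_group_def group_of_point_def)
qed

lemma group_of_point_one: "group_of_point unit = \<one>\<^bsub>G\<^esub>"
  by (simp add: group_of_point_def G_group_def ser_unit)

text \<open>The axioms are transported from points along \<open>group_of_point\<close>, which is
  onto and respects products.\<close>

lemma G_group: "group G"
proof (rule groupI)
  show "F \<otimes>\<^bsub>G\<^esub> K \<in> carrier G" if "F \<in> carrier G" "K \<in> carrier G" for F K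
    using that group_of_point_surj group_of_point_mult group_of_point_carrier by metis
  show "\<one>\<^bsub>G\<^esub> \<in> carrier G" using group_of_point_carrier group_of_point_one by metis
  show "F \<otimes>\<^bsub>G\<^esub> K \<otimes>\<^bsub>G\<^esub> M = F \<otimes>\<^bsub>G\<^esub> (K \<otimes>\<^bsub>G\<^esub> M)" if "F \<in> carrier G" "K \<in> carrier G" "M \<in> carrier G" for F K M
    using that group_of_point_surj group_of_point_mult mul_assoc by metis
  show "\<one>\<^bsub>G\<^esub> \<otimes>\<^bsub>G\<^esub> F = F" if "F \<in> carrier G" for F
    using that group_of_point_surj group_of_point_mult mul_unit_l group_of_point_one by metis
  show "\<exists>K\<in>carrier G. K \<otimes>\<^bsub>G\<^esub> F = \<one>\<^bsub>G\<^esub>" if "F \<in> carrier G" for F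
    using that group_of_point_surj group_of_point_mult mul_inver_l group_of_point_one group_of_point_carrier by metis
qed

section \<open>The Hopf algebra\<close>

text \<open>The coproduct takes values in a tensor space formed from \<open>HA\<close> itself, so it is first built over the
  underlying algebra \<open>HM\<close>, which has the same carrier and operations.\<close>

definition HM :: "('k, mon \<Rightarrow>\<^sub>0 'k) module" where
  "HM = \<lparr>carrier = HI, mult = (*), one = 1, zero = 0, add = (+), smult = (\<lambda>c h. Cst c * h)\<rparr>"

text \<open>The tensor square is modelled by polynomials whose monomials are pairs of monomials; in
  this model \<open>inl\<close> and \<open>inr\<close> are \<open>h \<otimes> 1\<close> and
  \<open>1 \<otimes> h\<close>.\<close>

definition inl :: "(mon \<Rightarrow>\<^sub>0 'k) \<Rightarrow> (mon \<times> mon \<Rightarrow>\<^sub>0 'k)" where "inl = aev Cst (\<lambda>m. single (m, 0) 1)"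
definition inr :: "(mon \<Rightarrow>\<^sub>0 'k) \<Rightarrow> (mon \<times> mon \<Rightarrow>\<^sub>0 'k)" where "inr = aev Cst (\<lambda>m. single (0, m) 1)"

text \<open>On variables this is \<open>mul_coord\<close> with left factors read at \<open>x\<close>
  and right factors at \<open>y\<close>. The summand \<open>1 \<otimes> Xv t\<close> is the
  splitting \<open>(snd t, 0)\<close>, since \<open>PP i \<alpha> 0\<close> is
  \<open>1\<close>.\<close>

definition Del :: "(mon \<Rightarrow>\<^sub>0 'k) \<Rightarrow> (mon \<times> mon \<Rightarrow>\<^sub>0 'k)" where
  "Del = pev Cst (\<lambda>t. inl (Xv t) + (\<Sum>(\<alpha>, \<delta>)\<in>nsplits (snd t). inl (PP (fst t) \<alpha> \<delta>) * inr (Xv (fst t, \<alpha>))))"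

definition X :: "mon \<Rightarrow> (mon \<Rightarrow>\<^sub>0 'k)" where "X m = single m 1"

text \<open>Carries the polynomial model of the tensor square to the tensor space in which a
  coproduct has to take its values.\<close>

definition kap0 :: "(mon \<times> mon \<Rightarrow>\<^sub>0 'k) \<Rightarrow> _" where
  "kap0 T = (\<Oplus>\<^bsub>tensor_space HM HM\<^esub>s\<in>keys T. lookup T s \<odot>\<^bsub>tensor_space HM HM\<^esub> pure_tensor HM HM (X (fst s)) (X (snd
    s)))"

definition HA :: "('k, mon \<Rightarrow>\<^sub>0 'k) hopf" where
  "HA = \<lparr>carrier = HI, mult = (*), one = 1, zero = 0, add = (+), smult = (\<lambda>c h. Cst c * h), counit = const_coeff,
     comult = (\<lambda>h. kap0 (Del h)), antipode = pev Cst anti\<rparr>"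

lemma HA_simps [simp]: "carrier HA = HI" "mult HA = (*)" "one HA = 1" "zero HA = 0" "add HA = (+)" "smult HA =
    (\<lambda>c h. Cst c * h)"
  "counit HA = const_coeff" "antipode HA = pev Cst anti"
  by (simp_all add: HA_def)

lemma HM_HA: "tensor_space HM HM = tensor_space HA HA" "pure_tensor HM HM = pure_tensor HA HA"
  by (rule tensor_space_cong pure_tensor_cong; simp add: HM_def)+

lemma C_simps: "Cst (a + b) = Cst a + Cst b" "Cst (a * b) = Cst a * Cst b" "Cst 1 = 1" "Cst 0 = 0" "Cst (- a) =
    - Cst a"
  using rhom.rho_add[OF C_rhom] rhom.rho_mult[OF C_rhom] rhom.rho_1[OF C_rhom] rhom.rho_0[OF C_rhom]
    rhom.rho_uminus[OF C_rhom] by auto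

lemma HA_kvs: "kvs HA"
  by (rule kvs.intro, rule vsI) (auto simp: algebra_simps C_simps)

lemma HA_kalg: "kalg HA"
proof (rule kalgI[OF HA_kvs])
  show "bilinear_map HA HA HA (mult HA)" by (rule bilinearI) (auto simp: algebra_simps)
qed (auto simp: algebra_simps)

sublocale HA: kalg HA by (rule HA_kalg)
sublocale TA: ktalg HA HA by unfold_locales
sublocale TS: kvs "tensor_space HA HA" by (rule TA.tensor_kvs)
sublocale TT: ktensor HA "tensor_space HA HA" by unfold_locales

abbreviation "HH \<equiv> tensor_space HA HA"
abbreviation "HHH \<equiv> tensor_space HA (tensor_space HA HA)"
abbreviation "pt \<equiv> pure_tensor HA HA"

lemma HHH_kvs: "kvs HHH" by (rule TT.tensor_kvs)

definition MI :: "mon set" where "MI = {m. keys m \<subseteq> I}"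

lemma MI_add_single: "m + single s 1 \<in> MI \<longleftrightarrow> m \<in> MI \<and> s \<in> I"
proof -
  have "keys (m + single s 1) = insert s (keys m)"
    by (auto simp: in_keys_iff lookup_add lookup_single when_def split: if_splits)
  then show ?thesis by (simp add: MI_def conj_commute)
qed

lemma X_HI [simp]: "m \<in> MI \<Longrightarrow> X m \<in> HI" by (auto simp: X_def HI_def MI_def)

definition to_tensor where "to_tensor T = (\<Oplus>\<^bsub>HH\<^esub>s\<in>keys T. lookup T s \<odot>\<^bsub>HH\<^esub> pt (X (fst s)) (X (snd s)))"

lemma comult_to_tensor: "comult HA h = to_tensor (Del h)"
proof -
  have "comult HA h = kap0 (Del h)" by (simp add: HA_def)
  then show ?thesis by (simp only: kap0_def to_tensor_def HM_HA)
qed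

lemma to_tensor_lin: "to_tensor \<in> lin (free_module (MI \<times> MI)) HH"
  unfolding to_tensor_def by (rule TS.lc_lin) auto

lemma ev_lin: "ev x \<in> lin HA base_algebra"
  by (rule linI) (simp_all add: ev_simps)

lemma ev_hom: "ev x \<in> alg_hom HA base_algebra"
  by (rule alg_homI[OF ev_lin]) (simp_all add: ev_simps)

definition tensor_eval where "tensor_eval f f' = tensor_lift base_algebra (\<lambda>a b. f a * f' b)"

lemma tensor_eval_lin: "f \<in> lin HA base_algebra \<Longrightarrow> f' \<in> lin HA base_algebra \<Longrightarrow> tensor_eval f f' \<in> lin HH base_algebra"
  unfolding tensor_eval_def by (intro tl_lin HA_kvs base_kvs lin_base_bil)

lemma tensor_eval_pure: "f \<in> lin HA base_algebra \<Longrightarrow> f' \<in> lin HA base_algebra \<Longrightarrow> a \<in> HI \<Longrightarrow> b \<in> HI \<Longrightarrow>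
    tensor_eval f f' (pt a b) = f a * f' b"
  unfolding tensor_eval_def by (rule tl_pure[OF HA_kvs HA_kvs base_kvs lin_base_bil]) simp_all

definition ev2 :: "(var \<Rightarrow> 'k) \<Rightarrow> (var \<Rightarrow> 'k) \<Rightarrow> (mon \<times> mon \<Rightarrow>\<^sub>0 'k) \<Rightarrow> 'k" where
  "ev2 x y = aev (\<lambda>c. c) (\<lambda>s. mev x (fst s) * mev y (snd s))"

lemma ev2_maev: "maev (\<lambda>c::'k. c) (\<lambda>s. mev x (fst s) * mev y (snd s))"
  by (intro maev.intro maev_axioms.intro rhom_id) (simp_all add: mev_add)

lemma ev2_rhom: "rhom (ev2 x y)"
proof -
  interpret maev "\<lambda>c. c" "\<lambda>s. mev x (fst s) * mev y (snd s)" by (rule ev2_maev)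
  show ?thesis unfolding ev2_def by (rule ev.rhom_axioms)
qed

lemma ev_X: "ev x (X m) = mev x m"
  using maev.aev_single[OF pev_maev[OF rhom_id], of x m 1] by (simp add: X_def)

lemma tensor_eval_to_tensor: "keys T \<subseteq> MI \<times> MI \<Longrightarrow> tensor_eval (ev x) (ev y) (to_tensor T) = ev2 x y T"
proof -
  assume T: "keys T \<subseteq> MI \<times> MI"
  have "tensor_eval (ev x) (ev y) (to_tensor T) = (\<Sum>s\<in>keys T. lookup T s * (ev x (X (fst s)) * ev y (X (snd s))))"
    unfolding to_tensor_def using T
    by (subst lin_finsum[OF TS.kvs_axioms base_kvs tensor_eval_lin[OF ev_lin ev_lin]])
      (auto simp: lin_smult[OF tensor_eval_lin[OF ev_lin ev_lin]] tensor_eval_pure[OF ev_lin ev_lin] intro!: sum.cong)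
  then show ?thesis unfolding ev2_def aev_def[of _ "\<lambda>s. mev x (fst s) * mev y (snd s)"] ev_X .
qed

lemma inl_maev: "maev (Cst :: 'k \<Rightarrow> (mon \<times> mon \<Rightarrow>\<^sub>0 'k)) (\<lambda>m. single (m, 0) 1)"
  and inr_maev: "maev (Cst :: 'k \<Rightarrow> (mon \<times> mon \<Rightarrow>\<^sub>0 'k)) (\<lambda>m. single (0, m) 1)"
  by (intro maev.intro maev_axioms.intro C_rhom; simp add: mult_single zero_prod_def[symmetric])+

lemma inl_single: "inl (single m c) = single (m, 0) c"
  and inr_single: "inr (single m c) = single (0, m) c"
  unfolding inl_def inr_def maev.aev_single[OF inl_maev] maev.aev_single[OF inr_maev]
    by (simp_all add: Cst_def mult_single)

lemma inl_rhom: "rhom inl" and inr_rhom: "rhom inr"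
proof -
  interpret l: maev "Cst :: 'k \<Rightarrow> (mon \<times> mon \<Rightarrow>\<^sub>0 'k)" "\<lambda>m. single (m, 0) 1" by (rule inl_maev)
  interpret r: maev "Cst :: 'k \<Rightarrow> (mon \<times> mon \<Rightarrow>\<^sub>0 'k)" "\<lambda>m. single (0, m) 1" by (rule inr_maev)
  show "rhom inl" "rhom inr" unfolding inl_def inr_def by (rule l.ev.rhom_axioms r.ev.rhom_axioms)+
qed

lemma ev2_single: "ev2 x y (single s c) = c * (mev x (fst s) * mev y (snd s))"
  unfolding ev2_def by (rule maev.aev_single[OF ev2_maev])

lemma ev2_inl: "ev2 x y (inl h) = ev x h" and ev2_inr: "ev2 x y (inr h) = ev y h"
proof -
  have "(\<lambda>h. ev2 x y (inl h)) h = ev x h"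
    by (rule rhom_ext[where I = UNIV, OF rhom_compose[OF inl_rhom ev2_rhom] ev_rhom])
      (simp_all add: Cst_def Xv_def inl_single ev2_single maev.aev_single[OF pev_maev[OF rhom_id]])
  then show "ev2 x y (inl h) = ev x h" .
  have "(\<lambda>h. ev2 x y (inr h)) h = ev y h"
    by (rule rhom_ext[where I = UNIV, OF rhom_compose[OF inr_rhom ev2_rhom] ev_rhom])
      (simp_all add: Cst_def Xv_def inr_single ev2_single maev.aev_single[OF pev_maev[OF rhom_id]])
  then show "ev2 x y (inr h) = ev y h" .
qed

lemma Del_rhom: "rhom Del" unfolding Del_def by (rule pev_rhom[OF C_rhom])

lemma Del_V: "Del (Xv t) = inl (Xv t) + (\<Sum>(\<alpha>, \<delta>)\<in>nsplits (snd t). inl (PP (fst t) \<alpha> \<delta>) * inr (Xv (fst t, \<alpha>)))"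
  unfolding Del_def by (rule pev_V[OF C_rhom])

text \<open>\<open>Del\<close> is dual to the group law. The counit, antipode and coassociativity
  laws are group identities read through this formula.\<close>

lemma ev2_Del: "h \<in> HI \<Longrightarrow> ev2 x y (Del h) = ev (mul x y) h"
proof -
  assume h: "h \<in> HI"
  have "(\<lambda>h. ev2 x y (Del h)) h = ev (mul x y) h"
  proof (rule rhom_ext[where I = I, OF rhom_compose[OF Del_rhom ev2_rhom] ev_rhom])
    show "ev2 x y (Del (Cst c)) = ev (mul x y) (Cst c)" for c
      using ev2_single[of x y 0 c] by (simp add: Del_def pev_C[OF C_rhom] pev_C[OF rhom_id]) (simp add: Cst_def)
    show "ev2 x y (Del (Xv t)) = ev (mul x y) (Xv t)" if "t \<in> I" for t
      using that mul_coord[of "fst t" "snd t" x y]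
      by (simp add: Del_V rhom.rho_add[OF ev2_rhom] rhom.rho_mult[OF ev2_rhom] rhom.rho_sum[OF ev2_rhom] ev2_inl
        ev2_inr ev_simps case_prod_unfold mult.commute)
  qed (use h in \<open>auto simp: HI_def\<close>)
  then show ?thesis .
qed

definition HHC :: "(nat \<Rightarrow>\<^sub>0 nat) \<Rightarrow> (mon \<times> mon \<Rightarrow>\<^sub>0 'k) set" where
  "HHC \<gamma> = {T. keys T \<subseteq> {(m, m'). m \<in> MI \<and> m' \<in> MI \<and> weight m + weight m' = \<gamma>}}"

lemma HHC_0: "0 \<in> HHC \<gamma>" by (simp add: HHC_def)
lemma HHC_add: "f \<in> HHC \<gamma> \<Longrightarrow> h \<in> HHC \<gamma> \<Longrightarrow> f + h \<in> HHC \<gamma>" by (simp add: HHC_def keys_add_sub)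
lemma HHC_sum: "(\<And>s. s \<in> S \<Longrightarrow> f s \<in> HHC \<gamma>) \<Longrightarrow> sum f S \<in> HHC \<gamma>"
  by (induction S rule: infinite_finite_induct) (auto simp: HHC_0 HHC_add)
lemma HHC_mult: "f \<in> HHC \<gamma> \<Longrightarrow> h \<in> HHC \<delta> \<Longrightarrow> f * h \<in> HHC (\<gamma> + \<delta>)"
proof -
  assume f: "f \<in> HHC \<gamma>" "h \<in> HHC \<delta>"
  show ?thesis unfolding HHC_def
  proof (rule CollectI, rule subsetI)
    fix m assume "m \<in> keys (f * h)"
    then obtain a b where ab: "a \<in> keys f" "b \<in> keys h" "m = a + b" using keys_mult[of f h] by blast
    then have "fst a \<in> MI" "snd a \<in> MI" "fst b \<in> MI" "snd b \<in> MI" "weight (fst a) + weight (snd a) = \<gamma>" "weight (fst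
      b) + weight (snd b) = \<delta>" using f by (auto simp: HHC_def)
    with ab show "m \<in> {(m, m'). m \<in> MI \<and> m' \<in> MI \<and> weight m + weight m' = \<gamma> + \<delta>}"
      by (auto simp: keys_add_sub weight_add MI_def plus_prod_def ac_simps)
  qed
qed
lemma HHC_C: "Cst c \<in> HHC 0" by (auto simp: HHC_def Cst_def MI_def zero_prod_def)
lemma HHC_1: "1 \<in> HHC 0" using HHC_C[of 1] by (simp add: rhom.rho_1[OF C_rhom])
lemma HHC_inl: "h \<in> HC \<gamma> \<Longrightarrow> inl h \<in> HHC \<gamma>"
proof -
  assume "h \<in> HC \<gamma>"
  then have "keys h \<subseteq> {m. keys m \<subseteq> I \<and> weight m = \<gamma>}" by (simp add: HC_def)
  then show ?thesis
    by (induction rule: pm_induct) (auto simp: rhom.rho_0[OF inl_rhom] rhom.rho_add[OF inl_rhom] HHC_0 HHC_add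
      inl_single, auto simp: HHC_def MI_def)
qed
lemma HHC_inr: "h \<in> HC \<gamma> \<Longrightarrow> inr h \<in> HHC \<gamma>"
proof -
  assume "h \<in> HC \<gamma>"
  then have "keys h \<subseteq> {m. keys m \<subseteq> I \<and> weight m = \<gamma>}" by (simp add: HC_def)
  then show ?thesis
    by (induction rule: pm_induct) (auto simp: rhom.rho_0[OF inr_rhom] rhom.rho_add[OF inr_rhom] HHC_0 HHC_add
      inr_single, auto simp: HHC_def MI_def)
qed

lemma Del_V_HHC: "t \<in> I \<Longrightarrow> Del (Xv t) \<in> HHC (snd t)"
proof -
  assume t: "t \<in> I"
  have "inl (PP (fst t) \<alpha> \<delta>) * inr (Xv (fst t, \<alpha>)) \<in> HHC (snd t)" if "(\<alpha>, \<delta>) \<in> nsplits (snd t)" for \<alpha> \<delta>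
  proof -
    have "(fst t, \<alpha>) \<in> I" using split_I[of "fst t" "snd t"] that t by simp
    then have "inl (PP (fst t) \<alpha> \<delta>) * inr (Xv (fst t, \<alpha>)) \<in> HHC (\<delta> + \<alpha>)"
      using HC_V[of "(fst t, \<alpha>)"] by (intro HHC_mult HHC_inl HHC_inr PP_HC) simp_all
    then show ?thesis using that by (simp add: nsplits_iff add.commute)
  qed
  then show ?thesis unfolding Del_V using t by (auto intro!: HHC_add HHC_sum HHC_inl HC_V)
qed

lemma HHC_power: "h \<in> HHC \<gamma> \<Longrightarrow> h ^ k \<in> HHC (of_nat k * \<gamma>)"
  by (induction k) (auto simp: HHC_1 algebra_simps dest: HHC_mult)

lemma Del_X_HHC: "m \<in> MI \<Longrightarrow> Del (X m) \<in> HHC (weight m)"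
proof -
  assume m: "m \<in> MI"
  have "finite T \<Longrightarrow> T \<subseteq> I \<Longrightarrow> (\<Prod>t\<in>T. Del (Xv t) ^ lookup m t) \<in> HHC (\<Sum>t\<in>T. of_nat (lookup m t) * snd t)" for T
    by (induction T rule: finite_induct) (auto simp: HHC_1 intro!: HHC_mult HHC_power Del_V_HHC)
  moreover have "Del (X m) = mev (\<lambda>t. Del (Xv t)) m"
    unfolding X_def V_mev[symmetric] by (simp add: mev_def rhom.rho_prod[OF Del_rhom] rhom.rho_power[OF Del_rhom])
  ultimately show ?thesis using m by (simp add: mev_def weight_def MI_def)
qed

lemma Del_C_mult: "Del (Cst c * h) = Cst c * Del h"
  by (simp add: rhom.rho_mult[OF Del_rhom]) (simp add: Del_def pev_C[OF C_rhom])

lemma Del_HHC: "h \<in> HC \<gamma> \<Longrightarrow> Del h \<in> HHC \<gamma>"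
proof -
  assume "h \<in> HC \<gamma>"
  then have "keys h \<subseteq> {m. keys m \<subseteq> I \<and> weight m = \<gamma>}" by (simp add: HC_def)
  then show ?thesis
  proof (induction rule: pm_induct)
    case (single m c)
    have "single m c = Cst c * X m" by (simp add: X_def Cst_def mult_single)
    then have "Del (single m c) = Cst c * Del (X m)" by (simp add: Del_C_mult)
    then show ?case using HHC_mult[OF HHC_C Del_X_HHC, of m c] single by (simp add: MI_def)
  qed (auto simp: rhom.rho_0[OF Del_rhom] rhom.rho_add[OF Del_rhom] HHC_0 HHC_add)
qed

lemma HI_induct [consumes 1, case_names zero single add]:
  assumes "h \<in> HI" "P 0" "\<And>m c. m \<in> MI \<Longrightarrow> P (Cst c * X m)" "\<And>a b. a \<in> HI \<Longrightarrow> b \<in> HI \<Longrightarrow> P a \<Longrightarrow> P b \<Longrightarrow> P (a + b)"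
  shows "P h"
proof -
  have "keys h \<subseteq> MI" using assms(1) by (simp add: HI_def MI_def)
  then show ?thesis
  proof (induction rule: pm_induct)
    case (single m c)
    have "single m c = Cst c * X m" by (simp add: X_def Cst_def mult_single)
    then show ?case using assms single by metis
  qed (use assms in \<open>auto simp: HI_def MI_def\<close>)
qed

lemma Del_keys: "h \<in> HI \<Longrightarrow> keys (Del h) \<subseteq> MI \<times> MI"
proof (induction rule: HI_induct)
  case (single m c)
  have "Cst c * Del (X m) \<in> HHC (weight m)" using HHC_mult[OF HHC_C Del_X_HHC, of m c] single by simp
  then show ?case by (auto simp: Del_C_mult HHC_def)
qed (simp_all add: rhom.rho_0[OF Del_rhom] rhom.rho_add[OF Del_rhom] keys_add_sub)

lemma tensor_eval_comult: "h \<in> HI \<Longrightarrow> tensor_eval (ev x) (ev y) (comult HA h) = ev (mul x y) h"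
  by (simp add: comult_to_tensor tensor_eval_to_tensor Del_keys ev2_Del)

text \<open>\<open>poly_separate\<close> tests at all assignments; coordinates off \<open>I\<close>
  may be set to zero because polynomials in \<open>HI\<close> do not involve them.\<close>

lemma HI_sep: "h \<in> HI \<Longrightarrow> h' \<in> HI \<Longrightarrow> (\<And>x. x \<in> pts \<Longrightarrow> ev x h = ev x h') \<Longrightarrow> h = h'"
proof -
  assume h: "h \<in> HI" "h' \<in> HI" and e: "\<And>x. x \<in> pts \<Longrightarrow> ev x h = ev x h'"
  have "ev x (h - h') = 0" for x
  proof -
    define y where "y t = (if t \<in> I then x t else 0)" for t
    have "ev x (h - h') = ev y (h - h')" using h by (intro ev_cong) (auto simp: y_def)
    also have "\<dots> = 0" using e[of y] by (simp add: rhom.rho_diff[OF ev_rhom]) (simp add: y_def pts_def)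
    finally show ?thesis .
  qed
  then have "h - h' = 0" by (rule poly_separate)
  then show ?thesis by simp
qed

lemma ev_sep0: "h \<in> carrier HA \<Longrightarrow> (\<And>l. l \<in> ev ` pts \<Longrightarrow> l h = 0) \<Longrightarrow> h = \<zero>\<^bsub>HA\<^esub>"
  using HI_sep[of h 0] by (simp add: ev_simps)

lemma ev_sub: "ev ` pts \<subseteq> lin HA base_algebra" using ev_lin by auto

lemma HH_sep: "S \<in> carrier HH \<Longrightarrow> T \<in> carrier HH \<Longrightarrow> (\<And>x y. x \<in> pts \<Longrightarrow> y \<in> pts \<Longrightarrow> tensor_eval (ev x) (ev y) S =
    tensor_eval (ev x) (ev y) T) \<Longrightarrow> S = T"
  by (rule TA.tensor_separate_eq[OF _ _ ev_sub ev_sep0 ev_sub ev_sep0]) (auto simp: tensor_eval_def)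

definition pr3 where "pr3 f f' k = tensor_lift base_algebra (\<lambda>a T. f a * tensor_eval f' k T)"

lemma pr3_lin: "f \<in> lin HA base_algebra \<Longrightarrow> f' \<in> lin HA base_algebra \<Longrightarrow> k \<in> lin HA base_algebra \<Longrightarrow>
    pr3 f f' k \<in> lin HHH base_algebra"
  unfolding pr3_def by (intro tl_lin HA_kvs TS.kvs_axioms base_kvs lin_base_bil tensor_eval_lin)

lemma pr3_pure: "f \<in> lin HA base_algebra \<Longrightarrow> f' \<in> lin HA base_algebra \<Longrightarrow> k \<in> lin HA base_algebra \<Longrightarrow>
  a \<in> HI \<Longrightarrow> T \<in> carrier HH \<Longrightarrow> pr3 f f' k (pure_tensor HA HH a T) = f a * tensor_eval f' k T"
  unfolding pr3_def by (rule tl_pure[OF HA_kvs TS.kvs_axioms base_kvs lin_base_bil[OF _ tensor_eval_lin]]) simp_all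

text \<open>Separation is applied twice: evaluations separate the left factor, and products of two
  evaluations separate \<open>HH\<close> by the case of two factors.\<close>

lemma HHH_sep: "S \<in> carrier HHH \<Longrightarrow> T \<in> carrier HHH \<Longrightarrow> (\<And>x y z. x \<in> pts \<Longrightarrow> y \<in> pts \<Longrightarrow> z \<in> pts \<Longrightarrow>
    pr3 (ev x) (ev y) (ev z) S = pr3 (ev x) (ev y) (ev z) T) \<Longrightarrow> S = T"
proof (rule TT.tensor_separate_eq[OF _ _ ev_sub ev_sep0, where M = "{tensor_eval (ev y) (ev z) | y z. y \<in> pts \<and>
    z \<in> pts}"])
  show "{tensor_eval (ev y) (ev z) |y z. y \<in> pts \<and> z \<in> pts} \<subseteq> lin HH base_algebra"
    using tensor_eval_lin[OF ev_lin ev_lin] by auto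
  fix w assume w: "w \<in> carrier HH" "\<And>l. l \<in> {tensor_eval (ev y) (ev z) |y z. y \<in> pts \<and> z \<in> pts} \<Longrightarrow> l w = 0"
  show "w = \<zero>\<^bsub>HH\<^esub>"
  proof (rule HH_sep[OF w(1) TS.zero_closed])
    fix y z assume "y \<in> pts" "z \<in> pts"
    then show "tensor_eval (ev y) (ev z) w = tensor_eval (ev y) (ev z) \<zero>\<^bsub>HH\<^esub>"
      using w(2) lin_zero[OF TS.kvs_axioms base_kvs tensor_eval_lin[OF ev_lin ev_lin]] by auto
  qed
qed (auto simp: pr3_def)

abbreviation "\<Delta> \<equiv> comult HA"

lemma comult_closed [simp]: "h \<in> HI \<Longrightarrow> \<Delta> h \<in> carrier HH"
  unfolding comult_to_tensor by (rule lin_closed[OF to_tensor_lin]) (simp add: Del_keys)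

lemma comult_lin: "\<Delta> \<in> lin HA HH"
proof (rule linI)
  show "\<Delta> (x \<oplus>\<^bsub>HA\<^esub> y) = \<Delta> x \<oplus>\<^bsub>HH\<^esub> \<Delta> y" if "x \<in> carrier HA" "y \<in> carrier HA" for x y
    using that lin_add[OF to_tensor_lin, of "Del x" "Del y"] by (simp add: comult_to_tensor rhom.rho_add[OF Del_rhom]
      Del_keys)
  show "\<Delta> (c \<odot>\<^bsub>HA\<^esub> x) = c \<odot>\<^bsub>HH\<^esub> \<Delta> x" if "x \<in> carrier HA" for c x
  proof -
    have "to_tensor (Cst c * Del x) = c \<odot>\<^bsub>HH\<^esub> to_tensor (Del x)"
      using that lin_smult[OF to_tensor_lin, of "Del x" c] by (simp add: C_mult Del_keys)
    then show ?thesis by (simp add: comult_to_tensor Del_C_mult)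
  qed
qed simp

lemma tensor_eval_hom: "tensor_eval (ev x) (ev y) \<in> alg_hom TA.AB base_algebra"
  unfolding tensor_eval_def by (rule TA.base_tensor_hom[OF ev_hom ev_hom])

lemma comult_hom: "\<Delta> \<in> alg_hom HA (tensor_algebra HA HA)"
proof (rule alg_homI)
  show "\<Delta> \<in> lin HA (tensor_algebra HA HA)" using comult_lin by (simp add: LinearCombinations.module_hom_def)
  show "\<Delta> (a \<otimes>\<^bsub>HA\<^esub> b) = \<Delta> a \<otimes>\<^bsub>tensor_algebra HA HA\<^esub> \<Delta> b" if "a \<in> carrier HA" "b \<in> carrier HA" for a b
  proof (rule HH_sep)
    show "\<Delta> a \<otimes>\<^bsub>tensor_algebra HA HA\<^esub> \<Delta> b \<in> carrier HH" using that by (intro bil_closed[OF TA.AB_mult_bil]) simp_all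
    fix x y
    show "tensor_eval (ev x) (ev y) (\<Delta> (a \<otimes>\<^bsub>HA\<^esub> b)) = tensor_eval (ev x) (ev y) (\<Delta> a \<otimes>\<^bsub>tensor_algebra HA HA\<^esub> \<Delta> b)"
      using that alg_hom_mult[OF tensor_eval_hom, of "\<Delta> a" "\<Delta> b"] by (simp add: tensor_eval_comult ev_simps)
  qed (use that in simp)
  show "\<Delta> \<one>\<^bsub>HA\<^esub> = \<one>\<^bsub>tensor_algebra HA HA\<^esub>"
    by (rule HH_sep) (simp_all add: tensor_eval_comult tensor_eval_pure[OF ev_lin ev_lin] ev_simps)
qed

lemma counit_ev: "h \<in> HI \<Longrightarrow> const_coeff h = ev unit h"
proof -
  have "const_coeff h = ev (\<lambda>_. 0) h"
    by (rule rhom_ext[where I = UNIV, OF _ ev_rhom]) (auto simp: rhom_def ev_simps, auto simp: const_coeff_def Cst_def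
      Xv_def lookup_single when_def)
  then show ?thesis by (simp add: unit_def)
qed

lemma const_coeff_Cst [simp]: "const_coeff (Cst c) = c" by (simp add: const_coeff_def Cst_def)

lemma counit_hom: "const_coeff \<in> alg_hom HA base_algebra"
  by (rule alg_homI, rule linI) simp_all

lemma counit_lin: "const_coeff \<in> lin HA base_algebra" by (rule alg_hom_lin[OF counit_hom])

lemma antipode_closed [simp]: "h \<in> HI \<Longrightarrow> pev Cst anti h \<in> HI"
proof (induction rule: HI_induct)
  case (single m c)
  have "X m \<in> HC (weight m)" using single by (auto simp: HC_def X_def MI_def)
  from pev_HC[OF this anti_HC] show ?case
    by (simp add: rhom.rho_mult[OF pev_rhom[OF C_rhom]] pev_C[OF C_rhom] HC_HI)
qed (simp_all add: rhom.rho_0[OF pev_rhom[OF C_rhom]] rhom.rho_add[OF pev_rhom[OF C_rhom]])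

lemma antipode_lin: "pev Cst anti \<in> lin HA HA"
  by (rule linI) (simp_all add: rhom.rho_add[OF pev_rhom[OF C_rhom]] rhom.rho_mult[OF pev_rhom[OF C_rhom]] pev_C[OF
    C_rhom])

lemma ev_antipode: "h \<in> HI \<Longrightarrow> ev x (pev Cst anti h) = ev (inver x) h"
  by (simp add: ev_inver)

text \<open>The recursion defining \<open>anti\<close> gives left inverses; in a group these are
  right inverses as well.\<close>

lemma mul_inver_r: "x \<in> pts \<Longrightarrow> mul x (inver x) = unit"
proof -
  assume x: "x \<in> pts"
  interpret G: group point_group by (rule point_group_group)
  have "inv\<^bsub>point_group\<^esub> x = inver x" using x by (intro G.inv_equality) (simp_all add: point_group_def mul_inver_l
    inver_pts)
  then show ?thesis using G.r_inv[of x] x by (simp add: point_group_def)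
qed

lemma lin_HA_tl:
  assumes b: "bilinear_map HA HA HA \<beta>" and T: "T \<in> carrier HH"
    and e: "\<And>a b. a \<in> HI \<Longrightarrow> b \<in> HI \<Longrightarrow> ev x (\<beta> a b) = f a * f' b" and f: "f \<in> lin HA base_algebra" "f' \<in> lin HA
      base_algebra"
  shows "ev x (tensor_lift HA \<beta> T) = tensor_eval f f' T"
proof -
  have "ev x (tensor_lift HA \<beta> T) = tensor_lift base_algebra (\<lambda>a b. ev x (\<beta> a b)) T"
    by (rule lin_tl[OF HA_kvs HA_kvs HA_kvs base_kvs b ev_lin T])
  also have "\<dots> = tensor_eval f f' T" unfolding tensor_eval_def
    by (rule tl_cong[OF HA_kvs HA_kvs base_kvs bil_compose[OF b ev_lin] T]) (simp add: e)
  finally show ?thesis .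
qed

lemma tl_HA_closed: "bilinear_map HA HA HA \<beta> \<Longrightarrow> T \<in> carrier HH \<Longrightarrow> tensor_lift HA \<beta> T \<in> HI"
  using tl_closed[OF HA_kvs HA_kvs HA_kvs, of \<beta> T] by simp

text \<open>Common form of the counit and antipode laws. After evaluation at \<open>x\<close> such a
  law becomes an identity for the product of \<open>f x\<close> and \<open>f' x\<close>, for
  instance \<open>mul (inver x) x = unit\<close>.\<close>

lemma hopf_unary:
  assumes b: "bilinear_map HA HA HA \<beta>" and h: "h \<in> HI" and r: "r \<in> HI"
    and e: "\<And>x a b. x \<in> pts \<Longrightarrow> a \<in> HI \<Longrightarrow> b \<in> HI \<Longrightarrow> ev x (\<beta> a b) = ev (f x) a * ev (f' x) b"
    and v: "\<And>x. x \<in> pts \<Longrightarrow> ev (mul (f x) (f' x)) h = ev x r"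
  shows "tensor_lift HA \<beta> (\<Delta> h) = r"
proof (rule HI_sep[OF tl_HA_closed[OF b comult_closed[OF h]] r])
  fix x assume x: "x \<in> pts"
  have "ev x (tensor_lift HA \<beta> (\<Delta> h)) = tensor_eval (ev (f x)) (ev (f' x)) (\<Delta> h)"
    by (rule lin_HA_tl[OF b]) (simp_all add: h e x ev_lin)
  then show "ev x (tensor_lift HA \<beta> (\<Delta> h)) = ev x r" by (simp add: tensor_eval_comult h v x)
qed

lemma coassoc_bil_in: "b \<in> HI \<Longrightarrow> bilinear_map HA HA HHH (\<lambda>a' a''. pure_tensor HA HH a' (pt a'' b))"
  by (rule bil_compose2[OF TT.pure_bil, of "\<lambda>a. a" HA "\<lambda>a. pt a b" HA]) (rule linI, auto intro: bil_lin_l[OF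
    TA.pure_bil])

lemma coassoc_param: "T \<in> carrier HH \<Longrightarrow> (\<lambda>b. tensor_lift HHH (\<lambda>a' a''. pure_tensor HA HH a' (pt a'' b)) T) \<in> lin HA
    HHH"
proof (rule tl_param_lin[OF HA_kvs HA_kvs HHH_kvs _ _ HA_kvs])
  fix a a' assume "a \<in> carrier HA" "a' \<in> carrier HA"
  then show "(\<lambda>w. pure_tensor HA HH a (pt a' w)) \<in> lin HA HHH"
    by (intro lin_compose[OF bil_lin_r[OF TA.pure_bil] bil_lin_r[OF TT.pure_bil]])
qed (simp_all add: coassoc_bil_in)

lemma coassoc_bil: "bilinear_map HA HA HHH (\<lambda>a b. tensor_lift HHH (\<lambda>a' a''. pure_tensor HA HH a' (pt a'' b)) (\<Delta> a))"
proof (rule bil_from_lin)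
  fix b assume b: "b \<in> carrier HA"
  show "(\<lambda>a. tensor_lift HHH (\<lambda>a' a''. pure_tensor HA HH a' (pt a'' b)) (\<Delta> a)) \<in> lin HA HHH"
    by (rule lin_compose[OF comult_lin tl_lin[OF HA_kvs HA_kvs HHH_kvs coassoc_bil_in]]) (use b in simp)
qed (simp add: coassoc_param)

lemma pr3_inner:
  assumes f: "f \<in> lin HA base_algebra" "f' \<in> lin HA base_algebra" "k \<in> lin HA base_algebra" and a: "a \<in> HI" and b: "b
    \<in> HI"
  shows "pr3 f f' k (tensor_lift HHH (\<lambda>a' a''. pure_tensor HA HH a' (pt a'' b)) (\<Delta> a)) = tensor_eval f f' (\<Delta> a) * k b"
proof -
  note cb = coassoc_bil_in[OF b] and p3 = pr3_lin[OF f]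
  have "pr3 f f' k (tensor_lift HHH (\<lambda>a' a''. pure_tensor HA HH a' (pt a'' b)) (\<Delta> a))
    = tensor_lift base_algebra (\<lambda>a' a''. pr3 f f' k (pure_tensor HA HH a' (pt a'' b))) (\<Delta> a)"
    by (rule lin_tl[OF HA_kvs HA_kvs HHH_kvs base_kvs cb p3]) (simp add: a)
  also have "\<dots> = tensor_lift base_algebra (\<lambda>a' a''. k b * (f a' * f' a'')) (\<Delta> a)"
    by (rule tl_cong[OF HA_kvs HA_kvs base_kvs bil_compose[OF cb p3]]) (simp_all add: a b pr3_pure[OF f]
      tensor_eval_pure f)
  also have "\<dots> = k b * tensor_eval f f' (\<Delta> a)"
  proof -
    have l: "(\<lambda>v. k b * v) \<in> lin base_algebra base_algebra" by (rule linI) (simp_all add: algebra_simps)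
    show ?thesis unfolding tensor_eval_def
      by (rule lin_tl[OF HA_kvs HA_kvs base_kvs base_kvs lin_base_bil[OF f(1,2)] l, symmetric]) (simp add: a)
  qed
  finally show ?thesis by (simp add: mult.commute)
qed

lemma coassoc_rbil: "bilinear_map HA HA HHH (\<lambda>a b. pure_tensor HA HH a (\<Delta> b))"
  by (rule bil_compose2[OF TT.pure_bil, of "\<lambda>a. a"]) (rule linI, auto intro: comult_lin)

lemma tensor_eval_comult_lin: "f \<in> lin HA base_algebra \<Longrightarrow> f' \<in> lin HA base_algebra \<Longrightarrow>
    (\<lambda>h. tensor_eval f f' (\<Delta> h)) \<in> lin HA base_algebra"
  by (rule lin_compose[OF comult_lin tensor_eval_lin])

text \<open>Arbitrary linear forms are allowed, and not just evaluations, because associativity of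
  convolution uses the same computation.\<close>

lemma pr3_left:
  assumes f: "f \<in> lin HA base_algebra" "f' \<in> lin HA base_algebra" "k \<in> lin HA base_algebra" and h: "h \<in> HI"
  shows "pr3 f f' k (tensor_lift HHH (\<lambda>a b. tensor_lift HHH (\<lambda>a' a''. pure_tensor HA HH a' (pt a'' b)) (\<Delta> a)) (\<Delta> h))
     = tensor_eval (\<lambda>a. tensor_eval f f' (\<Delta> a)) k (\<Delta> h)"
proof -
  have "pr3 f f' k (tensor_lift HHH (\<lambda>a b. tensor_lift HHH (\<lambda>a' a''. pure_tensor HA HH a' (pt a'' b)) (\<Delta> a)) (\<Delta> h))
     = tensor_lift base_algebra (\<lambda>a b. pr3 f f' k (tensor_lift HHH (\<lambda>a' a''. pure_tensor HA HH a' (pt a'' b)) (\<Delta> a)))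
       (\<Delta> h)"
    by (rule lin_tl[OF HA_kvs HA_kvs HHH_kvs base_kvs coassoc_bil pr3_lin[OF f]]) (simp add: h)
  also have "\<dots> = tensor_eval (\<lambda>a. tensor_eval f f' (\<Delta> a)) k (\<Delta> h)" unfolding tensor_eval_def[of "\<lambda>a. tensor_eval f f'
    (\<Delta> a)"]
    by (rule tl_cong[OF HA_kvs HA_kvs base_kvs bil_compose[OF coassoc_bil pr3_lin[OF f]]]) (simp_all add: h
      pr3_inner[OF f])
  finally show ?thesis .
qed

lemma pr3_right:
  assumes f: "f \<in> lin HA base_algebra" "f' \<in> lin HA base_algebra" "k \<in> lin HA base_algebra" and h: "h \<in> HI"
  shows "pr3 f f' k (tensor_lift HHH (\<lambda>a b. pure_tensor HA HH a (\<Delta> b)) (\<Delta> h)) = tensor_eval f (\<lambda>b. tensor_eval f' k (\<Delta>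
    b)) (\<Delta> h)"
proof -
  have "pr3 f f' k (tensor_lift HHH (\<lambda>a b. pure_tensor HA HH a (\<Delta> b)) (\<Delta> h))
     = tensor_lift base_algebra (\<lambda>a b. pr3 f f' k (pure_tensor HA HH a (\<Delta> b))) (\<Delta> h)"
    by (rule lin_tl[OF HA_kvs HA_kvs HHH_kvs base_kvs coassoc_rbil pr3_lin[OF f]]) (simp add: h)
  also have "\<dots> = tensor_eval f (\<lambda>b. tensor_eval f' k (\<Delta> b)) (\<Delta> h)" unfolding tensor_eval_def[of f]
    by (rule tl_cong[OF HA_kvs HA_kvs base_kvs bil_compose[OF coassoc_rbil pr3_lin[OF f]]]) (simp_all add: h
      pr3_pure[OF f])
  finally show ?thesis .
qed

lemma coassoc: "h \<in> HI \<Longrightarrow> tensor_lift HHH (\<lambda>a b. tensor_lift HHH (\<lambda>a' a''. pure_tensor HA HH a' (pt a'' b)) (\<Delta> a)) (\<Delta>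
    h)
  = tensor_lift HHH (\<lambda>a b. pure_tensor HA HH a (\<Delta> b)) (\<Delta> h)"
proof (rule HHH_sep)
  assume h: "h \<in> HI"
  show "tensor_lift HHH (\<lambda>a b. tensor_lift HHH (\<lambda>a' a''. pure_tensor HA HH a' (pt a'' b)) (\<Delta> a)) (\<Delta> h) \<in> carrier HHH"
    "tensor_lift HHH (\<lambda>a b. pure_tensor HA HH a (\<Delta> b)) (\<Delta> h) \<in> carrier HHH"
    by (rule tl_closed[OF HA_kvs HA_kvs HHH_kvs]; simp add: coassoc_bil coassoc_rbil h)+
  fix x y z
  have "tensor_eval (\<lambda>a. tensor_eval (ev x) (ev y) (\<Delta> a)) (ev z) (\<Delta> h) = tensor_eval (ev (mul x y)) (ev z) (\<Delta> h)"
    unfolding tensor_eval_def[of _ "ev z"]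
    by (rule tl_cong[OF HA_kvs HA_kvs base_kvs lin_base_bil[OF tensor_eval_comult_lin[OF ev_lin ev_lin] ev_lin]])
      (simp_all add: h tensor_eval_comult)
  also have "\<dots> = tensor_eval (ev x) (ev (mul y z)) (\<Delta> h)" by (simp add: tensor_eval_comult h mul_assoc)
  also have "\<dots> = tensor_eval (ev x) (\<lambda>b. tensor_eval (ev y) (ev z) (\<Delta> b)) (\<Delta> h)" unfolding tensor_eval_def[of "ev x"]
    by (rule tl_cong[OF HA_kvs HA_kvs base_kvs lin_base_bil[OF ev_lin ev_lin]]) (simp_all add: h tensor_eval_comult)
  finally show "pr3 (ev x) (ev y) (ev z) (tensor_lift HHH (\<lambda>a b. tensor_lift HHH (\<lambda>a' a''. pure_tensor HA HH a' (pt
    a'' b)) (\<Delta> a)) (\<Delta> h))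
    = pr3 (ev x) (ev y) (ev z) (tensor_lift HHH (\<lambda>a b. pure_tensor HA HH a (\<Delta> b)) (\<Delta> h))"
    by (simp only: pr3_left[OF ev_lin ev_lin ev_lin h] pr3_right[OF ev_lin ev_lin ev_lin h])
qed

lemma HA_hopf: "hopf_algebra HA"
  unfolding hopf_algebra_def Let_def
proof (intro conjI ballI)
  show "assoc_algebra HA" by (rule HA.alg)
  show "comult HA \<in> alg_hom HA (tensor_algebra HA HA)" by (rule comult_hom)
  show "counit HA \<in> alg_hom HA base_algebra" using counit_hom by simp
  show "antipode HA \<in> lin HA HA" using antipode_lin by simp
  fix h assume "h \<in> carrier HA"
  then have h: "h \<in> HI" by simp
  show "tensor_lift HHH (\<lambda>a b. tensor_lift HHH (\<lambda>a' a''. pure_tensor HA HH a' (pt a'' b)) (\<Delta> a)) (\<Delta> h)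
    = tensor_lift HHH (\<lambda>a b. pure_tensor HA HH a (\<Delta> b)) (\<Delta> h)" by (rule coassoc[OF h])
  have m: "bilinear_map HA HA HA (\<lambda>a b. f a * f' b)" if "f \<in> lin HA HA" "f' \<in> lin HA HA" for f f'
    using bil_compose2[OF HA.mult_bil that] by simp
  have i: "(\<lambda>a. a) \<in> lin HA HA" by (rule linI) simp_all
  have c: "(\<lambda>a. Cst (const_coeff a)) \<in> lin HA HA" by (rule linI) (simp_all add: C_simps)
  show "tensor_lift HA (\<lambda>a b. counit HA a \<odot>\<^bsub>HA\<^esub> b) (\<Delta> h) = h"
    by (rule hopf_unary[where f = "\<lambda>x. unit" and f' = "\<lambda>x. x"]) (use m[OF c i] h in \<open>simp_all add: ev_simps mul_unit_l
      counit_ev\<close>)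
  show "tensor_lift HA (\<lambda>a b. counit HA b \<odot>\<^bsub>HA\<^esub> a) (\<Delta> h) = h"
    by (rule hopf_unary[where f' = "\<lambda>x. unit" and f = "\<lambda>x. x"]) (use m[OF i c] h in \<open>simp_all add: ev_simps mul_unit_r
      counit_ev mult.commute\<close>)
  show "tensor_lift HA (\<lambda>a b. antipode HA a \<otimes>\<^bsub>HA\<^esub> b) (\<Delta> h) = counit HA h \<odot>\<^bsub>HA\<^esub> \<one>\<^bsub>HA\<^esub>"
    by (rule hopf_unary[where f = "\<lambda>x. inver x" and f' = "\<lambda>x. x"]) (use m[OF antipode_lin i] h in \<open>simp_all add:
      ev_simps mul_inver_l ev_antipode counit_ev\<close>)
  show "tensor_lift HA (\<lambda>a b. a \<otimes>\<^bsub>HA\<^esub> antipode HA b) (\<Delta> h) = counit HA h \<odot>\<^bsub>HA\<^esub> \<one>\<^bsub>HA\<^esub>"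
    by (rule hopf_unary[where f' = "\<lambda>x. inver x" and f = "\<lambda>x. x"]) (use m[OF i antipode_lin] h in \<open>simp_all add:
      ev_simps mul_inver_r ev_antipode counit_ev\<close>)
qed

lemma weight_mi: "m \<in> MI \<Longrightarrow> weight m \<in> mi"
proof -
  have on: "\<alpha> \<in> mi \<Longrightarrow> of_nat k * \<alpha> \<in> mi" for k \<alpha>
    by (induction k) (auto simp: algebra_simps intro: mi_add)
  have "finite T \<Longrightarrow> T \<subseteq> I \<Longrightarrow> (\<Sum>t\<in>T. of_nat (lookup m t) * snd t) \<in> mi" for T
    by (induction T rule: finite_induct) (auto simp: I_def intro!: mi_add on)
  then show "m \<in> MI \<Longrightarrow> weight m \<in> mi" by (simp add: weight_def MI_def)
qed

definition part :: "(nat \<Rightarrow>\<^sub>0 nat) \<Rightarrow> (mon \<Rightarrow>\<^sub>0 'k) \<Rightarrow> (mon \<Rightarrow>\<^sub>0 'k)" where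
  "part \<alpha> h = (\<Sum>m\<in>{m \<in> keys h. weight m = \<alpha>}. single m (lookup h m))"

lemma lookup_part: "lookup (part \<alpha> h) m = (if weight m = \<alpha> then lookup h m else 0)"
  by (auto simp: part_def lookup_sum lookup_single when_def in_keys_iff)

lemma HA_finsum: "finite S \<Longrightarrow> (\<And>s. s \<in> S \<Longrightarrow> f s \<in> HI) \<Longrightarrow> finsum HA f S = sum f S"
proof (induction S rule: finite_induct)
  case empty then show ?case using HA.finsum_empty by simp
next
  case (insert s S)
  have "finsum HA f (insert s S) = f s \<oplus>\<^bsub>HA\<^esub> finsum HA f S"
    by (rule HA.finsum_insert) (use insert in auto)
  then show ?case using insert by simp
qed

lemma HC_sub: "submodule class_ring (HC \<alpha>) HA"
  by (rule HA.submoduleI') (auto simp: HC_HI HC_C_mult)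

lemma HA_graded_space: "graded_space n HA HC"
  unfolding graded_space_def
proof (intro conjI ballI)
  show "vectorspace class_ring HA" by (rule HA.vs)
  show "VectorSpace.subspace class_ring (HC \<alpha>) HA" for \<alpha> by (rule HA.submodule_sp[OF HC_sub])
  fix h assume "h \<in> carrier HA"
  then have h: "h \<in> HI" by simp
  \<comment> \<open>Components of different weights have disjoint monomials, so the coefficient of
    \<open>m\<close> sees only the component of its own weight. Existence and uniqueness of the
    decomposition both rest on this.\<close>
  have look: "lookup (\<Sum>\<alpha>\<in>S. d \<alpha>) m = (if weight m \<in> S then lookup (d (weight m)) m else 0)"
    if "finite S" "S \<subseteq> mi" "d \<in> (\<Pi>\<^sub>E \<alpha>\<in>mi. HC \<alpha>)" for S d m
  proof -
    have "lookup (d \<alpha>) m = 0" if "\<alpha> \<in> S" "weight m \<noteq> \<alpha>" for \<alpha>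
      using that \<open>S \<subseteq> mi\<close> \<open>d \<in> _\<close> by (fastforce simp: HC_def in_keys_iff PiE_def Pi_def)
    then have "lookup (\<Sum>\<alpha>\<in>S. d \<alpha>) m = (\<Sum>\<alpha>\<in>S. if \<alpha> = weight m then lookup (d (weight m)) m else 0)"
      unfolding lookup_sum by (intro sum.cong) auto
    then show ?thesis using that by simp
  qed
  define d where "d = (\<lambda>\<alpha>\<in>mi. part \<alpha> h)"
  have dc: "d \<in> (\<Pi>\<^sub>E \<alpha>\<in>mi. HC \<alpha>)"
    using h by (auto simp: d_def HC_def lookup_part in_keys_iff HI_def split: if_splits)
  have fin: "finite {\<alpha> \<in> mi. d \<alpha> \<noteq> \<zero>\<^bsub>HA\<^esub>}"
  proof (rule finite_subset)
    show "{\<alpha> \<in> mi. d \<alpha> \<noteq> \<zero>\<^bsub>HA\<^esub>} \<subseteq> weight ` keys h"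
    proof
      fix \<alpha> assume "\<alpha> \<in> {\<alpha> \<in> mi. d \<alpha> \<noteq> \<zero>\<^bsub>HA\<^esub>}"
      then have "part \<alpha> h \<noteq> 0" by (auto simp: d_def)
      then have "\<exists>m. lookup (part \<alpha> h) m \<noteq> 0" by (metis poly_mapping_eqI lookup_zero)
      then obtain m where "lookup (part \<alpha> h) m \<noteq> 0" ..
      then show "\<alpha> \<in> weight ` keys h" by (auto simp: lookup_part in_keys_iff split: if_splits)
    qed
  qed simp
  have fs: "finsum HA e S = sum e S" if "finite S" "S \<subseteq> mi" "e \<in> (\<Pi>\<^sub>E \<alpha>\<in>mi. HC \<alpha>)" for e S
    by (rule HA_finsum[OF that(1)]) (meson HC_HI PiE_mem subsetD that)
  show "\<exists>!d. d \<in> (\<Pi>\<^sub>E \<alpha>\<in>mi. HC \<alpha>) \<and> finite {\<alpha> \<in> mi. d \<alpha> \<noteq> \<zero>\<^bsub>HA\<^esub>} \<and> h = (\<Oplus>\<^bsub>HA\<^esub>\<alpha>\<in>{\<alpha> \<in> mi. d \<alpha> \<noteq> \<zero>\<^bsub>HA\<^esub>}. d \<alpha>)"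
  proof (rule ex1I[of _ d], intro conjI dc fin)
    have "lookup h m = lookup (\<Sum>\<alpha>\<in>{\<alpha> \<in> mi. d \<alpha> \<noteq> \<zero>\<^bsub>HA\<^esub>}. d \<alpha>) m" for m
    proof (cases "m \<in> keys h")
      case True
      then have "m \<in> MI" using h by (auto simp: HI_def MI_def)
      then have "weight m \<in> mi" by (rule weight_mi)
      moreover have "lookup (d (weight m)) m = lookup h m" using calculation by (simp add: d_def lookup_part)
      moreover have "d (weight m) \<noteq> \<zero>\<^bsub>HA\<^esub>" using calculation True by (auto simp: in_keys_iff)
      ultimately show ?thesis using dc fin by (subst look) auto
    next
      case False
      then show ?thesis using dc fin by (subst look) (auto simp: d_def lookup_part in_keys_iff)
    qed
    then show "h = (\<Oplus>\<^bsub>HA\<^esub>\<alpha>\<in>{\<alpha> \<in> mi. d \<alpha> \<noteq> \<zero>\<^bsub>HA\<^esub>}. d \<alpha>)"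
      using dc fin by (subst fs) (auto intro: poly_mapping_eqI)
  next
    fix e assume e: "e \<in> (\<Pi>\<^sub>E \<alpha>\<in>mi. HC \<alpha>) \<and> finite {\<alpha> \<in> mi. e \<alpha> \<noteq> \<zero>\<^bsub>HA\<^esub>} \<and> h = (\<Oplus>\<^bsub>HA\<^esub>\<alpha>\<in>{\<alpha> \<in> mi. e \<alpha> \<noteq> \<zero>\<^bsub>HA\<^esub>}. e \<alpha>)"
    then have he: "h = (\<Sum>\<alpha>\<in>{\<alpha> \<in> mi. e \<alpha> \<noteq> \<zero>\<^bsub>HA\<^esub>}. e \<alpha>)" using fs[of "{\<alpha> \<in> mi. e \<alpha> \<noteq> \<zero>\<^bsub>HA\<^esub>}" e] by auto
    show "e = d"
    proof
      fix \<alpha>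
      show "e \<alpha> = d \<alpha>"
      proof (cases "\<alpha> \<in> mi")
        case True
        show ?thesis
        proof (rule poly_mapping_eqI)
          fix m
          have hm: "lookup h m = (if weight m \<in> {\<alpha> \<in> mi. e \<alpha> \<noteq> \<zero>\<^bsub>HA\<^esub>} then lookup (e (weight m)) m else 0)"
            unfolding he by (rule look) (use e in auto)
          have "e \<alpha> \<in> HC \<alpha>" using e True by auto
          then have "weight m \<noteq> \<alpha> \<Longrightarrow> lookup (e \<alpha>) m = 0" by (auto simp: HC_def in_keys_iff)
          then show "lookup (e \<alpha>) m = lookup (d \<alpha>) m"
            using hm True by (auto simp: d_def lookup_part split: if_splits)
        qed
      qed (use e in \<open>auto simp: d_def PiE_def extensional_def\<close>)
    qed
  qed
qed

lemma comult_graded: "h \<in> HC \<alpha> \<Longrightarrow> \<Delta> h \<in> lin_span HH {pt b c |b c \<beta> \<gamma>. \<beta> + \<gamma> = \<alpha> \<and> b \<in> HC \<beta> \<and> c \<in> HC \<gamma>}"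
proof -
  let ?S = "{pt b c |b c \<beta> \<gamma>. \<beta> + \<gamma> = \<alpha> \<and> b \<in> HC \<beta> \<and> c \<in> HC \<gamma>}"
  have S: "?S \<subseteq> carrier HH" using HC_HI by (auto intro!: TA.pure_closed)
  assume h: "h \<in> HC \<alpha>"
  show ?thesis unfolding comult_to_tensor to_tensor_def
  proof (rule TS.finsum_in_sub[OF TS.span_sub[OF S]], simp, rule TS.span_smult[OF S], rule TS.span_in[OF S])
    fix s assume "s \<in> keys (Del h)"
    then have "fst s \<in> MI" "snd s \<in> MI" "weight (fst s) + weight (snd s) = \<alpha>" using Del_HHC[OF h]
      by (auto simp: HHC_def)
    moreover have "X m \<in> HC (weight m)" if "m \<in> MI" for m using that by (auto simp: HC_def X_def MI_def)
    ultimately show "pt (X (fst s)) (X (snd s)) \<in> ?S" by blast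
  qed
qed

lemma HA_graded: "graded_hopf_algebra n HA HC"
  unfolding graded_hopf_algebra_def
  using HA_hopf HA_graded_space HC_1 HC_mult comult_graded HC_const_coeff pev_HC[OF _ anti_HC] by simp

lemma HA_comm: "commutative_algebra HA" by (simp add: commutative_algebra_def mult.commute)

lemma weight_lookup: "t \<in> I \<Longrightarrow> \<exists>\<beta>. weight m = of_nat (lookup m t) * snd t + \<beta>"
proof (cases "t \<in> keys m")
  case True
  then show ?thesis unfolding weight_def by (subst sum.remove[OF _ True]) auto
qed (auto simp: in_keys_iff)

text \<open>The exponent of each variable in such a monomial is a summand of \<alpha>, and being
  nonzero it limits the multiplicity to \<open>mdeg \<alpha>\<close>. Finitely many variables and
  multiplicities remain.\<close>

lemma finite_MI_weight: "finite {m \<in> MI. weight m = \<alpha>}"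
proof -
  define T where "T = {..<p} \<times> fst ` splits \<alpha>"
  have fT: "finite T" by (simp add: T_def)
  have on: "mdeg (of_nat k * \<beta>) = k * mdeg \<beta>" for k \<beta> by (induction k) (auto simp: algebra_simps)
  have k: "keys m \<subseteq> T \<and> (\<forall>t. lookup m t \<le> mdeg \<alpha>)" if mm: "m \<in> MI" "weight m = \<alpha>" for m
  proof
    show "keys m \<subseteq> T"
    proof
      fix t assume t: "t \<in> keys m"
      then obtain \<beta> where "\<alpha> = snd t + \<beta>" using weight_remove[OF t] mm by blast
      moreover have "t \<in> I" using t mm by (auto simp: MI_def)
      ultimately show "t \<in> T" by (cases t) (auto simp: T_def I_def splits_def image_iff)
    qed
    show "\<forall>t. lookup m t \<le> mdeg \<alpha>"
    proof
      fix t
      show "lookup m t \<le> mdeg \<alpha>"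
      proof (cases "t \<in> keys m")
        case True
        then have t: "t \<in> I" using mm by (auto simp: MI_def)
        then obtain \<beta> where "\<alpha> = of_nat (lookup m t) * snd t + \<beta>" using weight_lookup[OF t, of m] mm by blast
        then have "mdeg \<alpha> \<ge> lookup m t * mdeg (snd t)" by (simp add: on)
        moreover have "mdeg (snd t) \<ge> 1" using t mdeg_0_iff[of "snd t"] by (cases "mdeg (snd t)") (auto simp: I_def)
        ultimately show ?thesis by (metis mult.right_neutral mult_le_mono2 order.trans)
      qed (simp add: in_keys_iff)
    qed
  qed
  have "finite ((\<lambda>m. restrict (lookup m) T) ` {m \<in> MI. weight m = \<alpha>})"
  proof (rule finite_subset)
    show "(\<lambda>m. restrict (lookup m) T) ` {m \<in> MI. weight m = \<alpha>} \<subseteq> (\<Pi>\<^sub>E t\<in>T. {..mdeg \<alpha>})"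
      using k by (intro image_subsetI) (simp add: Pi_def restrict_PiE_iff)
    show "finite (\<Pi>\<^sub>E t\<in>T. {..mdeg \<alpha>})" using fT by (intro finite_PiE) auto
  qed
  moreover have "inj_on (\<lambda>m. restrict (lookup m) T) {m \<in> MI. weight m = \<alpha>}"
  proof (rule inj_onI)
    fix m m' assume m: "m \<in> {m \<in> MI. weight m = \<alpha>}" "m' \<in> {m \<in> MI. weight m = \<alpha>}"
      and e: "restrict (lookup m) T = restrict (lookup m') T"
    show "m = m'"
    proof (rule poly_mapping_eqI)
      fix t
      show "lookup m t = lookup m' t"
      proof (cases "t \<in> T")
        case True then show ?thesis using fun_cong[OF e, of t] by simp
      next
        case False
        then have "t \<notin> keys m" "t \<notin> keys m'" using k m by blast+
        then show ?thesis by (simp add: in_keys_iff)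
      qed
    qed
  qed
  ultimately show ?thesis by (rule finite_imageD)
qed

lemma HC_fin_dim: "vectorspace.fin_dim class_ring (HA\<lparr>carrier := HC \<alpha>\<rparr>)"
proof -
  let ?V = "HA\<lparr>carrier := HC \<alpha>\<rparr>"
  have k: "kvs ?V" by (rule kvs.intro, rule vsI) (simp_all add: HC_0 HC_add HC_C_mult C_simps algebra_simps, simp_all
    add: HC_C_mult mult.commute[of _ "Cst _"])
  interpret V: kvs ?V by (rule k)
  define S where "S = X ` {m \<in> MI. weight m = \<alpha>}"
  have S: "finite S" "S \<subseteq> carrier ?V" unfolding S_def by (auto simp: finite_MI_weight) (auto simp: HC_def X_def
    MI_def)
  have "h \<in> lin_span ?V S" if "keys h \<subseteq> {m. keys m \<subseteq> I \<and> weight m = \<alpha>}" for h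
    using that
  proof (induction rule: pm_induct)
    case zero show ?case using V.span_zero[OF S(2)] by simp
  next
    case (single m c)
    have "c \<odot>\<^bsub>?V\<^esub> X m \<in> lin_span ?V S" using single by (intro V.span_smult[OF S(2)] V.span_in[OF S(2)]) (auto simp:
      S_def MI_def)
    moreover have "single m c = Cst c * X m" by (simp add: X_def Cst_def mult_single)
    ultimately show ?case by simp
  next
    case (add a b) then show ?case using V.span_add[OF S(2)] by simp
  qed
  then have "lin_span ?V S = carrier ?V" using V.span_carrier[OF S(2)] by (auto simp: HC_def)
  then show ?thesis unfolding vectorspace.fin_dim_def[OF V.vs] using S by blast
qed

section \<open>Characters\<close>

abbreviation "CG \<equiv> character_group HA"

definition char_of_point :: "(var \<Rightarrow> 'k) \<Rightarrow> ((mon \<Rightarrow>\<^sub>0 'k) \<Rightarrow> 'k)" where "char_of_point x = restrict (ev x) HI"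

lemma alg_hom_restrict: assumes f: "f \<in> alg_hom HA base_algebra" shows "restrict f HI \<in> alg_hom HA base_algebra"
  using lin_add[OF alg_hom_lin[OF f]] lin_smult[OF alg_hom_lin[OF f]] alg_hom_mult[OF f] alg_hom_one[OF f]
  by (intro alg_homI linI) simp_all

lemma char_of_point_carrier: "char_of_point x \<in> carrier CG"
  by (simp add: character_group_def char_of_point_def alg_hom_restrict[OF ev_hom])

text \<open>Polynomials are generated by their variables, so an algebra morphism is the evaluation
  at the point formed by its values on them. Hence every character comes from a point.\<close>

lemma char_ev: assumes f: "f \<in> alg_hom HA base_algebra" and h: "h \<in> HI"
  shows "f h = ev (\<lambda>t. if t \<in> I then f (Xv t) else 0) h" (is "_ = ev ?x h")
proof -
  have fm: "f (a * b) = f a * f b" if "a \<in> HI" "b \<in> HI" for a b using alg_hom_mult[OF f, of a b] that by simp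
  have fa: "f (a + b) = f a + f b" if "a \<in> HI" "b \<in> HI" for a b using lin_add[OF alg_hom_lin[OF f], of a b] that
    by simp
  have f1: "f 1 = 1" using alg_hom_one[OF f] by simp
  have fC: "f (Cst c * a) = c * f a" if "a \<in> HI" for a c using lin_smult[OF alg_hom_lin[OF f], of a c] that by simp
  have f0: "f 0 = 0" using fC[of 0 0] by simp
  have m: "f (X m) = mev ?x m" if "keys m \<subseteq> I" for m
    using that
  proof (induction rule: pm_induct)
    case zero show ?case using f1 by (simp add: X_def)
  next
    case (single t k)
    have "Xv t ^ k = X (single t k)"
      by (induction k) (simp_all add: X_def Xv_def mult_single single_add[symmetric])
    moreover have "Xv t ^ k \<in> HI \<and> f (Xv t ^ k) = f (Xv t) ^ k" using single by (induction k) (simp_all add: f1 fm)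
    ultimately show ?case using single by simp
  next
    case (add m m')
    have "X (m + m') = X m * X m'" by (simp add: X_def mult_single)
    then show ?case using add by (simp add: mev_add fm MI_def)
  qed
  from h show ?thesis
    by (induction rule: HI_induct) (simp_all add: f0 fa fC m ev_simps ev_X MI_def)
qed

lemma char_of_point_mult: "char_of_point x \<otimes>\<^bsub>CG\<^esub> char_of_point y = char_of_point (mul x y)"
proof
  fix h
  show "(char_of_point x \<otimes>\<^bsub>CG\<^esub> char_of_point y) h = char_of_point (mul x y) h"
  proof (cases "h \<in> HI")
    case True
    have "(char_of_point x \<otimes>\<^bsub>CG\<^esub> char_of_point y) h = tensor_lift base_algebra (\<lambda>a b. char_of_point x a *
      char_of_point y b) (\<Delta> h)"
      using True by (simp add: character_group_def)
    also have "\<dots> = tensor_eval (ev x) (ev y) (\<Delta> h)" unfolding tensor_eval_def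
      by (rule tl_cong[OF HA_kvs HA_kvs base_kvs lin_base_bil[OF ev_lin ev_lin], symmetric]) (simp_all add: True
        char_of_point_def)
    finally show ?thesis using True by (simp add: tensor_eval_comult char_of_point_def)
  qed (simp add: character_group_def char_of_point_def)
qed

lemma char_of_point_iso: "char_of_point \<in> iso point_group CG"
proof (rule isoI)
  show "char_of_point \<in> hom point_group CG" by (rule homI) (simp_all add: char_of_point_carrier char_of_point_mult
    point_group_def)
  show "bij_betw char_of_point (carrier point_group) (carrier CG)"
  proof (rule bij_betw_imageI)
    show "inj_on char_of_point (carrier point_group)"
    proof (rule inj_onI, rule ext)
      fix x y t assume "x \<in> carrier point_group" "y \<in> carrier point_group" and e: "char_of_point x = char_of_point y"
      then have xy: "x \<in> pts" "y \<in> pts" by (simp_all add: point_group_def)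
      show "x t = y t"
      proof (cases "t \<in> I")
        case True
        then show ?thesis using fun_cong[OF e, of "Xv t"] by (simp add: char_of_point_def ev_simps)
      qed (use xy in \<open>cases t, simp add: pts_def\<close>)
    qed
    show "char_of_point ` carrier point_group = carrier CG"
    proof (intro equalityI subsetI)
      fix f assume "f \<in> carrier CG"
      then have f: "f \<in> alg_hom HA base_algebra" "f \<in> extensional HI" by (simp_all add: character_group_def)
      then have "f = char_of_point (\<lambda>t. if t \<in> I then f (Xv t) else 0)"
        by (intro ext) (auto simp: char_of_point_def extensional_def char_ev[OF f(1), symmetric])
      then show "f \<in> char_of_point ` carrier point_group" by (rule image_eqI[where x = "\<lambda>t.
        if t \<in> I then f (Xv t) else 0"]) (simp add: point_group_def pts_def)
    qed (auto simp: char_of_point_carrier)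
  qed
qed

lemma group_of_point_iso: "group_of_point \<in> iso point_group G"
proof (rule isoI)
  show "group_of_point \<in> hom point_group G" by (rule homI) (simp_all add: group_of_point_carrier group_of_point_mult,
    simp add: point_group_def group_of_point_mult[symmetric])
  show "bij_betw group_of_point (carrier point_group) (carrier G)"
    using group_of_point_inj group_of_point_surj group_of_point_carrier by (auto simp: bij_betw_def point_group_def)
qed

lemma G_CG: "G \<cong> CG"
proof -
  have "point_group \<cong> G" "point_group \<cong> CG" using group_of_point_iso char_of_point_iso by (auto simp: is_iso_def)
  then show ?thesis using group.iso_sym[OF point_group_group] iso_trans by blast
qed

end

lemma mon_induct [case_names zero add]:
  assumes "P 0" "\<And>m s. P m \<Longrightarrow> P (m + single s 1)"
  shows "P (m :: 'v \<Rightarrow>\<^sub>0 nat)"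
proof -
  have s: "P m \<Longrightarrow> P (m + single s k)" for m s k
  proof (induction k)
    case (Suc k)
    have "m + single s (Suc k) = (m + single s k) + single s 1"
      by (simp add: add.assoc single_add[symmetric])
    then show ?case using assms(2) Suc by metis
  qed simp
  have "\<forall>m'. P m' \<longrightarrow> P (m' + m)"
  proof (induction m rule: pm_induct0)
    case (add a b) then show ?case by (metis add.assoc)
  qed (auto simp: s)
  then show ?thesis using assms(1) by (metis add_0)
qed

definition mon_deg :: "('v \<Rightarrow>\<^sub>0 nat) \<Rightarrow> nat" where "mon_deg m = sum (lookup m) (keys m)"

lemma mon_deg_add: "mon_deg (m + m') = mon_deg m + mon_deg m'" unfolding mon_deg_def
    by (rule setsum_keys_plus_distrib) auto
lemma mon_deg_single [simp]: "mon_deg (single t k) = k" by (simp add: mon_deg_def)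
lemma mon_deg_0 [simp]: "mon_deg 0 = 0" by (simp add: mon_deg_def)

section \<open>Linear forms on the Hopf algebra\<close>

context gB begin

text \<open>Linear forms are kept as total functions here; restriction to the carrier enters only
  for elements of the graded dual.\<close>

definition linform :: "((mon \<Rightarrow>\<^sub>0 'k) \<Rightarrow> 'k) \<Rightarrow> bool" where "linform f \<longleftrightarrow> f \<in> lin HA base_algebra"

lemma linform_ev [simp]: "linform (ev x)" by (simp add: linform_def ev_lin)
lemma linform_const_coeff [simp]: "linform const_coeff" by (simp add: linform_def counit_lin)
lemma linform_lin_coeff [simp]: "linform (lin_coeff t)" unfolding linform_def by (rule linI) simp_all
lemma linform_restrict [simp]: "linform (restrict f HI) \<longleftrightarrow> linform f"
  unfolding linform_def by (rule lin_cong[OF HA_kvs]) simp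

lemma linform_add: "linform f \<Longrightarrow> a \<in> HI \<Longrightarrow> b \<in> HI \<Longrightarrow> f (a + b) = f a + f b"
  and linform_smult: "linform f \<Longrightarrow> a \<in> HI \<Longrightarrow> f (Cst c * a) = c * f a"
  using lin_add[of f HA base_algebra a b] lin_smult[of f HA base_algebra a c] by (simp_all add: linform_def)
lemma linform_smult_r: "linform f \<Longrightarrow> a \<in> HI \<Longrightarrow> f (a * Cst c) = c * f a"
  using linform_smult[of f a c] by (simp add: mult.commute)
lemma linform_0: "linform f \<Longrightarrow> f 0 = 0" using linform_smult[of f 0 0] by simp
lemma HI_sum: "(\<And>s. s \<in> S \<Longrightarrow> a s \<in> HI) \<Longrightarrow> sum a S \<in> HI"
  by (induction S rule: infinite_finite_induct) auto

lemma PP_HI [simp]: "PP i \<alpha> \<delta> \<in> HI" by (rule HC_HI[OF PP_HC])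

lemma flI: "(\<And>a b. a \<in> HI \<Longrightarrow> b \<in> HI \<Longrightarrow> f (a + b) = f a + f b) \<Longrightarrow> (\<And>c a. a \<in> HI \<Longrightarrow> f (Cst c * a) = c * f a) \<Longrightarrow> linform f"
  unfolding linform_def by (rule linI) simp_all

lemma linform_ext: "linform f \<Longrightarrow> linform f' \<Longrightarrow> (\<And>m. m \<in> MI \<Longrightarrow> f (X m) = f' (X m)) \<Longrightarrow> h \<in> HI \<Longrightarrow> f h = f' h"
proof -
  assume a: "linform f" "linform f'" "\<And>m. m \<in> MI \<Longrightarrow> f (X m) = f' (X m)" "h \<in> HI"
  from a(4) show ?thesis by (induction rule: HI_induct) (simp_all add: a(1-3) linform_0 linform_add linform_smult)
qed

lemma tensor_eval_cong: "linform f \<Longrightarrow> linform f' \<Longrightarrow> T \<in> carrier HH \<Longrightarrow> (\<And>a. a \<in> HI \<Longrightarrow> f a = k a) \<Longrightarrow> (\<And>a. a \<in> HI \<Longrightarrow>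
    f' a = k' a) \<Longrightarrow> tensor_eval f f' T = tensor_eval k k' T"
  unfolding tensor_eval_def linform_def by (rule tl_cong[OF HA_kvs HA_kvs base_kvs lin_base_bil]) simp_all

lemma tensor_eval_restrict [simp]: "linform f \<Longrightarrow> linform f' \<Longrightarrow> T \<in> carrier HH \<Longrightarrow> tensor_eval (restrict f HI) f' T =
    tensor_eval f f' T"
  "linform f \<Longrightarrow> linform f' \<Longrightarrow> T \<in> carrier HH \<Longrightarrow> tensor_eval f (restrict f' HI) T = tensor_eval f f' T"
  by (rule tensor_eval_cong; simp)+

lemma tensor_eval_add_l: "linform f \<Longrightarrow> linform f' \<Longrightarrow> linform k \<Longrightarrow> T \<in> carrier HH \<Longrightarrow> tensor_eval (\<lambda>a. f a + f' a) k T =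
    tensor_eval f k T + tensor_eval f' k T"
proof -
  assume a: "linform f" "linform f'" "linform k" "T \<in> carrier HH"
  have s: "linform (\<lambda>a. f a + f' a)" using a by (intro flI) (simp_all add: linform_add linform_smult linform_smult_r
    algebra_simps)
  show ?thesis
    using TA.lin_eq_tensor[OF tensor_eval_lin lin_add_fun[OF base_kvs tensor_eval_lin tensor_eval_lin] _ a(4), of "\<lambda>a.
      f a + f' a" k f k f' k] a s
    by (simp add: linform_def tensor_eval_pure algebra_simps)
qed

lemma tensor_eval_add_r: "linform f \<Longrightarrow> linform f' \<Longrightarrow> linform k \<Longrightarrow> T \<in> carrier HH \<Longrightarrow> tensor_eval k (\<lambda>a. f a + f' a) T =
    tensor_eval k f T + tensor_eval k f' T"
proof -
  assume a: "linform f" "linform f'" "linform k" "T \<in> carrier HH"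
  have s: "linform (\<lambda>a. f a + f' a)" using a by (intro flI) (simp_all add: linform_add linform_smult linform_smult_r
    algebra_simps)
  show ?thesis
    using TA.lin_eq_tensor[OF tensor_eval_lin lin_add_fun[OF base_kvs tensor_eval_lin tensor_eval_lin] _ a(4), of k
      "\<lambda>a. f a + f' a" k f k f'] a s
    by (simp add: linform_def tensor_eval_pure algebra_simps)
qed

lemma linform_scale: "linform f \<Longrightarrow> linform (\<lambda>a. c * f a)" by (intro flI) (simp_all add: linform_add linform_smult
    linform_smult_r algebra_simps)
lemma linform_plus: "linform f \<Longrightarrow> linform f' \<Longrightarrow> linform (\<lambda>a. f a + f' a)"
    by (intro flI) (simp_all add: linform_add linform_smult linform_smult_r algebra_simps)

lemma tensor_eval_smult_l: "linform f \<Longrightarrow> linform k \<Longrightarrow> T \<in> carrier HH \<Longrightarrow> tensor_eval (\<lambda>a. c * f a) k T = c * tensor_eval f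
    k T"
proof -
  assume a: "linform f" "linform k" "T \<in> carrier HH"
  show ?thesis
    using TA.lin_eq_tensor[OF tensor_eval_lin lin_smult_fun[OF base_kvs tensor_eval_lin] _ a(3), of "\<lambda>a. c * f a" k f
      k c] a linform_scale[OF a(1), of c]
    by (simp add: linform_def tensor_eval_pure algebra_simps)
qed

lemma tensor_eval_smult_r: "linform f \<Longrightarrow> linform k \<Longrightarrow> T \<in> carrier HH \<Longrightarrow> tensor_eval k (\<lambda>a. c * f a) T = c * tensor_eval k
    f T"
proof -
  assume a: "linform f" "linform k" "T \<in> carrier HH"
  show ?thesis
    using TA.lin_eq_tensor[OF tensor_eval_lin lin_smult_fun[OF base_kvs tensor_eval_lin] _ a(3), of k "\<lambda>a. c * f a" k
      f c] a linform_scale[OF a(1), of c]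
    by (simp add: linform_def tensor_eval_pure algebra_simps)
qed

section \<open>Convolution of linear forms\<close>

definition conv where "conv f f' h = tensor_eval f f' (\<Delta> h)"

lemma linform_conv: "linform f \<Longrightarrow> linform f' \<Longrightarrow> linform (conv f f')"
  using tensor_eval_comult_lin[of f f'] unfolding linform_def conv_def .

lemma conv_assoc: "linform f \<Longrightarrow> linform f' \<Longrightarrow> linform k \<Longrightarrow> h \<in> HI \<Longrightarrow> conv (conv f f') k h = conv f (conv f' k) h"
  unfolding conv_def[abs_def] linform_def by (simp only: pr3_left[symmetric] pr3_right[symmetric] coassoc)

text \<open>The left-invariant operator \<open>(f \<otimes> id) \<circ> \<Delta>\<close>, adjoint to the left convolution by \<open>f\<close>.\<close>

definition der where "der f h = tensor_lift HA (\<lambda>a b. Cst (f a) * b) (\<Delta> h)"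

lemma der_bil: "linform f \<Longrightarrow> bilinear_map HA HA HA (\<lambda>a b. Cst (f a) * b)"
  by (rule bilinearI) (simp_all add: linform_add linform_smult linform_smult_r C_simps algebra_simps)

lemma der_closed [simp]: "linform f \<Longrightarrow> h \<in> HI \<Longrightarrow> der f h \<in> HI"
  unfolding der_def by (rule tl_HA_closed[OF der_bil]) simp_all

lemma tensor_eval_der: "linform f \<Longrightarrow> linform k \<Longrightarrow> h \<in> HI \<Longrightarrow> k (der f h) = conv f k h"
proof -
  assume a: "linform f" "linform k" "h \<in> HI"
  have "k (der f h) = tensor_lift base_algebra (\<lambda>v w. k (Cst (f v) * w)) (\<Delta> h)"
    unfolding der_def using a by (intro lin_tl[OF HA_kvs HA_kvs HA_kvs base_kvs der_bil]) (simp_all add: linform_def)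
  also have "\<dots> = conv f k h" unfolding conv_def tensor_eval_def
    using a by (intro tl_cong[OF HA_kvs HA_kvs base_kvs bil_compose[OF der_bil]]) (simp_all add: linform_def
      linform_smult[unfolded linform_def])
  finally show ?thesis .
qed

lemma der_eqI: "linform f \<Longrightarrow> h \<in> HI \<Longrightarrow> r \<in> HI \<Longrightarrow> (\<And>x. conv f (ev x) h = ev x r) \<Longrightarrow> der f h = r"
  by (rule HI_sep) (simp_all add: tensor_eval_der)

lemma conv_const_coeff_l: "linform k \<Longrightarrow> h \<in> HI \<Longrightarrow> conv const_coeff k h = k h"
proof -
  assume a: "linform k" "h \<in> HI"
  have "der const_coeff h = h"
    using HA_hopf a unfolding der_def hopf_algebra_def Let_def by simp
  then show ?thesis using tensor_eval_der[of const_coeff k h] a by simp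
qed

lemma conv_const_coeff_r: "linform k \<Longrightarrow> h \<in> HI \<Longrightarrow> conv k const_coeff h = k h"
proof -
  assume a: "linform k" "h \<in> HI"
  have b: "bilinear_map HA HA HA (\<lambda>a b. Cst (const_coeff b) * a)"
    by (rule bilinearI) (simp_all add: C_simps algebra_simps)
  have h: "tensor_lift HA (\<lambda>a b. Cst (const_coeff b) * a) (\<Delta> h) = h"
    using HA_hopf a unfolding hopf_algebra_def Let_def by simp
  have "k (tensor_lift HA (\<lambda>a b. Cst (const_coeff b) * a) (\<Delta> h)) = tensor_lift base_algebra (\<lambda>v w. k (Cst (const_coeff
    w) * v)) (\<Delta> h)"
    using a by (intro lin_tl[OF HA_kvs HA_kvs HA_kvs base_kvs b]) (simp_all add: linform_def)
  also have "\<dots> = conv k const_coeff h" unfolding conv_def tensor_eval_def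
    using a by (intro tl_cong[OF HA_kvs HA_kvs base_kvs bil_compose[OF b]]) (simp_all add: linform_def
      linform_smult[unfolded linform_def])
  finally show ?thesis using h by simp
qed

lemma conv_1: "linform f \<Longrightarrow> linform k \<Longrightarrow> conv f k 1 = f 1 * k 1"
  using alg_hom_one[OF comult_hom] by (simp add: conv_def tensor_eval_pure linform_def)

text \<open>Derivations along the counit, that is, tangent vectors of the group at the unit.\<close>

definition counit_der where "counit_der f \<longleftrightarrow> linform f \<and> (\<forall>a\<in>HI. \<forall>b\<in>HI. f (a * b) = f a * const_coeff b +
    const_coeff a * f b)"

lemma counit_der_linform: "counit_der f \<Longrightarrow> linform f" by (simp add: counit_der_def)
lemma counit_der_mult: "counit_der f \<Longrightarrow> a \<in> HI \<Longrightarrow> b \<in> HI \<Longrightarrow> f (a * b) = f a * const_coeff b + const_coeff a * f b"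
    by (simp add: counit_der_def)
lemma counit_der_1: "counit_der f \<Longrightarrow> f 1 = 0" using counit_der_mult[of f 1 1] by simp
lemma counit_der_lin_coeff [simp]: "counit_der (lin_coeff t)" by (simp add: counit_der_def lin_coeff_mult)

text \<open>A derivation at the unit tensored with the evaluation at \<open>x\<close> is a
  derivation of the tensor square along the pair \<open>(unit, x)\<close>; bilinearity reduces this
  to pure tensors.\<close>

lemma tensor_eval_counit_der_mult:
  assumes f: "counit_der f" and S: "S \<in> carrier HH" and T: "T \<in> carrier HH"
  shows "tensor_eval f (ev x) (S \<otimes>\<^bsub>TA.AB\<^esub> T) = tensor_eval f (ev x) S * tensor_eval const_coeff (ev x) T +
    tensor_eval const_coeff (ev x) S * tensor_eval f (ev x) T"
proof -
  note bm = TA.AB_mult_bil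
  have linform: "f \<in> lin HA base_algebra" using f by (simp add: counit_der_def linform_def)
  note p = tensor_eval_lin[OF linform ev_lin, of x] and pc = tensor_eval_lin[OF counit_lin ev_lin, of x]
  have l1: "(\<lambda>S. tensor_eval f (ev x) (S \<otimes>\<^bsub>TA.AB\<^esub> T)) \<in> lin HH base_algebra" if "T \<in> carrier HH" for T
    by (rule lin_compose[OF bil_lin_l[OF bm that] p])
  have l2: "(\<lambda>T. tensor_eval f (ev x) (S \<otimes>\<^bsub>TA.AB\<^esub> T)) \<in> lin HH base_algebra" if "S \<in> carrier HH" for S
    by (rule lin_compose[OF bil_lin_r[OF bm that] p])
  have l3: "(\<lambda>S. tensor_eval f (ev x) S * c + tensor_eval const_coeff (ev x) S * d) \<in> lin HH base_algebra" for c d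
    by (rule linI) (simp_all add: lin_add[OF p] lin_add[OF pc] lin_smult[OF p] lin_smult[OF pc] algebra_simps)
  have l4: "(\<lambda>S. d * tensor_eval const_coeff (ev x) S + c * tensor_eval f (ev x) S) \<in> lin HH base_algebra" for c d
    by (rule linI) (simp_all add: lin_add[OF p] lin_add[OF pc] lin_smult[OF p] lin_smult[OF pc] algebra_simps)
  have "tensor_eval f (ev x) (pt a b \<otimes>\<^bsub>TA.AB\<^esub> T) = tensor_eval f (ev x) (pt a b) * tensor_eval const_coeff (ev x) T +
    tensor_eval const_coeff (ev x) (pt a b) * tensor_eval f (ev x) T"
    if ab: "a \<in> HI" "b \<in> HI" for a b
    by (rule TA.lin_eq_tensor[OF l2 l4 _ T])
      (use ab in \<open>simp_all add: TA.AB_pure tensor_eval_pure linform ev_lin counit_lin counit_der_mult[OF f] ev_simps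
        algebra_simps\<close>)
  then show ?thesis
    by (intro TA.lin_eq_tensor[OF l1[OF T] l3 _ S]) simp
qed

text \<open>At a point, \<open>der f\<close> is the infinitesimal left translation in the direction
  \<open>f\<close>. The coproduct being multiplicative, it inherits the Leibniz rule of
  \<open>f\<close>.\<close>

lemma der_mult: "counit_der f \<Longrightarrow> a \<in> HI \<Longrightarrow> b \<in> HI \<Longrightarrow> der f (a * b) = der f a * b + a * der f b"
proof (rule der_eqI)
  assume f: "counit_der f" and ab: "a \<in> HI" "b \<in> HI"
  show "linform f" "a * b \<in> HI" "der f a * b + a * der f b \<in> HI" using f ab by (simp_all add: counit_der_linform)
  fix x
  have "conv f (ev x) (a * b) = conv f (ev x) a * conv const_coeff (ev x) b + conv const_coeff (ev x) a * conv f (ev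
    x) b"
    using alg_hom_mult[OF comult_hom, of a b] ab by (simp add: conv_def tensor_eval_counit_der_mult[OF f])
  then show "conv f (ev x) (a * b) = ev x (der f a * b + a * der f b)"
    using f ab by (simp add: conv_const_coeff_l ev_simps tensor_eval_der counit_der_linform)
qed

lemma der_add: "linform f \<Longrightarrow> a \<in> HI \<Longrightarrow> b \<in> HI \<Longrightarrow> der f (a + b) = der f a + der f b"
  by (rule der_eqI) (simp_all add: linform_conv linform_add ev_simps tensor_eval_der)

lemma der_smult: "linform f \<Longrightarrow> a \<in> HI \<Longrightarrow> der f (Cst c * a) = Cst c * der f a"
  by (rule der_eqI) (simp_all add: linform_conv linform_smult ev_simps tensor_eval_der)

lemma der_1: "counit_der f \<Longrightarrow> der f 1 = 0"
  by (rule der_eqI) (simp_all add: counit_der_linform conv_1 counit_der_1 ev_simps)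

lemma to_tensor_inl_inr: "a \<in> HI \<Longrightarrow> b \<in> HI \<Longrightarrow> keys (inl a * inr b) \<subseteq> MI \<times> MI \<and> to_tensor (inl a * inr b) = pt a b"
proof -
  assume ab: "a \<in> HI" "b \<in> HI"
  have k: "keys (inl a * inr b) \<subseteq> MI \<times> MI"
  proof -
    have 1: "keys (inl a) \<subseteq> MI \<times> {0}" using ab(1)
      by (induction rule: HI_induct) (auto simp: rhom.rho_0[OF inl_rhom] rhom.rho_add[OF inl_rhom] keys_add_sub X_def
        Cst_def mult_single inl_single)
    have 2: "keys (inr b) \<subseteq> {0} \<times> MI" using ab(2)
      by (induction rule: HI_induct) (auto simp: rhom.rho_0[OF inr_rhom] rhom.rho_add[OF inr_rhom] keys_add_sub X_def
        Cst_def mult_single inr_single)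
    show ?thesis using keys_mult[of "inl a" "inr b"] 1 2 by force
  qed
  moreover have "to_tensor (inl a * inr b) = pt a b"
    by (rule HH_sep) (use ab k in \<open>simp_all add: lin_closed[OF to_tensor_lin] tensor_eval_to_tensor tensor_eval_pure
      ev_lin rhom.rho_mult[OF ev2_rhom] ev2_inl ev2_inr\<close>)
  ultimately show ?thesis by blast
qed

lemma to_tensor_add: "keys S \<subseteq> MI \<times> MI \<Longrightarrow> keys T \<subseteq> MI \<times> MI \<Longrightarrow> to_tensor (S + T) = to_tensor S \<oplus>\<^bsub>HH\<^esub> to_tensor T"
  using lin_add[OF to_tensor_lin, of S T] by simp

text \<open>Forms such as \<open>lin_coeff\<close> are not evaluations, so \<open>ev2_Del\<close>
  does not apply; the coproduct of a variable is paired with them term by term in the tensor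
  space.\<close>

lemma conv_Xv: "(i, \<gamma>) \<in> I \<Longrightarrow> linform f \<Longrightarrow> linform k \<Longrightarrow> conv f k (Xv (i, \<gamma>)) = f (Xv (i, \<gamma>)) * k 1 + (\<Sum>(\<alpha>, \<delta>)\<in>nsplits \<gamma>.
    f (PP i \<alpha> \<delta>) * k (Xv (i, \<alpha>)))"
proof -
  assume t: "(i, \<gamma>) \<in> I" and f: "linform f" "linform k"
  note pl = tensor_eval_lin[OF f[unfolded linform_def]]
  have s: "keys (\<Sum>(\<alpha>, \<delta>)\<in>S. inl (PP i \<alpha> \<delta>) * inr (Xv (i, \<alpha>))) \<subseteq> MI \<times> MI \<and>
     tensor_eval f k (to_tensor (\<Sum>(\<alpha>, \<delta>)\<in>S. inl (PP i \<alpha> \<delta>) * inr (Xv (i, \<alpha>)))) = (\<Sum>(\<alpha>, \<delta>)\<in>S. f (PP i \<alpha> \<delta>) * k (Xv (i,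
       \<alpha>)))"
    if "finite S" "S \<subseteq> nsplits \<gamma>" for S
    using that
  proof (induction S rule: finite_induct)
    case empty
    have "to_tensor 0 = \<zero>\<^bsub>HH\<^esub>" using lin_zero[OF free_kvs TS.kvs_axioms to_tensor_lin] by simp
    then show ?case using lin_zero[OF TS.kvs_axioms base_kvs pl] by simp
  next
    case (insert u S)
    obtain \<alpha> \<delta> where u: "u = (\<alpha>, \<delta>)" by (cases u)
    then have a: "(i, \<alpha>) \<in> I" using split_I[OF t] insert.prems by auto
    have ab: "PP i \<alpha> \<delta> \<in> HI" "Xv (i, \<alpha>) \<in> HI" using a by simp_all
    note ki = to_tensor_inl_inr[OF ab]
    show ?case using insert ki ab lin_add[OF pl] lin_closed[OF to_tensor_lin]
      by (simp add: u keys_add_sub to_tensor_add tensor_eval_pure f[unfolded linform_def])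
  qed
  have t': "Xv (i, \<gamma>) \<in> HI" using t by simp
  have i1: "inl (Xv (i, \<gamma>)) = inl (Xv (i, \<gamma>)) * inr 1" by (simp add: rhom.rho_1[OF inr_rhom])
  note ki = to_tensor_inl_inr[OF t' HI_1, folded i1] and sn = s[OF finite_nsplits order.refl]
  show ?thesis unfolding conv_def comult_to_tensor Del_V
    using ki sn lin_add[OF pl] lin_closed[OF to_tensor_lin] t'
    by (simp add: to_tensor_add tensor_eval_pure f[unfolded linform_def])
qed

text \<open>The part of positive degree of the derivative of a coordinate.\<close>

definition shift_part :: "var \<Rightarrow> var \<Rightarrow> (mon \<Rightarrow>\<^sub>0 'k)" where
  "shift_part t s = (\<Sum>(\<alpha>, \<delta>)\<in>nsplits (snd s). if \<delta> = snd t then Cst ((if fst s = fst t then 1 else 0) +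
    A (fst t) \<alpha>) * Xv (fst s, \<alpha>) else 0)"

lemma shift_part_HI: "s \<in> I \<Longrightarrow> shift_part t s \<in> HI"
  unfolding shift_part_def using split_I[of "fst s" "snd s"] by (auto intro!: HI_sum)

lemma conv_lin_coeff_Xv: "t \<in> I \<Longrightarrow> s \<in> I \<Longrightarrow> linform k \<Longrightarrow> conv (lin_coeff t) k (Xv s) = (if s = t then k 1 else 0) +
    (\<Sum>(\<alpha>, \<delta>)\<in>nsplits (snd s). if \<delta> = snd t then ((if fst s = fst t then 1 else 0) + A (fst t) \<alpha>) * k (Xv (fst s, \<alpha>))
      else 0)"
proof -
  assume a: "t \<in> I" "s \<in> I" "linform k"
  show ?thesis
    using conv_Xv[of "fst s" "snd s" "lin_coeff t" k] a lin_coeff_PP[of "fst t" "snd t" "fst s"]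
    by (auto simp: lin_coeff_V intro!: sum.cong)
qed

lemma der_Xv: "t \<in> I \<Longrightarrow> s \<in> I \<Longrightarrow> der (lin_coeff t) (Xv s) = (if s = t then 1 else 0) + shift_part t s"
proof (rule der_eqI)
  assume a: "t \<in> I" "s \<in> I"
  show "linform (lin_coeff t)" "Xv s \<in> HI" "(if s = t then 1 else 0) + shift_part t s \<in> HI" using a
    by (simp_all add: shift_part_HI)
  fix x
  show "conv (lin_coeff t) (ev x) (Xv s) = ev x ((if s = t then 1 else 0) + shift_part t s)"
    using a by (auto simp: conv_lin_coeff_Xv shift_part_def ev_simps case_prod_unfold intro!: sum.cong)
qed

text \<open>Filtration by the number of factors of a monomial. It differs from the weight, for which
  the Hopf algebra is graded, and is the one that makes the pairing triangular.\<close>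

definition deg_ge :: "nat \<Rightarrow> (mon \<Rightarrow>\<^sub>0 'k) set" where "deg_ge k = {h. keys h \<subseteq> {m \<in> MI. mon_deg m \<ge> k}}"

lemma deg_ge_HI: "h \<in> deg_ge k \<Longrightarrow> h \<in> HI" by (auto simp: deg_ge_def HI_def MI_def)
lemma deg_ge_0: "0 \<in> deg_ge k" by (simp add: deg_ge_def)
lemma deg_ge_add: "a \<in> deg_ge k \<Longrightarrow> b \<in> deg_ge k \<Longrightarrow> a + b \<in> deg_ge k" by (simp add: deg_ge_def keys_add_sub)
lemma deg_ge_mult: "a \<in> deg_ge k \<Longrightarrow> b \<in> deg_ge l \<Longrightarrow> a * b \<in> deg_ge (k + l)"
proof -
  assume f: "a \<in> deg_ge k" "b \<in> deg_ge l"
  show ?thesis unfolding deg_ge_def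
  proof (rule CollectI, rule subsetI)
    fix m assume "m \<in> keys (a * b)"
    then obtain u v where uv: "u \<in> keys a" "v \<in> keys b" "m = u + v" using keys_mult[of a b] by blast
    then have "u \<in> MI" "v \<in> MI" "mon_deg u \<ge> k" "mon_deg v \<ge> l" using f by (auto simp: deg_ge_def)
    with uv show "m \<in> {m \<in> MI. mon_deg m \<ge> k + l}" by (simp add: MI_def keys_add_sub mon_deg_add)
  qed
qed
lemma deg_ge_C: "a \<in> deg_ge k \<Longrightarrow> Cst c * a \<in> deg_ge k" using deg_ge_mult[of "Cst c" 0 a k]
    by (auto simp: deg_ge_def Cst_def MI_def)
lemma deg_ge_X: "m \<in> MI \<Longrightarrow> X m \<in> deg_ge (mon_deg m)" by (simp add: deg_ge_def X_def)
lemma deg_ge_Xv: "t \<in> I \<Longrightarrow> Xv t \<in> deg_ge (Suc 0)" by (auto simp: deg_ge_def Xv_def MI_def)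
lemma deg_ge_sum: "(\<And>s. s \<in> S \<Longrightarrow> f s \<in> deg_ge k) \<Longrightarrow> sum f S \<in> deg_ge k"
  by (induction S rule: infinite_finite_induct) (auto simp: deg_ge_0 deg_ge_add)

lemma shift_part_deg_ge: "s \<in> I \<Longrightarrow> shift_part t s \<in> deg_ge (Suc 0)"
  unfolding shift_part_def using split_I[of "fst s" "snd s"] by (auto intro!: deg_ge_sum deg_ge_C deg_ge_Xv deg_ge_0)

lemma X_add: "X (a + b) = X a * X b" by (simp add: X_def mult_single)
lemma X_single: "X (single t 1) = Xv t" by (simp add: X_def Xv_def)
lemma X_0: "X 0 = 1" by (simp add: X_def)

text \<open>Leibniz rule, one variable at a time. On a variable, \<open>der\<close> gives the
  partial derivative plus \<open>shift_part\<close>, which does not lower the number of factors;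
  these contributions are collected in \<open>r\<close>.\<close>

lemma der_X: "t \<in> I \<Longrightarrow> m \<in> MI \<Longrightarrow> \<exists>r\<in>deg_ge (mon_deg m). der (lin_coeff t) (X m) = Cst (of_nat (lookup m t)) * X (m -
    single t 1) + r"
proof (induction m rule: mon_induct)
  case zero
  then show ?case using deg_ge_0 by (auto simp: X_0 der_1 C_simps)
next
  case (add m s)
  have ms: "m \<in> MI" "s \<in> I" using add.prems by (simp_all only: MI_add_single)
  obtain r where r: "r \<in> deg_ge (mon_deg m)" "der (lin_coeff t) (X m) = Cst (of_nat (lookup m t)) * X (m - single t 1)
    + r"
    using add.IH add.prems ms by blast
  define r' where "r' = r * Xv s + X m * shift_part t s"
  have r': "r' \<in> deg_ge (mon_deg (m + single s 1))"
    unfolding r'_def mon_deg_add using deg_ge_mult[OF r(1) deg_ge_Xv[OF ms(2)]] deg_ge_mult[OF deg_ge_X[OF ms(1)]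
      shift_part_deg_ge[OF ms(2)]] by (simp add: deg_ge_add)
  have "der (lin_coeff t) (X (m + single s 1)) = der (lin_coeff t) (X m) * Xv s + X m * der (lin_coeff t) (Xv s)"
    using ms by (simp only: X_add X_single) (simp add: der_mult)
  also have "\<dots> = Cst (of_nat (lookup m t)) * (X (m - single t 1) * Xv s) + (if s = t then X m else 0) + r'"
    using add.prems ms by (simp add: r(2) der_Xv r'_def algebra_simps)
  also have "Cst (of_nat (lookup m t)) * (X (m - single t 1) * Xv s) + (if s = t then X m else 0)
    = Cst (of_nat (lookup (m + single s 1) t)) * X (m + single s 1 - single t 1)"
  proof (cases "lookup m t = 0")
    \<comment> \<open>Subtraction of exponents is truncated: if \<open>t\<close> does not occur in
      \<open>m\<close>, then \<open>m - single t 1\<close> is \<open>m\<close>, but its coefficient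
      is zero.\<close>
    case True
    have "s = t \<Longrightarrow> m + single s 1 - single t 1 = m" by simp
    then show ?thesis using True by (auto simp: lookup_add lookup_single when_def C_simps)
  next
    case False
    then have *: "m - single t 1 + single s 1 = m + single s 1 - single t 1"
      by (intro poly_mapping_eqI, cases "s = t") (auto simp: lookup_add lookup_minus lookup_single when_def)
    have "X (m - single t 1) * Xv s = X (m + single s 1 - single t 1)"
      by (simp only: X_single[symmetric] X_add[symmetric] *)
    moreover have "s = t \<Longrightarrow> X (m + single s 1 - single t 1) = X m" by simp
    ultimately show ?thesis by (auto simp: lookup_add lookup_single when_def C_simps algebra_simps)
  qed
  finally show ?case using r' add.prems by blast
qed

section \<open>The graded dual\<close>

abbreviation "DA \<equiv> graded_dual_algebra (p + q) HA HC"
abbreviation "GD \<equiv> graded_dual (p + q) HA HC"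

definition supp :: "((mon \<Rightarrow>\<^sub>0 'k) \<Rightarrow> 'k) \<Rightarrow> (nat \<Rightarrow>\<^sub>0 nat) set" where "supp f = {\<alpha> \<in> mi. \<exists>h\<in>HC \<alpha>. f h \<noteq> 0}"

lemma DA_carrier: "f \<in> carrier DA \<longleftrightarrow> linform f \<and> f \<in> extensional HI \<and> finite (supp f)"
  by (auto simp: graded_dual_algebra_def linform_def supp_def)

lemma DA_simps [simp]: "f \<otimes>\<^bsub>DA\<^esub> f' = restrict (conv f f') HI" "\<one>\<^bsub>DA\<^esub> = restrict const_coeff HI" "\<zero>\<^bsub>DA\<^esub> = (\<lambda>h\<in>HI. 0)"
  "f \<oplus>\<^bsub>DA\<^esub> f' = (\<lambda>h\<in>HI. f h + f' h)" "c \<odot>\<^bsub>DA\<^esub> f = (\<lambda>h\<in>HI. c * f h)"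
  by (simp_all add: graded_dual_algebra_def conv_def[abs_def] tensor_eval_def)

lemma DA_linform: "f \<in> carrier DA \<Longrightarrow> linform f" by (simp add: DA_carrier)

lemma supp_restrict [simp]: "supp (restrict f HI) = supp f"
  by (auto simp: supp_def HC_HI)

lemma DA_restrict: "linform f \<Longrightarrow> finite (supp f) \<Longrightarrow> restrict f HI \<in> carrier DA"
  by (simp add: DA_carrier)

lemma DA_eqI: "f \<in> carrier DA \<Longrightarrow> f' \<in> carrier DA \<Longrightarrow> (\<And>h. h \<in> HI \<Longrightarrow> f h = f' h) \<Longrightarrow> f = f'"
  by (rule extensionalityI[where A = HI]) (auto simp: DA_carrier)

text \<open>The degrees in \<open>comult_graded\<close> are not restricted to \<open>mi\<close>. An
  element on which a linear form is nonzero has a monomial, and the weight of that monomial lies in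
  \<open>mi\<close>.\<close>

lemma HC_mi: "b \<in> HC \<beta> \<Longrightarrow> f b \<noteq> 0 \<Longrightarrow> linform f \<Longrightarrow> \<beta> \<in> supp f"
proof -
  assume b: "b \<in> HC \<beta>" "f b \<noteq> 0" "linform f"
  then have "b \<noteq> 0" using linform_0 by auto
  then obtain m where "m \<in> keys b" by fastforce
  then have "m \<in> MI" "weight m = \<beta>" using b(1) by (auto simp: HC_def MI_def)
  then show ?thesis using weight_mi b by (auto simp: supp_def)
qed

lemma conv_supp: "linform f \<Longrightarrow> linform f' \<Longrightarrow> supp (conv f f') \<subseteq> (\<lambda>(\<alpha>, \<beta>). \<alpha> + \<beta>) ` (supp f \<times> supp f')"
proof (rule subsetI, rule ccontr)
  fix \<gamma> assume f: "linform f" "linform f'" and g: "\<gamma> \<in> supp (conv f f')" "\<gamma> \<notin> (\<lambda>(\<alpha>, \<beta>). \<alpha> + \<beta>) ` (supp f \<times> supp f')"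
  let ?S = "{pt b c |b c \<beta> \<delta>. \<beta> + \<delta> = \<gamma> \<and> b \<in> HC \<beta> \<and> c \<in> HC \<delta>}"
  have S: "?S \<subseteq> carrier HH" using HC_HI by (auto intro!: TA.pure_closed)
  obtain h where h: "h \<in> HC \<gamma>" "conv f f' h \<noteq> 0" using g(1) by (auto simp: supp_def)
  have "f b * f' c = 0" if "\<beta> + \<delta> = \<gamma>" "b \<in> HC \<beta>" "c \<in> HC \<delta>" for b c \<beta> \<delta>
    using HC_mi[OF that(2)] HC_mi[OF that(3)] that(1) f g(2) by fastforce
  then have z: "tensor_eval f f' s = 0" if "s \<in> ?S" for s
    using that f HC_HI by (auto simp: tensor_eval_pure linform_def)
  have l: "tensor_eval f f' \<in> lin HH base_algebra" using f by (simp add: linform_def tensor_eval_lin)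
  have "tensor_eval f f' (\<Delta> h) = 0"
    using comult_graded[OF h(1)] S
    by (induction rule: TS.span_induct)
      (simp_all add: z lin_zero[OF TS.kvs_axioms base_kvs l] lin_add[OF l] lin_smult[OF l])
  then show False using h(2) by (simp add: conv_def)
qed

lemma DA_conv: "f \<in> carrier DA \<Longrightarrow> f' \<in> carrier DA \<Longrightarrow> restrict (conv f f') HI \<in> carrier DA"
  by (intro DA_restrict linform_conv) (auto simp: DA_carrier intro: finite_subset[OF conv_supp])

lemma supp_add: "supp (\<lambda>h. f h + f' h) \<subseteq> supp f \<union> supp f'"
  by (force simp: supp_def)
lemma supp_scale: "supp (\<lambda>h. c * f h) \<subseteq> supp f"
  by (auto simp: supp_def)
lemma supp_const_coeff: "supp const_coeff \<subseteq> {0}"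
  using HC_const_coeff by (auto simp: supp_def)
lemma supp_0: "supp (\<lambda>h. 0) = {}"
  by (auto simp: supp_def)

lemma linform_zero: "linform (\<lambda>h. 0)" by (rule flI) simp_all

lemma DA_closed: "f \<in> carrier DA \<Longrightarrow> f' \<in> carrier DA \<Longrightarrow> (\<lambda>h\<in>HI. f h + f' h) \<in> carrier DA"
  "f \<in> carrier DA \<Longrightarrow> (\<lambda>h\<in>HI. c * f h) \<in> carrier DA" "restrict const_coeff HI \<in> carrier DA" "(\<lambda>h\<in>HI. 0) \<in> carrier DA"
  using finite_subset[OF supp_add[of f f']] finite_subset[OF supp_scale[of c f]] finite_subset[OF supp_const_coeff]
  by (simp_all add: DA_carrier linform_plus linform_scale linform_zero supp_0)

lemma DA_undef: "f \<in> carrier DA \<Longrightarrow> h \<notin> HI \<Longrightarrow> f h = undefined"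
  by (simp add: DA_carrier extensional_def)

lemma DA_kvs: "kvs DA"
  by (rule kvs.intro, rule vsI) (simp_all add: DA_closed, (rule ext, simp add: restrict_def algebra_simps DA_undef)+)

lemma conv_add_l: "linform f \<Longrightarrow> linform f' \<Longrightarrow> linform k \<Longrightarrow> h \<in> HI \<Longrightarrow> conv (\<lambda>a. f a + f' a) k h = conv f k h + conv f' k h"
  and conv_add_r: "linform f \<Longrightarrow> linform f' \<Longrightarrow> linform k \<Longrightarrow> h \<in> HI \<Longrightarrow> conv k (\<lambda>a. f a + f' a) h = conv k f h + conv k f' h"
  and conv_smult_l: "linform f \<Longrightarrow> linform k \<Longrightarrow> h \<in> HI \<Longrightarrow> conv (\<lambda>a. c * f a) k h = c * conv f k h"
  and conv_smult_r: "linform f \<Longrightarrow> linform k \<Longrightarrow> h \<in> HI \<Longrightarrow> conv k (\<lambda>a. c * f a) h = c * conv k f h"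
  by (simp_all add: conv_def tensor_eval_add_l tensor_eval_add_r tensor_eval_smult_l tensor_eval_smult_r)

lemma conv_restrict [simp]: "linform f \<Longrightarrow> linform f' \<Longrightarrow> h \<in> HI \<Longrightarrow> conv (restrict f HI) f' h = conv f f' h"
  "linform f \<Longrightarrow> linform f' \<Longrightarrow> h \<in> HI \<Longrightarrow> conv f (restrict f' HI) h = conv f f' h"
  by (simp_all add: conv_def)

lemma DA_kalg: "kalg DA"
proof (rule kalgI[OF DA_kvs])
  show "bilinear_map DA DA DA (mult DA)"
    by (rule bilinearI) (auto simp: DA_conv DA_linform linform_plus linform_scale conv_add_l conv_add_r conv_smult_l
      conv_smult_r)
  show "\<one>\<^bsub>DA\<^esub> \<in> carrier DA" by (simp add: DA_closed)
  show "x \<otimes>\<^bsub>DA\<^esub> y \<otimes>\<^bsub>DA\<^esub> z = x \<otimes>\<^bsub>DA\<^esub> (y \<otimes>\<^bsub>DA\<^esub> z)" if "x \<in> carrier DA" "y \<in> carrier DA" "z \<in> carrier DA" for x y z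
    using that by (auto simp: DA_linform linform_conv conv_assoc)
  show "\<one>\<^bsub>DA\<^esub> \<otimes>\<^bsub>DA\<^esub> x = x" "x \<otimes>\<^bsub>DA\<^esub> \<one>\<^bsub>DA\<^esub> = x" if "x \<in> carrier DA" for x
    by (rule DA_eqI; use that in \<open>simp add: DA_conv DA_closed DA_linform conv_const_coeff_l conv_const_coeff_r\<close>; use
      that in \<open>auto simp: DA_carrier\<close>)+
qed

sublocale DA: kalg DA by (rule DA_kalg)
sublocale TD: ktalg DA DA by unfold_locales

text \<open>The basis element \<open>f_i(\<alpha>)\<close> corresponds to the tangent vector
  \<open>lin_coeff (i, \<alpha>)\<close>, without any normalising factor.\<close>

definition lie_form :: "(var \<Rightarrow>\<^sub>0 'k) \<Rightarrow> (mon \<Rightarrow>\<^sub>0 'k) \<Rightarrow> 'k" where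
  "lie_form x h = (\<Sum>t\<in>keys x. lookup x t * lin_coeff t h)"

lemma lie_form_lin: "(\<lambda>x. lie_form x h) \<in> lin (free_module UNIV) base_algebra"
  using kvs.lc_lin[OF base_kvs, of UNIV "\<lambda>t. lin_coeff t h"] by (simp add: lie_form_def)

lemma lie_form_add: "lie_form (x + y) = (\<lambda>h. lie_form x h + lie_form y h)"
  using lin_add[OF lie_form_lin, of x y] by auto
lemma lie_form_scale: "lie_form (Poly_Mapping.map ((*) c) x) = (\<lambda>h. c * lie_form x h)"
  using lin_smult[OF lie_form_lin, of x c] by auto
lemma lie_form_single: "lie_form (single t c) = (\<lambda>h. c * lin_coeff t h)"
  by (rule ext) (simp add: lie_form_def)
lemma lie_form_0: "lie_form 0 = (\<lambda>h. 0)" by (simp add: lie_form_def[abs_def])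
lemma lie_form_diff: "lie_form (x - y) = (\<lambda>h. lie_form x h - lie_form y h)"
  using lie_form_add[of "x - y" y] by (auto simp: fun_eq_iff)

lemma linform_lie_form [simp]: "linform (lie_form x)"
  by (induction x rule: pm_induct0) (simp_all add: lie_form_0 lie_form_single lie_form_add linform_zero linform_scale
    linform_plus)

lemma counit_der_plus: "counit_der f \<Longrightarrow> counit_der f' \<Longrightarrow> counit_der (\<lambda>h. f h + f' h)"
  and counit_der_minus: "counit_der f \<Longrightarrow> counit_der f' \<Longrightarrow> counit_der (\<lambda>h. f h - f' h)"
  and counit_der_scale: "counit_der f \<Longrightarrow> counit_der (\<lambda>h. c * f h)"
  using linform_plus[of f "\<lambda>h. -1 * f' h"] linform_scale[of f' "-1"]
  by (auto simp: counit_der_def linform_plus linform_scale algebra_simps)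

lemma counit_der_lie_form [simp]: "counit_der (lie_form x)"
proof (induction x rule: pm_induct0)
  case zero then show ?case by (simp add: lie_form_0 counit_der_def linform_zero)
qed (simp_all add: lie_form_single lie_form_add counit_der_scale counit_der_plus)

text \<open>The Leibniz rule splits products, so a derivation at the unit is determined by the
  variables. Equality of brackets can thus be tested there.\<close>

lemma counit_der_ext:
  assumes f: "counit_der f" "counit_der f'" and e: "\<And>t. t \<in> I \<Longrightarrow> f (Xv t) = f' (Xv t)" and h: "h \<in> HI"
  shows "f h = f' h"
proof (rule linform_ext[OF counit_der_linform[OF f(1)] counit_der_linform[OF f(2)] _ h])
  show "m \<in> MI \<Longrightarrow> f (X m) = f' (X m)" for m
  proof (induction m rule: mon_induct)
    case zero then show ?case using f by (simp add: X_0 counit_der_1)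
  next
    case (add m s)
    have "m \<in> MI" "s \<in> I" using add.prems by (simp_all only: MI_add_single)
    then show ?case using add.IH by (simp only: X_add X_single) (simp add: counit_der_mult[OF f(1)] counit_der_mult[OF
      f(2)] e)
  qed
qed

text \<open>The convolution of two derivations fails to be a derivation only by the mixed terms.
  These are symmetric in \<open>f\<close> and \<open>f'\<close>, so the commutator is again a
  derivation.\<close>

lemma conv_counit_der_mult: "counit_der f \<Longrightarrow> counit_der f' \<Longrightarrow> a \<in> HI \<Longrightarrow> b \<in> HI \<Longrightarrow>
   conv f f' (a * b) = conv f f' a * const_coeff b + f a * f' b + f' a * f b + const_coeff a * conv f f' b"
proof -
  assume a: "counit_der f" "counit_der f'" "a \<in> HI" "b \<in> HI"
  note linform = counit_der_linform[OF a(1)] counit_der_linform[OF a(2)]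
  have c: "const_coeff (der f h) = f h" if "h \<in> HI" for h using tensor_eval_der[OF linform(1) linform_const_coeff
    that] conv_const_coeff_r[OF linform(1) that] by simp
  show ?thesis
    using a linform by (simp add: tensor_eval_der[symmetric] der_mult linform_add counit_der_mult c)
qed

lemma counit_der_bracket: "counit_der f \<Longrightarrow> counit_der f' \<Longrightarrow> counit_der (\<lambda>h. conv f f' h - conv f' f h)"
  using linform_plus[of "conv f f'" "\<lambda>h. -1 * conv f' f h"] linform_scale[of "conv f' f" "-1"]
  by (auto simp: counit_der_def[of "\<lambda>h. conv f f' h - conv f' f h"] conv_counit_der_mult linform_conv
    counit_der_linform algebra_simps)

text \<open>Only the splitting \<open>(\<alpha>, \<beta>)\<close> of the exponent of
  \<open>s\<close> pairs with both forms, and its contribution is given by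
  \<open>lin_coeff_PP\<close>.\<close>

lemma conv_lin_coeff_lin_coeff: "(j, \<beta>) \<in> I \<Longrightarrow> (i, \<alpha>) \<in> I \<Longrightarrow> s \<in> I \<Longrightarrow> conv (lin_coeff (j, \<beta>)) (lin_coeff (i, \<alpha>)) (Xv s) =
   (if s = (i, \<alpha> + \<beta>) then (if i = j then 1 else 0) + A j \<alpha> else 0)"
proof -
  assume a: "(j, \<beta>) \<in> I" "(i, \<alpha>) \<in> I" "s \<in> I"
  obtain k \<gamma> where s: "s = (k, \<gamma>)" by (cases s)
  have c: "conv (lin_coeff (j, \<beta>)) (lin_coeff (i, \<alpha>)) (Xv s) = (\<Sum>u\<in>nsplits \<gamma>. if u = (\<alpha>, \<beta>) then
    if k = i then (if k = j then 1 else 0) + A j \<alpha> else 0 else 0)"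
    unfolding conv_lin_coeff_Xv[OF a(1) a(3)[unfolded s] linform_lin_coeff] lin_coeff_1 s
    by (rule trans[OF arg_cong2[of _ 0 _ _ "(+)"]]) (auto simp: lin_coeff_V intro!: sum.cong sum.neutral simp del:
      sum.delta sum.delta')
  show ?thesis
    unfolding c using a by (simp add: s nsplits_iff I_def)
qed

text \<open>On basis elements the extra unit of the convolution is present only for
  \<open>i = j\<close>. It then sits at the coordinate \<open>(i, \<alpha> + \<beta>)\<close> in
  both orders and cancels, leaving the difference of the two pre-Lie products.\<close>

lemma lie_form_bracket_X: "keys x \<subseteq> I \<Longrightarrow> keys y \<subseteq> I \<Longrightarrow> s \<in> I \<Longrightarrow>
  lie_form (gm x y - gm y x) (Xv s) = conv (lie_form x) (lie_form y) (Xv s) - conv (lie_form y) (lie_form x) (Xv s)"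
proof (induction x rule: pm_induct)
  case zero show ?case using conv_smult_l[of "\<lambda>_. 0" "lie_form y" "Xv s" 0] conv_smult_r[of "\<lambda>_. 0" "lie_form y" "Xv
    s" 0] zero by (simp add: lie_form_0 linform_zero)
next
  case (single t c)
  from single(2) show ?case
  proof (induction y rule: pm_induct)
    case zero show ?case using conv_smult_l[of "\<lambda>_. 0" "lie_form (single t c)" "Xv s" 0] conv_smult_r[of "\<lambda>_. 0"
      "lie_form (single t c)" "Xv s" 0] single by (simp add: lie_form_0 linform_zero)
  next
    case (single u d)
    obtain j \<beta> i \<alpha> where "t = (j, \<beta>)" "u = (i, \<alpha>)" by (cases t, cases u) auto
    then show ?case using single \<open>t \<in> I\<close> \<open>s \<in> I\<close>
      by (auto simp: gm_single lie_form_diff lie_form_single conv_smult_l conv_smult_r linform_scale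
        conv_lin_coeff_lin_coeff lin_coeff_V add.commute algebra_simps)
  next
    case (add P R)
    then show ?case using \<open>s \<in> I\<close>
      by (simp add: gm_add lie_form_diff lie_form_add conv_add_l conv_add_r algebra_simps)
  qed
next
  case (add P R)
  then show ?case by (simp add: gm_add lie_form_diff lie_form_add conv_add_l conv_add_r algebra_simps)
qed

definition hat where "hat x = restrict (lie_form x) HI"

lemma supp_lin_coeff: "supp (lin_coeff t) \<subseteq> {snd t}"
  by (auto simp: supp_def HC_def lin_coeff_def in_keys_iff weight_single)

lemma supp_lie_form: "finite (supp (lie_form x))"
  by (induction x rule: pm_induct0)
    (auto simp: lie_form_0 supp_0 lie_form_single lie_form_add intro: finite_subset[OF supp_add] finite_subset[OF
      supp_scale] finite_subset[OF supp_lin_coeff])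

lemma hat_closed [simp]: "hat x \<in> carrier DA" unfolding hat_def by (simp add: DA_restrict supp_lie_form)

lemma hat_lin: "hat \<in> lin gL DA"
  by (rule linI) (auto simp: hat_def[of "_ + _"] hat_def[of "Poly_Mapping.map _ _"] lie_form_add lie_form_scale, auto
    simp: hat_def)

lemma DA_minus: "f \<in> carrier DA \<Longrightarrow> f' \<in> carrier DA \<Longrightarrow> f \<ominus>\<^bsub>DA\<^esub> f' = (\<lambda>h\<in>HI. f h - f' h)"
  by (auto simp: a_minus_def DA.ksm_m1[symmetric])

lemma hat_bracket: "x \<in> carrier gL \<Longrightarrow> y \<in> carrier gL \<Longrightarrow> hat (x \<otimes>\<^bsub>gL\<^esub> y) = hat x \<otimes>\<^bsub>DA\<^esub> hat y \<ominus>\<^bsub>DA\<^esub> hat y \<otimes>\<^bsub>DA\<^esub> hat x"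
proof -
  assume xy: "x \<in> carrier gL" "y \<in> carrier gL"
  have "lie_form (gm x y - gm y x) h = conv (lie_form x) (lie_form y) h - conv (lie_form y) (lie_form x) h"
    if "h \<in> HI" for h
    using counit_der_ext[OF counit_der_lie_form counit_der_bracket[OF counit_der_lie_form counit_der_lie_form] _ that,
      of "gm x y - gm y x" x y] lie_form_bracket_X xy by simp
  moreover have "hat x \<otimes>\<^bsub>DA\<^esub> hat y \<in> carrier DA" "hat y \<otimes>\<^bsub>DA\<^esub> hat x \<in> carrier DA" by (rule DA.m_closed; simp)+
  ultimately show ?thesis using xy
    by (auto simp: gL_mult DA_minus hat_def)
qed

sublocale PL: kenv_lift gL DA hat
  by (intro kenv_lift.intro gL_env DA_kalg kenv_lift_axioms.intro hat_lin hat_bracket)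

end

text \<open>The combination is indexed by \<open>S\<close> and not by the image, so coefficients can
  be compared before anything is known about injectivity of \<open>b\<close>.\<close>

lemma (in kvs) span_image_free:
  assumes "\<And>s. s \<in> S \<Longrightarrow> b s \<in> carrier V" "x \<in> lin_span V (b ` S)"
  shows "\<exists>P. keys P \<subseteq> S \<and> x = (\<Oplus>s\<in>keys P. lookup P s \<odot> b s)"
proof -
  let ?L = "\<lambda>P. \<Oplus>s\<in>keys P. lookup P s \<odot> b s"
  note l = lc_lin[of S b, OF assms(1)]
  have c: "b ` S \<subseteq> carrier V" using assms(1) by auto
  have "x \<in> ?L ` {P. keys P \<subseteq> S}"
    using assms(2) c
  proof (induction rule: span_induct)
    case zero show ?case by (rule image_eqI[of _ _ 0]) simp_all
  next
    case (base v)
    then obtain s where s: "s \<in> S" "v = b s" by auto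
    then show ?case using lc_single[of b s 1] assms(1)[of s] by (intro image_eqI[of _ _ "single s 1"]) auto
  next
    case (add x y)
    then obtain P R where "keys P \<subseteq> S" "keys R \<subseteq> S" "x = ?L P" "y = ?L R" by auto
    then show ?case using lin_add[OF l, of P R] by (intro image_eqI[of _ _ "P + R"]) (simp_all add: keys_add_sub)
  next
    case (smult c x)
    then obtain P where "keys P \<subseteq> S" "x = ?L P" by auto
    then show ?case using lin_smult[OF l, of P c] by (intro image_eqI[of _ _ "Poly_Mapping.map ((*) c) P"]) (simp_all
      add: keys_scale_sub)
  qed
  then show ?thesis by auto
qed

context gB begin

section \<open>The enveloping algebra as graded dual\<close>

abbreviation "UE \<equiv> env_algebra gL"
abbreviation "dual_map \<equiv> env_lift DA hat"
abbreviation "bt t \<equiv> env_incl gL (single t (1::'k))"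
abbreviation "basis_word \<equiv> word_prod UE bt"

lemma dual_map_lin: "dual_map \<in> lin UE DA" by (rule alg_hom_lin[OF PL.env_lift_hom])
lemma dual_map_closed [simp]: "Y \<in> carrier UE \<Longrightarrow> dual_map Y \<in> carrier DA" by (rule lin_closed[OF dual_map_lin])

lemma basis_word_closed [simp]: "w \<in> lists I \<Longrightarrow> basis_word w \<in> carrier UE"
  by (rule PL.UL.word_prod_closed) auto

text \<open>Left multiplication by a generator is adjoint to \<open>der\<close>. A word is thus
  evaluated at a polynomial by differentiating letter by letter and taking the constant term at the
  end.\<close>

lemma dual_map_inc: "x \<in> carrier gL \<Longrightarrow> Y \<in> carrier UE \<Longrightarrow> h \<in> HI \<Longrightarrow> dual_map (env_incl gL x \<otimes>\<^bsub>UE\<^esub> Y) h = dual_map Y (der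
    (lie_form x) h)"
proof -
  assume a: "x \<in> carrier gL" "Y \<in> carrier UE" "h \<in> HI"
  have "dual_map (env_incl gL x \<otimes>\<^bsub>UE\<^esub> Y) h = conv (hat x) (dual_map Y) h"
    using a alg_hom_mult[OF PL.env_lift_hom, of "env_incl gL x" Y] by (simp add: PL.env_lift_inc)
  then show ?thesis using a DA_linform[OF dual_map_closed[OF a(2)]] by (simp add: hat_def tensor_eval_der)
qed

lemma dual_map_bt: "t \<in> I \<Longrightarrow> Y \<in> carrier UE \<Longrightarrow> h \<in> HI \<Longrightarrow> dual_map (bt t \<otimes>\<^bsub>UE\<^esub> Y) h = dual_map Y (der (lin_coeff t) h)"
  using dual_map_inc[of "single t 1" Y h] by (simp add: lie_form_single)

lemma dual_map_one: "h \<in> HI \<Longrightarrow> dual_map \<one>\<^bsub>UE\<^esub> h = const_coeff h"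
  using alg_hom_one[OF PL.env_lift_hom] by simp

lemma mon_deg_pred: "lookup m t \<noteq> 0 \<Longrightarrow> mon_deg m = Suc (mon_deg (m - single t 1)) \<and> m = m - single t 1 + single t 1"
proof -
  assume a: "lookup m t \<noteq> 0"
  have m: "m = m - single t 1 + single t 1"
    by (rule poly_mapping_eqI) (use a in \<open>auto simp: lookup_add lookup_minus lookup_single when_def\<close>)
  have "mon_deg m = mon_deg (m - single t 1) + 1" by (subst m) (simp only: mon_deg_add mon_deg_single)
  then show ?thesis using m by simp
qed

lemma MI_minus: "m \<in> MI \<Longrightarrow> m - m' \<in> MI"
  by (auto simp: MI_def in_keys_iff lookup_minus subset_iff)

lemma deg_ge_mono: "h \<in> deg_ge k \<Longrightarrow> l \<le> k \<Longrightarrow> h \<in> deg_ge l"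
  by (fastforce simp: deg_ge_def)

lemma der_deg_ge: "t \<in> I \<Longrightarrow> h \<in> deg_ge (Suc k) \<Longrightarrow> der (lin_coeff t) h \<in> deg_ge k"
proof -
  assume t: "t \<in> I" and "h \<in> deg_ge (Suc k)"
  then have "keys h \<subseteq> {m \<in> MI. mon_deg m \<ge> Suc k}" by (simp add: deg_ge_def)
  then have "h \<in> HI \<and> der (lin_coeff t) h \<in> deg_ge k"
  proof (induction rule: pm_induct)
    case zero
    have "der (lin_coeff t) 0 = 0" using der_smult[of "lin_coeff t" 0 0] by (simp add: C_simps)
    then show ?case by (simp add: deg_ge_0)
  next
    case (single m c)
    then have m: "m \<in> MI" "mon_deg m \<ge> Suc k" by auto
    have s: "single m c = Cst c * X m" by (simp add: Cst_def X_def mult_single)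
    obtain r where r: "r \<in> deg_ge (mon_deg m)" "der (lin_coeff t) (X m) = Cst (of_nat (lookup m t)) * X (m - single t
      1) + r"
      using der_X[OF t m(1)] by blast
    have "X (m - single t 1) \<in> deg_ge k \<or> lookup m t = 0"
      using deg_ge_X[OF MI_minus[OF m(1)], of "single t 1"] mon_deg_pred[of m t] m(2) deg_ge_mono by fastforce
    then have "Cst (of_nat (lookup m t)) * X (m - single t 1) \<in> deg_ge k"
      by (elim disjE) (simp_all add: C_simps deg_ge_0 deg_ge_C)
    then have "der (lin_coeff t) (X m) \<in> deg_ge k" unfolding r(2)
      by (rule deg_ge_add) (use deg_ge_mono[OF r(1), of k] m(2) in simp)
    then show ?case using m by (simp add: s der_smult deg_ge_C)
  next
    case (add P R) then show ?case by (simp add: der_add deg_ge_add)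
  qed
  then show ?thesis by simp
qed

text \<open>Each letter differentiates once and lowers the number of factors by at most one; what
  remains has positive degree, hence no constant term.\<close>

lemma dual_map_deg_ge: "w \<in> lists I \<Longrightarrow> h \<in> deg_ge k \<Longrightarrow> length w < k \<Longrightarrow> dual_map (basis_word w) h = 0"
proof (induction w arbitrary: h k)
  case Nil
  then have "0 \<notin> keys h" by (auto simp: deg_ge_def)
  then show ?case using Nil deg_ge_HI[OF Nil(2)] by (simp add: dual_map_one const_coeff_def in_keys_iff)
next
  case (Cons t w)
  then obtain l where l: "k = Suc l" "length w < l" by (cases k) auto
  from Cons.IH[OF _ der_deg_ge[of t h l]] Cons.prems l show ?case by (simp add: dual_map_bt deg_ge_HI)
qed

definition cnt :: "var list \<Rightarrow> mon" where "cnt w = (\<Sum>t\<leftarrow>w. single t 1)"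

lemma cnt_simps [simp]: "cnt [] = 0" "cnt (t # w) = single t 1 + cnt w"
  by (simp_all add: cnt_def)

lemma lookup_cnt: "lookup (cnt w) t = count (mset w) t"
  by (induction w) (simp_all add: lookup_add lookup_single when_def)

lemma mon_deg_cnt: "mon_deg (cnt w) = length w"
  by (induction w) (simp_all add: mon_deg_add)

lemma cnt_MI: "w \<in> lists I \<Longrightarrow> cnt w \<in> MI"
  by (induction w rule: lists.induct) (simp_all add: MI_def keys_add_sub)

lemma weight_cnt: "weight (cnt w) = sum_list (map snd w)"
  by (induction w) (simp_all add: weight_add)

lemma cnt_mset: "cnt v = cnt w \<Longrightarrow> mset v = mset w"
  by (rule multiset_eqI) (simp add: lookup_cnt[symmetric])

text \<open>The pairing of words with monomials is triangular for the polynomial degree, because up to higher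
  degree \<open>der (lin_coeff t)\<close> is the partial derivative in \<open>Xv t\<close>.\<close>

lemma dual_map_triangular: "w \<in> lists I \<Longrightarrow> m \<in> MI \<Longrightarrow> length w \<le> mon_deg m \<Longrightarrow> dual_map (basis_word w) (X m) \<noteq> 0 \<longleftrightarrow> cnt w =
    m"
proof (induction w arbitrary: m)
  case Nil
  then have "dual_map \<one>\<^bsub>UE\<^esub> (X m) = const_coeff (X m)" by (intro dual_map_one X_HI)
  then show ?case by (auto simp: const_coeff_def X_def lookup_single when_def)
next
  case (Cons t w)
  then have t: "t \<in> I" "w \<in> lists I" by auto
  obtain r where r: "r \<in> deg_ge (mon_deg m)" "der (lin_coeff t) (X m) = Cst (of_nat (lookup m t)) * X (m - single t 1)
    + r"
    using der_X[OF t(1) Cons.prems(2)] by blast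
  note linform = DA_linform[OF dual_map_closed[OF basis_word_closed[OF t(2)]]] and mm = MI_minus[OF Cons.prems(2), of
    "single t 1"]
  have "dual_map (basis_word (t # w)) (X m) = of_nat (lookup m t) * dual_map (basis_word w) (X (m - single t 1)) +
    dual_map (basis_word w) r"
    using t Cons.prems mm deg_ge_HI[OF r(1)] by (simp add: dual_map_bt r(2) linform_add[OF linform] linform_smult[OF
      linform])
  \<comment> \<open>The monomials of the remainder have at least \<open>mon_deg m\<close> factors,
    more than \<open>w\<close> has letters.\<close>
  also have "dual_map (basis_word w) r = 0" using dual_map_deg_ge[OF t(2) r(1)] Cons.prems(3) by simp
  finally have e: "dual_map (basis_word (t # w)) (X m) = of_nat (lookup m t) * dual_map (basis_word w) (X (m - single
    t 1))" by simp
  show ?case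
  proof (cases "lookup m t = 0")
    case True
    then show ?thesis unfolding e by (auto simp: lookup_add)
  next
    case False
    note mon_deg = mon_deg_pred[OF False]
    have "dual_map (basis_word w) (X (m - single t 1)) \<noteq> 0 \<longleftrightarrow> cnt w = m - single t 1"
      by (rule Cons.IH[OF t(2) mm]) (use mon_deg Cons.prems(3) in simp)
    moreover have "cnt w = m - single t 1 \<longleftrightarrow> cnt (t # w) = m" using mon_deg
      by (metis add.commute add_diff_cancel_right' cnt_simps(2))
    \<comment> \<open>Characteristic zero enters here: the multiplicity \<open>lookup m t\<close> is
      nonzero in the field.\<close>
    ultimately show ?thesis unfolding e using False by simp
  qed
qed

text \<open>Words of length strictly below \<open>k\<close>: the error terms allowed when words of
  length \<open>k\<close> are compared.\<close>

definition W :: "nat \<Rightarrow> _" where "W k = lin_span UE (basis_word ` {w \<in> lists I. length w < k})"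

lemma W_gen: "basis_word ` {w \<in> lists I. length w < k} \<subseteq> carrier UE" using basis_word_closed by blast

lemma W_carrier: "W k \<subseteq> carrier UE" unfolding W_def by (rule PL.UL.span_carrier[OF W_gen])
lemma W_closed: "z \<in> W k \<Longrightarrow> z \<in> carrier UE" using W_carrier by auto
lemma W_0: "\<zero>\<^bsub>UE\<^esub> \<in> W k" unfolding W_def by (rule PL.UL.span_zero[OF W_gen])
lemma W_add: "y \<in> W k \<Longrightarrow> z \<in> W k \<Longrightarrow> y \<oplus>\<^bsub>UE\<^esub> z \<in> W k" unfolding W_def by (rule PL.UL.span_add[OF W_gen])
lemma W_smult: "y \<in> W k \<Longrightarrow> c \<odot>\<^bsub>UE\<^esub> y \<in> W k" unfolding W_def by (rule PL.UL.span_smult[OF W_gen])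
lemma W_basis_word: "w \<in> lists I \<Longrightarrow> length w < k \<Longrightarrow> basis_word w \<in> W k" unfolding W_def
    by (rule PL.UL.span_in[OF W_gen]) auto

lemma W_induct [consumes 1, case_names zero base add smult]:
  assumes "x \<in> W k" "P \<zero>\<^bsub>UE\<^esub>" "\<And>w. w \<in> lists I \<Longrightarrow> length w < k \<Longrightarrow> P (basis_word w)" "\<And>x y. x \<in> W k \<Longrightarrow> y \<in> W k \<Longrightarrow> P x \<Longrightarrow>
    P y \<Longrightarrow> P (x \<oplus>\<^bsub>UE\<^esub> y)" "\<And>c x. x \<in> W k \<Longrightarrow> P x \<Longrightarrow> P (c \<odot>\<^bsub>UE\<^esub> x)"
  shows "P x"
  using assms(1)[unfolded W_def] W_gen
  by (induction rule: PL.UL.span_induct) (use assms(2-) in \<open>auto simp: W_def[symmetric]\<close>)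

lemma W_bt: "t \<in> I \<Longrightarrow> z \<in> W k \<Longrightarrow> bt t \<otimes>\<^bsub>UE\<^esub> z \<in> W (Suc k)"
proof -
  assume t: "t \<in> I" and "z \<in> W k"
  from this(2) show ?thesis
  proof (induction rule: W_induct)
    case (base w)
    then show ?case using W_basis_word[of "t # w" "Suc k"] t by simp
  qed (simp_all add: t W_0 W_add W_smult W_closed PL.UL.r_distr)
qed

lemma W_inc: "x \<in> carrier gL \<Longrightarrow> z \<in> W k \<Longrightarrow> env_incl gL x \<otimes>\<^bsub>UE\<^esub> z \<in> W (Suc k)"
proof -
  assume x: "x \<in> carrier gL" and z: "z \<in> W k"
  from x have "keys x \<subseteq> I" by simp
  then show ?thesis
  proof (induction rule: pm_induct)
    case zero
    have "env_incl gL 0 = \<zero>\<^bsub>UE\<^esub>" using lin_zero[OF gL_kvs PL.UL.kvs_axioms PL.inc_lin] by simp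
    then show ?case using W_0 W_closed[OF z] by simp
  next
    case (single t c)
    have "env_incl gL (single t c) = c \<odot>\<^bsub>UE\<^esub> bt t" using PL.inc_smult[of "single t 1" c] single by simp
    then show ?case using W_smult[OF W_bt[OF single z], of c] W_closed[OF z] single by simp
  next
    case (add P R)
    then show ?case using PL.inc_add[of P R] W_closed[OF z] by (simp add: PL.UL.l_distr W_add)
  qed
qed

definition eqW where "eqW k x y \<longleftrightarrow> (\<exists>z\<in>W k. x = y \<oplus>\<^bsub>UE\<^esub> z)"

lemma eqW_refl: "x \<in> carrier UE \<Longrightarrow> eqW k x x" unfolding eqW_def using W_0 by (intro bexI[of _ "\<zero>\<^bsub>UE\<^esub>"]) simp_all
lemma eqW_trans: "eqW k x y \<Longrightarrow> eqW k y z \<Longrightarrow> z \<in> carrier UE \<Longrightarrow> eqW k x z"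
proof -
  assume "eqW k x y" "eqW k y z" and z: "z \<in> carrier UE"
  then obtain a b where "a \<in> W k" "x = y \<oplus>\<^bsub>UE\<^esub> a" "b \<in> W k" "y = z \<oplus>\<^bsub>UE\<^esub> b" by (auto simp: eqW_def)
  then have "x = z \<oplus>\<^bsub>UE\<^esub> (b \<oplus>\<^bsub>UE\<^esub> a)" "b \<oplus>\<^bsub>UE\<^esub> a \<in> W k"
    using z by (simp_all add: W_closed PL.UL.a_assoc W_add)
  then show ?thesis by (auto simp: eqW_def)
qed

lemma eqW_bt: "eqW k x y \<Longrightarrow> t \<in> I \<Longrightarrow> y \<in> carrier UE \<Longrightarrow> eqW (Suc k) (bt t \<otimes>\<^bsub>UE\<^esub> x) (bt t \<otimes>\<^bsub>UE\<^esub> y)"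
  unfolding eqW_def by (elim bexE, rule bexI[OF _ W_bt]) (auto simp: W_closed PL.UL.r_distr)

text \<open>The difference is the bracket of the two letters times \<open>w\<close>. The bracket is
  a combination of single letters, so the difference only involves words of length at most
  \<open>length w + 1\<close>.\<close>

lemma eqW_swap: "s \<in> I \<Longrightarrow> t \<in> I \<Longrightarrow> w \<in> lists I \<Longrightarrow> eqW (length w + 2) (basis_word (s # t # w)) (basis_word (t # s # w))"
proof -
  assume a: "s \<in> I" "t \<in> I" "w \<in> lists I"
  let ?s = "single s (1::'k)" and ?t = "single t (1::'k)"
  have x: "?s \<otimes>\<^bsub>gL\<^esub> ?t \<in> carrier gL" using a by (intro PL.bracket_closed) simp_all
  have "basis_word (s # t # w) = (bt s \<otimes>\<^bsub>UE\<^esub> bt t) \<otimes>\<^bsub>UE\<^esub> basis_word w" using a by (simp add: PL.UL.m_assoc)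
  also have "bt s \<otimes>\<^bsub>UE\<^esub> bt t = bt t \<otimes>\<^bsub>UE\<^esub> bt s \<oplus>\<^bsub>UE\<^esub> env_incl gL (?s \<otimes>\<^bsub>gL\<^esub> ?t)" using a
    by (intro PL.inc_bracket) simp_all
  also have "(bt t \<otimes>\<^bsub>UE\<^esub> bt s \<oplus>\<^bsub>UE\<^esub> env_incl gL (?s \<otimes>\<^bsub>gL\<^esub> ?t)) \<otimes>\<^bsub>UE\<^esub> basis_word w = basis_word (t # s # w) \<oplus>\<^bsub>UE\<^esub>
    env_incl gL (?s \<otimes>\<^bsub>gL\<^esub> ?t) \<otimes>\<^bsub>UE\<^esub> basis_word w"
    using a PL.inc_closed[OF x] by (simp add: PL.UL.l_distr PL.UL.m_assoc)
  finally show ?thesis unfolding eqW_def using W_inc[OF x W_basis_word[OF a(3), of "Suc (length w)"]] by auto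
qed

text \<open>Any reordering is obtained from adjacent swaps. A swap costs only shorter words, and
  prefixing a letter raises the bound on the error together with the length.\<close>

lemma eqW_mset: "v \<in> lists I \<Longrightarrow> w \<in> lists I \<Longrightarrow> mset v = mset w \<Longrightarrow> eqW (length v) (basis_word v) (basis_word w)"
proof (induction "length v" arbitrary: v w)
  case 0
  then show ?case by (simp add: eqW_refl)
next
  case (Suc k)
  then obtain t v' where v: "v = t # v'" by (cases v) auto
  with Suc obtain s w' where w: "w = s # w'" by (cases w) auto
  have I: "t \<in> I" "s \<in> I" "v' \<in> lists I" "w' \<in> lists I" and k: "length v' = k" using Suc v w by auto
  show ?case
  proof (cases "s = t")
    case True
    then have "eqW (length v') (basis_word v') (basis_word w')" using Suc v w by auto
    from eqW_bt[OF this I(1)] show ?thesis using True v w I by simp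
  next
    case False
    then have tw: "t \<in># mset w'" using Suc.prems(3) v w by (metis insert_noteq_member mset.simps(2))
    \<comment> \<open>With \<open>v = t # v'\<close> and \<open>w = s # w'\<close>, the letters
      besides \<open>s\<close> and \<open>t\<close> form \<open>u\<close> in both words;
      \<open>t # s # u\<close> and \<open>s # t # u\<close> mediate between them.\<close>
    define u where "u = remove1 t w'"
    have u: "mset w' = mset (t # u)" using tw by (simp add: u_def)
    have "add_mset t (mset v') = add_mset t (add_mset s (mset u))" using Suc.prems(3)
      by (simp add: v w u add_mset_commute)
    then have u1: "mset v' = mset (s # u)" "length w' = Suc (length u)" "u \<in> lists I"
      using I(4) mset_eq_length[OF u] unfolding u_def by (simp_all add: in_lists_conv_set notin_set_remove1)
        (metis notin_set_remove1)
    have lw: "length w' = k" "length u + 2 = Suc k" using k u1 mset_eq_length[OF Suc.prems(3)] v w by auto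
    have "eqW k (basis_word v') (basis_word (s # u))" using Suc.hyps(1)[of v' "s # u"] k u1 I by simp
    from eqW_bt[OF this I(1)] have 1: "eqW (Suc k) (basis_word v) (basis_word (t # s # u))" using v I u1 by simp
    have 2: "eqW (Suc k) (basis_word (t # s # u)) (basis_word (s # t # u))" using eqW_swap[OF I(1,2) u1(3)] lw by simp
    have "eqW k (basis_word (t # u)) (basis_word w')" using Suc.hyps(1)[of "t # u" w'] lw u u1 I by simp
    from eqW_bt[OF this I(2)] have 3: "eqW (Suc k) (basis_word (s # t # u)) (basis_word w)" using w I by simp
    have "eqW (Suc k) (basis_word v) (basis_word w)"
      by (rule eqW_trans[OF 1 eqW_trans[OF 2 3]]) (use Suc.prems in \<open>simp_all del: word_prod_simps\<close>)
    then show ?thesis using Suc by simp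
  qed
qed

text \<open>One ordering of the letters per monomial. Any choice will do, since words with the same
  letters agree up to shorter words.\<close>

definition mon_word :: "mon \<Rightarrow> var list" where "mon_word m = (SOME w. w \<in> lists I \<and> cnt w = m)"

lemma mon_word: "m \<in> MI \<Longrightarrow> mon_word m \<in> lists I" "m \<in> MI \<Longrightarrow> cnt (mon_word m) = m"
proof -
  have "m \<in> MI \<Longrightarrow> \<exists>w. w \<in> lists I \<and> cnt w = m"
  proof (induction m rule: mon_induct)
    case zero show ?case by (rule exI[of _ "[]"]) simp
  next
    case (add m s)
    have "m \<in> MI" "s \<in> I" using add.prems by (simp_all only: MI_add_single)
    with add.IH obtain w where "w \<in> lists I" "cnt w = m" by blast
    then show ?case using \<open>s \<in> I\<close> by (intro exI[of _ "s # w"]) (simp add: add.commute)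
  qed
  from someI_ex[OF this] show "m \<in> MI \<Longrightarrow> mon_word m \<in> lists I" "m \<in> MI \<Longrightarrow> cnt (mon_word m) = m"
    by (simp_all add: mon_word_def)
qed

definition "pbw m = basis_word (mon_word m)"

lemma pbw_closed [simp]: "m \<in> MI \<Longrightarrow> pbw m \<in> carrier UE" by (simp add: pbw_def mon_word)

lemma pbw_triangular: "m \<in> MI \<Longrightarrow> m' \<in> MI \<Longrightarrow> mon_deg m' \<le> mon_deg m \<Longrightarrow> dual_map (pbw m') (X m) \<noteq> 0 \<longleftrightarrow> m' = m"
  using dual_map_triangular[of "mon_word m'" m] by (simp add: pbw_def mon_word mon_deg_cnt[symmetric])

lemma pbw_gen: "pbw ` MI \<subseteq> carrier UE" by auto

text \<open>Replacing a word by the chosen word with the same letters costs only shorter words,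
  which are covered by the induction.\<close>

lemma basis_word_pbw: "w \<in> lists I \<Longrightarrow> basis_word w \<in> lin_span UE (pbw ` MI)"
proof (induction "length w" arbitrary: w rule: less_induct)
  case less
  have W: "z \<in> W (length w) \<Longrightarrow> z \<in> lin_span UE (pbw ` MI)" for z
    by (induction rule: W_induct) (simp_all add: less.hyps PL.UL.span_zero[OF pbw_gen] PL.UL.span_add[OF pbw_gen]
      PL.UL.span_smult[OF pbw_gen])
  note m = cnt_MI[OF less.prems]
  have "eqW (length w) (basis_word w) (pbw (cnt w))"
    unfolding pbw_def by (rule eqW_mset[OF less.prems mon_word(1)[OF m] cnt_mset]) (simp add: mon_word m)
  then obtain z where z: "z \<in> W (length w)" "basis_word w = pbw (cnt w) \<oplus>\<^bsub>UE\<^esub> z" by (auto simp: eqW_def)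
  show ?case unfolding z(2) by (intro PL.UL.span_add[OF pbw_gen] PL.UL.span_in[OF pbw_gen] W z imageI m)
qed

lemma U_span: "Y \<in> carrier UE \<Longrightarrow> Y \<in> lin_span UE (pbw ` MI)"
proof (induction rule: PL.UL_induct)
  case (word w c)
  have "word_prod UE (env_incl gL) w \<in> W (Suc (length w))"
    using word
  proof (induction w)
    case Nil show ?case using W_basis_word[of "[]" 1] by simp
  next
    case (Cons x w)
    then show ?case using W_inc[of x "word_prod UE (env_incl gL) w" "Suc (length w)"] by simp
  qed
  then have "word_prod UE (env_incl gL) w \<in> lin_span UE (pbw ` MI)"
    by (induction rule: W_induct) (simp_all add: basis_word_pbw PL.UL.span_zero[OF pbw_gen] PL.UL.span_add[OF pbw_gen]
      PL.UL.span_smult[OF pbw_gen])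
  then show ?case by (rule PL.UL.span_smult[OF pbw_gen])
qed (simp add: PL.UL.span_add[OF pbw_gen])

lemma dual_map_at_lin: "h \<in> HI \<Longrightarrow> (\<lambda>Y. dual_map Y h) \<in> lin UE base_algebra"
  by (rule linI) (simp_all add: lin_add[OF dual_map_lin] lin_smult[OF dual_map_lin])

lemma dual_map_lc: "h \<in> HI \<Longrightarrow> finite M \<Longrightarrow> M \<subseteq> MI \<Longrightarrow> dual_map (\<Oplus>\<^bsub>UE\<^esub>m\<in>M. c m \<odot>\<^bsub>UE\<^esub> pbw m) h = (\<Sum>m\<in>M. c m * dual_map (pbw
    m) h)"
  by (subst lin_finsum[OF PL.UL.kvs_axioms base_kvs dual_map_at_lin]) (auto simp: lin_smult[OF dual_map_at_lin]
    intro!: sum.cong)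

text \<open>In a nontrivial combination of the \<open>pbw m\<close>, a monomial with the largest
  number of factors is isolated by evaluating at \<open>X m\<close>, by triangularity.\<close>

lemma dual_map_kernel: "Y \<in> carrier UE \<Longrightarrow> dual_map Y = \<zero>\<^bsub>DA\<^esub> \<Longrightarrow> Y = \<zero>\<^bsub>UE\<^esub>"
proof -
  assume Y: "Y \<in> carrier UE" "dual_map Y = \<zero>\<^bsub>DA\<^esub>"
  obtain P where P: "keys P \<subseteq> MI" "Y = (\<Oplus>\<^bsub>UE\<^esub>s\<in>keys P. lookup P s \<odot>\<^bsub>UE\<^esub> pbw s)"
    using PL.UL.span_image_free[OF pbw_closed U_span[OF Y(1)]] by auto
  have "P = 0"
  proof (rule ccontr)
    assume "P \<noteq> 0"
    then have ne: "keys P \<noteq> {}" by simp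
    obtain m where m: "m \<in> keys P" "\<And>m'. m' \<in> keys P \<Longrightarrow> mon_deg m' \<le> mon_deg m"
      using ne Max_in[of "mon_deg ` keys P"] by (metis (no_types, lifting) Max_ge finite_imageI finite_keys image_iff
        image_is_empty)
    have mm: "m \<in> MI" using P m by auto
    have "dual_map Y (X m) = (\<Sum>m'\<in>keys P. lookup P m' * dual_map (pbw m') (X m))"
      unfolding P(2) by (rule dual_map_lc) (use P mm in auto)
    also have "\<dots> = (\<Sum>m'\<in>keys P. if m' = m then lookup P m * dual_map (pbw m) (X m) else 0)"
      by (rule sum.cong) (use pbw_triangular[OF mm] P m in auto)
    also have "\<dots> \<noteq> 0" using m pbw_triangular[OF mm mm] by (simp add: in_keys_iff)
    finally show False using Y(2) mm by simp
  qed
  then show ?thesis using P(2) by simp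
qed

lemma dual_map_inj: "inj_on dual_map (carrier UE)"
proof (rule inj_onI)
  fix x y assume xy: "x \<in> carrier UE" "y \<in> carrier UE" "dual_map x = dual_map y"
  have "dual_map (x \<ominus>\<^bsub>UE\<^esub> y) = \<zero>\<^bsub>DA\<^esub>"
    using xy by (simp only: lin_minus[OF PL.UL.kvs_axioms DA_kvs dual_map_lin]) (simp only: a_minus_def DA.r_neg
      dual_map_closed)
  then have "x \<ominus>\<^bsub>UE\<^esub> y = \<zero>\<^bsub>UE\<^esub>" by (rule dual_map_kernel[rotated]) (use xy in simp)
  then show "x = y" by (rule PL.UL.diff_eqI) (use xy in auto)
qed

lemma dual_map_word_supp: "w \<in> lists I \<Longrightarrow> supp (dual_map (basis_word w)) \<subseteq> {weight (cnt w)}"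
proof (induction w)
  case Nil show ?case using supp_const_coeff by (simp only: word_prod_simps alg_hom_one[OF PL.env_lift_hom] DA_simps
    supp_restrict cnt_simps weight_0)
next
  case (Cons t w)
  then have t: "t \<in> I" "w \<in> lists I" by auto
  have "dual_map (basis_word (t # w)) = restrict (conv (hat (single t 1)) (dual_map (basis_word w))) HI"
    using t alg_hom_mult[OF PL.env_lift_hom, of "bt t" "basis_word w"] by (simp add: PL.env_lift_inc)
  moreover have "supp (hat (single t 1)) \<subseteq> {snd t}" using supp_lin_coeff unfolding hat_def supp_restrict
    by (simp add: lie_form_single)
  moreover have "supp (dual_map (basis_word w)) \<subseteq> {weight (cnt w)}" using Cons t by simp
  moreover have "linform (hat (single t 1))" "linform (dual_map (basis_word w))" using t by (intro DA_linform; simp)+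
  ultimately show ?case using conv_supp[of "hat (single t 1)" "dual_map (basis_word w)"]
    by (simp only: supp_restrict cnt_simps weight_add weight_single One_nat_def) fastforce
qed

lemma supp_pbw: "m \<in> MI \<Longrightarrow> supp (dual_map (pbw m)) \<subseteq> {weight m}"
  using dual_map_word_supp[of "mon_word m"] by (simp add: pbw_def mon_word)

lemma DA_ext: "f \<in> carrier DA \<Longrightarrow> f' \<in> carrier DA \<Longrightarrow> (\<And>m. m \<in> MI \<Longrightarrow> f (X m) = f' (X m)) \<Longrightarrow> f = f'"
  by (rule DA_eqI) (auto intro: linform_ext DA_linform)

text \<open>The values of \<open>f\<close> are removed from the top down: subtracting the image of a
  combination of words of length \<open>N\<close> makes \<open>f\<close> vanish on monomials with
  \<open>N\<close> factors without disturbing those with more. The set \<open>S\<close> keeps track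
  of weights, for the comparison of gradings.\<close>

lemma dual_map_surj_step:
  assumes "f \<in> carrier DA" "supp f \<subseteq> S" "\<And>m. m \<in> MI \<Longrightarrow> mon_deg m \<ge> N \<Longrightarrow> f (X m) = 0"
  shows "f \<in> dual_map ` lin_span UE (pbw ` {m \<in> MI. weight m \<in> S})"
  using assms
proof (induction N arbitrary: f)
  case 0
  let ?T = "pbw ` {m \<in> MI. weight m \<in> S}"
  have T: "?T \<subseteq> carrier UE" by auto
  have "f = \<zero>\<^bsub>DA\<^esub>" by (rule DA_ext) (use 0 DA_closed(4) in auto)
  moreover have "dual_map \<zero>\<^bsub>UE\<^esub> = \<zero>\<^bsub>DA\<^esub>" by (rule lin_zero[OF PL.UL.kvs_axioms DA_kvs dual_map_lin])
  ultimately show ?case using PL.UL.span_zero[OF T] by (intro image_eqI[of _ _ "\<zero>\<^bsub>UE\<^esub>"]) (simp_all only:)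
next
  case (Suc N)
  let ?T = "pbw ` {m \<in> MI. weight m \<in> S}"
  have T: "?T \<subseteq> carrier UE" by auto
  define M where "M = {m \<in> MI. mon_deg m = N \<and> f (X m) \<noteq> 0}"
  have X_HC: "m \<in> MI \<Longrightarrow> X m \<in> HC (weight m)" for m by (auto simp: HC_def X_def MI_def)
  have wtM: "weight m \<in> supp f" if "m \<in> M" for m
    using that HC_mi[OF X_HC] DA_linform[OF Suc.prems(1)] by (auto simp: M_def)
  have "M \<subseteq> (\<Union>\<alpha>\<in>supp f. {m \<in> MI. weight m = \<alpha>})" using wtM by (auto simp: M_def)
  moreover have "finite (supp f)" using Suc.prems(1) by (simp add: DA_carrier)
  ultimately have fM: "finite M" using finite_MI_weight by (meson finite_UN finite_subset)
  have MM: "M \<subseteq> MI" by (auto simp: M_def)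
  \<comment> \<open>On monomials with at least \<open>N\<close> factors, the image of
    \<open>pbw m\<close> for \<open>m\<close> in \<open>M\<close> is nonzero only at
    \<open>X m\<close>, so this coefficient reproduces \<open>f\<close> there.\<close>
  define c where "c m = f (X m) / dual_map (pbw m) (X m)" for m
  define Y where "Y = (\<Oplus>\<^bsub>UE\<^esub>m\<in>M. c m \<odot>\<^bsub>UE\<^esub> pbw m)"
  have YT: "Y \<in> lin_span UE ?T" unfolding Y_def
    by (rule PL.UL.finsum_in_sub[OF PL.UL.span_sub[OF T] fM]) (rule PL.UL.span_smult[OF T], rule PL.UL.span_in[OF T],
      use wtM Suc.prems(2) MM in auto)
  then have Yc: "Y \<in> carrier UE" using PL.UL.span_carrier[OF T] by auto
  define f' where "f' = (\<lambda>h\<in>HI. f h - dual_map Y h)"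
  have f': "f' \<in> carrier DA" using DA.minus_closed[OF Suc.prems(1) dual_map_closed[OF Yc]] Suc.prems(1) Yc
    by (simp add: DA_minus f'_def)
  have Yh: "dual_map Y h = (\<Sum>m\<in>M. c m * dual_map (pbw m) h)" if "h \<in> HI" for h unfolding Y_def
    by (rule dual_map_lc[OF that fM MM])
  have "supp f' \<subseteq> S"
  proof
    fix \<gamma> assume "\<gamma> \<in> supp f'"
    then obtain h where h: "h \<in> HC \<gamma>" "\<gamma> \<in> mi" "f h - dual_map Y h \<noteq> 0" by (auto simp: f'_def supp_def HC_HI)
    have "dual_map Y h = 0" if "\<And>m. m \<in> M \<Longrightarrow> dual_map (pbw m) h = 0"
      unfolding Yh[OF HC_HI[OF h(1)]] using that by simp
    then consider "f h \<noteq> 0" | m where "m \<in> M" "dual_map (pbw m) h \<noteq> 0" using h(3) by fastforce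
    then show "\<gamma> \<in> S"
    proof cases
      case 1 then show ?thesis using h Suc.prems(2) by (auto simp: supp_def)
    next
      case 2
      then have "\<gamma> \<in> supp (dual_map (pbw m))" using h by (auto simp: supp_def)
      then show ?thesis using supp_pbw[of m] wtM[OF 2(1)] Suc.prems(2) 2 MM by auto
    qed
  qed
  moreover have "f' (X m) = 0" if m: "m \<in> MI" "mon_deg m \<ge> N" for m
  proof -
    have "dual_map Y (X m) = (\<Sum>m'\<in>M. if m' = m then f (X m) else 0)"
      unfolding Yh[OF X_HI[OF m(1)]] using pbw_triangular[OF m(1)] MM m
      by (intro sum.cong) (auto simp: c_def M_def)
    also have "\<dots> = f (X m)" using fM Suc.prems(3)[OF m(1)] m by (auto simp: M_def)
    finally show ?thesis using m by (simp add: f'_def)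
  qed
  ultimately obtain Y' where Y': "Y' \<in> lin_span UE ?T" "f' = dual_map Y'" using Suc.IH[OF f'] by auto
  have Y'c: "Y' \<in> carrier UE" using Y' PL.UL.span_carrier[OF T] by auto
  have "f = dual_map (Y' \<oplus>\<^bsub>UE\<^esub> Y)"
    unfolding lin_add[OF dual_map_lin Y'c Yc] Y'(2)[symmetric] using DA_undef[OF Suc.prems(1)]
    by (simp add: f'_def fun_eq_iff)
  then show ?case using PL.UL.span_add[OF T Y'(1) YT] by blast
qed

lemma dual_map_surj: assumes f: "f \<in> carrier DA" "supp f \<subseteq> S" shows "f \<in> dual_map ` lin_span UE (pbw ` {m \<in> MI. weight
    m \<in> S})"
proof -
  have X_HC: "m \<in> MI \<Longrightarrow> X m \<in> HC (weight m)" for m by (auto simp: HC_def X_def MI_def)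
  define M where "M = {m \<in> MI. f (X m) \<noteq> 0}"
  have "M \<subseteq> (\<Union>\<alpha>\<in>supp f. {m \<in> MI. weight m = \<alpha>})" using HC_mi[OF X_HC _ DA_linform[OF f(1)]] by (auto simp: M_def)
  moreover have "finite (supp f)" using f by (simp add: DA_carrier)
  ultimately have fM: "finite M" using finite_MI_weight by (meson finite_UN finite_subset)
  \<comment> \<open>Any bound on the number of factors of the monomials in the finite set
    \<open>M\<close> can start the induction; the sum of their degrees is one.\<close>
  have "f (X m) = 0" if "m \<in> MI" "mon_deg m \<ge> Suc (sum mon_deg M)" for m
  proof (rule ccontr)
    assume "f (X m) \<noteq> 0"
    then have "mon_deg m \<le> sum mon_deg M" using fM that by (intro member_le_sum) (auto simp: M_def)
    then show False using that by simp
  qed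
  then show ?thesis by (rule dual_map_surj_step[OF f])
qed

lemma dual_map_bij: "bij_betw dual_map (carrier UE) (carrier DA)"
proof (rule bij_betw_imageI[OF dual_map_inj], rule antisym)
  show "dual_map ` carrier UE \<subseteq> carrier DA" by auto
  show "carrier DA \<subseteq> dual_map ` carrier UE"
    using dual_map_surj[of _ UNIV] PL.UL.span_carrier[OF pbw_gen] by auto
qed

end

lemma alg_hom_compose: "f \<in> alg_hom A A' \<Longrightarrow> f' \<in> alg_hom A' A'' \<Longrightarrow> (\<lambda>x. f' (f x)) \<in> alg_hom A A''"
proof (rule alg_homI)
  assume f: "f \<in> alg_hom A A'" and f': "f' \<in> alg_hom A' A''"
  note l = alg_hom_lin[OF f] and l' = alg_hom_lin[OF f']
  show "(\<lambda>x. f' (f x)) \<in> lin A A''" by (rule lin_compose[OF l l'])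
  show "f' (f (x \<otimes>\<^bsub>A\<^esub> y)) = f' (f x) \<otimes>\<^bsub>A''\<^esub> f' (f y)" if "x \<in> carrier A" "y \<in> carrier A" for x y
    using that by (simp add: alg_hom_mult[OF f] alg_hom_mult[OF f'] lin_closed[OF l])
  show "f' (f \<one>\<^bsub>A\<^esub>) = \<one>\<^bsub>A''\<^esub>" by (simp add: alg_hom_one[OF f] alg_hom_one[OF f'])
qed

lemma (in kvs) add_minus_cancel: "v \<in> carrier V \<Longrightarrow> w \<in> carrier V \<Longrightarrow> (v \<oplus> w) \<ominus> w = v"
  by (simp add: a_minus_def a_assoc r_neg)

lemma word_prod_map: "word_prod A f (map h w) = word_prod A (\<lambda>x. f (h x)) w"
  by (induction w) simp_all

section \<open>Compatibility with counit, antipode and coproduct\<close>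

context gB begin

lemma GD_simps [simp]: "carrier GD = carrier DA" "add GD = add DA" "smult GD = smult DA" "mult GD = mult DA" "one GD =
    one DA"
  "counit GD = (\<lambda>f. f 1)" "antipode GD f = (\<lambda>h\<in>HI. f (pev Cst anti h))"
  by (simp_all add: graded_dual_def Let_def module.defs hopf.defs)

lemma GD_comult: "comult GD f = (THE T. T \<in> carrier (tensor_space DA DA) \<and>
   (\<forall>a\<in>HI. \<forall>b\<in>HI. tensor_lift base_algebra (\<lambda>g g'. g a * g' b) T = f (a * b)))"
  by (simp add: graded_dual_def Let_def module.defs hopf.defs)

abbreviation "UH \<equiv> env_hopf gL"
abbreviation "UU \<equiv> tensor_algebra UE UE"
abbreviation "pU \<equiv> pure_tensor UE UE"
abbreviation "inc \<equiv> env_incl gL"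

definition "cop x = pU (inc x) \<one>\<^bsub>UE\<^esub> \<oplus>\<^bsub>UU\<^esub> pU \<one>\<^bsub>UE\<^esub> (inc x)"

lemma UH_simps [simp]: "carrier UH = carrier UE" "add UH = add UE" "smult UH = smult UE" "mult UH = mult UE" "one UH =
    one UE"
  "counit UH = env_lift base_algebra (\<lambda>_. 0)" "comult UH = env_lift UU cop"
  "antipode UH = env_lift (opposite_algebra UE) (\<lambda>x. \<ominus>\<^bsub>UE\<^esub> inc x)"
  by (simp_all add: env_hopf_def Let_def module.defs hopf.defs cop_def[abs_def])

lemma base_kalg: "kalg base_algebra" by (rule kalg.intro[OF base_alg])

sublocale EC: kenv_lift gL base_algebra "\<lambda>_. 0"
proof (intro kenv_lift.intro gL_env base_kalg kenv_lift_axioms.intro)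
  interpret b: kalg base_algebra by (rule base_kalg)
  show "(\<lambda>_. 0) \<in> lin gL base_algebra" by (rule linI) simp_all
  show "0 = 0 \<otimes>\<^bsub>base_algebra\<^esub> 0 \<ominus>\<^bsub>base_algebra\<^esub> 0 \<otimes>\<^bsub>base_algebra\<^esub> (0::'k)"
    using b.r_neg[of 0] by (simp add: a_minus_def)
qed

lemma at_1_hom: "(\<lambda>f. f 1) \<in> alg_hom DA base_algebra"
  by (rule alg_homI, rule linI) (simp_all add: DA_linform conv_1)

lemma dual_map_counit: "Y \<in> carrier UE \<Longrightarrow> dual_map Y 1 = env_lift base_algebra (\<lambda>_. 0) Y"
  by (rule PL.UL_hom_eq[OF base_kalg alg_hom_compose[OF PL.env_lift_hom at_1_hom] EC.env_lift_hom])
    (simp_all add: PL.env_lift_inc EC.env_lift_inc hat_def counit_der_1)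

abbreviation "antip \<equiv> pev Cst anti"

lemma antip_rhom: "rhom antip" by (rule pev_rhom[OF C_rhom])

lemma const_coeff_antip: "h \<in> HI \<Longrightarrow> const_coeff (antip h) = const_coeff h"
proof -
  assume h: "h \<in> HI"
  have "unit \<in> pts" by (simp add: unit_def pts_def)
  then have "inver unit = unit" using mul_inver_l[of unit] mul_unit_r[of "inver unit"] inver_pts by simp
  then show ?thesis using h by (simp add: counit_ev ev_antipode)
qed

lemma linform_antip: "linform f \<Longrightarrow> linform (\<lambda>h. f (antip h))"
  unfolding linform_def by (rule lin_compose[OF antipode_lin])

lemma inver_mul: "x \<in> pts \<Longrightarrow> y \<in> pts \<Longrightarrow> inver (mul x y) = mul (inver y) (inver x)"
proof -
  assume xy: "x \<in> pts" "y \<in> pts"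
  interpret G: group point_group by (rule point_group_group)
  have i: "inv\<^bsub>point_group\<^esub> z = inver z" if "z \<in> pts" for z using that
    by (intro G.inv_equality) (simp_all add: point_group_def mul_inver_l inver_pts)
  have m: "mul x y \<in> pts" using G.m_closed[of x y] xy by (simp add: point_group_def)
  show ?thesis using G.inv_mult_group[of x y] xy i[OF m] i[OF xy(1)] i[OF xy(2)] by (simp add: point_group_def)
qed

lemma pt_antip_bil: "bilinear_map HA HA HH (\<lambda>a b. pt (antip b) (antip a))"
proof (rule bil_from_lin)
  show "(\<lambda>v. pt (antip w) (antip v)) \<in> lin HA HH" if "w \<in> carrier HA" for w
    using that by (intro lin_compose[OF antipode_lin bil_lin_r[OF TA.pure_bil]]) simp
  show "(\<lambda>w. pt (antip w) (antip v)) \<in> lin HA HH" if "v \<in> carrier HA" for v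
    using that by (intro lin_compose[OF antipode_lin bil_lin_l[OF TA.pure_bil]]) simp
qed

lemma tensor_eval_pt_antip: "linform f \<Longrightarrow> linform f' \<Longrightarrow> T \<in> carrier HH \<Longrightarrow>
  tensor_eval f f' (tensor_lift HH (\<lambda>a b. pt (antip b) (antip a)) T) = tensor_eval (\<lambda>h. f' (antip h)) (\<lambda>h. f (antip
    h)) T"
proof -
  assume f: "linform f" "linform f'" and T: "T \<in> carrier HH"
  note tl = tl_lin[OF HA_kvs HA_kvs TS.kvs_axioms pt_antip_bil] and tp = tl_pure[OF HA_kvs HA_kvs TS.kvs_axioms
    pt_antip_bil]
  note fs = linform_antip[OF f(1)] linform_antip[OF f(2)]
  show ?thesis
    by (rule TA.lin_eq_tensor[OF lin_compose[OF tl tensor_eval_lin] tensor_eval_lin _ T])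
      (use f fs in \<open>simp_all add: tp tensor_eval_pure linform_def\<close>)
qed

text \<open>Tested at pairs of points, where it says that inversion reverses products.\<close>

lemma comult_antip: "h \<in> HI \<Longrightarrow> \<Delta> (antip h) = tensor_lift HH (\<lambda>a b. pt (antip b) (antip a)) (\<Delta> h)"
proof (rule HH_sep)
  assume h: "h \<in> HI"
  show "\<Delta> (antip h) \<in> carrier HH" using h by simp
  show c: "tensor_lift HH (\<lambda>a b. pt (antip b) (antip a)) (\<Delta> h) \<in> carrier HH"
    using h by (intro tl_closed[OF HA_kvs HA_kvs TS.kvs_axioms pt_antip_bil]) simp
  fix x y assume xy: "x \<in> pts" "y \<in> pts"
  have "tensor_eval (ev x) (ev y) (tensor_lift HH (\<lambda>a b. pt (antip b) (antip a)) (\<Delta> h)) = tensor_eval (\<lambda>a. ev y (antip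
    a)) (\<lambda>a. ev x (antip a)) (\<Delta> h)"
    using h by (simp add: tensor_eval_pt_antip)
  also have "\<dots> = tensor_eval (ev (inver y)) (ev (inver x)) (\<Delta> h)"
    using h by (intro tensor_eval_cong linform_antip) (simp_all add: ev_antipode)
  also have "\<dots> = tensor_eval (ev x) (ev y) (\<Delta> (antip h))"
    using h xy by (simp add: tensor_eval_comult ev_antipode inver_mul)
  finally show "tensor_eval (ev x) (ev y) (\<Delta> (antip h)) = tensor_eval (ev x) (ev y) (tensor_lift HH (\<lambda>a b. pt (antip
    b) (antip a)) (\<Delta> h))" ..
qed

lemma conv_antip: "linform f \<Longrightarrow> linform f' \<Longrightarrow> h \<in> HI \<Longrightarrow> conv f f' (antip h) = conv (\<lambda>a. f' (antip a)) (\<lambda>a. f (antip a))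
    h"
  by (simp add: conv_def comult_antip tensor_eval_pt_antip)

abbreviation "DAop \<equiv> opposite_algebra DA"

lemma DA_antip: "f \<in> carrier DA \<Longrightarrow> (\<lambda>h\<in>HI. f (antip h)) \<in> carrier DA"
proof -
  assume f: "f \<in> carrier DA"
  have "supp (\<lambda>h. f (antip h)) \<subseteq> supp f" using pev_HC[OF _ anti_HC] by (fastforce simp: supp_def)
  then show ?thesis using f linform_antip[of f] by (intro DA_restrict) (auto simp: DA_carrier intro: finite_subset)
qed

lemma antip_dual_hom: "(\<lambda>f. \<lambda>h\<in>HI. f (antip h)) \<in> alg_hom DA DAop"
proof (rule alg_homI)
  show "(\<lambda>f. \<lambda>h\<in>HI. f (antip h)) \<in> lin DA DAop" by (rule linI) (auto simp: DA_antip)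
  show "(\<lambda>h\<in>HI. (f \<otimes>\<^bsub>DA\<^esub> f') (antip h)) = (\<lambda>h\<in>HI. f (antip h)) \<otimes>\<^bsub>DAop\<^esub> (\<lambda>h\<in>HI. f' (antip h))"
    if "f \<in> carrier DA" "f' \<in> carrier DA" for f f'
    using that by (auto simp: DA_linform conv_antip linform_antip)
  show "(\<lambda>h\<in>HI. \<one>\<^bsub>DA\<^esub> (antip h)) = \<one>\<^bsub>DAop\<^esub>" by (auto simp: const_coeff_antip)
qed

lemma antip_conv: "h \<in> HI \<Longrightarrow> tensor_lift HA (\<lambda>a b. antip a * b) (\<Delta> h) = Cst (const_coeff h)"
  using HA_hopf unfolding hopf_algebra_def by simp

text \<open>Apply \<open>f\<close> to the antipode law. By the Leibniz rule the left side becomes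
  \<open>f (antip h) + f h\<close>, while \<open>f\<close> vanishes on constants.\<close>

lemma counit_der_antip: assumes f: "counit_der f" and h: "h \<in> HI" shows "f (antip h) = - f h"
proof -
  note linform = counit_der_linform[OF f]
  have b: "bilinear_map HA HA HA (\<lambda>a b. antip a * b)"
    by (rule bil_from_lin; rule linI) (simp_all add: rhom.rho_add[OF antip_rhom] rhom.rho_mult[OF antip_rhom] pev_C[OF
      C_rhom] algebra_simps)
  note tl = tl_lin[OF HA_kvs HA_kvs HA_kvs b] and tp = tl_pure[OF HA_kvs HA_kvs HA_kvs b]
  have l: "f \<in> lin HA base_algebra" using linform by (simp add: linform_def)
  have "f (tensor_lift HA (\<lambda>a b. antip a * b) (\<Delta> h)) = tensor_eval (\<lambda>a. f (antip a)) const_coeff (\<Delta> h) \<oplus>\<^bsub>base_algebra\<^esub>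
    tensor_eval (\<lambda>a. const_coeff (antip a)) f (\<Delta> h)"
    by (rule TA.lin_eq_tensor[OF lin_compose[OF tl l] lin_add_fun[OF base_kvs tensor_eval_lin tensor_eval_lin]])
      (use h linform_antip[OF linform] linform_antip[OF linform_const_coeff] l linform_const_coeff in \<open>simp_all add:
        tp tensor_eval_pure linform_def counit_der_mult[OF f]\<close>)
  also have "tensor_eval (\<lambda>a. f (antip a)) const_coeff (\<Delta> h) = f (antip h)"
    using conv_const_coeff_r[OF linform_antip[OF linform] h] by (simp add: conv_def)
  also have "tensor_eval (\<lambda>a. const_coeff (antip a)) f (\<Delta> h) = tensor_eval const_coeff f (\<Delta> h)"
    by (rule tensor_eval_cong) (simp_all add: h linform linform_antip const_coeff_antip)
  also have "\<dots> = f h" using conv_const_coeff_l[OF linform h] by (simp add: conv_def)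
  finally have "f (Cst (const_coeff h)) = f (antip h) + f h" using h by (simp add: antip_conv)
  moreover have "f (Cst (const_coeff h)) = 0" using linform_smult[OF linform, of 1 "const_coeff h"] counit_der_1[OF f]
    by simp
  ultimately show ?thesis by (simp add: eq_neg_iff_add_eq_0)
qed

abbreviation "UEop \<equiv> opposite_algebra UE"

sublocale EA: kenv_lift gL UEop "\<lambda>x. \<ominus>\<^bsub>UE\<^esub> inc x"
proof (intro kenv_lift.intro gL_env PL.UL.op_kalg kenv_lift_axioms.intro)
  show "(\<lambda>x. \<ominus>\<^bsub>UE\<^esub> inc x) \<in> lin gL UEop"
    using PL.inc_closed PL.inc_add PL.inc_smult
    by (intro linI) (simp_all add: PL.UL.minus_add PL.UL.ksm_m1[symmetric] PL.UL.ksm_add mult.commute)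
  fix x y assume xy: "x \<in> carrier gL" "y \<in> carrier gL"
  interpret o: kalg UEop by (rule PL.UL.op_kalg)
  have c: "inc x \<in> carrier UE" "inc y \<in> carrier UE" "inc (x \<otimes>\<^bsub>gL\<^esub> y) \<in> carrier UE"
    using xy by (simp_all only: PL.inc_closed PL.bracket_closed)
  have m: "z \<ominus>\<^bsub>UEop\<^esub> z' = z \<ominus>\<^bsub>UE\<^esub> z'" if "z \<in> carrier UE" "z' \<in> carrier UE" for z z'
    using o.ksm_m1[of z'] PL.UL.ksm_m1[of z'] that by (simp add: a_minus_def)
  have "\<ominus>\<^bsub>UE\<^esub> inc (x \<otimes>\<^bsub>gL\<^esub> y) = inc y \<otimes>\<^bsub>UE\<^esub> inc x \<ominus>\<^bsub>UE\<^esub> inc x \<otimes>\<^bsub>UE\<^esub> inc y"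
    unfolding PL.inc_bracket[OF xy] using c by (simp add: a_minus_def PL.UL.minus_add PL.UL.r_neg2)
  also have "\<dots> = (\<ominus>\<^bsub>UE\<^esub> inc x) \<otimes>\<^bsub>UEop\<^esub> (\<ominus>\<^bsub>UE\<^esub> inc y) \<ominus>\<^bsub>UEop\<^esub> (\<ominus>\<^bsub>UE\<^esub> inc y) \<otimes>\<^bsub>UEop\<^esub> (\<ominus>\<^bsub>UE\<^esub> inc x)"
    using c by (simp add: m PL.UL.l_minus PL.UL.r_minus)
  finally show "\<ominus>\<^bsub>UE\<^esub> inc (x \<otimes>\<^bsub>gL\<^esub> y) = (\<ominus>\<^bsub>UE\<^esub> inc x) \<otimes>\<^bsub>UEop\<^esub> (\<ominus>\<^bsub>UE\<^esub> inc y) \<ominus>\<^bsub>UEop\<^esub> (\<ominus>\<^bsub>UE\<^esub> inc y) \<otimes>\<^bsub>UEop\<^esub> (\<ominus>\<^bsub>UE\<^esub> inc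
    x)" .
qed

lemma dual_map_op_hom: "dual_map \<in> alg_hom UEop DAop"
  using dual_map_lin alg_hom_mult[OF PL.env_lift_hom] alg_hom_one[OF PL.env_lift_hom]
  by (intro alg_homI) (simp_all add: LinearCombinations.module_hom_def)

text \<open>Both sides are algebra morphisms into the opposite of the graded dual, and on generators
  both are the negative of \<open>hat\<close>.\<close>

lemma dual_map_antipode: "Y \<in> carrier UE \<Longrightarrow> (\<lambda>h\<in>HI. dual_map Y (antip h)) = dual_map (env_lift UEop (\<lambda>x. \<ominus>\<^bsub>UE\<^esub> inc x)
    Y)"
proof (rule PL.UL_hom_eq[OF DA.op_kalg alg_hom_compose[OF PL.env_lift_hom antip_dual_hom] alg_hom_compose[OF
    EA.env_lift_hom dual_map_op_hom]])
  fix x assume x: "x \<in> carrier gL"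
  have "dual_map (\<ominus>\<^bsub>UE\<^esub> inc x) = \<ominus>\<^bsub>DA\<^esub> hat x"
    using lin_uminus[OF PL.UL.kvs_axioms DA_kvs dual_map_lin PL.inc_closed[OF x]] PL.env_lift_inc[OF x] by simp
  also have "\<dots> = (\<lambda>h\<in>HI. hat x (antip h))"
    using DA.ksm_m1[OF hat_closed, of x, symmetric] by (auto simp: hat_def counit_der_antip)
  finally show "(\<lambda>h\<in>HI. dual_map (inc x) (antip h)) = dual_map (env_lift UEop (\<lambda>x. \<ominus>\<^bsub>UE\<^esub> inc x) (inc x))"
    using x by (simp only: EA.env_lift_inc PL.env_lift_inc)
qed

sublocale TU: ktalg UE UE by unfold_locales
abbreviation "UT \<equiv> tensor_space UE UE"
sublocale UT: kvs UT by (rule TU.tensor_kvs)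
sublocale UU: kalg UU by (rule TU.AB_alg)

lemma cop_closed: "x \<in> carrier gL \<Longrightarrow> cop x \<in> carrier UT"
  using PL.inc_closed[of x] by (simp add: cop_def TU.pure_closed)

sublocale ED: kenv_lift gL UU cop
proof (intro kenv_lift.intro gL_env UU.kalg_axioms kenv_lift_axioms.intro)
  show "cop \<in> lin gL UU"
  proof (rule linI)
    show "cop x \<in> carrier UU" if "x \<in> carrier gL" for x using cop_closed[OF that] by simp
    show "cop (x \<oplus>\<^bsub>gL\<^esub> y) = cop x \<oplus>\<^bsub>UU\<^esub> cop y" if "x \<in> carrier gL" "y \<in> carrier gL" for x y
      using that[THEN PL.inc_closed] unfolding cop_def PL.inc_add[OF that]
      by (simp add: TU.pure_simps UT.a_ac TU.pure_closed)
    show "cop (c \<odot>\<^bsub>gL\<^esub> x) = c \<odot>\<^bsub>UU\<^esub> cop x" if "x \<in> carrier gL" for c x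
      using that[THEN PL.inc_closed] unfolding cop_def PL.inc_smult[OF that]
      by (simp add: TU.pure_simps UT.ksm_add TU.pure_closed)
  qed
  fix x y assume xy: "x \<in> carrier gL" "y \<in> carrier gL"
  define a b z where "a = inc x" "b = inc y" "z = inc (x \<otimes>\<^bsub>gL\<^esub> y)"
  have c: "a \<in> carrier UE" "b \<in> carrier UE" "z \<in> carrier UE"
    using xy unfolding a_b_z_def by (simp_all only: PL.inc_closed PL.bracket_closed)
  have ab: "a \<otimes>\<^bsub>UE\<^esub> b = b \<otimes>\<^bsub>UE\<^esub> a \<oplus>\<^bsub>UE\<^esub> z" unfolding a_b_z_def by (rule PL.inc_bracket[OF xy])
  \<comment> \<open>The mixed terms \<open>pU a b\<close> and \<open>pU b a\<close> form a sum that
    is unchanged when the two factors are exchanged, so they cancel in the commutator and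
    \<open>cop\<close> respects brackets.\<close>
  have e: "cop x \<otimes>\<^bsub>UU\<^esub> cop y = (pU (a \<otimes>\<^bsub>UE\<^esub> b) \<one>\<^bsub>UE\<^esub> \<oplus>\<^bsub>UT\<^esub> pU \<one>\<^bsub>UE\<^esub> (a \<otimes>\<^bsub>UE\<^esub> b)) \<oplus>\<^bsub>UT\<^esub> (pU a b \<oplus>\<^bsub>UT\<^esub> pU b a)"
    if "a = inc x" "b = inc y" "a \<in> carrier UE" "b \<in> carrier UE" for a b x y
    using that(3,4) UU.l_distr[of "pU a \<one>\<^bsub>UE\<^esub>" "pU \<one>\<^bsub>UE\<^esub> a" "cop y"]
      UU.r_distr[of "pU b \<one>\<^bsub>UE\<^esub>" "pU \<one>\<^bsub>UE\<^esub> b" "pU a \<one>\<^bsub>UE\<^esub>"] UU.r_distr[of "pU b \<one>\<^bsub>UE\<^esub>" "pU \<one>\<^bsub>UE\<^esub> b" "pU \<one>\<^bsub>UE\<^esub> a"]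
    unfolding cop_def that(1,2)[symmetric] by (simp add: TU.AB_pure TU.pure_closed UT.a_ac)
  have cz: "cop (x \<otimes>\<^bsub>gL\<^esub> y) = pU z \<one>\<^bsub>UE\<^esub> \<oplus>\<^bsub>UT\<^esub> pU \<one>\<^bsub>UE\<^esub> z" by (simp add: cop_def a_b_z_def(3))
  have "cop x \<otimes>\<^bsub>UU\<^esub> cop y = cop (x \<otimes>\<^bsub>gL\<^esub> y) \<oplus>\<^bsub>UU\<^esub> cop y \<otimes>\<^bsub>UU\<^esub> cop x"
    unfolding e[OF a_b_z_def(1,2) c(1,2)] e[OF a_b_z_def(2,1) c(2,1)] ab cz
    using c by (simp add: TU.pure_simps TU.pure_closed UT.a_ac)
  then show "cop (x \<otimes>\<^bsub>gL\<^esub> y) = cop x \<otimes>\<^bsub>UU\<^esub> cop y \<ominus>\<^bsub>UU\<^esub> cop y \<otimes>\<^bsub>UU\<^esub> cop x"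
    using UU.add_minus_cancel[of "cop (x \<otimes>\<^bsub>gL\<^esub> y)" "cop y \<otimes>\<^bsub>UU\<^esub> cop x"] UU.m_closed[of "cop y" "cop x"]
      cop_closed[OF xy(1)] cop_closed[OF xy(2)] cop_closed[OF PL.bracket_closed[OF xy]] by simp
qed

text \<open>Pairing of a tensor over the enveloping algebra with two polynomials; it turns the
  comparison of coproducts into a statement about \<open>h * h'\<close>.\<close>

definition "qq h h' = tensor_lift base_algebra (\<lambda>a b. dual_map a h * dual_map b h')"

lemma qq_lin: "h \<in> HI \<Longrightarrow> h' \<in> HI \<Longrightarrow> qq h h' \<in> lin UT base_algebra"
  unfolding qq_def by (intro tl_lin PL.UL.kvs_axioms base_kvs lin_base_bil dual_map_at_lin)

lemma qq_pure: "h \<in> HI \<Longrightarrow> h' \<in> HI \<Longrightarrow> a \<in> carrier UE \<Longrightarrow> b \<in> carrier UE \<Longrightarrow> qq h h' (pU a b) = dual_map a h * dual_map b h'"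
  unfolding qq_def by (intro tl_pure PL.UL.kvs_axioms base_kvs lin_base_bil dual_map_at_lin)

text \<open>Each summand of \<open>cop x\<close> acts through the adjoint \<open>der\<close> on one
  of the arguments: these are the two terms of the Leibniz rule.\<close>

lemma qq_cop:
  assumes x: "x \<in> carrier gL" and h: "h \<in> HI" "h' \<in> HI" and T: "T \<in> carrier UT"
  shows "qq h h' (cop x \<otimes>\<^bsub>UU\<^esub> T) = qq (der (lie_form x) h) h' T \<oplus>\<^bsub>base_algebra\<^esub> qq h (der (lie_form x) h') T"
proof (rule TU.lin_eq_tensor[OF lin_compose[OF bil_lin_r[OF TU.AB_mult_bil] qq_lin] lin_add_fun[OF base_kvs qq_lin
    qq_lin] _ T])
  fix a b assume ab: "a \<in> carrier UE" "b \<in> carrier UE"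
  have "cop x \<otimes>\<^bsub>UU\<^esub> pU a b = pU (inc x \<otimes>\<^bsub>UE\<^esub> a) b \<oplus>\<^bsub>UT\<^esub> pU a (inc x \<otimes>\<^bsub>UE\<^esub> b)"
    using ab PL.inc_closed[OF x] UU.l_distr[of "pU (inc x) \<one>\<^bsub>UE\<^esub>" "pU \<one>\<^bsub>UE\<^esub> (inc x)" "pU a b"]
    unfolding cop_def by (simp add: TU.AB_pure TU.pure_closed)
  then show "qq h h' (cop x \<otimes>\<^bsub>UU\<^esub> pU a b) = qq (der (lie_form x) h) h' (pU a b) \<oplus>\<^bsub>base_algebra\<^esub> qq h (der (lie_form x)
    h') (pU a b)"
    using ab h PL.inc_closed[OF x] by (simp add: lin_add[OF qq_lin] TU.pure_closed qq_pure dual_map_inc[OF x])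
qed (simp_all add: h cop_closed[OF x])

abbreviation "cU \<equiv> env_lift UU cop"

lemma cU_lin: "cU \<in> lin UE UT"
  using alg_hom_lin[OF ED.env_lift_hom] by (simp add: LinearCombinations.module_hom_def)

text \<open>Induction on words with \<open>h\<close> and \<open>h'\<close> arbitrary. The first
  letter acts by \<open>cop x\<close> on the side of the coproduct and by the derivation
  \<open>der\<close> on the product \<open>h * h'\<close>; the two agree by the Leibniz
  rule.\<close>

lemma qq_cU: "Y \<in> carrier UE \<Longrightarrow> h \<in> HI \<Longrightarrow> h' \<in> HI \<Longrightarrow> qq h h' (cU Y) = dual_map Y (h * h')"
proof -
  have w: "set w \<subseteq> carrier gL \<Longrightarrow> h \<in> HI \<Longrightarrow> h' \<in> HI \<Longrightarrow> qq h h' (cU (word_prod UE inc w)) = dual_map (word_prod UE inc w)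
    (h * h')" for w h h'
  proof (induction w arbitrary: h h')
    case Nil
    then show ?case using alg_hom_one[OF ED.env_lift_hom] by (simp add: qq_pure dual_map_one del: DA_simps)
  next
    case (Cons x w)
    then have x: "x \<in> carrier gL" and w: "set w \<subseteq> carrier gL" and d: "der (lie_form x) h \<in> HI" "der (lie_form x) h' \<in>
      HI" by simp_all
    note wc = PL.UL_word_closed[OF w]
    have "cU (word_prod UE inc (x # w)) = cop x \<otimes>\<^bsub>UU\<^esub> cU (word_prod UE inc w)"
      using alg_hom_mult[OF ED.env_lift_hom PL.inc_closed[OF x] wc] ED.env_lift_inc[OF x] by simp
    then have "qq h h' (cU (word_prod UE inc (x # w))) = dual_map (word_prod UE inc w) (der (lie_form x) h * h') +
      dual_map (word_prod UE inc w) (h * der (lie_form x) h')"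
      using qq_cop[OF x Cons.prems(2,3) lin_closed[OF cU_lin wc]] Cons.IH[OF w d(1) Cons.prems(3)] Cons.IH[OF w
        Cons.prems(2) d(2)] by simp
    also have "\<dots> = dual_map (word_prod UE inc w) (der (lie_form x) (h * h'))"
      using Cons.prems d by (simp add: der_mult linform_add[OF DA_linform[OF dual_map_closed[OF wc]]])
    also have "\<dots> = dual_map (word_prod UE inc (x # w)) (h * h')"
      using dual_map_inc[OF x wc, of "h * h'"] Cons.prems by simp
    finally show ?case .
  qed
  assume "Y \<in> carrier UE" and h: "h \<in> HI" "h' \<in> HI"
  then show ?thesis
  proof (induction rule: PL.UL_induct)
    case (word v c)
    note wc = PL.UL_word_closed[OF word(1)]
    show ?case using h w[OF word(1) h] lin_closed[OF cU_lin wc]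
      by (simp only: lin_smult[OF cU_lin wc] lin_smult[OF qq_lin[OF h] lin_closed[OF cU_lin wc]] lin_smult[OF
        dual_map_lin wc]) simp
  next
    case (add Y Z)
    then show ?case
      by (simp only: lin_add[OF cU_lin] lin_add[OF qq_lin[OF h]] lin_closed[OF cU_lin] lin_add[OF dual_map_lin]) (simp
        add: h)
  qed
qed

abbreviation "DD \<equiv> tensor_space DA DA"
abbreviation "pD \<equiv> pure_tensor DA DA"
abbreviation "at2 a b \<equiv> tensor_lift base_algebra (\<lambda>g g'. g a * g' b)"

lemma at_lin: "a \<in> HI \<Longrightarrow> (\<lambda>f. f a) \<in> lin DA base_algebra"
  by (rule linI) simp_all

text \<open>Evaluations at polynomials separate linear forms. This gives the uniqueness demanded by
  the description that defines the coproduct of the graded dual.\<close>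

lemma DD_sep: "S \<in> carrier DD \<Longrightarrow> T \<in> carrier DD \<Longrightarrow> (\<And>a b. a \<in> HI \<Longrightarrow> b \<in> HI \<Longrightarrow> at2 a b S = at2 a b T) \<Longrightarrow> S = T"
proof (rule TD.tensor_separate_eq[where \<Lambda> = "(\<lambda>a f. f a) ` HI" and M = "(\<lambda>a f. f a) ` HI"])
  have z: "v = \<zero>\<^bsub>DA\<^esub>" if "v \<in> carrier DA" "\<And>l. l \<in> (\<lambda>a f. f a) ` HI \<Longrightarrow> l v = 0" for v
    by (rule DA_eqI) (use that DA_closed(4) in auto)
  show "v \<in> carrier DA \<Longrightarrow> (\<And>l. l \<in> (\<lambda>a f. f a) ` HI \<Longrightarrow> l v = 0) \<Longrightarrow> v = \<zero>\<^bsub>DA\<^esub>" for v by (rule z)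
  then show "v \<in> carrier DA \<Longrightarrow> (\<And>l. l \<in> (\<lambda>a f. f a) ` HI \<Longrightarrow> l v = 0) \<Longrightarrow> v = \<zero>\<^bsub>DA\<^esub>" for v .
qed (auto simp: at_lin)

text \<open>The image of the coproduct of \<open>Y\<close> has the required values by
  \<open>qq_cU\<close>, and \<open>DD_sep\<close> makes it the only such tensor.\<close>

lemma dual_map_comult:
  assumes Y: "Y \<in> carrier UE"
  shows "comult GD (dual_map Y) = tensor_lift DD (\<lambda>a b. pD (dual_map a) (dual_map b)) (cU Y)"
proof -
  let ?T = "tensor_lift DD (\<lambda>a b. pD (dual_map a) (dual_map b)) (cU Y)"
  have b: "bilinear_map UE UE DD (\<lambda>a b. pD (dual_map a) (dual_map b))"
    by (rule bil_compose2[OF TD.pure_bil dual_map_lin dual_map_lin])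
  note tl = tl_lin[OF PL.UL.kvs_axioms PL.UL.kvs_axioms TD.tensor_kvs b] and tp = tl_pure[OF PL.UL.kvs_axioms
    PL.UL.kvs_axioms TD.tensor_kvs b]
  have T: "?T \<in> carrier DD" by (rule lin_closed[OF tl lin_closed[OF cU_lin Y]])
  have e: "at2 a b ?T = dual_map Y (a * b)" if ab: "a \<in> HI" "b \<in> HI" for a b
  proof -
    have al: "at2 a b \<in> lin DD base_algebra"
      using ab by (intro tl_lin DA_kvs base_kvs lin_base_bil at_lin)
    have ap: "at2 a b (pD f f') = f a * f' b" if "f \<in> carrier DA" "f' \<in> carrier DA" for f f'
      using ab that by (intro tl_pure DA_kvs base_kvs lin_base_bil at_lin)
    have "at2 a b ?T = qq a b (cU Y)"
      by (rule TU.lin_eq_tensor[OF lin_compose[OF tl al] qq_lin[OF ab] _ lin_closed[OF cU_lin Y]])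
        (simp only: tp ap dual_map_closed qq_pure[OF ab])
    then show ?thesis using qq_cU[OF Y ab] by simp
  qed
  show ?thesis unfolding GD_comult
    by (rule the_equality) (use T e DD_sep in auto)
qed

lemma dual_map_hopf_iso: "dual_map \<in> hopf_iso UH GD"
proof -
  have "dual_map \<in> alg_hom UH GD"
    using PL.env_lift_hom by (simp add: alg_hom_def Ring.ring_hom_def LinearCombinations.module_hom_def)
  moreover have "tensor_space GD GD = DD" "pure_tensor GD GD = pD"
    by (rule tensor_space_cong pure_tensor_cong; simp)+
  ultimately show ?thesis
    using dual_map_bij dual_map_comult dual_map_counit dual_map_antipode unfolding hopf_iso_def by simp
qed

section \<open>The gradings\<close>

abbreviation "gC \<equiv> g_comp p q B"

lemma graded_dual_comp_iff: "\<alpha> \<in> mi \<Longrightarrow> f \<in> graded_dual_comp n HA HC \<alpha> \<longleftrightarrow> f \<in> carrier DA \<and> supp f \<subseteq> {\<alpha>}"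
  by (auto simp: graded_dual_comp_def supp_def)

lemma supp_hat: "x \<in> gC \<beta> \<Longrightarrow> supp (hat x) \<subseteq> {\<beta>}"
proof
  fix \<gamma> assume x: "x \<in> gC \<beta>" and "\<gamma> \<in> supp (hat x)"
  then obtain h where h: "h \<in> HC \<gamma>" "\<gamma> \<in> mi" "lie_form x h \<noteq> 0" by (auto simp: hat_def supp_def HC_HI)
  then obtain t where "t \<in> keys x" "lin_coeff t h \<noteq> 0" unfolding lie_form_def
    by (metis (no_types, lifting) mult_eq_0_iff sum.neutral)
  moreover from this have "\<gamma> \<in> supp (lin_coeff t)" using h by (auto simp: supp_def)
  moreover have "snd t = \<beta>" using x \<open>t \<in> keys x\<close> by (cases t) (auto simp: g_comp_def)
  ultimately show "\<gamma> \<in> {\<beta>}" using supp_lin_coeff[of t] by auto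
qed

lemma env_word_supp: "list_all2 (\<lambda>x \<beta>. \<beta> \<in> mi \<and> x \<in> gC \<beta>) w d \<Longrightarrow>
   set w \<subseteq> carrier gL \<and> supp (dual_map (word_prod UE inc w)) \<subseteq> {sum_list d}"
proof (induction rule: list_all2_induct)
  case Nil show ?case using supp_const_coeff by (simp only: word_prod_simps alg_hom_one[OF PL.env_lift_hom] DA_simps
    supp_restrict) simp
next
  case (Cons x w \<beta> d)
  then have x: "x \<in> carrier gL" "x \<in> gC \<beta>" and w: "set w \<subseteq> carrier gL" by (auto simp: g_comp_def)
  note wc = PL.UL_word_closed[OF w]
  have "dual_map (word_prod UE inc (x # w)) = restrict (conv (hat x) (dual_map (word_prod UE inc w))) HI"
    using alg_hom_mult[OF PL.env_lift_hom PL.inc_closed[OF x(1)] wc] PL.env_lift_inc[OF x(1)] by simp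
  moreover have "linform (hat x)" "linform (dual_map (word_prod UE inc w))"
    by (intro DA_linform hat_closed dual_map_closed wc)+
  ultimately have "supp (dual_map (word_prod UE inc (x # w))) \<subseteq> {sum_list (\<beta> # d)}"
    using conv_supp[of "hat x" "dual_map (word_prod UE inc w)"] supp_hat[OF x(2)] Cons.IH
    by (simp only: supp_restrict sum_list.Cons) fastforce
  then show ?case using x w by (simp del: word_prod_simps)
qed

text \<open>Weights add under convolution, which gives one inclusion. For the other,
  \<open>dual_map_surj\<close> finds preimages among words whose weights lie in any prescribed set
  containing the support, here the singleton of \<alpha>.\<close>

lemma dual_map_grading: assumes \<alpha>: "\<alpha> \<in> mi" shows "dual_map ` env_comp n gL gC \<alpha> = graded_dual_comp n HA HC \<alpha>"
proof
  let ?W = "{word_prod UE inc w | w d. list_all2 (\<lambda>x \<beta>. \<beta> \<in> mi \<and> x \<in> gC \<beta>) w d \<and> sum_list d = \<alpha>}"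
  have W: "?W \<subseteq> carrier UE" using env_word_supp PL.UL_word_closed by blast
  show "dual_map ` env_comp n gL gC \<alpha> \<subseteq> graded_dual_comp n HA HC \<alpha>"
  proof
    fix f assume "f \<in> dual_map ` env_comp n gL gC \<alpha>"
    then obtain Y where Y: "Y \<in> lin_span UE ?W" "f = dual_map Y" by (auto simp: env_comp_def)
    have "supp (dual_map Y) \<subseteq> {\<alpha>}" using Y(1) W
    proof (induction rule: PL.UL.span_induct)
      case zero
      then show ?case using supp_0 by (simp only: lin_zero[OF PL.UL.kvs_axioms DA_kvs dual_map_lin] DA_simps
        supp_restrict) simp
    next
      case (base s)
      then show ?case using env_word_supp by blast
    next
      case (add x y)
      have "supp (dual_map (x \<oplus>\<^bsub>UE\<^esub> y)) = supp (\<lambda>h. dual_map x h + dual_map y h)"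
        by (simp only: lin_add[OF dual_map_lin add(1,2)] DA_simps supp_restrict)
      then show ?case using supp_add[of "dual_map x" "dual_map y"] add by blast
    next
      case (smult c x)
      have "supp (dual_map (c \<odot>\<^bsub>UE\<^esub> x)) = supp (\<lambda>h. c * dual_map x h)"
        by (simp only: lin_smult[OF dual_map_lin smult(1)] DA_simps supp_restrict)
      then show ?case using supp_scale[of c "dual_map x"] smult by blast
    qed
    moreover have "dual_map Y \<in> carrier DA" using Y PL.UL.span_carrier[OF W] by auto
    ultimately show "f \<in> graded_dual_comp n HA HC \<alpha>" by (simp add: Y(2) graded_dual_comp_iff[OF \<alpha>])
  qed
  show "graded_dual_comp n HA HC \<alpha> \<subseteq> dual_map ` env_comp n gL gC \<alpha>"
  proof
    fix f assume "f \<in> graded_dual_comp n HA HC \<alpha>"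
    then have "f \<in> dual_map ` lin_span UE (pbw ` {m \<in> MI. weight m \<in> {\<alpha>}})"
      using dual_map_surj graded_dual_comp_iff[OF \<alpha>] by blast
    moreover have "pbw m \<in> ?W" if m: "m \<in> MI" "weight m = \<alpha>" for m
    proof -
      have "pbw m = word_prod UE inc (map (\<lambda>t. single t 1) (mon_word m))"
        unfolding pbw_def word_prod_map ..
      moreover have "list_all2 (\<lambda>x \<beta>. \<beta> \<in> mi \<and> x \<in> gC \<beta>) (map (\<lambda>t. single t 1) (mon_word m)) (map snd (mon_word m))"
        using mon_word(1)[OF m(1)] by (auto simp: list_all2_map1 list_all2_map2 list_all2_same g_comp_def I_def)
      moreover have "sum_list (map snd (mon_word m)) = \<alpha>" using weight_cnt[of "mon_word m"] mon_word(2)[OF m(1)] m(2)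
        by simp
      ultimately show ?thesis by blast
    qed
    then have "lin_span UE (pbw ` {m \<in> MI. weight m \<in> {\<alpha>}}) \<subseteq> lin_span UE ?W"
      by (intro PL.UL.span_min[OF _ PL.UL.span_sub[OF W]]) (use PL.UL.span_in[OF W] in blast)
    ultimately show "f \<in> dual_map ` env_comp n gL gC \<alpha>" by (auto simp: env_comp_def)
  qed
qed

end

theorem proposition29:
  fixes p q :: nat and B :: "'k::field_char_0 mat"
  assumes "1 \<le> p" and "B \<in> carrier_mat q p"
  shows "group (G_group p q B) \<and>
    deg1_pre_lie_algebra (g_algebra p q B) \<and>
    deg1_with (g_algebra p q B) p (p + q) g_basis
      (\<lambda>i j. col (stacked_matrix p B) j) (\<lambda>i j. 0) \<and>
    (\<exists>(H :: ('k, ((nat \<times> (nat \<Rightarrow>\<^sub>0 nat)) \<Rightarrow>\<^sub>0 nat) \<Rightarrow>\<^sub>0 'k) hopf) H_comp.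
       graded_hopf_algebra (p + q) H H_comp \<and>
       commutative_algebra H \<and>
       (\<forall>\<alpha>\<in>multi_indices (p + q). vectorspace.fin_dim class_ring (H\<lparr>carrier := H_comp \<alpha>\<rparr>)) \<and>
       G_group p q B \<cong> character_group H \<and>
       (\<exists>\<phi>\<in>hopf_iso (env_hopf (commutator_lie (g_algebra p q B))) (graded_dual (p + q) H H_comp).
          \<forall>\<alpha>\<in>multi_indices (p + q).
            \<phi> ` env_comp (p + q) (commutator_lie (g_algebra p q B)) (g_comp p q B) \<alpha> =
            graded_dual_comp (p + q) H H_comp \<alpha>))"
proof -
  interpret gB p q B using assms by (rule gB.intro)
  show ?thesis
    using G_group g_deg1_pre_lie g_deg1 HA_graded HA_comm HC_fin_dim G_CG dual_map_hopf_iso dual_map_grading by blast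
qed

end
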